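(* Under the regularity conditions (i)–(iii) below, the asymptotic covariance matrix of $\sqrt n(\hat{\boldsymbol{\tau}}-\boldsymbol{\tau})$ under ReFM (threshold $a>0$) is smaller than or equal to (in the positive semidefinite order) that under the CRFE, and the reduction equals $(1-v_{LF,a})\lim_{n\to\infty}n\boldsymbol{V}^{\parallel}_{\tau\tau}$. In particular, for each $1\le f\le F$, the percentage reduction in asymptotic sampling variance of $\hat\tau_f$ is $(1-v_{LF,a})\lim_{n\to\infty}R^2_f$.
   Context: Setup ($2^K$ factorial experiment, finite population). $K\ge1$ two-level factors, $Q=2^K$ treatment combinations $q=1,\dots,Q$; combination $q$ sets factor $k$ at $\iota_k(q)\in\{-1,+1\}$, bijectively onto $\{-1,+1\}^K$. $F=Q-1$ factorial effects, one per nonempty $A\subseteq\{1,\dots,K\}$, enumerated $f=1,\dots,F$, with $g_{fq}=\prod_{k\in A}\iota_k(q)$; $\boldsymbol{b}_q=(g_{1q},\dots,g_{Fq})'$. Units $i=1,\dots,n$ have fixed potential outcomes $Y_i(q)$ and covariates $\boldsymbol{x}_i\in\mathbb{R}^L$; $\bar Y(q),\bar{\boldsymbol{x}}$ means; $\boldsymbol{\tau}_i=2^{-(K-1)}\sum_q\boldsymbol{b}_qY_i(q)$, $\boldsymbol{\tau}=2^{-(K-1)}\sum_q\boldsymbol{b}_q\bar Y(q)$. Finite-population (co)variances with divisor $n-1$: $S_{qk}$ between $Y(q),Y(k)$; $\boldsymbol{S}_{\tau\tau}$ of $\boldsymbol{\tau}_i$; $\boldsymbol{S}_{xx}$ of $\boldsymbol{x}$;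 $\boldsymbol{S}_{q,x}$ between $Y(q)$ and $\boldsymbol{x}$. CRFE: fixed $n_q\ge1$, $\sum n_q=n$; $\boldsymbol{Z}$ uniform over assignments with $n_q$ units in combination $q$. $\hat{\bar Y}(q),\hat{\bar{\boldsymbol{x}}}(q)$ group-$q$ means of observed outcomes $Y_i(Z_i)$ and covariates; $\hat{\boldsymbol{\tau}}=(\hat\tau_1,\dots,\hat\tau_F)'=2^{-(K-1)}\sum_q\boldsymbol{b}_q\hat{\bar Y}(q)$; $\hat{\boldsymbol{\tau}}_x=(\hat{\boldsymbol{\tau}}_{x,1}',\dots,\hat{\boldsymbol{\tau}}_{x,F}')'$, $\hat{\boldsymbol{\tau}}_{x,f}=2^{-(K-1)}\sum_qg_{fq}\hat{\bar{\boldsymbol{x}}}(q)$. $\boldsymbol{V}_{\tau\tau}=2^{-2(K-1)}\sum_qn_q^{-1}\boldsymbol{b}_q\boldsymbol{b}_q'S_{qq}-n^{-1}\boldsymbol{S}_{\tau\tau}$ (the CRFE covariance of $\hat{\boldsymbol{\tau}}$), $\boldsymbol{V}_{xx}=2^{-2(K-1)}\sum_qn_q^{-1}(\boldsymbol{b}_q\boldsymbol{b}_q')\otimes\boldsymbol{S}_{xx}$. ReFM: accept the assignment iff $M=\hat{\boldsymbol{\tau}}_x'\boldsymbol{V}_{xx}^{-1}\hat{\boldsymbol{\tau}}_x\le a$; the distribution under ReFM is the CRFE distribution conditional on this event. Projections: $Y_i^{\parallel}(q)=\bar Y(q)+\boldsymbol{S}_{q,x}\boldsymbol{S}_{xx}^{-1}(\boldsymbol{x}_i-\bar{\boldsymbol{x}})$;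 $\boldsymbol{\tau}_i^{\parallel}=2^{-(K-1)}\sum_q\boldsymbol{b}_qY^{\parallel}_i(q)$; $S^{\parallel}_{qq},\boldsymbol{S}^{\parallel}_{\tau\tau}$ their finite-population variances; $\boldsymbol{V}^{\parallel}_{\tau\tau}=2^{-2(K-1)}\sum_qn_q^{-1}\boldsymbol{b}_q\boldsymbol{b}_q'S^{\parallel}_{qq}-n^{-1}\boldsymbol{S}^{\parallel}_{\tau\tau}$. $R^2_f=V^{\parallel}_{\tau_f\tau_f}/V_{\tau_f\tau_f}$, the ratio of $f$th diagonal entries (the squared multiple correlation between $\hat\tau_f$ and $\hat{\boldsymbol{\tau}}_x$ under the CRFE). $v_{m,a}=P(\chi^2_{m+2}\le a)/P(\chi^2_m\le a)$. Asymptotic covariance means the covariance of the weak limit of $\sqrt n(\hat{\boldsymbol{\tau}}-\boldsymbol{\tau})$; percentage reduction in asymptotic sampling variance of $\hat\tau_f$ is $1-$(its asymptotic variance under ReFM)/(its asymptotic variance under CRFE). Regularity conditions, as $n\to\infty$, for all $q\ne k$: (i) $n_q/n$ has a positive limit; (ii) $S_{qq},S_{qk},\boldsymbol{S}_{xx},\boldsymbol{S}_{q,x}$ have limits, $\boldsymbol{S}_{xx}$ and its limit nonsingular; (iii) $\max_i|Y_i(q)-\bar Y(q)|^2/n\to0$, $\max_i\|\boldsymbol{x}_i-\bar{\boldsymbol{x}}\|_2^2/n\to0$. *)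

theory Defs
  imports "HOL-Probability.Probability"
begin

text \<open>Treatment combinations are q < 2^K; factor k (k < K) is at level +1 in
combination q iff bit k of q is set.  Factorial effects are f in {1..<2^K};
effect f corresponds to the nonempty factor set A = set of bits of f.\<close>

definition effs :: "nat \<Rightarrow> nat set" where
  "effs K = {1..<2^K}"

definition iota :: "nat \<Rightarrow> nat \<Rightarrow> real" where
  "iota k q = (if odd (q div 2^k) then 1 else -1)"

definition gcoef :: "nat \<Rightarrow> nat \<Rightarrow> nat \<Rightarrow> real" where
  "gcoef K f q = (\<Prod>k<K. if odd (f div 2^k) then iota k q else 1)"

definition pmean :: "nat \<Rightarrow> (nat \<Rightarrow> real) \<Rightarrow> real" where
  "pmean n y = (\<Sum>i<n. y i) / real n"

definition pcov :: "nat \<Rightarrow> (nat \<Rightarrow> real) \<Rightarrow> (nat \<Rightarrow> real) \<Rightarrow> real" where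
  "pcov n y z = (\<Sum>i<n. (y i - pmean n y) * (z i - pmean n z)) / (real n - 1)"

definition invertible_on :: "'i set \<Rightarrow> ('i \<Rightarrow> 'i \<Rightarrow> real) \<Rightarrow> bool" where
  "invertible_on I A \<longleftrightarrow> (\<exists>B. (\<forall>i\<in>I. \<forall>j\<in>I. (\<Sum>k\<in>I. A i k * B k j) = (if i = j then 1 else 0))
                                \<and> (\<forall>i\<in>I. \<forall>j\<in>I. (\<Sum>k\<in>I. B i k * A k j) = (if i = j then 1 else 0)))"

definition minv :: "'i set \<Rightarrow> ('i \<Rightarrow> 'i \<Rightarrow> real) \<Rightarrow> ('i \<Rightarrow> 'i \<Rightarrow> real)" where
  "minv I A = (SOME B. (\<forall>i\<in>I. \<forall>j\<in>I. (\<Sum>k\<in>I. A i k * B k j) = (if i = j then 1 else 0))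
                     \<and> (\<forall>i\<in>I. \<forall>j\<in>I. (\<Sum>k\<in>I. B i k * A k j) = (if i = j then 1 else 0)))"

definition psd_on :: "'i set \<Rightarrow> ('i \<Rightarrow> 'i \<Rightarrow> real) \<Rightarrow> bool" where
  "psd_on I A \<longleftrightarrow> (\<forall>u. 0 \<le> (\<Sum>i\<in>I. \<Sum>j\<in>I. u i * A i j * u j))"

text \<open>Y i q: potential outcome of unit i under combination q;
x i l: l-th covariate (l < L) of unit i; nq q: size of group q.\<close>

definition tau_unit :: "nat \<Rightarrow> (nat \<Rightarrow> nat \<Rightarrow> real) \<Rightarrow> nat \<Rightarrow> nat \<Rightarrow> real" where
  "tau_unit K Y i f = (\<Sum>q<2^K. gcoef K f q * Y i q) / 2^(K-1)"

definition tau_pop :: "nat \<Rightarrow> nat \<Rightarrow> (nat \<Rightarrow> nat \<Rightarrow> real) \<Rightarrow> nat \<Rightarrow> real" where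
  "tau_pop K n Y f = (\<Sum>q<2^K. gcoef K f q * pmean n (\<lambda>i. Y i q)) / 2^(K-1)"

text \<open>V_tautau: the CRFE covariance matrix of the vector of estimated effects.\<close>
definition Vtt :: "nat \<Rightarrow> nat \<Rightarrow> (nat \<Rightarrow> nat) \<Rightarrow> (nat \<Rightarrow> nat \<Rightarrow> real) \<Rightarrow> nat \<Rightarrow> nat \<Rightarrow> real" where
  "Vtt K n nq Y f g =
     (\<Sum>q<2^K. gcoef K f q * gcoef K g q * pcov n (\<lambda>i. Y i q) (\<lambda>i. Y i q) / real (nq q)) / (2^(K-1))^2
     - pcov n (\<lambda>i. tau_unit K Y i f) (\<lambda>i. tau_unit K Y i g) / real n"

definition Sxx :: "nat \<Rightarrow> (nat \<Rightarrow> nat \<Rightarrow> real) \<Rightarrow> nat \<Rightarrow> nat \<Rightarrow> real" where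
  "Sxx n x l l' = pcov n (\<lambda>i. x i l) (\<lambda>i. x i l')"

definition Sqx :: "nat \<Rightarrow> (nat \<Rightarrow> nat \<Rightarrow> real) \<Rightarrow> (nat \<Rightarrow> nat \<Rightarrow> real) \<Rightarrow> nat \<Rightarrow> nat \<Rightarrow> real" where
  "Sqx n Y x q l = pcov n (\<lambda>i. Y i q) (\<lambda>i. x i l)"

definition Ypar :: "nat \<Rightarrow> nat \<Rightarrow> (nat \<Rightarrow> nat \<Rightarrow> real) \<Rightarrow> (nat \<Rightarrow> nat \<Rightarrow> real) \<Rightarrow> nat \<Rightarrow> nat \<Rightarrow> real" where
  "Ypar L n Y x i q = pmean n (\<lambda>j. Y j q)
     + (\<Sum>l<L. \<Sum>l'<L. Sqx n Y x q l * minv {..<L} (Sxx n x) l l' * (x i l' - pmean n (\<lambda>j. x j l')))"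

definition Vpar :: "nat \<Rightarrow> nat \<Rightarrow> nat \<Rightarrow> (nat \<Rightarrow> nat) \<Rightarrow> (nat \<Rightarrow> nat \<Rightarrow> real) \<Rightarrow> (nat \<Rightarrow> nat \<Rightarrow> real) \<Rightarrow> nat \<Rightarrow> nat \<Rightarrow> real" where
  "Vpar K L n nq Y x = Vtt K n nq (Ypar L n Y x)"

definition assigns :: "nat \<Rightarrow> nat \<Rightarrow> (nat \<Rightarrow> nat) \<Rightarrow> (nat \<Rightarrow> nat) set" where
  "assigns K n nq = {Z \<in> PiE {..<n} (\<lambda>_. {..<2^K}). \<forall>q<2^K. card {i\<in>{..<n}. Z i = q} = nq q}"

definition gmean :: "nat \<Rightarrow> (nat \<Rightarrow> nat) \<Rightarrow> nat \<Rightarrow> (nat \<Rightarrow> real) \<Rightarrow> real" where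
  "gmean n Z q y = (\<Sum>i\<in>{i\<in>{..<n}. Z i = q}. y i) / real (card {i\<in>{..<n}. Z i = q})"

definition tau_hat :: "nat \<Rightarrow> nat \<Rightarrow> (nat \<Rightarrow> nat \<Rightarrow> real) \<Rightarrow> (nat \<Rightarrow> nat) \<Rightarrow> nat \<Rightarrow> real" where
  "tau_hat K n Y Z f = (\<Sum>q<2^K. gcoef K f q * gmean n Z q (\<lambda>i. Y i q)) / 2^(K-1)"

definition taux_hat :: "nat \<Rightarrow> nat \<Rightarrow> (nat \<Rightarrow> nat \<Rightarrow> real) \<Rightarrow> (nat \<Rightarrow> nat) \<Rightarrow> nat \<times> nat \<Rightarrow> real" where
  "taux_hat K n x Z p = (\<Sum>q<2^K. gcoef K (fst p) q * gmean n Z q (\<lambda>i. x i (snd p))) / 2^(K-1)"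

definition Vxx :: "nat \<Rightarrow> nat \<Rightarrow> (nat \<Rightarrow> nat) \<Rightarrow> (nat \<Rightarrow> nat \<Rightarrow> real) \<Rightarrow> nat \<times> nat \<Rightarrow> nat \<times> nat \<Rightarrow> real" where
  "Vxx K n nq x p p' =
     (\<Sum>q<2^K. gcoef K (fst p) q * gcoef K (fst p') q / real (nq q)) / (2^(K-1))^2 * Sxx n x (snd p) (snd p')"

definition Mstat :: "nat \<Rightarrow> nat \<Rightarrow> nat \<Rightarrow> (nat \<Rightarrow> nat) \<Rightarrow> (nat \<Rightarrow> nat \<Rightarrow> real) \<Rightarrow> (nat \<Rightarrow> nat) \<Rightarrow> real" where
  "Mstat K L n nq x Z =
     (let I = effs K \<times> {..<L}; Vi = minv I (Vxx K n nq x) in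
      \<Sum>p\<in>I. \<Sum>p'\<in>I. taux_hat K n x Z p * Vi p p' * taux_hat K n x Z p')"

definition crfe :: "nat \<Rightarrow> nat \<Rightarrow> (nat \<Rightarrow> nat) \<Rightarrow> (nat \<Rightarrow> nat) measure" where
  "crfe K n nq = measure_pmf (pmf_of_set (assigns K n nq))"

definition refm :: "nat \<Rightarrow> nat \<Rightarrow> nat \<Rightarrow> (nat \<Rightarrow> nat) \<Rightarrow> (nat \<Rightarrow> nat \<Rightarrow> real) \<Rightarrow> real \<Rightarrow> (nat \<Rightarrow> nat) measure" where
  "refm K L n nq x a = uniform_measure (crfe K n nq) {Z. Mstat K L n nq x Z \<le> a}"

definition stat :: "nat \<Rightarrow> nat \<Rightarrow> (nat \<Rightarrow> nat \<Rightarrow> real) \<Rightarrow> (nat \<Rightarrow> nat) \<Rightarrow> nat \<Rightarrow> real" where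
  "stat K n Y Z = restrict (\<lambda>f. sqrt (real n) * (tau_hat K n Y Z f - tau_pop K n Y f)) (effs K)"

text \<open>X m is a random vector (extensional on the finite index set I) under the law P m;
mu is a Borel probability measure on R^I.  Weak convergence: E h(X m) \<rightarrow> \<integral> h d mu for every
bounded continuous h on R^I.\<close>
definition weak_conv_vec ::
  "'i set \<Rightarrow> (nat \<Rightarrow> 'a measure) \<Rightarrow> (nat \<Rightarrow> 'a \<Rightarrow> 'i \<Rightarrow> real) \<Rightarrow> ('i \<Rightarrow> real) measure \<Rightarrow> bool" where
  "weak_conv_vec I P X mu \<longleftrightarrow>
     prob_space mu \<and> sets mu = sets (PiM I (\<lambda>_. borel)) \<and>
     (\<forall>h :: ('i \<Rightarrow> real) \<Rightarrow> real.
        continuous_on (PiE I (\<lambda>_. UNIV)) h \<and> bounded (h ` PiE I (\<lambda>_. UNIV)) \<longrightarrow>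
        (\<lambda>m. \<integral>z. h (X m z) \<partial>P m) \<longlonglongrightarrow> (\<integral>y. h y \<partial>mu))"

definition mcov :: "('i \<Rightarrow> real) measure \<Rightarrow> 'i \<Rightarrow> 'i \<Rightarrow> real" where
  "mcov mu f g = (\<integral>y. y f * y g \<partial>mu) - (\<integral>y. y f \<partial>mu) * (\<integral>y. y g \<partial>mu)"

definition chisq_cdf :: "nat \<Rightarrow> real \<Rightarrow> real" where
  "chisq_cdf k a = (LBINT t=0..a. t powr (real k / 2 - 1) * exp (- t / 2)
                                  / (2 powr (real k / 2) * Gamma (real k / 2)))"

definition vma :: "nat \<Rightarrow> real \<Rightarrow> real" where
  "vma m a = chisq_cdf (m + 2) a / chisq_cdf m a"

end

theory Submission
  imports Defs "HOL-Combinatorics.Transposition"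
begin

text \<open>
  The group means of outcomes and covariates are jointly asymptotically normal under complete
  randomization: a linear combination of them is a sum \<open>\<Sum>i. c i (Z i)\<close>, and swapping the labels of
  two random units gives an approximate differential equation for its characteristic function.
  In the limit, \<open>\<tau>\<close> splits into its linear projection on \<open>\<tau>\<^sub>x\<close>, with covariance \<open>lim n V\<^sup>\<parallel>\<close>, and an
  independent residual, and the projection is a linear function of the whitened vector
  \<open>D = V\<^bsub>xx\<^esub>\<^bsup>-1/2\<^esup> \<tau>\<^sub>x\<close>. Rerandomization conditions on \<open>|D|\<^sup>2 \<le> a\<close>. This leaves the residual alone and, by
  the symmetries of the standard normal law, keeps the components of \<open>D\<close> uncorrelated and centred
  while multiplying their variances by \<open>E (|D|\<^sup>2; |D|\<^sup>2 \<le> a) / (L F P (|D|\<^sup>2 \<le> a)) = v\<^bsub>LF,a\<^esub>\<close>.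
\<close>

section \<open>Inverses and factors of indexed matrices\<close>

definition inverse_on :: "'i set \<Rightarrow> ('i \<Rightarrow> 'i \<Rightarrow> real) \<Rightarrow> ('i \<Rightarrow> 'i \<Rightarrow> real) \<Rightarrow> bool" where
  "inverse_on I A B \<longleftrightarrow>
     (\<forall>i\<in>I. \<forall>j\<in>I. (\<Sum>k\<in>I. A i k * B k j) = (if i = j then 1 else 0)) \<and>
     (\<forall>i\<in>I. \<forall>j\<in>I. (\<Sum>k\<in>I. B i k * A k j) = (if i = j then 1 else 0))"

lemma inverse_on_minv: "invertible_on I A \<Longrightarrow> inverse_on I A (minv I A)"
  unfolding invertible_on_def minv_def inverse_on_def
  by (rule someI_ex[where P="\<lambda>B. (\<forall>i\<in>I. \<forall>j\<in>I. (\<Sum>k\<in>I. A i k * B k j) = (if i = j then 1 else 0)) \<and> (\<forall>i\<in>I. \<forall>j\<in>I. (\<Sum>k\<in>I. B i k * A k j) = (if i = j then 1 else 0))"])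

lemma inverse_on_invertible: "inverse_on I A B \<Longrightarrow> invertible_on I A"
  unfolding invertible_on_def inverse_on_def by blast

lemma inverse_on_resolvent:
  assumes fin: "finite I" and B: "inverse_on I A B" and B': "inverse_on I A' B'"
    and ij: "i \<in> I" "j \<in> I"
  shows "B' i j - B i j = (\<Sum>k\<in>I. \<Sum>l\<in>I. B i k * (A k l - A' k l) * B' l j)"
proof -
  have 1: "(\<Sum>k\<in>I. \<Sum>l\<in>I. B i k * A k l * B' l j) = B' i j"
  proof -
    have "(\<Sum>k\<in>I. \<Sum>l\<in>I. B i k * A k l * B' l j) = (\<Sum>l\<in>I. (\<Sum>k\<in>I. B i k * A k l) * B' l j)"
      by (subst sum.swap) (simp add: sum_distrib_right)
    also have "\<dots> = (\<Sum>l\<in>I. (if i = l then 1 else 0) * B' l j)"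
      using B ij unfolding inverse_on_def by (intro sum.cong) auto
    also have "\<dots> = B' i j" using fin ij by (simp add: if_distrib[of "\<lambda>z. z * _"] cong: if_cong)
    finally show ?thesis .
  qed
  have 2: "(\<Sum>k\<in>I. \<Sum>l\<in>I. B i k * A' k l * B' l j) = B i j"
  proof -
    have "(\<Sum>k\<in>I. \<Sum>l\<in>I. B i k * A' k l * B' l j) = (\<Sum>k\<in>I. B i k * (\<Sum>l\<in>I. A' k l * B' l j))"
      by (simp add: sum_distrib_left mult.assoc)
    also have "\<dots> = (\<Sum>k\<in>I. B i k * (if k = j then 1 else 0))"
      using B' ij unfolding inverse_on_def by (intro sum.cong) auto
    also have "\<dots> = B i j" using fin ij by (simp add: if_distrib[of "\<lambda>z. _ * z"] cong: if_cong)
    finally show ?thesis .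
  qed
  show ?thesis
    by (simp add: right_diff_distrib left_diff_distrib sum_subtractf 1 2)
qed

lemma inverse_on_unique:
  assumes "finite I" "inverse_on I A B" "inverse_on I A B'" "i \<in> I" "j \<in> I"
  shows "B i j = B' i j"
  using inverse_on_resolvent[OF assms] by simp

lemma inverse_on_sym:
  assumes fin: "finite I" and B: "inverse_on I A B"
    and sym: "\<And>i j. i \<in> I \<Longrightarrow> j \<in> I \<Longrightarrow> A i j = A j i" and ij: "i \<in> I" "j \<in> I"
  shows "B i j = B j i"
proof -
  have "inverse_on I A (\<lambda>i j. B j i)"
    using B unfolding inverse_on_def
    by (auto simp: sym mult.commute cong: sum.cong)
  from inverse_on_unique[OF fin B this ij] show ?thesis .
qed

lemma inverse_on_tendsto:
  fixes A :: "nat \<Rightarrow> 'i \<Rightarrow> 'i \<Rightarrow> real"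
  assumes fin: "finite I"
    and lim: "\<And>i j. i \<in> I \<Longrightarrow> j \<in> I \<Longrightarrow> (\<lambda>m. A m i j) \<longlonglongrightarrow> A0 i j"
    and inv: "\<And>m. inverse_on I (A m) (B m)" and inv0: "inverse_on I A0 B0"
    and ij: "i \<in> I" "j \<in> I"
  shows "(\<lambda>m. B m i j) \<longlonglongrightarrow> B0 i j"
proof -
  define b where "b = (\<Sum>i\<in>I. \<Sum>j\<in>I. \<bar>B0 i j\<bar>)"
  define \<beta> where "\<beta> m = (\<Sum>i\<in>I. \<Sum>j\<in>I. \<bar>B m i j\<bar>)" for m
  define e where "e m = (\<Sum>i\<in>I. \<Sum>j\<in>I. \<bar>A0 i j - A m i j\<bar>)" for m
  have entry: "\<bar>f i j\<bar> \<le> (\<Sum>i\<in>I. \<Sum>j\<in>I. \<bar>f i j\<bar>)" if "i \<in> I" "j \<in> I" for f :: "'i \<Rightarrow> 'i \<Rightarrow> real" and i j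
  proof -
    have "\<bar>f i j\<bar> \<le> (\<Sum>j\<in>I. \<bar>f i j\<bar>)" using that fin by (intro member_le_sum) auto
    also have "\<dots> \<le> (\<Sum>i\<in>I. \<Sum>j\<in>I. \<bar>f i j\<bar>)"
      using that fin by (intro member_le_sum[where f="\<lambda>i. \<Sum>j\<in>I. \<bar>f i j\<bar>"]) (auto intro: sum_nonneg)
    finally show ?thesis .
  qed
  have b0: "b \<ge> 0" "\<beta> m \<ge> 0" "e m \<ge> 0" for m
    unfolding b_def \<beta>_def e_def by (auto intro!: sum_nonneg)
  have bound: "\<bar>B m i j - B0 i j\<bar> \<le> b * e m * \<beta> m" if "i \<in> I" "j \<in> I" for m i j
  proof -
    have "\<bar>B m i j - B0 i j\<bar> \<le> (\<Sum>k\<in>I. \<Sum>l\<in>I. \<bar>B0 i k * (A0 k l - A m k l) * B m l j\<bar>)"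
      unfolding inverse_on_resolvent[OF fin inv0 inv that]
      by (rule order_trans[OF sum_abs]) (intro sum_mono sum_abs)
    also have "\<dots> \<le> (\<Sum>k\<in>I. \<Sum>l\<in>I. b * \<bar>A0 k l - A m k l\<bar> * \<beta> m)"
      unfolding abs_mult b_def \<beta>_def
      by (intro sum_mono mult_mono entry that mult_nonneg_nonneg) (auto intro!: sum_nonneg)
    also have "\<dots> = b * e m * \<beta> m"
      by (simp add: e_def sum_distrib_left sum_distrib_right)
    finally show ?thesis .
  qed
  have e: "e \<longlonglongrightarrow> 0"
  proof -
    have "(\<lambda>m. \<Sum>i\<in>I. \<Sum>j\<in>I. \<bar>A0 i j - A m i j\<bar>) \<longlonglongrightarrow> (\<Sum>i\<in>I. \<Sum>j\<in>I. \<bar>A0 i j - A0 i j\<bar>)"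
      by (intro tendsto_intros lim)
    then show ?thesis by (simp add: e_def[abs_def])
  qed
  have sumb: "\<beta> m \<le> b + real (card I)^2 * (b * e m * \<beta> m)" for m
  proof -
    have "\<beta> m \<le> (\<Sum>i\<in>I. \<Sum>j\<in>I. \<bar>B0 i j\<bar> + b * e m * \<beta> m)"
      unfolding \<beta>_def[of m]
    proof (intro sum_mono)
      fix i j assume "i \<in> I" "j \<in> I"
      from bound[OF this, of m] show "\<bar>B m i j\<bar> \<le> \<bar>B0 i j\<bar> + b * e m * (\<Sum>i\<in>I. \<Sum>j\<in>I. \<bar>B m i j\<bar>)"
        unfolding \<beta>_def by linarith
    qed
    also have "\<dots> = b + real (card I)^2 * (b * e m * \<beta> m)"
      by (simp add: sum.distrib b_def power2_eq_square)
    finally show ?thesis .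
  qed
  have "(\<lambda>m. real (card I)^2 * (b * e m)) \<longlonglongrightarrow> 0"
    using tendsto_mult[OF tendsto_const[of "real (card I)^2 * b"] e] by (simp add: mult.assoc)
  then have "\<forall>\<^sub>F m in sequentially. real (card I)^2 * (b * e m) < 1/2"
    by (rule order_tendstoD) simp
  then have "\<forall>\<^sub>F m in sequentially. \<beta> m \<le> 2 * b"
  proof eventually_elim
    case (elim m)
    have "real (card I)^2 * (b * e m) * \<beta> m \<le> 1/2 * \<beta> m"
      using elim b0 by (intro mult_right_mono) auto
    with sumb[of m] show ?case by (simp add: mult.assoc)
  qed
  then have "\<forall>\<^sub>F m in sequentially. norm (B m i j - B0 i j) \<le> b * e m * (2 * b)"
  proof eventually_elim
    case (elim m)
    have "b * e m * \<beta> m \<le> b * e m * (2 * b)" using elim b0 by (intro mult_left_mono) auto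
    with bound[OF ij, of m] show ?case by simp
  qed
  moreover have "(\<lambda>m. b * e m * (2 * b)) \<longlonglongrightarrow> 0"
    using tendsto_mult[OF tendsto_mult[OF tendsto_const[of b] e] tendsto_const[of "2*b"]] by simp
  ultimately have "(\<lambda>m. B m i j - B0 i j) \<longlonglongrightarrow> 0" by (rule Lim_null_comparison)
  then show ?thesis by (simp add: LIM_zero_iff)
qed

lemma cholesky:
  fixes A :: "'i \<Rightarrow> 'i \<Rightarrow> real"
  assumes "finite I" "psd_on I A" "\<And>i j. i \<in> I \<Longrightarrow> j \<in> I \<Longrightarrow> A i j = A j i"
  shows "\<exists>C. \<forall>i\<in>I. \<forall>j\<in>I. A i j = (\<Sum>k\<in>I. C i k * C j k)"
  using assms
proof (induction I arbitrary: A rule: finite_induct)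
  case empty
  then show ?case by simp
next
  case (insert x F A)
  have form: "(\<Sum>i\<in>insert x F. \<Sum>j\<in>insert x F. u i * A i j * u j)
      = (u x)^2 * A x x + 2 * u x * (\<Sum>j\<in>F. A x j * u j) + (\<Sum>i\<in>F. \<Sum>j\<in>F. u i * A i j * u j)" for u
  proof -
    have "(\<Sum>i\<in>F. u i * A i x * u x) = u x * (\<Sum>j\<in>F. A x j * u j)"
      unfolding sum_distrib_left using insert.prems(2) by (intro sum.cong) auto
    moreover have "(\<Sum>j\<in>F. u x * A x j * u j) = u x * (\<Sum>j\<in>F. A x j * u j)"
      by (simp add: sum_distrib_left mult.assoc)
    ultimately show ?thesis using insert.hyps
      by (simp add: sum.distrib power2_eq_square algebra_simps)
  qed
  have nonneg: "0 \<le> (u x)^2 * A x x + 2 * u x * (\<Sum>j\<in>F. A x j * u j) + (\<Sum>i\<in>F. \<Sum>j\<in>F. u i * A i j * u j)" for u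
    using insert.prems(1) unfolding psd_on_def form by blast
  have dnn: "A x x \<ge> 0"
    using nonneg[of "\<lambda>i. if i = x then 1 else 0"] insert.hyps
    by (simp add: if_distrib[of "\<lambda>z. _ * z"] if_distrib[of "\<lambda>z. z * _"] cong: if_cong)
  have zero: "A x y = 0" if "A x x = 0" "y \<in> F" for y
  proof (rule ccontr)
    assume ne: "A x y \<noteq> 0"
    define s where "s = - (A y y + 1) / (2 * A x y)"
    define u where "u i = (if i = x then s else if i = y then 1 else 0)" for i
    have 1: "(\<Sum>j\<in>F. A x j * u j) = A x y"
    proof -
      have "(\<Sum>j\<in>F. A x j * u j) = (\<Sum>j\<in>F. if j = y then A x y else 0)"
        using insert.hyps by (intro sum.cong) (auto simp: u_def)
      then show ?thesis using that insert.hyps by simp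
    qed
    have 2: "(\<Sum>i\<in>F. \<Sum>j\<in>F. u i * A i j * u j) = A y y"
    proof -
      have "(\<Sum>i\<in>F. \<Sum>j\<in>F. u i * A i j * u j) = (\<Sum>i\<in>F. \<Sum>j\<in>F. if j = y then (if i = y then A y y else 0) else 0)"
        using insert.hyps by (intro sum.cong) (auto simp: u_def)
      then show ?thesis using that insert.hyps by simp
    qed
    have "0 \<le> 2 * s * A x y + A y y"
      using nonneg[of u] that unfolding 1 2 by (simp add: u_def)
    also have "2 * s * A x y = - (A y y + 1)" using ne by (simp add: s_def)
    finally show False by simp
  qed
  define A' where "A' i j = A i j - A i x * A j x / A x x" for i j
  have psd': "psd_on F A'"
    unfolding psd_on_def
  proof
    fix u
    define S where "S = (\<Sum>j\<in>F. A x j * u j)"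
    define v where "v = u(x := - S / A x x)"
    have 1: "(\<Sum>j\<in>F. A x j * v j) = S"
      unfolding S_def v_def using insert.hyps by (intro sum.cong) auto
    have 2: "(\<Sum>i\<in>F. \<Sum>j\<in>F. v i * A i j * v j) = (\<Sum>i\<in>F. \<Sum>j\<in>F. u i * A i j * u j)"
      unfolding v_def using insert.hyps by (intro sum.cong) auto
    have "0 \<le> (\<Sum>i\<in>F. \<Sum>j\<in>F. u i * A i j * u j) - S * S / A x x"
      using nonneg[of v] unfolding 1 2 by (cases "A x x = 0") (simp_all add: v_def field_simps power2_eq_square)
    also have "S * S / A x x = (\<Sum>i\<in>F. \<Sum>j\<in>F. u i * (A i x * A j x / A x x) * u j)"
      unfolding S_def sum_product sum_divide_distrib
      using insert.prems(2) by (intro sum.cong refl) (auto simp: mult_ac)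
    finally show "0 \<le> (\<Sum>i\<in>F. \<Sum>j\<in>F. u i * A' i j * u j)"
      by (simp add: A'_def algebra_simps sum_subtractf)
  qed
  have sym': "A' i j = A' j i" if "i \<in> F" "j \<in> F" for i j
    using insert.prems(2)[of i j] that by (simp add: A'_def mult.commute)
  obtain C where C: "\<And>i j. i \<in> F \<Longrightarrow> j \<in> F \<Longrightarrow> A' i j = (\<Sum>k\<in>F. C i k * C j k)"
    using insert.IH[OF psd' sym'] by blast
  define C' where "C' i k = (if k = x then A i x / sqrt (A x x) else if i = x then 0 else C i k)" for i k
  have "A i j = (\<Sum>k\<in>insert x F. C' i k * C' j k)" if ij: "i \<in> insert x F" "j \<in> insert x F" for i j
  proof -
    have s: "(\<Sum>k\<in>insert x F. C' i k * C' j k) = A i x * A j x / A x x + (\<Sum>k\<in>F. if i = x \<or> j = x then 0 else C i k * C j k)"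
    proof -
      have "(\<Sum>k\<in>F. C' i k * C' j k) = (\<Sum>k\<in>F. if i = x \<or> j = x then 0 else C i k * C j k)"
        using insert.hyps by (intro sum.cong) (auto simp: C'_def)
      then show ?thesis using insert.hyps dnn by (simp add: C'_def)
    qed
    show ?thesis
    proof (cases "i = x \<or> j = x")
      case True
      have z: "A y x = 0" if "A x x = 0" "y \<in> insert x F" for y
        using zero[OF that(1)] that insert.prems(2)[of y x] by auto
      show ?thesis unfolding s using True ij z insert.prems(2)[of i j] by (cases "A x x = 0") auto
    next
      case False
      then have "i \<in> F" "j \<in> F" using ij by auto
      from C[OF this] show ?thesis unfolding s using False by (simp add: A'_def)
    qed
  qed
  then show ?case by blast
qed

text \<open>\<open>C\<^sup>T W C\<close> is a symmetric idempotent of full trace, so \<open>1 - C\<^sup>T W C\<close> has Frobenius norm 0.\<close>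

lemma factor_whitens:
  fixes C W Om :: "'i \<Rightarrow> 'i \<Rightarrow> real"
  assumes fin: "finite I"
    and C: "\<And>i j. i \<in> I \<Longrightarrow> j \<in> I \<Longrightarrow> Om i j = (\<Sum>k\<in>I. C i k * C j k)"
    and W: "inverse_on I Om W"
    and ij: "i \<in> I" "j \<in> I"
  shows "(\<Sum>k\<in>I. \<Sum>l\<in>I. C k i * W k l * C l j) = (if i = j then 1 else 0)"
proof -
  have Wsym: "W k l = W l k" if "k \<in> I" "l \<in> I" for k l
    by (rule inverse_on_sym[OF fin W _ that]) (simp add: C mult.commute)
  define P where "P i j = (\<Sum>k\<in>I. \<Sum>l\<in>I. C k i * W k l * C l j)" for i j
  define R where "R k j = (\<Sum>l\<in>I. W k l * C l j)" for k j
  have P_R: "P i j = (\<Sum>k\<in>I. C k i * R k j)" for i j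
    by (simp add: P_def R_def sum_distrib_left mult.assoc)
  have Psym: "P i j = P j i" for i j
    unfolding P_def by (subst sum.swap) (auto simp: Wsym mult_ac intro!: sum.cong)
  have CP: "(\<Sum>h\<in>I. C k h * P h j) = C k j" if k: "k \<in> I" for k j
  proof -
    have "(\<Sum>h\<in>I. C k h * P h j) = (\<Sum>h\<in>I. \<Sum>l\<in>I. C k h * C l h * R l j)"
      by (simp add: P_R sum_distrib_left mult.assoc)
    also have "\<dots> = (\<Sum>l\<in>I. Om k l * R l j)"
      by (subst sum.swap) (auto simp: C k sum_distrib_right intro!: sum.cong)
    also have "\<dots> = (\<Sum>l\<in>I. \<Sum>h\<in>I. Om k l * W l h * C h j)"
      by (simp add: R_def sum_distrib_left mult.assoc)
    also have "\<dots> = (\<Sum>h\<in>I. (\<Sum>l\<in>I. Om k l * W l h) * C h j)"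
      by (subst sum.swap) (simp add: sum_distrib_right)
    also have "\<dots> = (\<Sum>h\<in>I. (if k = h then 1 else 0) * C h j)"
      using W k unfolding inverse_on_def by (intro sum.cong) auto
    also have "\<dots> = C k j" using fin k by (simp add: if_distrib[of "\<lambda>z. z * _"] cong: if_cong)
    finally show ?thesis .
  qed
  have idem: "(\<Sum>h\<in>I. P i h * P h j) = P i j" for i j
  proof -
    have "(\<Sum>h\<in>I. P i h * P h j) = (\<Sum>h\<in>I. P h j * (\<Sum>k\<in>I. C k h * R k i))"
      by (simp add: Psym[of i] P_R[of _ i] mult.commute)
    also have "\<dots> = (\<Sum>h\<in>I. \<Sum>k\<in>I. (C k h * P h j) * R k i)"
      by (simp add: sum_distrib_left mult_ac)
    also have "\<dots> = (\<Sum>k\<in>I. (\<Sum>h\<in>I. C k h * P h j) * R k i)"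
      by (subst sum.swap) (simp add: sum_distrib_right)
    also have "\<dots> = (\<Sum>k\<in>I. C k j * R k i)" by (simp add: CP)
    also have "\<dots> = P i j" by (simp add: P_R[symmetric] Psym)
    finally show ?thesis .
  qed
  have trace: "(\<Sum>i\<in>I. P i i) = real (card I)"
  proof -
    have "(\<Sum>i\<in>I. P i i) = (\<Sum>i\<in>I. \<Sum>k\<in>I. \<Sum>l\<in>I. W k l * (C l i * C k i))"
      by (simp add: P_def mult_ac)
    also have "\<dots> = (\<Sum>k\<in>I. \<Sum>l\<in>I. \<Sum>i\<in>I. W k l * (C l i * C k i))"
      by (subst sum.swap, rule sum.cong[OF refl], rule sum.swap)
    also have "\<dots> = (\<Sum>k\<in>I. \<Sum>l\<in>I. W k l * Om l k)"
      by (simp add: C sum_distrib_left)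
    also have "\<dots> = (\<Sum>k\<in>I. 1)"
      using W unfolding inverse_on_def by (intro sum.cong) auto
    finally show ?thesis by simp
  qed
  define d :: "'i \<Rightarrow> 'i \<Rightarrow> real" where "d i j = (if i = j then 1 else 0)" for i j
  have "(\<Sum>i\<in>I. \<Sum>j\<in>I. (d i j - P i j)^2) = (\<Sum>i\<in>I. 1 - 2 * P i i + (\<Sum>j\<in>I. P i j * P j i))"
  proof (rule sum.cong[OF refl])
    fix i assume i: "i \<in> I"
    have "(\<Sum>j\<in>I. (d i j - P i j)^2) = (\<Sum>j\<in>I. (if i = j then 1 - 2 * P i i else 0) + P i j * P j i)"
      by (intro sum.cong) (auto simp: d_def Psym power2_eq_square algebra_simps)
    then show "(\<Sum>j\<in>I. (d i j - P i j)^2) = 1 - 2 * P i i + (\<Sum>j\<in>I. P i j * P j i)"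
      using fin i by (simp add: sum.distrib)
  qed
  also have "\<dots> = 0" by (simp add: idem sum.distrib sum_subtractf trace sum_distrib_left[symmetric])
  finally have z: "(\<Sum>i\<in>I. \<Sum>j\<in>I. (d i j - P i j)^2) = 0" .
  have "(\<Sum>j\<in>I. (d i j - P i j)^2) = 0"
    using z fin ij by (subst (asm) sum_nonneg_eq_0_iff) (auto intro: sum_nonneg)
  then have "(d i j - P i j)^2 = 0"
    using fin ij by (subst (asm) sum_nonneg_eq_0_iff) auto
  then show ?thesis by (simp add: d_def P_def)
qed

section \<open>Convergence of characteristic functions\<close>

lemma compact_PiE_Icc:
  fixes M :: real
  shows "compact (PiE I (\<lambda>_. {-M..M}) :: ('i \<Rightarrow> real) set)"
proof -
  define S where "S i = (if i \<in> I then {-M..M} else {undefined::real})" for i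
  have eq: "PiE I (\<lambda>_. {-M..M}) = PiE UNIV S"
    unfolding PiE_def extensional_def Pi_def S_def by (intro set_eqI) (simp split: if_split, metis singletonD singletonI)
  have "compactin (product_topology (\<lambda>i. euclidean) UNIV) (PiE UNIV S)"
    unfolding compactin_PiE by (simp add: S_def)
  then show ?thesis unfolding eq euclidean_product_topology by simp
qed

lemma continuous_on_coordinate: "continuous_on S (\<lambda>x::'i \<Rightarrow> real. x i)"
  by (rule continuous_on_subset[OF continuous_on_product_coordinates]) simp

inductive_set coord_poly :: "'i set \<Rightarrow> (('i \<Rightarrow> real) \<Rightarrow> real) set" for I where
  const: "(\<lambda>_. c) \<in> coord_poly I"
| coord: "i \<in> I \<Longrightarrow> (\<lambda>x. x i) \<in> coord_poly I"
| add: "f \<in> coord_poly I \<Longrightarrow> g \<in> coord_poly I \<Longrightarrow> (\<lambda>x. f x + g x) \<in> coord_poly I"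
| mult: "f \<in> coord_poly I \<Longrightarrow> g \<in> coord_poly I \<Longrightarrow> (\<lambda>x. f x * g x) \<in> coord_poly I"

inductive_set trig_poly :: "'i set \<Rightarrow> (('i \<Rightarrow> real) \<Rightarrow> real) set" for I where
  cos: "(\<lambda>x. c * cos ((\<Sum>i\<in>I. t i * x i) + \<theta>)) \<in> trig_poly I"
| add: "f \<in> trig_poly I \<Longrightarrow> g \<in> trig_poly I \<Longrightarrow> (\<lambda>x. f x + g x) \<in> trig_poly I"

lemma trig_poly_mult:
  assumes "f \<in> trig_poly I" "g \<in> trig_poly I"
  shows "(\<lambda>x. f x * g x) \<in> trig_poly I"
  using assms(1)
proof induction
  case (cos c t \<theta>)
  show ?case using assms(2)
  proof induction
    case (cos d s \<eta>)
    let ?T = "\<lambda>x. \<Sum>i\<in>I. t i * x i" and ?S = "\<lambda>x. \<Sum>i\<in>I. s i * x i"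
    have 1: "(\<lambda>x. (c * d / 2) * cos ((\<Sum>i\<in>I. (t i - s i) * x i) + (\<theta> - \<eta>))) \<in> trig_poly I"
      by (rule trig_poly.cos)
    have 2: "(\<lambda>x. (c * d / 2) * cos ((\<Sum>i\<in>I. (t i + s i) * x i) + (\<theta> + \<eta>))) \<in> trig_poly I"
      by (rule trig_poly.cos)
    have "c * cos (?T x + \<theta>) * (d * cos (?S x + \<eta>)) =
       (c * d / 2) * cos ((\<Sum>i\<in>I. (t i - s i) * x i) + (\<theta> - \<eta>))
       + (c * d / 2) * cos ((\<Sum>i\<in>I. (t i + s i) * x i) + (\<theta> + \<eta>))" for x
    proof -
      have a: "(\<Sum>i\<in>I. (t i - s i) * x i) + (\<theta> - \<eta>) = (?T x + \<theta>) - (?S x + \<eta>)"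
        "(\<Sum>i\<in>I. (t i + s i) * x i) + (\<theta> + \<eta>) = (?T x + \<theta>) + (?S x + \<eta>)"
        by (simp_all add: algebra_simps sum.distrib sum_subtractf)
      have "c * cos u * (d * cos v) = (c * d / 2) * cos (u - v) + (c * d / 2) * cos (u + v)" for u v
        by (simp add: cos_add cos_diff algebra_simps)
      then show ?thesis unfolding a .
    qed
    then show ?case using trig_poly.add[OF 1 2] by (simp only:)
  next
    case (add f g)
    show ?case unfolding distrib_left by (rule trig_poly.add[OF add.IH])
  qed
next
  case (add f g)
  show ?case unfolding distrib_right by (rule trig_poly.add[OF add.IH])
qed

lemma coord_poly_sin:
  assumes fin: "finite I" and "f \<in> coord_poly I"
  shows "(\<lambda>x. f (\<lambda>i\<in>I. M * sin (x i / M))) \<in> trig_poly I"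
  using assms(2)
proof induction
  case (const c)
  show ?case using trig_poly.cos[of c "\<lambda>_. 0" I 0] by simp
next
  case (coord i)
  have "(\<Sum>j\<in>I. (if j = i then 1 / M else 0) * x j) = x i / M" for x :: "'a \<Rightarrow> real"
    using coord fin by (simp add: if_distrib[of "\<lambda>z. z * _"] cong: if_cong)
  moreover have "cos (y + - pi / 2) = sin y" for y :: real
    by (simp add: cos_diff)
  ultimately show ?case
    using trig_poly.cos[of M "\<lambda>j. if j = i then 1 / M else 0" I "- pi / 2"] coord
    by simp
next
  case (add f g)
  show ?case by (rule trig_poly.add[OF add.IH])
next
  case (mult f g)
  show ?case by (rule trig_poly_mult[OF mult.IH])
qed

lemma coord_poly_dense:
  fixes h :: "('i::countable \<Rightarrow> real) \<Rightarrow> real"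
  assumes h: "continuous_on (PiE I (\<lambda>_. {-M..M})) h" and e: "e > 0"
  shows "\<exists>g\<in>coord_poly I. \<forall>x\<in>PiE I (\<lambda>_. {-M..M}). \<bar>h x - g x\<bar> < e"
proof -
  interpret function_ring_on "coord_poly I" "PiE I (\<lambda>_. {-M..M})"
  proof
    show "continuous_on (PiE I (\<lambda>_. {-M..M})) f" if "f \<in> coord_poly I" for f
      using that
    proof induction
      case (coord i)
      show ?case by (rule continuous_on_coordinate)
    qed (auto intro: continuous_on_const continuous_on_add continuous_on_mult)
    show "\<exists>f\<in>coord_poly I. f x \<noteq> f y"
      if xy: "x \<in> PiE I (\<lambda>_. {-M..M})" "y \<in> PiE I (\<lambda>_. {-M..M})" "x \<noteq> y" for x y
    proof -
      obtain i where i: "i \<in> I" "x i \<noteq> y i" using PiE_ext[OF xy(1,2)] xy(3) by blast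
      show ?thesis by (rule bexI[OF _ coord_poly.coord[OF i(1)]]) (rule i(2))
    qed
    show "compact (PiE I (\<lambda>_. {-M..M}) :: ('i \<Rightarrow> real) set)" by (rule compact_PiE_Icc)
    show "(\<lambda>_. c) \<in> coord_poly I" for c by (rule coord_poly.const)
    show "(\<lambda>x. f x + g x) \<in> coord_poly I" "(\<lambda>x. f x * g x) \<in> coord_poly I"
      if "f \<in> coord_poly I" "g \<in> coord_poly I" for f g
      using that by (rule coord_poly.add coord_poly.mult)+
  qed
  show ?thesis by (rule Stone_Weierstrass_basic[OF h e])
qed

lemma borel_measurable_continuous_PiE:
  fixes h :: "('i::countable \<Rightarrow> real) \<Rightarrow> real"
  assumes h: "continuous_on (PiE I (\<lambda>_. UNIV)) h"
  shows "h \<in> borel_measurable (PiM I (\<lambda>_. borel))"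
proof -
  have r: "continuous_on UNIV (\<lambda>x::'i \<Rightarrow> real. restrict x I)"
  proof (rule continuous_on_coordinatewise_then_product)
    fix i show "continuous_on UNIV (\<lambda>x::'i \<Rightarrow> real. restrict x I i)"
      by (cases "i \<in> I") auto
  qed
  have "continuous_on UNIV (\<lambda>x. h (restrict x I))"
    by (rule continuous_on_compose2[OF h r]) auto
  then have 1: "(\<lambda>x. h (restrict x I)) \<in> borel_measurable borel"
    by (rule borel_measurable_continuous_onI)
  have 2: "(\<lambda>x. x) \<in> measurable (PiM I (\<lambda>_. borel)) (PiM UNIV (\<lambda>_::'i. borel :: real measure))"
  proof (rule measurable_PiM_single')
    fix i :: 'i
    show "(\<lambda>x. x i) \<in> measurable (PiM I (\<lambda>_. borel)) (borel :: real measure)"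
    proof (cases "i \<in> I")
      case False
      have "(\<lambda>x. x i) \<in> measurable (PiM I (\<lambda>_. borel)) (borel :: real measure) \<longleftrightarrow>
        (\<lambda>x. undefined) \<in> measurable (PiM I (\<lambda>_. borel :: real measure)) (borel :: real measure)"
        using False by (intro measurable_cong) (auto simp: space_PiM)
      then show ?thesis by simp
    qed simp
  qed auto
  have 3: "(\<lambda>x. h (restrict x I)) \<in> borel_measurable (PiM UNIV (\<lambda>_::'i. borel :: real measure))"
    using 1 by (simp add: measurable_cong_sets[OF sets_PiM_equal_borel refl])
  have "(\<lambda>x. h (restrict x I)) \<in> borel_measurable (PiM I (\<lambda>_. borel))"
    using measurable_compose[OF 2 3] .
  then show ?thesis
    by (rule measurable_cong[THEN iffD1, rotated]) (auto simp: space_PiM PiE_restrict)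
qed

lemma coord_poly_Lipschitz:
  assumes fin: "finite I" and R: "R \<ge> 0" and "g \<in> coord_poly I"
  shows "\<exists>B\<ge>0. \<forall>x\<in>PiE I (\<lambda>_. {-R..R}). \<forall>y\<in>PiE I (\<lambda>_. {-R..R}).
           \<bar>g x\<bar> \<le> B \<and> \<bar>g x - g y\<bar> \<le> B * (\<Sum>i\<in>I. \<bar>x i - y i\<bar>)"
  using assms(3)
proof induction
  case (const c)
  show ?case by (rule exI[of _ "\<bar>c\<bar>"]) (simp add: sum_nonneg)
next
  case (coord i)
  have 1: "\<bar>x i - y i\<bar> \<le> (R + 1) * (\<Sum>i\<in>I. \<bar>x i - y i\<bar>)" for x y :: "'a \<Rightarrow> real"
  proof -
    have "\<bar>x i - y i\<bar> \<le> 1 * (\<Sum>i\<in>I. \<bar>x i - y i\<bar>)"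
      using member_le_sum[of i I "\<lambda>i. \<bar>x i - y i\<bar>"] coord fin by simp
    also have "\<dots> \<le> (R + 1) * (\<Sum>i\<in>I. \<bar>x i - y i\<bar>)"
      using R by (intro mult_right_mono) (auto intro: sum_nonneg)
    finally show ?thesis .
  qed
  have 2: "\<bar>x i\<bar> \<le> R + 1" if "x \<in> PiE I (\<lambda>_. {-R..R})" for x
    using PiE_mem[OF that coord] by auto
  show ?case
    by (intro exI[of _ "R + 1"] conjI ballI 1 2) (use R in simp)
next
  case (add f g)
  from add.IH obtain B B' where B: "B \<ge> 0" "B' \<ge> 0"
    and f': "\<forall>x\<in>PiE I (\<lambda>_. {-R..R}). \<forall>y\<in>PiE I (\<lambda>_. {-R..R}).
           \<bar>f x\<bar> \<le> B \<and> \<bar>f x - f y\<bar> \<le> B * (\<Sum>i\<in>I. \<bar>x i - y i\<bar>)"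
    and g': "\<forall>x\<in>PiE I (\<lambda>_. {-R..R}). \<forall>y\<in>PiE I (\<lambda>_. {-R..R}).
           \<bar>g x\<bar> \<le> B' \<and> \<bar>g x - g y\<bar> \<le> B' * (\<Sum>i\<in>I. \<bar>x i - y i\<bar>)"
    by (elim exE conjE) (rule that)
  note f = bspec[OF bspec[OF f']] and g = bspec[OF bspec[OF g']]
  show ?case
  proof (intro exI[of _ "B + B'"] conjI ballI)
    fix x y assume xy: "x \<in> PiE I (\<lambda>_. {-R..R})" "y \<in> PiE I (\<lambda>_. {-R..R})"
    show "\<bar>f x + g x\<bar> \<le> B + B'" using f[OF xy] g[OF xy] by linarith
    show "\<bar>f x + g x - (f y + g y)\<bar> \<le> (B + B') * (\<Sum>i\<in>I. \<bar>x i - y i\<bar>)"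
      using f[OF xy] g[OF xy] unfolding distrib_right by linarith
  qed (use B in simp)
next
  case (mult f g)
  from mult.IH obtain B B' where B: "B \<ge> 0" "B' \<ge> 0"
    and f': "\<forall>x\<in>PiE I (\<lambda>_. {-R..R}). \<forall>y\<in>PiE I (\<lambda>_. {-R..R}).
           \<bar>f x\<bar> \<le> B \<and> \<bar>f x - f y\<bar> \<le> B * (\<Sum>i\<in>I. \<bar>x i - y i\<bar>)"
    and g': "\<forall>x\<in>PiE I (\<lambda>_. {-R..R}). \<forall>y\<in>PiE I (\<lambda>_. {-R..R}).
           \<bar>g x\<bar> \<le> B' \<and> \<bar>g x - g y\<bar> \<le> B' * (\<Sum>i\<in>I. \<bar>x i - y i\<bar>)"
    by (elim exE conjE) (rule that)
  note f = bspec[OF bspec[OF f']] and g = bspec[OF bspec[OF g']]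
  show ?case
  proof (intro exI[of _ "2 * (B * B')"] conjI ballI)
    fix x y assume xy: "x \<in> PiE I (\<lambda>_. {-R..R})" "y \<in> PiE I (\<lambda>_. {-R..R})"
    let ?d = "\<Sum>i\<in>I. \<bar>x i - y i\<bar>"
    have "\<bar>f x * g x\<bar> \<le> B * B'"
      unfolding abs_mult using f[OF xy] g[OF xy] B by (intro mult_mono) auto
    also have "\<dots> \<le> 2 * (B * B')" using B by simp
    finally show "\<bar>f x * g x\<bar> \<le> 2 * (B * B')" .
    have "\<bar>f x * g x - f y * g y\<bar> = \<bar>f x * (g x - g y) + g y * (f x - f y)\<bar>"
      by (simp add: algebra_simps)
    also have "\<dots> \<le> \<bar>f x\<bar> * \<bar>g x - g y\<bar> + \<bar>g y\<bar> * \<bar>f x - f y\<bar>"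
      unfolding abs_mult[symmetric] by (rule abs_triangle_ineq)
    also have "\<dots> \<le> B * (B' * ?d) + B' * (B * ?d)"
      using f[OF xy] g[OF xy] g[OF xy(2,1)] B by (intro add_mono mult_mono) auto
    finally show "\<bar>f x * g x - f y * g y\<bar> \<le> 2 * (B * B') * ?d" by (simp add: mult_ac)
  qed (use B in simp)
qed

lemma abs_sin_minus_self: "\<bar>sin v - v\<bar> \<le> v\<^sup>2 / 2" for v :: real
proof -
  have "cmod (iexp v - (\<Sum>k \<le> 1. (\<i> * v)^k / fact k)) \<le> \<bar>v\<bar>^(Suc 1) / fact (Suc 1)"
    by (rule iexp_approx1)
  then have "cmod (iexp v - 1 - \<i> * v) \<le> v\<^sup>2 / 2"
    by (simp add: power2_eq_square algebra_simps)
  moreover have "\<bar>sin v - v\<bar> = \<bar>Im (iexp v - 1 - \<i> * v)\<bar>" by (simp add: Im_exp)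
  ultimately show ?thesis using abs_Im_le_cmod order_trans by metis
qed

text \<open>Composing with \<open>x \<mapsto> M sin (x / M)\<close>, which for large \<open>M\<close> is close to the identity on
  bounded sets, turns a polynomial approximation on a box into a trigonometric polynomial that is
  controlled on the whole space.\<close>

lemma trig_poly_approx:
  fixes h :: "('i::countable \<Rightarrow> real) \<Rightarrow> real"
  assumes fin: "finite I" and h: "continuous_on (PiE I (\<lambda>_. UNIV)) h"
    and bdd: "bounded (h ` PiE I (\<lambda>_. UNIV))" and e: "e > 0"
  shows "\<exists>p\<in>trig_poly I. \<forall>x. \<bar>h (restrict x I) - p x\<bar> \<le> e * (1 + (\<Sum>i\<in>I. (x i)\<^sup>2))"
proof -
  obtain H where H: "H > 0" "\<And>x. x \<in> PiE I (\<lambda>_. UNIV) \<Longrightarrow> \<bar>h x\<bar> \<le> H"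
    using bdd unfolding bounded_pos by auto
  define R where "R = sqrt (2 * H / e)"
  have R: "R > 0" "R\<^sup>2 = 2 * H / e" using H e by (auto simp: R_def)
  have sub: "PiE I (\<lambda>_. {-M..M}) \<subseteq> PiE I (\<lambda>_. UNIV :: real set)" for M by (auto simp: PiE_def)
  obtain g where g: "g \<in> coord_poly I" "\<And>x. x \<in> PiE I (\<lambda>_. {-R..R}) \<Longrightarrow> \<bar>h x - g x\<bar> < e / 4"
    using coord_poly_dense[OF continuous_on_subset[OF h sub], of "e/4" R] e by auto
  obtain B where B: "B \<ge> 0" "\<And>x y. x \<in> PiE I (\<lambda>_. {-R..R}) \<Longrightarrow> y \<in> PiE I (\<lambda>_. {-R..R}) \<Longrightarrow>
       \<bar>g x - g y\<bar> \<le> B * (\<Sum>i\<in>I. \<bar>x i - y i\<bar>)"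
    using coord_poly_Lipschitz[OF fin _ g(1), of R] R(1) by (meson less_imp_le)
  define M where "M = max R (2 * B * real (card I) * R\<^sup>2 / e + 1)"
  have M: "M \<ge> R" "M > 0" using R by (auto simp: M_def)
  have MB: "B * real (card I) * (R\<^sup>2 / (2 * M)) \<le> e / 4"
  proof -
    have "2 * B * real (card I) * R\<^sup>2 / e \<le> M" by (simp add: M_def)
    then show ?thesis using M e by (simp add: field_simps)
  qed
  obtain p where p: "p \<in> coord_poly I" "\<And>x. x \<in> PiE I (\<lambda>_. {-M..M}) \<Longrightarrow> \<bar>h x - p x\<bar> < e / 4"
    using coord_poly_dense[OF continuous_on_subset[OF h sub], of "e/4" M] e by auto
  define s where "s x = (\<lambda>i\<in>I. M * sin (x i / M))" for x :: "'i \<Rightarrow> real"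
  have s_le: "\<bar>M * sin (u / M)\<bar> \<le> \<bar>u\<bar>" for u
    using abs_sin_x_le_abs_x[of "u / M"] M by (simp add: abs_mult field_simps)
  have s_M: "s x \<in> PiE I (\<lambda>_. {-M..M})" for x
  proof -
    have "\<bar>M * sin u\<bar> \<le> M" for u using M mult_left_le[of "\<bar>sin u\<bar>" M] by (simp add: abs_mult)
    then have "- M \<le> M * sin u \<and> M * sin u \<le> M" for u by (smt (verit))
    then show ?thesis unfolding s_def by auto
  qed
  have main: "\<bar>h (restrict x I) - p (s x)\<bar> \<le> e * (1 + (\<Sum>i\<in>I. (x i)\<^sup>2))" for x
  proof (cases "\<forall>i\<in>I. \<bar>x i\<bar> \<le> R")
    case True
    have x: "restrict x I \<in> PiE I (\<lambda>_. {-R..R})" using True by (auto simp: abs_le_iff)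
    have sx: "s x \<in> PiE I (\<lambda>_. {-R..R})"
    proof -
      have "\<bar>M * sin (x i / M)\<bar> \<le> R" if "i \<in> I" for i
        using s_le[of "x i"] True that by force
      then have "- R \<le> M * sin (x i / M) \<and> M * sin (x i / M) \<le> R" if "i \<in> I" for i
        using that by (smt (verit))
      then show ?thesis unfolding s_def by auto
    qed
    have "(\<Sum>i\<in>I. \<bar>restrict x I i - s x i\<bar>) \<le> (\<Sum>i\<in>I. R\<^sup>2 / (2 * M))"
    proof (rule sum_mono)
      fix i assume i: "i \<in> I"
      have "\<bar>x i - M * sin (x i / M)\<bar> = M * \<bar>sin (x i / M) - x i / M\<bar>"
      proof -
        have "x i - M * sin (x i / M) = - (M * (sin (x i / M) - x i / M))"
          using M by (simp add: right_diff_distrib)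
        then show ?thesis using M by (simp add: abs_mult)
      qed
      also have "\<dots> \<le> M * ((x i / M)\<^sup>2 / 2)"
        using M by (intro mult_left_mono abs_sin_minus_self) auto
      also have "\<dots> = (x i)\<^sup>2 / (2 * M)" using M by (simp add: power2_eq_square)
      also have "\<dots> \<le> R\<^sup>2 / (2 * M)"
        using M True i R(1) abs_le_square_iff[of "x i" R] by (intro divide_right_mono) auto
      finally show "\<bar>restrict x I i - s x i\<bar> \<le> R\<^sup>2 / (2 * M)" using i by (simp add: s_def)
    qed
    from order_trans[OF B(2)[OF x sx] mult_left_mono[OF this B(1)]]
    have "\<bar>g (restrict x I) - g (s x)\<bar> \<le> B * (real (card I) * (R\<^sup>2 / (2 * M)))"
      by (simp only: sum_constant)
    then have "\<bar>g (restrict x I) - g (s x)\<bar> \<le> e / 4" using MB by (simp only: mult.assoc)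
    then have "\<bar>h (restrict x I) - p (s x)\<bar> \<le> e"
      using g(2)[OF x] g(2)[OF sx] p(2)[OF s_M[of x]] by linarith
    also have "\<dots> \<le> e * (1 + (\<Sum>i\<in>I. (x i)\<^sup>2))"
      using e by (simp add: sum_nonneg)
    finally show ?thesis .
  next
    case False
    then obtain i where i: "i \<in> I" "\<bar>x i\<bar> > R" by auto
    have "2 * H \<le> e * (x i)\<^sup>2"
    proof -
      have "R\<^sup>2 \<le> (x i)\<^sup>2" using i R(1) abs_le_square_iff[of R "x i"] by simp
      then show ?thesis using R(2) e by (simp add: field_simps)
    qed
    also have "\<dots> \<le> e * (\<Sum>i\<in>I. (x i)\<^sup>2)"
      using e i fin by (intro mult_left_mono member_le_sum) auto
    finally have 1: "2 * H \<le> e * (\<Sum>i\<in>I. (x i)\<^sup>2)" .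
    have "\<bar>h (restrict x I)\<bar> \<le> H" "\<bar>h (s x)\<bar> \<le> H"
      using H(2) by (auto simp: s_def)
    with p(2)[OF s_M[of x]] have "\<bar>h (restrict x I) - p (s x)\<bar> \<le> 2 * H + e / 4" by linarith
    also have "\<dots> \<le> e * 1 + e * (\<Sum>i\<in>I. (x i)\<^sup>2)" using 1 e by linarith
    finally show ?thesis by (simp only: distrib_left)
  qed
  have "(\<lambda>x. p (s x)) \<in> trig_poly I"
    unfolding s_def by (rule coord_poly_sin[OF fin p(1)])
  then show ?thesis by (rule bexI[rotated]) (intro allI main)
qed

lemma trig_poly_bounded: "f \<in> trig_poly I \<Longrightarrow> \<exists>B. \<forall>x. \<bar>f x\<bar> \<le> B"
proof (induction rule: trig_poly.induct)
  case (cos c t \<theta>)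
  show ?case by (rule exI[of _ "\<bar>c\<bar>"]) (auto simp: abs_mult intro!: mult_left_le)
next
  case (add f g)
  then obtain B B' where "\<And>x. \<bar>f x\<bar> \<le> B" "\<And>x. \<bar>g x\<bar> \<le> B'" by blast
  then have "\<bar>f x + g x\<bar> \<le> B + B'" for x by (meson abs_triangle_ineq add_mono order_trans)
  then show ?case by blast
qed

lemma trig_poly_measurable:
  assumes "f \<in> trig_poly I" "\<And>i. i \<in> I \<Longrightarrow> (\<lambda>z. X z i) \<in> borel_measurable M"
  shows "(\<lambda>z. f (X z)) \<in> borel_measurable M"
  using assms(1)
proof induction
  case (cos c t \<theta>)
  have "(\<lambda>z. \<Sum>i\<in>I. t i * X z i) \<in> borel_measurable M"
    using assms(2) by (intro borel_measurable_sum borel_measurable_times) auto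
  then show ?case by measurable
next
  case (add f g)
  then show ?case by measurable
qed

lemma trig_poly_integrable:
  assumes "prob_space M" "f \<in> trig_poly I" "\<And>i. i \<in> I \<Longrightarrow> (\<lambda>z. X z i) \<in> borel_measurable M"
  shows "integrable M (\<lambda>z. f (X z))"
proof -
  interpret prob_space M by fact
  obtain B where "\<And>x. \<bar>f x\<bar> \<le> B" using trig_poly_bounded[OF assms(2)] by blast
  then show ?thesis
    by (intro integrable_const_bound[of _ B] trig_poly_measurable[OF assms(2,3)]) auto
qed

lemma continuous_PiE_measurable:
  fixes h :: "('i::countable \<Rightarrow> real) \<Rightarrow> real"
  assumes h: "continuous_on (PiE I (\<lambda>_. UNIV)) h"
    and X: "\<And>i. i \<in> I \<Longrightarrow> (\<lambda>z. X z i) \<in> borel_measurable M"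
  shows "(\<lambda>z. h (restrict (X z) I)) \<in> borel_measurable M"
proof -
  have "(\<lambda>z. restrict (X z) I) \<in> measurable M (PiM I (\<lambda>_. borel))"
    using X by (intro measurable_restrict) auto
  from measurable_compose[OF this borel_measurable_continuous_PiE[OF h]] show ?thesis .
qed

lemma trig_poly_approx_expectation:
  fixes h :: "('i::countable \<Rightarrow> real) \<Rightarrow> real" and X :: "'a \<Rightarrow> 'i \<Rightarrow> real"
  assumes P: "prob_space P"
    and X: "\<And>i. i \<in> I \<Longrightarrow> (\<lambda>z. X z i) \<in> borel_measurable P"
    and sq: "\<And>i. i \<in> I \<Longrightarrow> integrable P (\<lambda>z. (X z i)\<^sup>2)"
    and B: "\<And>i. i \<in> I \<Longrightarrow> (\<integral>z. (X z i)\<^sup>2 \<partial>P) \<le> B"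
    and h: "continuous_on (PiE I (\<lambda>_. UNIV)) h" "bounded (h ` PiE I (\<lambda>_. UNIV))"
    and p: "p \<in> trig_poly I" "\<And>x. \<bar>h (restrict x I) - p x\<bar> \<le> e * (1 + (\<Sum>i\<in>I. (x i)\<^sup>2))"
    and e: "e \<ge> 0"
  shows "\<bar>(\<integral>z. h (restrict (X z) I) \<partial>P) - (\<integral>z. p (X z) \<partial>P)\<bar> \<le> e * (1 + real (card I) * B)"
proof -
  interpret prob_space P by fact
  obtain H where H: "\<And>x. x \<in> PiE I (\<lambda>_. UNIV) \<Longrightarrow> \<bar>h x\<bar> \<le> H"
    using h(2) unfolding bounded_pos by auto
  have ih: "integrable P (\<lambda>z. h (restrict (X z) I))"
    by (rule integrable_const_bound[of _ H]) (auto intro!: H continuous_PiE_measurable[OF h(1)] X)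
  have ip: "integrable P (\<lambda>z. p (X z))" by (rule trig_poly_integrable[OF P p(1) X])
  have "\<bar>(\<integral>z. h (restrict (X z) I) \<partial>P) - (\<integral>z. p (X z) \<partial>P)\<bar>
      = \<bar>\<integral>z. h (restrict (X z) I) - p (X z) \<partial>P\<bar>" using ih ip by simp
  also have "\<dots> \<le> (\<integral>z. \<bar>h (restrict (X z) I) - p (X z)\<bar> \<partial>P)" by (rule integral_abs_bound)
  also have "\<dots> \<le> (\<integral>z. e * (1 + (\<Sum>i\<in>I. (X z i)\<^sup>2)) \<partial>P)"
    using ih ip sq p(2)
    by (intro integral_mono integrable_abs Bochner_Integration.integrable_diff integrable_mult_right
        Bochner_Integration.integrable_add Bochner_Integration.integrable_sum) auto
  also have "\<dots> = e * (1 + (\<Sum>i\<in>I. \<integral>z. (X z i)\<^sup>2 \<partial>P))"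
    using sq by (simp add: Bochner_Integration.integral_sum Bochner_Integration.integral_add prob_space)
  also have "\<dots> \<le> e * (1 + real (card I) * B)"
    using e sum_bounded_above[of I "\<lambda>i. \<integral>z. (X z i)\<^sup>2 \<partial>P" B, OF B] by (intro mult_left_mono) auto
  finally show ?thesis .
qed

theorem Levy_continuity_vec:
  fixes h :: "('i::countable \<Rightarrow> real) \<Rightarrow> real"
    and X :: "nat \<Rightarrow> 'a \<Rightarrow> 'i \<Rightarrow> real" and U :: "'b \<Rightarrow> 'i \<Rightarrow> real"
  assumes P: "\<And>m. prob_space (P m)" and G: "prob_space G" and fin: "finite I"
    and X: "\<And>m i. i \<in> I \<Longrightarrow> (\<lambda>z. X m z i) \<in> borel_measurable (P m)"
    and X2: "\<And>m i. i \<in> I \<Longrightarrow> integrable (P m) (\<lambda>z. (X m z i)\<^sup>2)"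
    and XB: "\<And>m i. i \<in> I \<Longrightarrow> (\<integral>z. (X m z i)\<^sup>2 \<partial>P m) \<le> B"
    and U: "\<And>i. i \<in> I \<Longrightarrow> (\<lambda>z. U z i) \<in> borel_measurable G"
    and U2: "\<And>i. i \<in> I \<Longrightarrow> integrable G (\<lambda>z. (U z i)\<^sup>2)"
    and conv: "\<And>t \<theta>. (\<lambda>m. \<integral>z. cos ((\<Sum>i\<in>I. t i * X m z i) + \<theta>) \<partial>P m)
                 \<longlonglongrightarrow> (\<integral>z. cos ((\<Sum>i\<in>I. t i * U z i) + \<theta>) \<partial>G)"
    and h: "continuous_on (PiE I (\<lambda>_. UNIV)) h" "bounded (h ` PiE I (\<lambda>_. UNIV))"
  shows "(\<lambda>m. \<integral>z. h (restrict (X m z) I) \<partial>P m) \<longlonglongrightarrow> (\<integral>z. h (restrict (U z) I) \<partial>G)"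
proof (rule LIMSEQ_I)
  fix r :: real assume r: "r > 0"
  define B' where "B' = max 0 (max B (\<Sum>i\<in>I. \<integral>z. (U z i)\<^sup>2 \<partial>G))"
  have UB: "(\<integral>z. (U z i)\<^sup>2 \<partial>G) \<le> B'" if "i \<in> I" for i
    using member_le_sum[of i I "\<lambda>i. \<integral>z. (U z i)\<^sup>2 \<partial>G"] that fin by (auto simp: B'_def)
  have XB': "(\<integral>z. (X m z i)\<^sup>2 \<partial>P m) \<le> B'" if "i \<in> I" for i m
    using XB[OF that, of m] by (simp add: B'_def)
  define D where "D = 1 + real (card I) * B'"
  define e where "e = r / (3 * D)"
  have pos: "D > 0" using add_pos_nonneg[of 1 "real (card I) * B'"] by (auto simp: B'_def D_def)
  have e: "e > 0" "e * (1 + real (card I) * B') = r / 3"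
    using r pos unfolding D_def[symmetric] by (auto simp: e_def)
  obtain p where p: "p \<in> trig_poly I" "\<And>x. \<bar>h (restrict x I) - p x\<bar> \<le> e * (1 + (\<Sum>i\<in>I. (x i)\<^sup>2))"
    using trig_poly_approx[OF fin h e(1)] by blast
  have iX: "integrable (P m) (\<lambda>z. q (X m z))" if "q \<in> trig_poly I" for q m
    by (rule trig_poly_integrable[OF P that X])
  have iU: "integrable G (\<lambda>z. q (U z))" if "q \<in> trig_poly I" for q
    by (rule trig_poly_integrable[OF G that U])
  have lim: "(\<lambda>m. \<integral>z. p (X m z) \<partial>P m) \<longlonglongrightarrow> (\<integral>z. p (U z) \<partial>G)"
    using p(1)
  proof induction
    case (cos c t \<theta>)
    show ?case using tendsto_mult[OF tendsto_const[of c] conv[of t \<theta>]] by simp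
  next
    case (add f g)
    have "(\<integral>z. f (X m z) + g (X m z) \<partial>P m) = (\<integral>z. f (X m z) \<partial>P m) + (\<integral>z. g (X m z) \<partial>P m)" for m
      by (intro Bochner_Integration.integral_add iX add.hyps)
    moreover have "(\<integral>z. f (U z) + g (U z) \<partial>G) = (\<integral>z. f (U z) \<partial>G) + (\<integral>z. g (U z) \<partial>G)"
      by (intro Bochner_Integration.integral_add iU add.hyps)
    ultimately show ?case using tendsto_add[OF add.IH] by simp
  qed
  obtain m0 where m0: "\<And>m. m \<ge> m0 \<Longrightarrow> \<bar>(\<integral>z. p (X m z) \<partial>P m) - (\<integral>z. p (U z) \<partial>G)\<bar> < r / 3"
    using LIMSEQ_D[OF lim, of "r/3"] r by auto
  show "\<exists>no. \<forall>m\<ge>no. norm ((\<integral>z. h (restrict (X m z) I) \<partial>P m) - (\<integral>z. h (restrict (U z) I) \<partial>G)) < r"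
  proof (intro exI[of _ m0] allI impI)
    fix m assume "m \<ge> m0"
    have "\<bar>(\<integral>z. h (restrict (X m z) I) \<partial>P m) - (\<integral>z. p (X m z) \<partial>P m)\<bar> \<le> r / 3"
      unfolding e(2)[symmetric]
      by (rule trig_poly_approx_expectation[OF P X X2 XB' h p less_imp_le[OF e(1)]])
    moreover have "\<bar>(\<integral>z. h (restrict (U z) I) \<partial>G) - (\<integral>z. p (U z) \<partial>G)\<bar> \<le> r / 3"
      unfolding e(2)[symmetric]
      by (rule trig_poly_approx_expectation[OF G U U2 UB h p less_imp_le[OF e(1)]])
    ultimately show "norm ((\<integral>z. h (restrict (X m z) I) \<partial>P m) - (\<integral>z. h (restrict (U z) I) \<partial>G)) < r"
      using m0[OF \<open>m \<ge> m0\<close>] unfolding real_norm_def by linarith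
  qed
qed

section \<open>Standard normal vectors and the chi-square distribution\<close>

definition gauss :: "'i set \<Rightarrow> ('i \<Rightarrow> real) measure" where
  "gauss I = PiM I (\<lambda>_. std_normal_distribution)"

lemma prob_space_std_normal: "prob_space std_normal_distribution"
  by (rule prob_space_normal_density) simp

interpretation std_normal: prob_space std_normal_distribution
  by (rule prob_space_std_normal)

interpretation gauss_prod: product_sigma_finite "\<lambda>_. std_normal_distribution"
  by (intro product_sigma_finite.intro std_normal.sigma_finite_measure_axioms)

lemma prob_space_gauss: "prob_space (gauss I)"
  unfolding gauss_def by (intro prob_space_PiM prob_space_std_normal)

lemma sets_gauss: "sets (gauss I) = sets (PiM I (\<lambda>_. borel))"
  unfolding gauss_def by (intro sets_PiM_cong) auto

lemma gauss_component: "i \<in> I \<Longrightarrow> (\<lambda>w. w i) \<in> borel_measurable (gauss I)"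
  unfolding measurable_cong_sets[OF sets_gauss refl] by (rule measurable_component_singleton)

lemma gauss_cos:
  assumes fin: "finite I"
  shows "(\<integral>w. cos ((\<Sum>i\<in>I. t i * w i) + \<theta>) \<partial>gauss I) = cos \<theta> * exp (- (\<Sum>i\<in>I. (t i)\<^sup>2) / 2)"
proof -
  interpret prob_space "gauss I" by (rule prob_space_gauss)
  have [measurable]: "(\<lambda>w. \<Sum>i\<in>I. t i * w i) \<in> borel_measurable (gauss I)"
    by (intro borel_measurable_sum borel_measurable_times gauss_component) auto
  have "(CLINT w|gauss I. iexp (\<Sum>i\<in>I. t i * w i)) = (CLINT w|gauss I. \<Prod>i\<in>I. iexp (t i * w i))"
    using fin by (simp add: exp_sum[symmetric] sum_distrib_left)
  also have "\<dots> = (\<Prod>i\<in>I. CLINT x|std_normal_distribution. iexp (t i * x))"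
    unfolding gauss_def using fin
    by (intro gauss_prod.product_integral_prod std_normal.integrable_const_bound[of _ 1]) auto
  also have "\<dots> = (\<Prod>i\<in>I. complex_of_real (exp (- (t i)\<^sup>2 / 2)))"
    using char_std_normal_distribution by (intro prod.cong) (auto simp: char_def fun_eq_iff)
  also have "\<dots> = complex_of_real (exp (- (\<Sum>i\<in>I. (t i)\<^sup>2) / 2))"
    using fin by (simp add: exp_sum[symmetric] of_real_prod[symmetric] sum_negf sum_divide_distrib del: of_real_exp)
  finally have E: "(CLINT w|gauss I. iexp (\<Sum>i\<in>I. t i * w i)) = complex_of_real (exp (- (\<Sum>i\<in>I. (t i)\<^sup>2) / 2))" .
  have int: "complex_integrable (gauss I) (\<lambda>w. iexp \<theta> * iexp (\<Sum>i\<in>I. t i * w i))"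
  proof (rule integrable_const_bound[of _ 1])
    show "(\<lambda>w. iexp \<theta> * iexp (\<Sum>i\<in>I. t i * w i)) \<in> borel_measurable (gauss I)" by measurable
  qed (simp add: norm_mult)
  have "(\<integral>w. cos ((\<Sum>i\<in>I. t i * w i) + \<theta>) \<partial>gauss I) = (\<integral>w. Re (iexp \<theta> * iexp (\<Sum>i\<in>I. t i * w i)) \<partial>gauss I)"
    by (intro Bochner_Integration.integral_cong refl) (simp add: exp_add[symmetric] distrib_left[symmetric] of_real_add[symmetric] Re_exp add.commute del: of_real_add of_real_sum)
  also have "\<dots> = Re (CLINT w|gauss I. iexp \<theta> * iexp (\<Sum>i\<in>I. t i * w i))"
    by (rule integral_Re[OF int])
  also have "(CLINT w|gauss I. iexp \<theta> * iexp (\<Sum>i\<in>I. t i * w i)) = iexp \<theta> * complex_of_real (exp (- (\<Sum>i\<in>I. (t i)\<^sup>2) / 2))"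
    unfolding E[symmetric] by (rule integral_mult_right_zero)
  also have "Re (iexp \<theta> * complex_of_real (exp (- (\<Sum>i\<in>I. (t i)\<^sup>2) / 2))) = cos \<theta> * exp (- (\<Sum>i\<in>I. (t i)\<^sup>2) / 2)"
    by (simp add: Re_exp)
  finally show ?thesis .
qed

lemma gauss_marginal:
  assumes f: "inj_on f P" "f \<in> P \<rightarrow> J"
  shows "distr (gauss J) (gauss P) (\<lambda>w. \<lambda>p\<in>P. w (f p)) = gauss P"
  unfolding gauss_def by (rule distr_PiM_reindex[OF prob_space_std_normal f])

lemma gauss_marginal_measurable:
  assumes "f \<in> P \<rightarrow> J"
  shows "(\<lambda>w. \<lambda>p\<in>P. w (f p)) \<in> measurable (gauss J) (gauss P)"
proof -
  have "(\<lambda>w. \<lambda>p\<in>P. w (f p)) \<in> measurable (gauss J) (PiM P (\<lambda>_. borel))"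
    using assms by (intro measurable_restrict gauss_component) auto
  then show ?thesis by (simp add: measurable_cong_sets[OF refl sets_gauss])
qed

lemma integral_gauss_marginal:
  fixes g :: "_ \<Rightarrow> real"
  assumes f: "inj_on f P" "f \<in> P \<rightarrow> J" and g: "g \<in> borel_measurable (gauss P)"
  shows "(\<integral>w. g (\<lambda>p\<in>P. w (f p)) \<partial>gauss J) = (\<integral>w. g w \<partial>gauss P)"
    "integrable (gauss J) (\<lambda>w. g (\<lambda>p\<in>P. w (f p))) \<longleftrightarrow> integrable (gauss P) g"
  by (rule integral_distr[OF gauss_marginal_measurable[OF f(2)] g, unfolded gauss_marginal[OF f], symmetric])
    (rule integrable_distr_eq[OF gauss_marginal_measurable[OF f(2)] g, unfolded gauss_marginal[OF f], symmetric])

lemma gauss_component_integral: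
  fixes g :: "real \<Rightarrow> real"
  assumes i: "i \<in> I" and g: "g \<in> borel_measurable borel"
  shows "(\<integral>w. g (w i) \<partial>gauss I) = (\<integral>x. g x \<partial>std_normal_distribution)"
    "integrable (gauss I) (\<lambda>w. g (w i)) \<longleftrightarrow> integrable std_normal_distribution g"
proof -
  have d: "distr (gauss I) std_normal_distribution (\<lambda>w. w i) = std_normal_distribution"
    unfolding gauss_def by (rule distr_PiM_component[OF prob_space_std_normal i])
  have b: "sets std_normal_distribution = sets borel" by simp
  have m: "(\<lambda>w. w i) \<in> measurable (gauss I) std_normal_distribution"
    unfolding measurable_cong_sets[OF refl b] by (rule gauss_component[OF i])
  have g': "g \<in> borel_measurable std_normal_distribution"
    unfolding measurable_cong_sets[OF b refl] by (rule g)
  show "(\<integral>w. g (w i) \<partial>gauss I) = (\<integral>x. g x \<partial>std_normal_distribution)"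
    "integrable (gauss I) (\<lambda>w. g (w i)) \<longleftrightarrow> integrable std_normal_distribution g"
    by (rule integral_distr[OF m g', unfolded d, symmetric])
      (rule integrable_distr_eq[OF m g', unfolded d, symmetric])
qed

lemma gauss_square:
  assumes "i \<in> I"
  shows "integrable (gauss I) (\<lambda>w. (w i)\<^sup>2)" "(\<integral>w. (w i)\<^sup>2 \<partial>gauss I) = 1"
proof -
  have b: "(\<lambda>x::real. x\<^sup>2) \<in> borel_measurable borel" by measurable
  show "integrable (gauss I) (\<lambda>w. (w i)\<^sup>2)"
    unfolding gauss_component_integral(2)[OF assms b] by (rule integrable_std_normal_distribution_moment)
  have "(\<integral>x. x ^ (2 * 1) \<partial>std_normal_distribution) = 1"
    unfolding std_normal_distribution_even_moments by (simp add: fact_numeral)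
  then show "(\<integral>w. (w i)\<^sup>2 \<partial>gauss I) = 1"
    unfolding gauss_component_integral(1)[OF assms b] by (simp only: mult_1_right)
qed

lemma gauss_linear_integrable: 
  assumes "i \<in> I"
  shows "integrable (gauss I) (\<lambda>w. w i)"
proof -
  have b: "(\<lambda>x::real. x) \<in> borel_measurable borel" by measurable
  show ?thesis
    unfolding gauss_component_integral(2)[OF assms b]
    using integrable_std_normal_distribution_moment[of 1] by (simp only: power_one_right)
qed

lemma gauss_mult_integrable:
  assumes "i \<in> I" "j \<in> I"
  shows "integrable (gauss I) (\<lambda>w. w i * w j)"
proof (rule Bochner_Integration.integrable_bound)
  show "integrable (gauss I) (\<lambda>w. (w i)\<^sup>2 + (w j)\<^sup>2)"
    by (intro Bochner_Integration.integrable_add gauss_square assms)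
  have "\<bar>x * y\<bar> \<le> x\<^sup>2 + y\<^sup>2" for x y :: real
    using sum_squares_bound[of "\<bar>x\<bar>" "\<bar>y\<bar>"] mult_nonneg_nonneg[of "\<bar>x\<bar>" "\<bar>y\<bar>"]
    unfolding abs_mult power2_abs by linarith
  then show "AE w in gauss I. norm (w i * w j) \<le> norm ((w i)\<^sup>2 + (w j)\<^sup>2)" by simp
  show "(\<lambda>w. w i * w j) \<in> borel_measurable (gauss I)"
    by (intro borel_measurable_times gauss_component assms)
qed

lemma gauss_reflect:
  fixes g :: "('a \<Rightarrow> real) \<Rightarrow> real"
  assumes fin: "finite I" and g: "g \<in> borel_measurable (gauss I)" and i: "i \<in> I"
  shows "(\<integral>w. g (w(i := - w i)) \<partial>gauss I) = (\<integral>w. g w \<partial>gauss I)"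
proof -
  define T where "T w = w(i := - w i)" for w :: "'a \<Rightarrow> real"
  have T: "T \<in> measurable (gauss I) (gauss I)"
  proof -
    have "T \<in> measurable (gauss I) (PiM I (\<lambda>_. borel))"
      unfolding T_def
    proof (rule measurable_PiM_single')
      show "(\<lambda>w. (w(i := - w i)) j) \<in> borel_measurable (gauss I)" if "j \<in> I" for j
        using that i by (cases "j = i") (auto simp: gauss_component)
      show "(\<lambda>w. w(i := - w i)) \<in> space (gauss I) \<rightarrow> (\<Pi>\<^sub>E i\<in>I. space borel)"
        using i by (auto simp: gauss_def space_PiM PiE_def extensional_def)
    qed
    then show ?thesis by (simp add: measurable_cong_sets[OF refl sets_gauss])
  qed
  have um: "uminus -` A \<in> sets borel" if "A \<in> sets borel" for A :: "real set"
  proof -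
    have "uminus \<in> borel_measurable (borel :: real measure)" by simp
    from measurable_sets[OF this that] show ?thesis by simp
  qed
  have sym: "emeasure std_normal_distribution (uminus -` A) = emeasure std_normal_distribution A"
    if A: "A \<in> sets borel" for A :: "real set"
  proof -
    have [measurable]: "uminus -` A \<in> sets borel" "A \<in> sets borel" by (auto intro: um A)
    have "emeasure std_normal_distribution (uminus -` A) = (\<integral>\<^sup>+x. ennreal (std_normal_density x) * indicator A (- x) \<partial>lborel)"
      by (subst emeasure_density) (auto intro!: nn_integral_cong simp: indicator_def)
    also have "\<dots> = (\<integral>\<^sup>+x. ennreal (std_normal_density (- x)) * indicator A (- (- x)) \<partial>lborel)"
      using nn_integral_real_affine[of "\<lambda>x. ennreal (std_normal_density x) * indicator A (- x)" "-1" 0] by simp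
    also have "\<dots> = emeasure std_normal_distribution A"
      using A by (subst emeasure_density) (auto simp: normal_density_def)
    finally show ?thesis .
  qed
  have "distr (gauss I) (gauss I) T = gauss I"
    unfolding gauss_def
  proof (rule gauss_prod.PiM_eqI[OF fin])
    fix A :: "'a \<Rightarrow> real set" assume "\<And>i. i \<in> I \<Longrightarrow> A i \<in> sets std_normal_distribution"
    then have A: "\<And>i. i \<in> I \<Longrightarrow> A i \<in> sets borel" by simp
    define A' where "A' = A(i := uminus -` A i)"
    have A': "A' j \<in> sets borel" if "j \<in> I" for j
      using A[OF that] um[OF A[OF i]] by (auto simp: A'_def)
    have "T -` (PiE I A) \<inter> space (PiM I (\<lambda>_. std_normal_distribution)) = PiE I A'"
      using i by (auto simp: T_def A'_def space_PiM PiE_iff extensional_def split: if_splits)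
    then have "emeasure (distr (PiM I (\<lambda>_. std_normal_distribution)) (PiM I (\<lambda>_. std_normal_distribution)) T) (PiE I A)
        = emeasure (PiM I (\<lambda>_. std_normal_distribution)) (PiE I A')"
      using T A fin by (subst emeasure_distr) (auto simp: gauss_def intro!: sets_PiM_I_finite)
    also have "\<dots> = (\<Prod>j\<in>I. emeasure std_normal_distribution (A' j))"
      using fin A' by (intro gauss_prod.emeasure_PiM) auto
    also have "\<dots> = (\<Prod>j\<in>I. emeasure std_normal_distribution (A j))"
      using sym[OF A[OF i]] by (intro prod.cong) (auto simp: A'_def)
    finally show "emeasure (distr (PiM I (\<lambda>_. std_normal_distribution)) (PiM I (\<lambda>_. std_normal_distribution)) T) (PiE I A)
        = (\<Prod>j\<in>I. emeasure std_normal_distribution (A j))" .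
  qed simp
  then show ?thesis using integral_distr[OF T g] by (simp add: T_def)
qed

lemma lborel_component: "i \<in> I \<Longrightarrow> (\<lambda>w. w i) \<in> borel_measurable (PiM I (\<lambda>_. lborel :: real measure))"
  using measurable_component_singleton[of i I "\<lambda>_. lborel :: real measure"] by simp

lemma gauss_density:
  fixes I :: "'a set"
  assumes fin: "finite I"
  shows "gauss I = density (PiM I (\<lambda>_. lborel)) (\<lambda>w. ennreal (\<Prod>i\<in>I. std_normal_density (w i)))"
proof -
  interpret L: product_sigma_finite "\<lambda>_::'a. lborel :: real measure" by standard
  let ?f = "\<lambda>w. ennreal (\<Prod>i\<in>I. std_normal_density (w i))"
  have "density (PiM I (\<lambda>_. lborel)) ?f = PiM I (\<lambda>_. std_normal_distribution)"
  proof (rule gauss_prod.PiM_eqI[OF fin])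
    show "sets (density (PiM I (\<lambda>_. lborel)) ?f) = sets (PiM I (\<lambda>_. std_normal_distribution))"
      by (simp, intro sets_PiM_cong) auto
    fix A :: "'a \<Rightarrow> real set" assume "\<And>i. i \<in> I \<Longrightarrow> A i \<in> sets std_normal_distribution"
    then have A: "\<And>i. i \<in> I \<Longrightarrow> A i \<in> sets borel" by simp
    have "emeasure (density (PiM I (\<lambda>_. lborel)) ?f) (PiE I A)
        = (\<integral>\<^sup>+w. ?f w * indicator (PiE I A) w \<partial>PiM I (\<lambda>_. lborel))"
    proof (rule emeasure_density)
      show "?f \<in> borel_measurable (PiM I (\<lambda>_. lborel))"
        by (intro measurable_compose[OF _ measurable_ennreal] borel_measurable_prod
            measurable_compose[OF lborel_component borel_measurable_normal_density])
      show "PiE I A \<in> sets (PiM I (\<lambda>_. lborel))"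
        using A by (intro sets_PiM_I_finite fin) simp
    qed
    also have "\<dots> = (\<integral>\<^sup>+w. (\<Prod>i\<in>I. ennreal (std_normal_density (w i)) * indicator (A i) (w i)) \<partial>PiM I (\<lambda>_. lborel))"
    proof (rule nn_integral_cong)
      fix w assume w: "w \<in> space (PiM I (\<lambda>_. lborel :: real measure))"
      have "indicator (PiE I A) w = (\<Prod>i\<in>I. indicator (A i) (w i) :: ennreal)"
      proof (cases "w \<in> PiE I A")
        case True
        then show ?thesis by (auto simp: PiE_iff)
      next
        case False
        then obtain i where "i \<in> I" "w i \<notin> A i" using w by (auto simp: space_PiM PiE_iff)
        then have "(\<Prod>i\<in>I. indicator (A i) (w i) :: ennreal) = 0" using fin by (intro prod_zero bexI[of _ i]) auto
        then show ?thesis using False by simp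
      qed
      moreover have "?f w = (\<Prod>i\<in>I. ennreal (std_normal_density (w i)))"
        by (simp add: prod_ennreal normal_density_nonneg)
      ultimately show "?f w * indicator (PiE I A) w = (\<Prod>i\<in>I. ennreal (std_normal_density (w i)) * indicator (A i) (w i))"
        by (simp add: prod.distrib)
    qed
    also have "\<dots> = (\<Prod>i\<in>I. \<integral>\<^sup>+x. ennreal (std_normal_density x) * indicator (A i) x \<partial>lborel)"
      using A fin by (intro L.product_nn_integral_prod) auto
    also have "\<dots> = (\<Prod>i\<in>I. emeasure std_normal_distribution (A i))"
      using A by (intro prod.cong) (auto simp: emeasure_density)
    finally show "emeasure (density (PiM I (\<lambda>_. lborel)) ?f) (PiE I A) = (\<Prod>i\<in>I. emeasure std_normal_distribution (A i))" .
  qed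
  then show ?thesis by (simp add: gauss_def)
qed

lemma sq_norm_measurable_lborel:
  "(\<lambda>w. \<Sum>i\<in>I. (w i)\<^sup>2) \<in> borel_measurable (PiM I (\<lambda>_. lborel :: real measure))"
  by (intro borel_measurable_sum borel_measurable_power lborel_component)

lemma sq_norm_measurable:
  "P \<subseteq> I \<Longrightarrow> (\<lambda>w. \<Sum>i\<in>P. (w i)\<^sup>2) \<in> borel_measurable (gauss I)"
  by (intro borel_measurable_sum borel_measurable_power gauss_component) auto

lemma radial_lborel:
  fixes I :: "'a set"
  assumes fin: "finite I" and ne: "I \<noteq> {}"
  defines "m \<equiv> real (card I)"
  shows "distr (PiM I (\<lambda>_. lborel)) borel (\<lambda>w. \<Sum>i\<in>I. (w i)\<^sup>2)
       = density lborel (\<lambda>t. ennreal (indicator {0<..} t * (unit_ball_vol m * (m / 2) * t powr (m / 2 - 1))))"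
    (is "?M = ?N")
proof -
  have m: "m \<ge> 1" using fin ne by (simp add: m_def Suc_le_eq card_gt_0_iff)
  have card: "card I \<ge> 1" using fin ne by (simp add: Suc_le_eq card_gt_0_iff)
  define V where "V = unit_ball_vol m"
  have V: "V > 0" unfolding V_def using m by simp
  let ?S = "\<lambda>s. {w \<in> space (PiM I (\<lambda>_. lborel :: real measure)). (\<Sum>i\<in>I. (w i)\<^sup>2) \<le> s}"
  have ball: "emeasure (PiM I (\<lambda>_. lborel)) (?S (r\<^sup>2)) = ennreal (V * r ^ card I)" if "r > 0" for r
  proof -
    have "?S (r\<^sup>2) = {f. sqrt (\<Sum>i\<in>I. (f i)\<^sup>2) \<le> r} \<inter> space (PiM I (\<lambda>_. lborel))"
    proof -
      have "sqrt y \<le> r \<longleftrightarrow> y \<le> r\<^sup>2" for y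
        using that by (metis abs_of_pos real_sqrt_abs real_sqrt_le_iff)
      then show ?thesis by auto
    qed
    then show ?thesis using emeasure_cball_aux[OF fin that] by (simp add: V_def m_def)
  qed
  have M: "emeasure ?M {..s} = emeasure (PiM I (\<lambda>_. lborel)) (?S s)" for s
  proof -
    have S: "(\<lambda>w. \<Sum>i\<in>I. (w i)\<^sup>2) -` {..s} \<inter> space (PiM I (\<lambda>_. lborel :: real measure)) = ?S s"
      by auto
    show ?thesis
      using emeasure_distr[OF sq_norm_measurable_lborel[of I], of "{..s}"] unfolding S by simp
  qed
  have M_pos: "emeasure ?M {..s} = ennreal (V * s powr (m / 2))" if s: "s > 0" for s
  proof -
    have "sqrt s ^ card I = s powr (m / 2)"
      using s by (simp add: powr_half_sqrt[symmetric] powr_realpow[symmetric] powr_powr m_def)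
    then show ?thesis using ball[of "sqrt s"] s unfolding M by simp
  qed
  have M_neg: "emeasure ?M {..s} = 0" if s: "s \<le> 0" for s
  proof -
    have "emeasure ?M {..s} \<le> 0"
    proof (rule ennreal_le_epsilon)
      fix e :: real assume e: "e > 0"
      define r where "r = min 1 (e / V)"
      have r: "r > 0" "r \<le> 1" "V * r \<le> e" using e V by (auto simp: r_def min_def field_simps)
      have "emeasure ?M {..s} \<le> emeasure (PiM I (\<lambda>_. lborel)) (?S (r\<^sup>2))"
        unfolding M
      proof (rule emeasure_mono)
        have "s \<le> r\<^sup>2" using s zero_le_power2[of r] by linarith
        then show "?S s \<subseteq> ?S (r\<^sup>2)" by (auto intro: order_trans)
        show "?S (r\<^sup>2) \<in> sets (PiM I (\<lambda>_. lborel))"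
          by (rule borel_measurable_le[OF sq_norm_measurable_lborel borel_measurable_const])
      qed
      also have "\<dots> = ennreal (V * r ^ card I)" by (rule ball[OF r(1)])
      also have "\<dots> \<le> ennreal e"
      proof (rule ennreal_leI)
        have "r ^ card I \<le> r ^ 1" using r card by (intro power_decreasing) auto
        then have "V * r ^ card I \<le> V * r" using V by simp
        then show "V * r ^ card I \<le> e" using r(3) by linarith
      qed
      finally show "emeasure ?M {..s} \<le> 0 + ennreal e" by simp
    qed
    then show ?thesis by simp
  qed
  let ?f = "\<lambda>t. V * (m / 2) * t powr (m / 2 - 1)"
  have N: "emeasure ?N {..s} = (\<integral>\<^sup>+t. ennreal (indicator {0<..} t * ?f t) * indicator {..s} t \<partial>lborel)" for s
    unfolding V_def[symmetric] by (subst emeasure_density) auto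
  have N_neg: "emeasure ?N {..s} = 0" if s: "s \<le> 0" for s
    unfolding N using s by (intro nn_integral_0_iff_AE[THEN iffD2]) (auto simp: indicator_def)
  have N_pos: "emeasure ?N {..s} = ennreal (V * s powr (m / 2))" if s: "s > 0" for s
  proof -
    have "((\<lambda>t. t powr (m / 2 - 1)) has_integral s powr (m / 2 - 1 + 1) / (m / 2 - 1 + 1)) {0..s}"
      using s m by (intro has_integral_powr_from_0) auto
    then have "(?f has_integral (V * (m / 2)) * (s powr (m / 2 - 1 + 1) / (m / 2 - 1 + 1))) {0..s}"
      by (rule has_integral_mult_right)
    then have hi: "(?f has_integral V * s powr (m / 2)) {0..s}" using m by simp
    have "emeasure ?N {..s} = (\<integral>\<^sup>+t. ennreal (?f t * indicator {0..s} t) \<partial>lborel)"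
      unfolding N by (intro nn_integral_cong) (auto simp: indicator_def)
    also have "\<dots> = (\<integral>\<^sup>+t. ennreal (indicator {0..s} t * ?f t) \<partial>lborel)" by (simp add: mult.commute)
    also have "\<dots> = ennreal (V * s powr (m / 2))"
      using V m by (intro nn_integral_has_integral_lebesgue[OF _ hi]) auto
    finally show ?thesis .
  qed
  have MN: "emeasure ?M {..s} = emeasure ?N {..s}" for s
    using M_pos N_pos M_neg N_neg by (cases "s > 0") auto
  have gen: "sets (borel :: real measure) = sigma_sets UNIV (range atMost)"
    by (subst borel_eq_atMost) simp
  show ?thesis
  proof (rule measure_eqI_generator_eq[where \<Omega>=UNIV and E="range atMost" and A="\<lambda>n. {..real n}"])
    show "Int_stable (range (atMost :: real \<Rightarrow> _))"
    proof (rule Int_stableI)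
      fix a b :: "real set" assume "a \<in> range atMost" "b \<in> range atMost"
      then obtain x y where "a = {..x}" "b = {..y}" by blast
      then have "a \<inter> b = {..min x y}" by auto
      then show "a \<inter> b \<in> range atMost" by blast
    qed
    show "(\<Union>i. {..real i}) = UNIV" using real_arch_simple by auto
    show "emeasure ?M {..real i} \<noteq> \<infinity>" for i
      using M_pos[of "real i"] M_neg[of "real i"] by (cases "i = 0") auto
  qed (auto simp: gen MN)
qed

definition chi_density :: "nat \<Rightarrow> real \<Rightarrow> real" where
  "chi_density k t = indicator {0<..} t * (t powr (real k / 2 - 1) * exp (- t / 2) / (2 powr (real k / 2) * Gamma (real k / 2)))"

lemma chi_density_measurable [measurable]: "chi_density k \<in> borel_measurable borel"
  unfolding chi_density_def by measurable

lemma gauss_radial: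
  fixes I :: "'a set" and g :: "real \<Rightarrow> real"
  assumes fin: "finite I" and ne: "I \<noteq> {}" and g: "g \<in> borel_measurable borel"
  shows "(\<integral>w. g (\<Sum>i\<in>I. (w i)\<^sup>2) \<partial>gauss I) = (\<integral>t. chi_density (card I) t * g t \<partial>lborel)"
proof -
  define m where "m = real (card I)"
  have m: "m > 0" using fin ne by (simp add: m_def card_gt_0_iff)
  define G where "G s = (1 / sqrt (2 * pi)) ^ card I * exp (- s / 2)" for s :: real
  have Gm: "G \<in> borel_measurable borel" unfolding G_def by measurable
  have Ggm: "(\<lambda>s. G s * g s) \<in> borel_measurable borel"
    by (rule borel_measurable_times[OF Gm g])
  have prod: "(\<Prod>i\<in>I. std_normal_density (w i)) = G (\<Sum>i\<in>I. (w i)\<^sup>2)" for w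
    unfolding G_def std_normal_density_def prod.distrib prod_constant exp_sum[OF fin, symmetric]
    by (simp add: sum_negf sum_divide_distrib)
  have Gnn: "G s \<ge> 0" for s by (simp add: G_def)
  have "(\<integral>w. g (\<Sum>i\<in>I. (w i)\<^sup>2) \<partial>gauss I) = (\<integral>w. G (\<Sum>i\<in>I. (w i)\<^sup>2) * g (\<Sum>i\<in>I. (w i)\<^sup>2) \<partial>PiM I (\<lambda>_. lborel))"
    unfolding gauss_density[OF fin] prod
    using integral_density[OF measurable_compose[OF sq_norm_measurable_lborel g]
        measurable_compose[OF sq_norm_measurable_lborel Gm] AE_I2[OF Gnn]] by simp
  also have "\<dots> = (\<integral>s. G s * g s \<partial>distr (PiM I (\<lambda>_. lborel)) borel (\<lambda>w. \<Sum>i\<in>I. (w i)\<^sup>2))"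
    by (rule integral_distr[OF sq_norm_measurable_lborel Ggm, symmetric])
  also have "\<dots> = (\<integral>t. (indicator {0<..} t * (unit_ball_vol m * (m / 2) * t powr (m / 2 - 1))) * (G t * g t) \<partial>lborel)"
  proof -
    let ?r = "\<lambda>t. indicator {0<..} t * (unit_ball_vol m * (m / 2) * t powr (m / 2 - 1))"
    have 1: "(\<lambda>t. G t * g t) \<in> borel_measurable lborel" unfolding measurable_lborel2 by (rule Ggm)
    have 2: "?r \<in> borel_measurable lborel" by measurable
    have 3: "0 \<le> ?r t" for t using m by simp
    show ?thesis
      unfolding radial_lborel[OF fin ne] m_def[symmetric]
      using integral_density[OF 1 2 AE_I2[OF 3]] by simp
  qed
  also have "\<dots> = (\<integral>t. chi_density (card I) t * g t \<partial>lborel)"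
  proof (rule Bochner_Integration.integral_cong[OF refl])
    fix t :: real
    have const: "unit_ball_vol m * (m / 2) * (1 / sqrt (2 * pi)) ^ card I = 1 / (2 powr (m / 2) * Gamma (m / 2))"
    proof -
      have "sqrt (2 * pi) ^ card I = (2 * pi) powr (m / 2)"
        by (simp add: powr_half_sqrt[symmetric] powr_realpow[symmetric] powr_powr m_def)
      also have "\<dots> = 2 powr (m / 2) * pi powr (m / 2)" by (simp add: powr_mult)
      finally have 1: "sqrt (2 * pi) ^ card I = 2 powr (m / 2) * pi powr (m / 2)" .
      have 2: "Gamma (m / 2 + 1) = (m / 2) * Gamma (m / 2)" using m by (intro Gamma_plus1) auto
      have 3: "Gamma (m / 2) > 0" using m by simp
      show ?thesis unfolding unit_ball_vol_def 2 power_divide 1 power_one using m 3 by (simp add: field_simps)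
    qed
    have alg: "x * (U * p) * ((k * e) * y) = x * (p * e * (U * k)) * y" for x U p k e y :: real
      by (simp add: mult_ac)
    have "(indicator {0<..} t * (unit_ball_vol m * (m / 2) * t powr (m / 2 - 1))) * (G t * g t)
      = indicator {0<..} t * (t powr (m / 2 - 1) * exp (- t / 2) * (unit_ball_vol m * (m / 2) * (1 / sqrt (2 * pi)) ^ card I)) * g t"
      unfolding G_def by (rule alg)
    then show "(indicator {0<..} t * (unit_ball_vol m * (m / 2) * t powr (m / 2 - 1))) * (G t * g t) = chi_density (card I) t * g t"
      unfolding const chi_density_def m_def[symmetric] by simp
  qed
  finally show ?thesis .
qed

lemma chi_density_eq:
  "t > 0 \<Longrightarrow> chi_density k t = t powr (real k / 2 - 1) * exp (- t / 2) / (2 powr (real k / 2) * Gamma (real k / 2))"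
  by (simp add: chi_density_def)

lemma chisq_cdf_eq_chi_density:
  assumes "a > 0"
  shows "chisq_cdf k a = (\<integral>t. chi_density k t * indicator {..a} t \<partial>lborel)"
proof -
  have "chisq_cdf k a = (LBINT t:{0<..a}. t powr (real k / 2 - 1) * exp (- t / 2) / (2 powr (real k / 2) * Gamma (real k / 2)))"
    unfolding chisq_cdf_def zero_ereal_def by (rule interval_integral_Ioc) (use assms in simp)
  also have "\<dots> = (\<integral>t. chi_density k t * indicator {..a} t \<partial>lborel)"
    unfolding set_lebesgue_integral_def
    by (intro Bochner_Integration.integral_cong) (auto simp: chi_density_def indicator_def)
  finally show ?thesis .
qed

definition trunc :: "'i set \<Rightarrow> real \<Rightarrow> ('i \<Rightarrow> real) \<Rightarrow> real" where
  "trunc P a w = indicator {..a} (\<Sum>p\<in>P. (w p)\<^sup>2)"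

lemma trunc_measurable: "P \<subseteq> J \<Longrightarrow> trunc P a \<in> borel_measurable (gauss J)"
  unfolding trunc_def by (rule measurable_compose[OF sq_norm_measurable borel_measurable_indicator]) auto

lemma trunc_bounds: "0 \<le> trunc P a w" "trunc P a w \<le> 1" "\<bar>trunc P a w\<bar> \<le> 1"
  by (auto simp: trunc_def indicator_def)

lemma integrable_mult_trunc:
  assumes f: "integrable (gauss J) f" and P: "P \<subseteq> J"
  shows "integrable (gauss J) (\<lambda>w. f w * trunc P a w)"
proof (rule Bochner_Integration.integrable_bound[OF f])
  show "(\<lambda>w. f w * trunc P a w) \<in> borel_measurable (gauss J)"
    by (intro borel_measurable_times borel_measurable_integrable[OF f] trunc_measurable P)
  show "AE w in gauss J. norm (f w * trunc P a w) \<le> norm (f w)"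
    unfolding real_norm_def abs_mult by (intro AE_I2 mult_left_le[OF trunc_bounds(3) abs_ge_zero])
qed

lemma integrable_trunc: "P \<subseteq> J \<Longrightarrow> integrable (gauss J) (trunc P a)"
proof -
  assume P: "P \<subseteq> J"
  interpret prob_space "gauss J" by (rule prob_space_gauss)
  show ?thesis
    by (rule integrable_const_bound[of _ 1]) (use trunc_bounds(3) trunc_measurable[OF P] in auto)
qed

lemma trunc_restrict: "trunc P a (\<lambda>p\<in>P. w p) = trunc P a w"
  by (simp add: trunc_def)

lemma prob_trunc:
  assumes J: "finite J" "P \<subseteq> J" "P \<noteq> {}" and a: "a > 0"
  shows "(\<integral>w. trunc P a w \<partial>gauss J) = chisq_cdf (card P) a"
proof -
  have fP: "finite P" using J finite_subset by blast
  have "(\<integral>w. trunc P a w \<partial>gauss J) = (\<integral>w. trunc P a w \<partial>gauss P)"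
    using integral_gauss_marginal(1)[of "\<lambda>p. p" P J "trunc P a"] J trunc_measurable[of P P a]
    by (auto simp: trunc_restrict inj_on_def)
  also have "\<dots> = chisq_cdf (card P) a"
    unfolding trunc_def chisq_cdf_eq_chi_density[OF a] by (rule gauss_radial[OF fP J(3)]) simp
  finally show ?thesis .
qed

lemma chisq_cdf_pos:
  assumes k: "k \<ge> 1" and a: "a > 0"
  shows "chisq_cdf k a > 0"
proof -
  define I where "I = {..<k}"
  have I: "finite I" "I \<noteq> {}" "card I = k" using k by (auto simp: I_def lessThan_empty_iff)
  have eq: "chisq_cdf k a = (\<integral>w. trunc I a w \<partial>gauss I)" using prob_trunc[of I I a] I a by simp
  have nn: "chisq_cdf k a \<ge> 0" unfolding eq by (intro integral_nonneg_AE AE_I2 trunc_bounds)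
  have "chisq_cdf k a \<noteq> 0"
  proof
    assume 0: "chisq_cdf k a = 0"
    have "(\<integral>w. trunc I a w \<partial>gauss I) = 0" using eq 0 by simp
    then have "AE w in gauss I. trunc I a w = 0"
      using integral_nonneg_eq_0_iff_AE[OF integrable_trunc[OF order_refl, of I a]] trunc_bounds(1) by auto
    then have "AE w in density (PiM I (\<lambda>_. lborel)) (\<lambda>w. ennreal (\<Prod>i\<in>I. std_normal_density (w i))). trunc I a w = 0"
      unfolding gauss_density[OF I(1)] .
    then have AE0: "AE w in PiM I (\<lambda>_. lborel). 0 < ennreal (\<Prod>i\<in>I. std_normal_density (w i)) \<longrightarrow> trunc I a w = 0"
      by (subst (asm) AE_density)
        (intro measurable_compose[OF _ measurable_ennreal] borel_measurable_prod
            measurable_compose[OF lborel_component borel_measurable_normal_density])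
    have pos: "0 < ennreal (\<Prod>i\<in>I. std_normal_density (w i))" for w
      by (simp add: prod_pos normal_density_pos)
    have S: "{w \<in> space (PiM I (\<lambda>_. lborel :: real measure)). (\<Sum>i\<in>I. (w i)\<^sup>2) \<le> a} \<in> sets (PiM I (\<lambda>_. lborel))"
      by (rule borel_measurable_le[OF sq_norm_measurable_lborel borel_measurable_const])
    have "AE w in PiM I (\<lambda>_. lborel). w \<notin> {w \<in> space (PiM I (\<lambda>_. lborel :: real measure)). (\<Sum>i\<in>I. (w i)\<^sup>2) \<le> a}"
      using AE0 by eventually_elim (use pos in \<open>auto simp: trunc_def indicator_def\<close>)
    then have "emeasure (PiM I (\<lambda>_. lborel)) {w \<in> space (PiM I (\<lambda>_. lborel :: real measure)). (\<Sum>i\<in>I. (w i)\<^sup>2) \<le> a} = 0"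
      by (subst (asm) AE_iff_measurable[OF S]) auto
    moreover have "{w \<in> space (PiM I (\<lambda>_. lborel :: real measure)). (\<Sum>i\<in>I. (w i)\<^sup>2) \<le> a}
      = {f. sqrt (\<Sum>i\<in>I. (f i)\<^sup>2) \<le> sqrt a} \<inter> space (PiM I (\<lambda>_. lborel))" by auto
    ultimately have "ennreal (unit_ball_vol (real k) * sqrt a ^ k) = 0"
      using emeasure_cball_aux[OF I(1), of "sqrt a"] a I(3) by simp
    moreover have "unit_ball_vol (real k) * sqrt a ^ k > 0" using a by simp
    ultimately show False by (simp add: ennreal_eq_0_iff)
  qed
  then show ?thesis using nn by simp
qed

lemma sq_norm_trunc:
  assumes P: "finite P" "P \<noteq> {}" and a: "a > 0"
  shows "(\<integral>w. (\<Sum>p\<in>P. (w p)\<^sup>2) * trunc P a w \<partial>gauss P) = real (card P) * chisq_cdf (card P + 2) a"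
proof -
  let ?k = "card P"
  have k: "real ?k > 0" using P by (simp add: card_gt_0_iff)
  have "(\<integral>w. (\<Sum>p\<in>P. (w p)\<^sup>2) * trunc P a w \<partial>gauss P) = (\<integral>t. chi_density ?k t * (t * indicator {..a} t) \<partial>lborel)"
    unfolding trunc_def by (rule gauss_radial[OF P]) measurable
  also have "\<dots> = (\<integral>t. real ?k * (chi_density (?k + 2) t * indicator {..a} t) \<partial>lborel)"
  proof (rule Bochner_Integration.integral_cong[OF refl])
    fix t :: real
    have "chi_density ?k t * t = real ?k * chi_density (?k + 2) t"
    proof (cases "t > 0")
      case True
      have 1: "t powr (real ?k / 2 - 1) * t = t powr (real ?k / 2)"
        using True by (simp add: powr_diff)
      have 2: "Gamma (real ?k / 2 + 1) = (real ?k / 2) * Gamma (real ?k / 2)" using k by (intro Gamma_plus1) auto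
      have 3: "real (?k + 2) / 2 = real ?k / 2 + 1" by simp
      have 4: "Gamma (real ?k / 2) > 0" using k by simp
      have "chi_density ?k t * t = t powr (real ?k / 2) * exp (- t / 2) / (2 powr (real ?k / 2) * Gamma (real ?k / 2))"
        unfolding chi_density_eq[OF True] 1[symmetric] by (simp add: mult_ac)
      also have "\<dots> = real ?k * (t powr (real ?k / 2) * exp (- t / 2) / (2 powr (real ?k / 2) * 2 * ((real ?k / 2) * Gamma (real ?k / 2))))"
        using k 4 by (simp add: field_simps)
      also have "\<dots> = real ?k * chi_density (?k + 2) t"
        unfolding chi_density_eq[OF True] 3 2 by (simp add: powr_add)
      finally show ?thesis .
    qed (simp add: chi_density_def)
    then show "chi_density ?k t * (t * indicator {..a} t) = real ?k * (chi_density (?k + 2) t * indicator {..a} t)"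
      by (metis mult.assoc)
  qed
  also have "\<dots> = real ?k * chisq_cdf (?k + 2) a"
    unfolding chisq_cdf_eq_chi_density[OF a] by (rule integral_mult_right_zero)
  finally show ?thesis .
qed

lemma gauss_sphere_null:
  assumes P: "finite P" "P \<noteq> {}"
  shows "(\<integral>w. indicator {a} (\<Sum>p\<in>P. (w p)\<^sup>2) \<partial>gauss P) = (0::real)"
proof -
  have "(\<integral>w. indicator {a} (\<Sum>p\<in>P. (w p)\<^sup>2) \<partial>gauss P) = (\<integral>t. chi_density (card P) t * indicator {a} t \<partial>lborel)"
    by (rule gauss_radial[OF P]) simp
  also have "\<dots> = (\<integral>t. 0 \<partial>(lborel :: real measure))"
  proof (rule integral_cong_AE)
    show "AE t in lborel. chi_density (card P) t * indicator {a} t = 0"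
      using AE_lborel_singleton[of a] by eventually_elim auto
  qed measurable
  finally show ?thesis by simp
qed

lemma coordinate_sq_trunc:
  assumes P: "finite P" and i: "i \<in> P" and a: "a > 0"
  shows "(\<integral>w. (w i)\<^sup>2 * trunc P a w \<partial>gauss P) = chisq_cdf (card P + 2) a"
proof -
  have ne: "P \<noteq> {}" using i by auto
  have int: "integrable (gauss P) (\<lambda>w. (w j)\<^sup>2 * trunc P a w)" if "j \<in> P" for j
    by (intro integrable_mult_trunc gauss_square that order_refl)
  have same: "(\<integral>w. (w j)\<^sup>2 * trunc P a w \<partial>gauss P) = (\<integral>w. (w i)\<^sup>2 * trunc P a w \<partial>gauss P)" if j: "j \<in> P" for j
  proof -
    let ?t = "Transposition.transpose i j"
    have tP: "?t p \<in> P \<longleftrightarrow> p \<in> P" for p using i j by (auto simp: Transposition.transpose_def)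
    have bij: "bij_betw ?t P P"
      by (rule bij_betw_byWitness[of _ ?t]) (auto simp: tP)
    have S: "(\<Sum>p\<in>P. (w (?t p))\<^sup>2) = (\<Sum>p\<in>P. (w p)\<^sup>2)" for w :: "'a \<Rightarrow> real"
      by (rule sum.reindex_bij_betw[OF bij])
    have m: "(\<lambda>w. (w i)\<^sup>2 * trunc P a w) \<in> borel_measurable (gauss P)"
      using int[OF i] by (rule borel_measurable_integrable)
    have "(\<integral>w. (\<lambda>w. (w i)\<^sup>2 * trunc P a w) (\<lambda>p\<in>P. w (?t p)) \<partial>gauss P) = (\<integral>w. (w i)\<^sup>2 * trunc P a w \<partial>gauss P)"
      by (rule integral_gauss_marginal(1)[OF _ _ m]) (use bij in \<open>auto simp: bij_betw_def\<close>)
    then show ?thesis using i by (simp add: trunc_def S)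
  qed
  have "real (card P) * chisq_cdf (card P + 2) a = (\<integral>w. (\<Sum>p\<in>P. (w p)\<^sup>2 * trunc P a w) \<partial>gauss P)"
    unfolding sq_norm_trunc[OF P ne a, symmetric] by (simp add: sum_distrib_right)
  also have "\<dots> = (\<Sum>p\<in>P. \<integral>w. (w p)\<^sup>2 * trunc P a w \<partial>gauss P)"
    by (rule Bochner_Integration.integral_sum) (rule int)
  also have "\<dots> = (\<Sum>p\<in>P. \<integral>w. (w i)\<^sup>2 * trunc P a w \<partial>gauss P)"
    by (intro sum.cong refl same)
  also have "\<dots> = real (card P) * (\<integral>w. (w i)\<^sup>2 * trunc P a w \<partial>gauss P)" by simp
  finally show ?thesis using P ne by simp
qed

lemma chisq_cdf_mono:
  assumes k: "k \<ge> 1" and a: "a > 0"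
  shows "chisq_cdf (k + 2) a \<le> chisq_cdf k a"
proof -
  define I where "I = {..<k}"
  have I: "finite I" "I \<noteq> {}" "card I = k" using k by (auto simp: I_def lessThan_empty_iff)
  interpret prob_space "gauss I" by (rule prob_space_gauss)
  let ?S = "\<lambda>w. \<Sum>p\<in>I. (w p)\<^sup>2"
  have iS: "integrable (gauss I) ?S" by (intro Bochner_Integration.integrable_sum gauss_square)
  have iT: "integrable (gauss I) (trunc I a)" by (rule integrable_trunc) simp
  have iST: "integrable (gauss I) (\<lambda>w. ?S w * trunc I a w)" by (rule integrable_mult_trunc[OF iS]) simp
  have ES: "(\<integral>w. ?S w \<partial>gauss I) = real k"
    using I by (subst Bochner_Integration.integral_sum) (auto simp: gauss_square)
  have eq: "(\<integral>w. (?S w - real k) * trunc I a w \<partial>gauss I) = real k * (chisq_cdf (k + 2) a - chisq_cdf k a)"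
  proof -
    have "(\<integral>w. (?S w - real k) * trunc I a w \<partial>gauss I) = (\<integral>w. ?S w * trunc I a w - real k * trunc I a w \<partial>gauss I)"
      by (simp add: left_diff_distrib)
    also have "\<dots> = (\<integral>w. ?S w * trunc I a w \<partial>gauss I) - real k * (\<integral>w. trunc I a w \<partial>gauss I)"
      using iST iT by simp
    also have "\<dots> = real k * chisq_cdf (k + 2) a - real k * chisq_cdf k a"
      using sq_norm_trunc[OF I(1,2) a] prob_trunc[OF I(1) order_refl I(2) a] I(3) by simp
    finally show ?thesis by (simp add: right_diff_distrib)
  qed
  have "(\<integral>w. (?S w - real k) * trunc I a w \<partial>gauss I) \<le> 0"
  proof (cases "a \<le> real k")
    case True
    have "(?S w - real k) * trunc I a w \<le> 0" for w
      using True by (auto simp: trunc_def indicator_def)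
    moreover have "integrable (gauss I) (\<lambda>w. (?S w - real k) * trunc I a w)"
      by (rule integrable_mult_trunc) (use iS in auto)
    ultimately have "(\<integral>w. (?S w - real k) * trunc I a w \<partial>gauss I) \<le> (\<integral>w. 0 \<partial>gauss I)"
      by (intro integral_mono) auto
    then show ?thesis by simp
  next
    case False
    have "(\<integral>w. (?S w - real k) * trunc I a w \<partial>gauss I) \<le> (\<integral>w. ?S w - real k \<partial>gauss I)"
    proof (rule integral_mono)
      show "(?S w - real k) * trunc I a w \<le> ?S w - real k" for w
        using False by (auto simp: trunc_def indicator_def)
      show "integrable (gauss I) (\<lambda>w. (?S w - real k) * trunc I a w)"
        by (rule integrable_mult_trunc) (use iS in auto)
    qed (use iS in auto)
    also have "\<dots> = 0" using iS ES by (simp add: prob_space)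
    finally show ?thesis .
  qed
  then show ?thesis unfolding eq using k by (simp add: mult_le_0_iff)
qed

lemma gauss_odd_zero:
  fixes g :: "('a \<Rightarrow> real) \<Rightarrow> real"
  assumes "finite J" "i \<in> J" and g: "g \<in> borel_measurable (gauss J)" and odd: "\<And>w. g (w(i := - w i)) = - g w"
  shows "(\<integral>w. g w \<partial>gauss J) = 0"
proof -
  have "(\<integral>w. g w \<partial>gauss J) = (\<integral>w. - g w \<partial>gauss J)"
    using gauss_reflect[OF assms(1) g assms(2)] unfolding odd by simp
  then show ?thesis by simp
qed

lemma trunc_reflect: "trunc P a (w(i := - w i)) = trunc P a w"
proof -
  have "(\<Sum>p\<in>P. ((w(i := - w i)) p)\<^sup>2) = (\<Sum>p\<in>P. (w p)\<^sup>2)" by (intro sum.cong) auto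
  then show ?thesis by (simp add: trunc_def)
qed

lemma gauss_first_moments:
  assumes J: "finite J" "P \<subseteq> J" and i: "i \<in> J"
  shows "(\<integral>w. w i \<partial>gauss J) = 0" "(\<integral>w. w i * trunc P a w \<partial>gauss J) = 0"
proof -
  show "(\<integral>w. w i \<partial>gauss J) = 0" by (rule gauss_odd_zero[OF J(1) i gauss_component[OF i]]) simp
  show "(\<integral>w. w i * trunc P a w \<partial>gauss J) = 0"
    by (rule gauss_odd_zero[OF J(1) i]) (intro borel_measurable_times gauss_component i trunc_measurable J, simp add: trunc_reflect)
qed

lemma gauss_second_moments:
  assumes J: "finite J" and ij: "i \<in> J" "j \<in> J"
  shows "(\<integral>w. w i * w j \<partial>gauss J) = (if i = j then 1 else 0)"
proof (cases "i = j")
  case True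
  then show ?thesis using gauss_square(2)[OF ij(1)] by (simp add: power2_eq_square)
next
  case False
  have "(\<integral>w. w i * w j \<partial>gauss J) = 0"
    by (rule gauss_odd_zero[OF J ij(1)]) (intro borel_measurable_times gauss_component ij, use False in simp)
  then show ?thesis using False by simp
qed

lemma gauss_second_moments_trunc:
  assumes J: "finite J" "P \<subseteq> J" "P \<noteq> {}" and ij: "i \<in> J" "j \<in> J" and a: "a > 0"
  shows "(\<integral>w. w i * w j * trunc P a w \<partial>gauss J)
     = (if i = j then if i \<in> P then chisq_cdf (card P + 2) a else chisq_cdf (card P) a else 0)"
proof -
  have fP: "finite P" using J finite_subset by blast
  consider "i \<noteq> j" | "i = j" "i \<in> P" | "i = j" "i \<notin> P" by blast
  then show ?thesis
  proof cases
    case 1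
    have "(\<integral>w. w i * w j * trunc P a w \<partial>gauss J) = 0"
      by (rule gauss_odd_zero[OF J(1) ij(1)])
        (intro borel_measurable_times gauss_component ij trunc_measurable J, use 1 in \<open>simp add: trunc_reflect\<close>)
    then show ?thesis using 1 by simp
  next
    case 2
    have m: "(\<lambda>w. (w i)\<^sup>2 * trunc P a w) \<in> borel_measurable (gauss P)"
      by (intro borel_measurable_times borel_measurable_power gauss_component 2 trunc_measurable order_refl)
    have "(\<integral>w. (\<lambda>w. (w i)\<^sup>2 * trunc P a w) (\<lambda>p\<in>P. w p) \<partial>gauss J) = (\<integral>w. (w i)\<^sup>2 * trunc P a w \<partial>gauss P)"
      by (rule integral_gauss_marginal(1)[OF _ _ m]) (use J in \<open>auto simp: inj_on_def\<close>)
    then show ?thesis using 2 coordinate_sq_trunc[OF fP 2(2) a] by (simp add: trunc_restrict power2_eq_square)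
  next
    case 3
    let ?J = "J - {i}"
    have Ji: "insert i ?J = J" using ij by auto
    have E: "trunc P a (w(i := y)) = trunc P a w" for w :: "'a \<Rightarrow> real" and y
    proof -
      have "(\<Sum>p\<in>P. ((w(i := y)) p)\<^sup>2) = (\<Sum>p\<in>P. (w p)\<^sup>2)" using 3 by (intro sum.cong) auto
      then show ?thesis by (simp add: trunc_def)
    qed
    have fold: "(\<integral>w. h (w i) * trunc P a w \<partial>gauss J) = (\<integral>x. h x \<partial>std_normal_distribution) * (\<integral>w. trunc P a w \<partial>gauss ?J)"
      if int: "integrable (gauss J) (\<lambda>w. h (w i) * trunc P a w)" for h :: "real \<Rightarrow> real"
    proof -
      have "(\<integral>w. h (w i) * trunc P a w \<partial>gauss J)
          = (\<integral>w. (\<integral>y. h ((w(i := y)) i) * trunc P a (w(i := y)) \<partial>std_normal_distribution) \<partial>gauss ?J)"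
        using gauss_prod.product_integral_insert[of ?J i "\<lambda>w. h (w i) * trunc P a w"] int J(1)
        unfolding Ji gauss_def by simp
      then show ?thesis unfolding E by simp
    qed
    have "(\<integral>w. (w i)\<^sup>2 * trunc P a w \<partial>gauss J) = (\<integral>w. 1 * trunc P a w \<partial>gauss J)"
    proof -
      have "(\<integral>x. x ^ (2 * 1) \<partial>std_normal_distribution) = 1"
        unfolding std_normal_distribution_even_moments by (simp add: fact_numeral)
      then have 1: "(\<integral>x. x\<^sup>2 \<partial>std_normal_distribution) = 1" by (simp only: mult_1_right)
      have "(\<integral>w. (w i)\<^sup>2 * trunc P a w \<partial>gauss J) = 1 * (\<integral>w. trunc P a w \<partial>gauss ?J)"
        using fold[of "\<lambda>x. x\<^sup>2"] integrable_mult_trunc[OF gauss_square(1)[OF ij(1)] J(2)] unfolding 1 by blast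
      moreover have "(\<integral>w. 1 * trunc P a w \<partial>gauss J) = 1 * (\<integral>w. trunc P a w \<partial>gauss ?J)"
        using fold[of "\<lambda>x. 1"] integrable_trunc[OF J(2)] std_normal.prob_space by simp
      ultimately show ?thesis by simp
    qed
    then show ?thesis using 3 prob_trunc[OF J a] by (simp add: power2_eq_square)
  qed
qed

section \<open>Covariances of weak limits\<close>

definition clip :: "nat \<Rightarrow> real \<Rightarrow> real" where
  "clip n x = max (- real n) (min (real n) x)"

lemma clip_abs_le: "\<bar>clip n x\<bar> \<le> \<bar>x\<bar>" "\<bar>clip n x\<bar> \<le> real n"
  by (auto simp: clip_def)

lemma clip_tendsto: "(\<lambda>n. clip n x) \<longlonglongrightarrow> x"
proof (rule tendsto_eventually)
  obtain k :: nat where "\<bar>x\<bar> \<le> real k" using real_arch_simple by blast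
  then have "clip n x = x" if "n \<ge> k" for n
  proof -
    have "real k \<le> real n" using that by simp
    then show ?thesis using \<open>\<bar>x\<bar> \<le> real k\<close> by (auto simp: clip_def)
  qed
  then show "\<forall>\<^sub>F n in sequentially. clip n x = x" unfolding eventually_sequentially by blast
qed

lemma clip_continuous: "continuous_on S (\<lambda>y::'i \<Rightarrow> real. clip n (y f))"
  unfolding clip_def by (intro continuous_on_max continuous_on_min continuous_on_const continuous_on_coordinate)

lemma clip_borel: "clip n \<in> borel_measurable borel"
  unfolding clip_def[abs_def] by measurable

locale same_weak_integrals =
  fixes I :: "'i set" and mu nu :: "('i \<Rightarrow> real) measure"
  assumes prob: "prob_space mu" "prob_space nu"
    and sets: "sets mu = sets (PiM I (\<lambda>_. borel))" "sets nu = sets (PiM I (\<lambda>_. borel))"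
    and eq: "\<And>h :: ('i \<Rightarrow> real) \<Rightarrow> real. continuous_on (PiE I (\<lambda>_. UNIV)) h \<Longrightarrow> bounded (h ` PiE I (\<lambda>_. UNIV)) \<Longrightarrow>
      (\<integral>y. h y \<partial>mu) = (\<integral>y. h y \<partial>nu)"
    and sq: "\<And>f. f \<in> I \<Longrightarrow> integrable nu (\<lambda>y. (y f)\<^sup>2)"
begin

lemma coord_meas:
  assumes "f \<in> I"
  shows "(\<lambda>y. y f) \<in> borel_measurable mu" "(\<lambda>y. y f) \<in> borel_measurable nu"
  unfolding measurable_cong_sets[OF sets(1) refl] measurable_cong_sets[OF sets(2) refl]
  by (rule measurable_component_singleton[OF assms])+

lemma clip_meas:
  assumes "f \<in> I"
  shows "(\<lambda>y. clip n (y f)) \<in> borel_measurable mu" "(\<lambda>y. clip n (y f)) \<in> borel_measurable nu"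
  by (rule measurable_compose[OF coord_meas(1)[OF assms] clip_borel])
    (rule measurable_compose[OF coord_meas(2)[OF assms] clip_borel])

lemma sq_mu:
  assumes f: "f \<in> I"
  shows "integrable mu (\<lambda>y. (y f)\<^sup>2)"
proof -
  interpret mu: prob_space mu by (rule prob)
  interpret nu: prob_space nu by (rule prob)
  have bd: "\<bar>(clip n x)\<^sup>2\<bar> \<le> (real n)\<^sup>2" for n x
    using clip_abs_le(2)[of n x] abs_le_square_iff[of "clip n x" "real n"] by simp
  have h: "(\<integral>y. (clip n (y f))\<^sup>2 \<partial>mu) = (\<integral>y. (clip n (y f))\<^sup>2 \<partial>nu)" for n
  proof (rule eq)
    show "continuous_on (PiE I (\<lambda>_. UNIV)) (\<lambda>y. (clip n (y f))\<^sup>2)"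
      by (intro continuous_on_power clip_continuous)
    show "bounded ((\<lambda>y. (clip n (y f))\<^sup>2) ` PiE I (\<lambda>_. UNIV))"
      unfolding bounded_iff using bd by (intro exI[of _ "(real n)\<^sup>2"]) auto
  qed
  have le: "(clip n x)\<^sup>2 \<le> x\<^sup>2" for n x
    using clip_abs_le(1)[of n x] abs_le_square_iff[of "clip n x" x] by simp
  have lim_nu: "(\<lambda>n. \<integral>y. (clip n (y f))\<^sup>2 \<partial>nu) \<longlonglongrightarrow> (\<integral>y. (y f)\<^sup>2 \<partial>nu)"
  proof (rule integral_dominated_convergence[where w="\<lambda>y. (y f)\<^sup>2"])
    show "AE y in nu. (\<lambda>n. (clip n (y f))\<^sup>2) \<longlonglongrightarrow> (y f)\<^sup>2"
      by (intro AE_I2 tendsto_power clip_tendsto)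
    show "AE y in nu. norm ((clip n (y f))\<^sup>2) \<le> (y f)\<^sup>2" for n using le by (intro AE_I2) simp
  qed (intro borel_measurable_power coord_meas clip_meas f sq)+
  show ?thesis
  proof (rule integrable_monotone_convergence[where f="\<lambda>n y. (clip n (y f))\<^sup>2" and x="\<integral>y. (y f)\<^sup>2 \<partial>nu"])
    show "integrable mu (\<lambda>y. (clip n (y f))\<^sup>2)" for n
      by (rule mu.integrable_const_bound[of _ "(real n)\<^sup>2"])
        (use bd in \<open>auto intro!: borel_measurable_power clip_meas f\<close>)
    show "AE y in mu. mono (\<lambda>n. (clip n (y f))\<^sup>2)"
    proof (intro AE_I2 monoI)
      fix y :: "'i \<Rightarrow> real" and n k :: nat assume "n \<le> k"
      then have "real n \<le> real k" by simp
      then have "\<bar>clip n (y f)\<bar> \<le> \<bar>clip k (y f)\<bar>" by (auto simp: clip_def)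
      then show "(clip n (y f))\<^sup>2 \<le> (clip k (y f))\<^sup>2" by (simp only: abs_le_square_iff)
    qed
    show "AE y in mu. (\<lambda>n. (clip n (y f))\<^sup>2) \<longlonglongrightarrow> (y f)\<^sup>2"
      by (intro AE_I2 tendsto_power clip_tendsto)
    show "(\<lambda>n. \<integral>y. (clip n (y f))\<^sup>2 \<partial>mu) \<longlonglongrightarrow> (\<integral>y. (y f)\<^sup>2 \<partial>nu)" unfolding h by (rule lim_nu)
  qed (intro borel_measurable_power coord_meas f)
qed

lemma dominated_eq:
  fixes q :: "nat \<Rightarrow> ('i \<Rightarrow> real) \<Rightarrow> real" and r w :: "('i \<Rightarrow> real) \<Rightarrow> real"
  assumes cont: "\<And>n. continuous_on (PiE I (\<lambda>_. UNIV)) (q n)"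
    and bdd: "\<And>n y. \<bar>q n y\<bar> \<le> B n" and lim: "\<And>y. (\<lambda>n. q n y) \<longlonglongrightarrow> r y"
    and dom: "\<And>n y. \<bar>q n y\<bar> \<le> w y" "integrable mu w" "integrable nu w"
    and meas: "\<And>n. q n \<in> borel_measurable mu" "\<And>n. q n \<in> borel_measurable nu"
      "r \<in> borel_measurable mu" "r \<in> borel_measurable nu"
  shows "(\<integral>y. r y \<partial>mu) = (\<integral>y. r y \<partial>nu)"
proof -
  have 1: "(\<lambda>n. \<integral>y. q n y \<partial>mu) \<longlonglongrightarrow> (\<integral>y. r y \<partial>mu)"
    by (rule integral_dominated_convergence[where w=w]) (use assms in auto)
  have 2: "(\<lambda>n. \<integral>y. q n y \<partial>nu) \<longlonglongrightarrow> (\<integral>y. r y \<partial>nu)"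
    by (rule integral_dominated_convergence[where w=w]) (use assms in auto)
  have "(\<integral>y. q n y \<partial>mu) = (\<integral>y. q n y \<partial>nu)" for n
  proof (rule eq[OF cont])
    show "bounded (q n ` PiE I (\<lambda>_. UNIV))"
      unfolding bounded_iff using bdd by (intro exI[of _ "B n"]) auto
  qed
  with 1 have "(\<lambda>n. \<integral>y. q n y \<partial>nu) \<longlonglongrightarrow> (\<integral>y. r y \<partial>mu)" by simp
  from LIMSEQ_unique[OF this 2] show ?thesis .
qed

lemma first_moment_eq:
  assumes f: "f \<in> I"
  shows "(\<integral>y. y f \<partial>mu) = (\<integral>y. y f \<partial>nu)"
proof (rule dominated_eq[where q="\<lambda>n y. clip n (y f)" and B="\<lambda>n. real n" and w="\<lambda>y. 1 + (y f)\<^sup>2"])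
  interpret mu: prob_space mu by (rule prob)
  interpret nu: prob_space nu by (rule prob)
  show "integrable mu (\<lambda>y. 1 + (y f)\<^sup>2)" "integrable nu (\<lambda>y. 1 + (y f)\<^sup>2)"
    using sq_mu[OF f] sq[OF f] by auto
  show "\<bar>clip n (y f)\<bar> \<le> 1 + (y f)\<^sup>2" for n y
  proof -
    have "\<bar>x\<bar> \<le> 1 + x\<^sup>2" for x :: real
      using sum_squares_bound[of 1 "\<bar>x\<bar>"] unfolding power2_abs by simp
    then show ?thesis using clip_abs_le(1)[of n "y f"] order_trans by blast
  qed
qed (intro clip_continuous clip_abs_le clip_tendsto clip_meas coord_meas f)+

lemma second_moment_eq:
  assumes f: "f \<in> I" and g: "g \<in> I"
  shows "(\<integral>y. y f * y g \<partial>mu) = (\<integral>y. y f * y g \<partial>nu)"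
proof (rule dominated_eq[where q="\<lambda>n y. clip n (y f) * clip n (y g)" and B="\<lambda>n. real n * real n" and w="\<lambda>y. (y f)\<^sup>2 + (y g)\<^sup>2"])
  show "integrable mu (\<lambda>y. (y f)\<^sup>2 + (y g)\<^sup>2)" "integrable nu (\<lambda>y. (y f)\<^sup>2 + (y g)\<^sup>2)"
    by (intro Bochner_Integration.integrable_add sq_mu sq f g)+
  show "\<bar>clip n (y f) * clip n (y g)\<bar> \<le> real n * real n" for n y
    unfolding abs_mult by (intro mult_mono clip_abs_le) auto
  show "\<bar>clip n (y f) * clip n (y g)\<bar> \<le> (y f)\<^sup>2 + (y g)\<^sup>2" for n y
  proof -
    have "\<bar>clip n (y f) * clip n (y g)\<bar> \<le> \<bar>y f\<bar> * \<bar>y g\<bar>"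
      unfolding abs_mult by (intro mult_mono clip_abs_le) auto
    also have "\<dots> \<le> (y f)\<^sup>2 + (y g)\<^sup>2"
      using sum_squares_bound[of "\<bar>y f\<bar>" "\<bar>y g\<bar>"] mult_nonneg_nonneg[of "\<bar>y f\<bar>" "\<bar>y g\<bar>"]
      unfolding power2_abs by linarith
    finally show ?thesis .
  qed
  show "(\<lambda>n. clip n (y f) * clip n (y g)) \<longlonglongrightarrow> y f * y g" for y by (intro tendsto_mult clip_tendsto)
qed (intro continuous_on_mult clip_continuous borel_measurable_times clip_meas coord_meas f g)+

lemma mcov_eq: "f \<in> I \<Longrightarrow> g \<in> I \<Longrightarrow> mcov mu f g = mcov nu f g"
  unfolding mcov_def by (simp add: first_moment_eq second_moment_eq)

end

lemma weak_limits_same_integrals: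
  assumes mu: "weak_conv_vec I P X mu" and nu: "weak_conv_vec I P X nu"
    and sq: "\<And>f. f \<in> I \<Longrightarrow> integrable nu (\<lambda>y. (y f)\<^sup>2)"
  shows "same_weak_integrals I mu nu"
proof (rule same_weak_integrals.intro)
  fix h :: "('a \<Rightarrow> real) \<Rightarrow> real"
  assume h: "continuous_on (PiE I (\<lambda>_. UNIV)) h" "bounded (h ` PiE I (\<lambda>_. UNIV))"
  have "(\<lambda>m. \<integral>z. h (X m z) \<partial>P m) \<longlonglongrightarrow> (\<integral>y. h y \<partial>mu)"
    using mu h unfolding weak_conv_vec_def by blast
  moreover have "(\<lambda>m. \<integral>z. h (X m z) \<partial>P m) \<longlonglongrightarrow> (\<integral>y. h y \<partial>nu)"
    using nu h unfolding weak_conv_vec_def by blast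
  ultimately show "(\<integral>y. h y \<partial>mu) = (\<integral>y. h y \<partial>nu)" by (rule LIMSEQ_unique)
next
  show "prob_space mu" "sets mu = sets (PiM I (\<lambda>_. borel))"
    using mu unfolding weak_conv_vec_def by blast+
  show "prob_space nu" "sets nu = sets (PiM I (\<lambda>_. borel))"
    using nu unfolding weak_conv_vec_def by blast+
qed (rule sq)

section \<open>Normal limits conditioned on a Mahalanobis ball\<close>

lemma quadratic_form_expand:
  fixes Sg R :: "'j \<Rightarrow> 'j \<Rightarrow> real"
  assumes "\<And>j k. j \<in> J \<Longrightarrow> k \<in> J \<Longrightarrow> Sg j k = (\<Sum>l\<in>J. R j l * R k l)"
  shows "(\<Sum>j\<in>J. \<Sum>k\<in>J. t j * Sg j k * t k) = (\<Sum>l\<in>J. (\<Sum>j\<in>J. t j * R j l)\<^sup>2)"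
proof -
  have "(\<Sum>l\<in>J. (\<Sum>j\<in>J. t j * R j l)\<^sup>2) = (\<Sum>l\<in>J. \<Sum>j\<in>J. \<Sum>k\<in>J. (t j * R j l) * (t k * R k l))"
    by (simp add: power2_eq_square sum_product)
  also have "\<dots> = (\<Sum>j\<in>J. \<Sum>l\<in>J. \<Sum>k\<in>J. (t j * R j l) * (t k * R k l))" by (rule sum.swap)
  also have "\<dots> = (\<Sum>j\<in>J. \<Sum>k\<in>J. \<Sum>l\<in>J. (t j * R j l) * (t k * R k l))"
    by (intro sum.cong refl sum.swap)
  also have "\<dots> = (\<Sum>j\<in>J. \<Sum>k\<in>J. t j * Sg j k * t k)"
    using assms by (intro sum.cong refl) (simp add: sum_distrib_left sum_distrib_right mult_ac)
  finally show ?thesis by simp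
qed

lemma sum_Plus_split: "finite A \<Longrightarrow> finite B \<Longrightarrow> (\<Sum>j\<in>A <+> B. f j) = (\<Sum>x\<in>A. f (Inl x)) + (\<Sum>y\<in>B. f (Inr y))"
  by (simp add: sum.Plus o_def)

locale block_cov =
  fixes I :: "'i set" and P :: "'p set" and Sg :: "'i + 'p \<Rightarrow> 'i + 'p \<Rightarrow> real" and W :: "'p \<Rightarrow> 'p \<Rightarrow> real"
  assumes finI: "finite I" and finP: "finite P"
    and sym: "\<And>j k. j \<in> I <+> P \<Longrightarrow> k \<in> I <+> P \<Longrightarrow> Sg j k = Sg k j"
    and psd: "psd_on (I <+> P) Sg"
    and W: "inverse_on P (\<lambda>p q. Sg (Inr p) (Inr q)) W"
begin

definition Vpar_lim :: "'i \<Rightarrow> 'i \<Rightarrow> real" where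
  "Vpar_lim f g = (\<Sum>p\<in>P. \<Sum>q\<in>P. Sg (Inl f) (Inr p) * W p q * Sg (Inl g) (Inr q))"

lemma W_sym: "p \<in> P \<Longrightarrow> q \<in> P \<Longrightarrow> W p q = W q p"
  by (rule inverse_on_sym[OF finP W]) (auto intro: sym)

lemma psd_Inr: "psd_on P (\<lambda>p q. Sg (Inr p) (Inr q))"
  unfolding psd_on_def
proof
  fix u :: "'p \<Rightarrow> real"
  let ?t = "case_sum (\<lambda>_. 0) u"
  have "0 \<le> (\<Sum>i\<in>I <+> P. \<Sum>j\<in>I <+> P. ?t i * Sg i j * ?t j)" using psd unfolding psd_on_def by blast
  then show "0 \<le> (\<Sum>p\<in>P. \<Sum>q\<in>P. u p * Sg (Inr p) (Inr q) * u q)"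
    by (simp add: sum_Plus_split finI finP)
qed

lemma W_contract:
  assumes p: "p \<in> P"
  shows "(\<Sum>r\<in>P. (\<Sum>q\<in>P. b q * W q r) * Sg (Inr r) (Inr p)) = b p"
proof -
  have "(\<Sum>r\<in>P. (\<Sum>q\<in>P. b q * W q r) * Sg (Inr r) (Inr p)) = (\<Sum>q\<in>P. b q * (\<Sum>r\<in>P. W q r * Sg (Inr r) (Inr p)))"
    unfolding sum_distrib_right sum_distrib_left by (subst sum.swap) (simp add: mult.assoc)
  also have "\<dots> = (\<Sum>q\<in>P. b q * (if q = p then 1 else 0))"
    using W p unfolding inverse_on_def by (intro sum.cong) auto
  also have "\<dots> = b p" using finP p by (simp add: if_distrib[of "\<lambda>z. _ * z"] cong: if_cong)
  finally show ?thesis .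
qed

lemma psd_residual: "psd_on I (\<lambda>f g. Sg (Inl f) (Inl g) - Vpar_lim f g)"
  unfolding psd_on_def
proof
  fix u :: "'i \<Rightarrow> real"
  define s where "s p = (\<Sum>f\<in>I. u f * Sg (Inl f) (Inr p))" for p
  define b where "b r = (\<Sum>q\<in>P. s q * W q r)" for r
  let ?t = "case_sum u (\<lambda>p. - b p)"
  have cross: "(\<Sum>f\<in>I. \<Sum>p\<in>P. u f * Sg (Inl f) (Inr p) * b p) = (\<Sum>p\<in>P. s p * b p)"
    by (subst sum.swap) (simp add: s_def sum_distrib_right)
  have cross': "(\<Sum>p\<in>P. \<Sum>f\<in>I. b p * Sg (Inr p) (Inl f) * u f) = (\<Sum>p\<in>P. s p * b p)"
    unfolding s_def sum_distrib_right using sym by (intro sum.cong refl) (auto simp: mult_ac)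
  have bb: "(\<Sum>p\<in>P. \<Sum>q\<in>P. b p * Sg (Inr p) (Inr q) * b q) = (\<Sum>p\<in>P. s p * b p)"
  proof -
    have "(\<Sum>p\<in>P. \<Sum>q\<in>P. b p * Sg (Inr p) (Inr q) * b q) = (\<Sum>q\<in>P. (\<Sum>p\<in>P. b p * Sg (Inr p) (Inr q)) * b q)"
      by (subst sum.swap) (simp add: sum_distrib_right)
    also have "\<dots> = (\<Sum>q\<in>P. s q * b q)"
      unfolding b_def[abs_def] by (intro sum.cong refl) (simp add: W_contract)
    finally show ?thesis .
  qed
  have sb: "(\<Sum>p\<in>P. s p * b p) = (\<Sum>f\<in>I. \<Sum>g\<in>I. u f * Vpar_lim f g * u g)"
  proof -
    have "(\<Sum>p\<in>P. s p * b p) = (\<Sum>p\<in>P. \<Sum>q\<in>P. s q * W q p * s p)"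
      by (simp add: b_def sum_distrib_left mult_ac)
    also have "\<dots> = (\<Sum>p\<in>P. \<Sum>q\<in>P. s p * W p q * s q)"
      by (rule sum.swap)
    also have "\<dots> = (\<Sum>p\<in>P. \<Sum>q\<in>P. \<Sum>f\<in>I. \<Sum>g\<in>I. u f * (Sg (Inl f) (Inr p) * W p q * Sg (Inl g) (Inr q)) * u g)"
      by (simp add: s_def sum_distrib_left sum_distrib_right mult_ac)
    also have "\<dots> = (\<Sum>p\<in>P. \<Sum>f\<in>I. \<Sum>q\<in>P. \<Sum>g\<in>I. u f * (Sg (Inl f) (Inr p) * W p q * Sg (Inl g) (Inr q)) * u g)"
      by (intro sum.cong refl sum.swap)
    also have "\<dots> = (\<Sum>f\<in>I. \<Sum>p\<in>P. \<Sum>q\<in>P. \<Sum>g\<in>I. u f * (Sg (Inl f) (Inr p) * W p q * Sg (Inl g) (Inr q)) * u g)"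
      by (rule sum.swap)
    also have "\<dots> = (\<Sum>f\<in>I. \<Sum>p\<in>P. \<Sum>g\<in>I. \<Sum>q\<in>P. u f * (Sg (Inl f) (Inr p) * W p q * Sg (Inl g) (Inr q)) * u g)"
      by (intro sum.cong refl sum.swap)
    also have "\<dots> = (\<Sum>f\<in>I. \<Sum>g\<in>I. \<Sum>p\<in>P. \<Sum>q\<in>P. u f * (Sg (Inl f) (Inr p) * W p q * Sg (Inl g) (Inr q)) * u g)"
      by (intro sum.cong refl sum.swap)
    also have "\<dots> = (\<Sum>f\<in>I. \<Sum>g\<in>I. u f * Vpar_lim f g * u g)"
      by (simp add: Vpar_lim_def sum_distrib_left sum_distrib_right)
    finally show ?thesis .
  qed
  have "0 \<le> (\<Sum>i\<in>I <+> P. \<Sum>j\<in>I <+> P. ?t i * Sg i j * ?t j)" using psd unfolding psd_on_def by blast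
  also have "\<dots> = (\<Sum>f\<in>I. \<Sum>g\<in>I. u f * Sg (Inl f) (Inl g) * u g) - (\<Sum>p\<in>P. s p * b p)"
    by (simp add: sum_Plus_split finI finP sum.distrib sum_negf sum_subtractf cross cross' bb)
  also have "\<dots> = (\<Sum>f\<in>I. \<Sum>g\<in>I. u f * (Sg (Inl f) (Inl g) - Vpar_lim f g) * u g)"
    unfolding sb by (simp add: right_diff_distrib left_diff_distrib sum_subtractf)
  finally show "0 \<le> (\<Sum>f\<in>I. \<Sum>g\<in>I. u f * (Sg (Inl f) (Inl g) - Vpar_lim f g) * u g)" .
qed

lemma Vpar_lim_sym: "f \<in> I \<Longrightarrow> g \<in> I \<Longrightarrow> Vpar_lim f g = Vpar_lim g f"
  unfolding Vpar_lim_def by (subst sum.swap) (auto intro!: sum.cong simp: W_sym mult_ac)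

text \<open>The limit vector is represented as \<open>(\<Gamma> D + E D', C D)\<close> with independent standard normal
  \<open>D\<close>, \<open>D'\<close>, so that the Mahalanobis distance of the second block is \<open>|D|\<^sup>2\<close>.\<close>

lemma block_factor:
  obtains R :: "'i + 'p \<Rightarrow> 'i + 'p \<Rightarrow> real" where
    "\<And>j k. j \<in> I <+> P \<Longrightarrow> k \<in> I <+> P \<Longrightarrow> Sg j k = (\<Sum>l\<in>I <+> P. R j l * R k l)"
    "\<And>p f. R (Inr p) (Inl f) = 0"
    "\<And>p q. p \<in> P \<Longrightarrow> q \<in> P \<Longrightarrow>
       (\<Sum>r\<in>P. \<Sum>s\<in>P. R (Inr r) (Inr p) * W r s * R (Inr s) (Inr q)) = (if p = q then 1 else 0)"
    "\<And>f g. f \<in> I \<Longrightarrow> g \<in> I \<Longrightarrow> (\<Sum>p\<in>P. R (Inl f) (Inr p) * R (Inl g) (Inr p)) = Vpar_lim f g"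
proof -
  obtain C where C: "\<And>p q. p \<in> P \<Longrightarrow> q \<in> P \<Longrightarrow> Sg (Inr p) (Inr q) = (\<Sum>r\<in>P. C p r * C q r)"
  proof -
    have "\<exists>C. \<forall>p\<in>P. \<forall>q\<in>P. Sg (Inr p) (Inr q) = (\<Sum>r\<in>P. C p r * C q r)"
      by (rule cholesky[OF finP psd_Inr]) (auto intro: sym)
    then show ?thesis using that by blast
  qed
  obtain E where E: "\<And>f g. f \<in> I \<Longrightarrow> g \<in> I \<Longrightarrow> Sg (Inl f) (Inl g) - Vpar_lim f g = (\<Sum>h\<in>I. E f h * E g h)"
  proof -
    have "\<exists>E. \<forall>f\<in>I. \<forall>g\<in>I. Sg (Inl f) (Inl g) - Vpar_lim f g = (\<Sum>h\<in>I. E f h * E g h)"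
      by (rule cholesky[OF finI psd_residual]) (auto intro: arg_cong2[where f="(-)"] sym Vpar_lim_sym)
    then show ?thesis using that by blast
  qed
  define a where "a f r = (\<Sum>q\<in>P. Sg (Inl f) (Inr q) * W q r)" for f r
  define \<Gamma> where "\<Gamma> f p = (\<Sum>r\<in>P. a f r * C r p)" for f p
  have \<Gamma>C: "(\<Sum>r\<in>P. \<Gamma> f r * C s r) = Sg (Inl f) (Inr s)" if "s \<in> P" for f s
  proof -
    have "(\<Sum>r\<in>P. \<Gamma> f r * C s r) = (\<Sum>r\<in>P. \<Sum>q\<in>P. a f q * (C q r * C s r))"
      by (simp add: \<Gamma>_def sum_distrib_right mult.assoc)
    also have "\<dots> = (\<Sum>q\<in>P. a f q * Sg (Inr q) (Inr s))"
      by (subst sum.swap) (simp add: sum_distrib_left C that)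
    also have "\<dots> = Sg (Inl f) (Inr s)" unfolding a_def by (rule W_contract[OF that])
    finally show ?thesis .
  qed
  have \<Gamma>\<Gamma>: "(\<Sum>p\<in>P. \<Gamma> f p * \<Gamma> g p) = Vpar_lim f g" for f g
  proof -
    have "(\<Sum>p\<in>P. \<Gamma> f p * \<Gamma> g p) = (\<Sum>p\<in>P. \<Sum>r\<in>P. a g r * (\<Gamma> f p * C r p))"
      by (simp add: \<Gamma>_def[of g] sum_distrib_left mult_ac)
    also have "\<dots> = (\<Sum>r\<in>P. a g r * Sg (Inl f) (Inr r))"
      by (subst sum.swap) (simp add: sum_distrib_left[symmetric] \<Gamma>C)
    also have "\<dots> = (\<Sum>r\<in>P. \<Sum>q\<in>P. Sg (Inl f) (Inr r) * W r q * Sg (Inl g) (Inr q))"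
      unfolding a_def sum_distrib_right by (intro sum.cong refl) (simp add: W_sym mult_ac)
    finally show ?thesis unfolding Vpar_lim_def .
  qed
  define R where "R j k = (case j of Inl f \<Rightarrow> (case k of Inl h \<Rightarrow> E f h | Inr p \<Rightarrow> \<Gamma> f p)
      | Inr p \<Rightarrow> (case k of Inl h \<Rightarrow> 0 | Inr q \<Rightarrow> C p q))" for j k
  have R: "R (Inl f) (Inl h) = E f h" "R (Inl f) (Inr p) = \<Gamma> f p" "R (Inr p) (Inl h) = 0" "R (Inr p) (Inr q) = C p q"
    for f h p q by (simp_all add: R_def)
  show thesis
  proof (rule that[of R])
    fix j k assume jk: "j \<in> I <+> P" "k \<in> I <+> P"
    show "Sg j k = (\<Sum>l\<in>I <+> P. R j l * R k l)"
    proof (cases j; cases k)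
      fix f g assume "j = Inl f" "k = Inl g"
      then show ?thesis using E[of f g] jk by (simp add: sum_Plus_split finI finP R \<Gamma>\<Gamma>) auto
    next
      fix f p assume "j = Inl f" "k = Inr p"
      then show ?thesis using jk by (auto simp: sum_Plus_split finI finP R \<Gamma>C)
    next
      fix p f assume "j = Inr p" "k = Inl f"
      then show ?thesis using jk sym[OF jk] \<Gamma>C[of p f] by (auto simp: sum_Plus_split finI finP R mult.commute)
    next
      fix p q assume "j = Inr p" "k = Inr q"
      then show ?thesis using jk by (auto simp: sum_Plus_split finI finP R C)
    qed
  next
    fix p q assume pq: "p \<in> P" "q \<in> P"
    show "(\<Sum>r\<in>P. \<Sum>s\<in>P. R (Inr r) (Inr p) * W r s * R (Inr s) (Inr q)) = (if p = q then 1 else 0)"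
      unfolding R by (rule factor_whitens[OF finP C W pq])
  qed (auto simp: R \<Gamma>\<Gamma>)
qed

abbreviation "J \<equiv> I <+> P"

definition factors :: "('i + 'p \<Rightarrow> 'i + 'p \<Rightarrow> real) \<Rightarrow> bool" where
  "factors R \<longleftrightarrow> (\<forall>j\<in>J. \<forall>k\<in>J. Sg j k = (\<Sum>l\<in>J. R j l * R k l)) \<and> (\<forall>p f. R (Inr p) (Inl f) = 0) \<and>
    (\<forall>p\<in>P. \<forall>q\<in>P. (\<Sum>r\<in>P. \<Sum>s\<in>P. R (Inr r) (Inr p) * W r s * R (Inr s) (Inr q)) = (if p = q then 1 else 0)) \<and>
    (\<forall>f\<in>I. \<forall>g\<in>I. (\<Sum>p\<in>P. R (Inl f) (Inr p) * R (Inl g) (Inr p)) = Vpar_lim f g)"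

lemma ex_factors: "\<exists>R. factors R"
proof -
  obtain R where
    1: "\<And>j k. j \<in> J \<Longrightarrow> k \<in> J \<Longrightarrow> Sg j k = (\<Sum>l\<in>J. R j l * R k l)"
    and 2: "\<And>p f. R (Inr p) (Inl f) = 0"
    and 3: "\<And>p q. p \<in> P \<Longrightarrow> q \<in> P \<Longrightarrow>
       (\<Sum>r\<in>P. \<Sum>s\<in>P. R (Inr r) (Inr p) * W r s * R (Inr s) (Inr q)) = (if p = q then 1 else 0)"
    and 4: "\<And>f g. f \<in> I \<Longrightarrow> g \<in> I \<Longrightarrow> (\<Sum>p\<in>P. R (Inl f) (Inr p) * R (Inl g) (Inr p)) = Vpar_lim f g"
    using block_factor by blast
  have "factors R" unfolding factors_def by (intro conjI ballI allI 1 2 3 4)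
  then show ?thesis by blast
qed

definition R :: "'i + 'p \<Rightarrow> 'i + 'p \<Rightarrow> real" where "R = (SOME R. factors R)"

lemma factors_R: "factors R"
  unfolding R_def by (rule someI_ex[OF ex_factors])

lemmas R_cov = factors_R[unfolded factors_def, THEN conjunct1, THEN bspec, THEN bspec]
  and R_Vpar = factors_R[unfolded factors_def, THEN conjunct2, THEN conjunct2, THEN conjunct2, THEN bspec, THEN bspec]

lemma finJ: "finite J" using finI finP by simp

definition U :: "('i + 'p \<Rightarrow> real) \<Rightarrow> 'i + 'p \<Rightarrow> real" where
  "U w j = (\<Sum>l\<in>J. R j l * w l)"

lemma U_measurable: "(\<lambda>w. U w j) \<in> borel_measurable (gauss J)"
  unfolding U_def by (intro borel_measurable_sum borel_measurable_times borel_measurable_const gauss_component)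

lemma U_mult: "U w j * U w k = (\<Sum>l\<in>J. \<Sum>l'\<in>J. (R j l * R k l') * (w l * w l'))"
  unfolding U_def sum_product by (intro sum.cong refl) (simp add: mult_ac)

lemma U_mult_integrable: "integrable (gauss J) (\<lambda>w. U w j * U w k)"
  unfolding U_mult
  by (intro Bochner_Integration.integrable_sum integrable_mult_right gauss_mult_integrable)

lemma U_cos: "(\<integral>w. cos ((\<Sum>j\<in>J. t j * U w j) + \<theta>) \<partial>gauss J) = cos \<theta> * exp (- (\<Sum>j\<in>J. \<Sum>k\<in>J. t j * Sg j k * t k) / 2)"
proof -
  have 1: "(\<Sum>j\<in>J. t j * U w j) = (\<Sum>l\<in>J. (\<Sum>j\<in>J. t j * R j l) * w l)" for w
  proof -
    have "(\<Sum>j\<in>J. t j * U w j) = (\<Sum>j\<in>J. \<Sum>l\<in>J. t j * R j l * w l)"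
      by (simp only: U_def sum_distrib_left mult.assoc)
    also have "\<dots> = (\<Sum>l\<in>J. \<Sum>j\<in>J. t j * R j l * w l)" by (rule sum.swap)
    finally show ?thesis by (simp only: sum_distrib_right)
  qed
  have 2: "(\<Sum>j\<in>J. \<Sum>k\<in>J. t j * Sg j k * t k) = (\<Sum>l\<in>J. (\<Sum>j\<in>J. t j * R j l)\<^sup>2)"
    by (rule quadratic_form_expand) (rule R_cov)
  show ?thesis unfolding 1 2 by (rule gauss_cos[OF finJ])
qed

lemma sum_mult_diag:
  assumes "finite A"
  shows "(\<Sum>l\<in>A. \<Sum>l'\<in>A. b l l' * (if l = l' then c l else 0)) = (\<Sum>l\<in>A. b l l * (c l :: real))"
  using assms by (intro sum.cong refl) (simp add: if_distrib[of "\<lambda>z. _ * z"] cong: if_cong)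

lemma U_mahalanobis: "(\<Sum>p\<in>P. \<Sum>q\<in>P. U w (Inr p) * W p q * U w (Inr q)) = (\<Sum>p\<in>P. (w (Inr p))\<^sup>2)"
proof -
  let ?C = "\<lambda>p r. R (Inr p) (Inr r)" and ?d = "\<lambda>p. w (Inr p)"
  have U: "U w (Inr p) = (\<Sum>r\<in>P. ?C p r * ?d r)" for p
    using factors_R unfolding U_def factors_def by (simp add: sum_Plus_split finI finP)
  have "(\<Sum>p\<in>P. \<Sum>q\<in>P. U w (Inr p) * W p q * U w (Inr q))
      = (\<Sum>p\<in>P. \<Sum>q\<in>P. \<Sum>r\<in>P. \<Sum>s\<in>P. (?d r * ?d s) * (?C p r * W p q * ?C q s))"
    unfolding U by (simp add: sum_distrib_left sum_distrib_right mult_ac)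
  also have "\<dots> = (\<Sum>p\<in>P. \<Sum>r\<in>P. \<Sum>q\<in>P. \<Sum>s\<in>P. (?d r * ?d s) * (?C p r * W p q * ?C q s))"
    by (intro sum.cong refl sum.swap)
  also have "\<dots> = (\<Sum>r\<in>P. \<Sum>p\<in>P. \<Sum>q\<in>P. \<Sum>s\<in>P. (?d r * ?d s) * (?C p r * W p q * ?C q s))"
    by (rule sum.swap)
  also have "\<dots> = (\<Sum>r\<in>P. \<Sum>p\<in>P. \<Sum>s\<in>P. \<Sum>q\<in>P. (?d r * ?d s) * (?C p r * W p q * ?C q s))"
    by (intro sum.cong refl sum.swap)
  also have "\<dots> = (\<Sum>r\<in>P. \<Sum>s\<in>P. \<Sum>p\<in>P. \<Sum>q\<in>P. (?d r * ?d s) * (?C p r * W p q * ?C q s))"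
    by (intro sum.cong refl sum.swap)
  also have "\<dots> = (\<Sum>r\<in>P. \<Sum>s\<in>P. (?d r * ?d s) * (\<Sum>p\<in>P. \<Sum>q\<in>P. ?C p r * W p q * ?C q s))"
    by (simp only: sum_distrib_left)
  also have "\<dots> = (\<Sum>r\<in>P. \<Sum>s\<in>P. (?d r * ?d s) * (if r = s then 1 else 0))"
    using factors_R unfolding factors_def by (intro sum.cong refl) simp
  also have "\<dots> = (\<Sum>r\<in>P. (?d r)\<^sup>2)"
    by (simp only: sum_mult_diag[OF finP] power2_eq_square mult_1_right)
  finally show ?thesis .
qed

lemma U_second_moment: "j \<in> J \<Longrightarrow> k \<in> J \<Longrightarrow> (\<integral>w. U w j * U w k \<partial>gauss J) = Sg j k"
proof -
  assume jk: "j \<in> J" "k \<in> J"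
  have "(\<integral>w. U w j * U w k \<partial>gauss J) = (\<Sum>l\<in>J. \<Sum>l'\<in>J. (R j l * R k l') * (\<integral>w. w l * w l' \<partial>gauss J))"
    unfolding U_mult
    by (subst Bochner_Integration.integral_sum, intro Bochner_Integration.integrable_sum integrable_mult_right gauss_mult_integrable, assumption, assumption)
      (intro sum.cong refl, subst Bochner_Integration.integral_sum, auto intro!: gauss_mult_integrable)
  also have "\<dots> = (\<Sum>l\<in>J. \<Sum>l'\<in>J. (R j l * R k l') * (if l = l' then 1 else 0))"
    by (intro sum.cong refl) (simp only: gauss_second_moments[OF finJ])
  also have "\<dots> = (\<Sum>l\<in>J. R j l * R k l)" by (simp only: sum_mult_diag[OF finJ] mult_1_right)
  also have "\<dots> = Sg j k" by (rule R_cov[OF jk, symmetric])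
  finally show ?thesis .
qed

lemma Inr_P: "Inr ` P \<subseteq> J" by auto

lemma U_first_moment: "(\<integral>w. U w j \<partial>gauss J) = 0" "(\<integral>w. U w j * trunc (Inr ` P) a w \<partial>gauss J) = 0"
proof -
  have "(\<integral>w. U w j \<partial>gauss J) = (\<Sum>l\<in>J. \<integral>w. R j l * w l \<partial>gauss J)"
    unfolding U_def by (rule Bochner_Integration.integral_sum) (intro integrable_mult_right gauss_linear_integrable)
  also have "\<dots> = 0"
    by (intro sum.neutral ballI) (simp add: gauss_first_moments(1)[OF finJ Inr_P])
  finally show "(\<integral>w. U w j \<partial>gauss J) = 0" .
  have "(\<integral>w. U w j * trunc (Inr ` P) a w \<partial>gauss J) = (\<integral>w. (\<Sum>l\<in>J. R j l * (w l * trunc (Inr ` P) a w)) \<partial>gauss J)"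
    by (simp only: U_def sum_distrib_right mult.assoc)
  also have "\<dots> = (\<Sum>l\<in>J. \<integral>w. R j l * (w l * trunc (Inr ` P) a w) \<partial>gauss J)"
    by (rule Bochner_Integration.integral_sum)
      (intro integrable_mult_right integrable_mult_trunc gauss_linear_integrable Inr_P)
  also have "\<dots> = 0"
    by (intro sum.neutral ballI) (simp add: gauss_first_moments(2)[OF finJ Inr_P])
  finally show "(\<integral>w. U w j * trunc (Inr ` P) a w \<partial>gauss J) = 0" .
qed

lemma U_second_moment_trunc:
  assumes a: "a > 0" and P_ne: "P \<noteq> {}" and fg: "f \<in> I" "g \<in> I"
  shows "(\<integral>w. U w (Inl f) * U w (Inl g) * trunc (Inr ` P) a w \<partial>gauss J)
    = (Sg (Inl f) (Inl g) - Vpar_lim f g) * chisq_cdf (card P) a + Vpar_lim f g * chisq_cdf (card P + 2) a"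
proof -
  let ?T = "trunc (Inr ` P) a" and ?j = "Inl f" and ?k = "Inl g"
  have card: "card (Inr ` P :: ('i + 'p) set) = card P" by (simp add: card_image)
  define e where "e l = (if l \<in> Inr ` P then chisq_cdf (card P + 2) a else chisq_cdf (card P) a)" for l :: "'i + 'p"
  have int: "integrable (gauss J) (\<lambda>w. w l * w l' * ?T w)" if "l \<in> J" "l' \<in> J" for l l'
    by (intro integrable_mult_trunc gauss_mult_integrable that Inr_P)
  have mom: "(\<integral>w. w l * w l' * ?T w \<partial>gauss J) = (if l = l' then e l else 0)" if "l \<in> J" "l' \<in> J" for l l'
    unfolding e_def using gauss_second_moments_trunc[OF finJ Inr_P _ that a] P_ne card by simp
  have "(\<integral>w. U w ?j * U w ?k * ?T w \<partial>gauss J)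
      = (\<integral>w. (\<Sum>l\<in>J. \<Sum>l'\<in>J. (R ?j l * R ?k l') * (w l * w l' * ?T w)) \<partial>gauss J)"
    by (simp only: U_mult sum_distrib_right mult.assoc)
  also have "\<dots> = (\<Sum>l\<in>J. \<integral>w. (\<Sum>l'\<in>J. (R ?j l * R ?k l') * (w l * w l' * ?T w)) \<partial>gauss J)"
    by (rule Bochner_Integration.integral_sum) (intro Bochner_Integration.integrable_sum integrable_mult_right int)
  also have "\<dots> = (\<Sum>l\<in>J. \<Sum>l'\<in>J. \<integral>w. (R ?j l * R ?k l') * (w l * w l' * ?T w) \<partial>gauss J)"
    by (intro sum.cong refl Bochner_Integration.integral_sum integrable_mult_right int)
  also have "\<dots> = (\<Sum>l\<in>J. \<Sum>l'\<in>J. (R ?j l * R ?k l') * (if l = l' then e l else 0))"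
    by (intro sum.cong refl) (simp add: mom)
  also have "\<dots> = (\<Sum>l\<in>J. (R ?j l * R ?k l) * e l)" by (rule sum_mult_diag[OF finJ])
  also have "\<dots> = (\<Sum>h\<in>I. R ?j (Inl h) * R ?k (Inl h)) * chisq_cdf (card P) a + (\<Sum>p\<in>P. R ?j (Inr p) * R ?k (Inr p)) * chisq_cdf (card P + 2) a"
    unfolding sum_Plus_split[OF finI finP] sum_distrib_right
    by (intro arg_cong2[where f="(+)"] sum.cong refl) (auto simp: e_def)
  also have "(\<Sum>p\<in>P. R ?j (Inr p) * R ?k (Inr p)) = Vpar_lim f g"
    by (rule R_Vpar[OF fg])
  also have "(\<Sum>h\<in>I. R ?j (Inl h) * R ?k (Inl h)) = Sg ?j ?k - Vpar_lim f g"
  proof -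
    have "Sg ?j ?k = (\<Sum>l\<in>J. R ?j l * R ?k l)"
      by (rule R_cov[OF InlI[OF fg(1)] InlI[OF fg(2)]])
    also have "\<dots> = (\<Sum>h\<in>I. R ?j (Inl h) * R ?k (Inl h)) + Vpar_lim f g"
      unfolding sum_Plus_split[OF finI finP] \<open>(\<Sum>p\<in>P. R ?j (Inr p) * R ?k (Inr p)) = Vpar_lim f g\<close> ..
    finally show ?thesis by simp
  qed
  finally show ?thesis .
qed

end

lemma indicator_smoothing:
  fixes a \<delta> M q :: real
  assumes \<delta>: "\<delta> > 0"
  shows "\<bar>indicator {..a} M - max 0 (min 1 (1 + (a - q) / \<delta>))\<bar> \<le> max 0 (min 1 (2 - \<bar>q - a\<bar> / \<delta>)) + \<bar>M - q\<bar> / \<delta>"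
proof -
  let ?\<psi> = "max 0 (min 1 (1 + (a - q) / \<delta>))" and ?\<xi> = "max 0 (min 1 (2 - \<bar>q - a\<bar> / \<delta>))"
  have le1: "\<bar>indicator {..a} M - ?\<psi>\<bar> \<le> 1" by (auto simp: indicator_def)
  have nn: "\<bar>M - q\<bar> / \<delta> \<ge> 0" using \<delta> by simp
  consider "\<bar>M - q\<bar> > \<delta>" | "\<bar>q - a\<bar> \<le> \<delta>" | "\<bar>M - q\<bar> \<le> \<delta>" "q < a - \<delta>" | "\<bar>M - q\<bar> \<le> \<delta>" "q > a + \<delta>"
    by linarith
  then show ?thesis
  proof cases
    case 1
    then have "\<bar>M - q\<bar> / \<delta> \<ge> 1" using \<delta> by simp
    moreover have "?\<xi> \<ge> 0" by simp
    ultimately show ?thesis using le1 by linarith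
  next
    case 2
    then have "\<bar>q - a\<bar> / \<delta> \<le> 1" using \<delta> by simp
    then have "?\<xi> = 1" by simp
    then show ?thesis using le1 nn by linarith
  next
    case 3
    then have "M \<le> a" by linarith
    moreover have "(a - q) / \<delta> \<ge> 0" using 3 \<delta> by simp
    ultimately have "indicator {..a} M - ?\<psi> = 0" by simp
    moreover have "?\<xi> \<ge> 0" by simp
    ultimately show ?thesis using nn by linarith
  next
    case 4
    then have "\<not> M \<le> a" by linarith
    moreover have "(a - q) / \<delta> \<le> -1" using 4 \<delta> by (simp add: divide_le_eq)
    ultimately have "indicator {..a} M - ?\<psi> = 0" by simp
    moreover have "?\<xi> \<ge> 0" by simp
    ultimately show ?thesis using nn by linarith
  qed
qed

lemma quadratic_form_bound:
  fixes D :: "'p \<Rightarrow> 'p \<Rightarrow> real"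
  assumes fin: "finite P"
  shows "\<bar>\<Sum>p\<in>P. \<Sum>q\<in>P. x p * D p q * x q\<bar> \<le> (\<Sum>p\<in>P. \<Sum>q\<in>P. \<bar>D p q\<bar>) * (\<Sum>p\<in>P. (x p)\<^sup>2)"
proof -
  let ?S = "\<Sum>p\<in>P. (x p)\<^sup>2"
  have "\<bar>\<Sum>p\<in>P. \<Sum>q\<in>P. x p * D p q * x q\<bar> \<le> (\<Sum>p\<in>P. \<Sum>q\<in>P. \<bar>x p * D p q * x q\<bar>)"
    by (rule order_trans[OF sum_abs]) (intro sum_mono sum_abs)
  also have "\<dots> \<le> (\<Sum>p\<in>P. \<Sum>q\<in>P. \<bar>D p q\<bar> * ?S)"
  proof (intro sum_mono)
    fix p q assume pq: "p \<in> P" "q \<in> P"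
    have 1: "(x p)\<^sup>2 \<le> ?S" "(x q)\<^sup>2 \<le> ?S"
      using fin pq by (intro member_le_sum[where f="\<lambda>p. (x p)\<^sup>2"]; simp)+
    have "\<bar>x p\<bar> * \<bar>x q\<bar> \<le> ?S"
      using sum_squares_bound[of "\<bar>x p\<bar>" "\<bar>x q\<bar>"] 1 unfolding power2_abs by linarith
    then have "\<bar>D p q\<bar> * (\<bar>x p\<bar> * \<bar>x q\<bar>) \<le> \<bar>D p q\<bar> * ?S" by (rule mult_left_mono) simp
    then show "\<bar>x p * D p q * x q\<bar> \<le> \<bar>D p q\<bar> * ?S" by (simp only: abs_mult mult_ac)
  qed
  also have "\<dots> = (\<Sum>p\<in>P. \<Sum>q\<in>P. \<bar>D p q\<bar>) * ?S" by (simp only: sum_distrib_right)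
  finally show ?thesis .
qed

lemma uniform_measure_eq_density:
  assumes "prob_space M" "A \<in> sets M" "measure M A > 0"
  shows "uniform_measure M A = density M (\<lambda>x. ennreal (indicator A x / measure M A))"
proof -
  interpret prob_space M by fact
  have "indicator A x / emeasure M A = ennreal (indicator A x / measure M A)" for x
    using assms(3) by (simp add: emeasure_eq_measure divide_ennreal[symmetric] ennreal_indicator)
  then show ?thesis unfolding uniform_measure_def by simp
qed

locale joint_normal_limit = block_cov I P Sg W
  for I :: "'i::countable set" and P :: "'p::countable set" and Sg W +
  fixes Pr :: "nat \<Rightarrow> 'a measure" and X :: "nat \<Rightarrow> 'a \<Rightarrow> 'i + 'p \<Rightarrow> real"
    and Wm :: "nat \<Rightarrow> 'p \<Rightarrow> 'p \<Rightarrow> real" and a B :: real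
  assumes P_ne: "P \<noteq> {}" and a: "a > 0" and Pr: "\<And>m. prob_space (Pr m)"
    and X: "\<And>m j. j \<in> I <+> P \<Longrightarrow> (\<lambda>z. X m z j) \<in> borel_measurable (Pr m)"
    and X2: "\<And>m j. j \<in> I <+> P \<Longrightarrow> integrable (Pr m) (\<lambda>z. (X m z j)\<^sup>2)"
    and XB: "\<And>m j. j \<in> I <+> P \<Longrightarrow> (\<integral>z. (X m z j)\<^sup>2 \<partial>Pr m) \<le> B"
    and Wm: "\<And>p q. p \<in> P \<Longrightarrow> q \<in> P \<Longrightarrow> (\<lambda>m. Wm m p q) \<longlonglongrightarrow> W p q"
    and conv: "\<And>t \<theta>. (\<lambda>m. \<integral>z. cos ((\<Sum>j\<in>I <+> P. t j * X m z j) + \<theta>) \<partial>Pr m)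
        \<longlonglongrightarrow> cos \<theta> * exp (- (\<Sum>j\<in>I <+> P. \<Sum>k\<in>I <+> P. t j * Sg j k * t k) / 2)"
begin

lemma joint_conv:
  fixes h :: "('i + 'p \<Rightarrow> real) \<Rightarrow> real"
  assumes h: "continuous_on (PiE J (\<lambda>_. UNIV)) h" "bounded (h ` PiE J (\<lambda>_. UNIV))"
  shows "(\<lambda>m. \<integral>z. h (restrict (X m z) J) \<partial>Pr m) \<longlonglongrightarrow> (\<integral>w. h (restrict (U w) J) \<partial>gauss J)"
proof (rule Levy_continuity_vec[where B=B])
  show "(\<lambda>w. U w j) \<in> borel_measurable (gauss J)" for j by (rule U_measurable)
  show "integrable (gauss J) (\<lambda>w. (U w j)\<^sup>2)" for j
    unfolding power2_eq_square by (rule U_mult_integrable)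
  show "(\<lambda>m. \<integral>z. cos ((\<Sum>i\<in>J. t i * X m z i) + \<theta>) \<partial>Pr m) \<longlonglongrightarrow> (\<integral>w. cos ((\<Sum>i\<in>J. t i * U w i) + \<theta>) \<partial>gauss J)" for t \<theta>
    unfolding U_cos by (rule conv)
qed (fact Pr prob_space_gauss finJ X X2 XB h)+

definition pull :: "('i + 'p \<Rightarrow> real) \<Rightarrow> 'i \<Rightarrow> real" where
  "pull y = (\<lambda>f\<in>I. y (Inl f))"

definition Q :: "('i + 'p \<Rightarrow> real) \<Rightarrow> real" where
  "Q y = (\<Sum>p\<in>P. \<Sum>q\<in>P. y (Inr p) * W p q * y (Inr q))"

definition M :: "nat \<Rightarrow> 'a \<Rightarrow> real" where
  "M m z = (\<Sum>p\<in>P. \<Sum>q\<in>P. X m z (Inr p) * Wm m p q * X m z (Inr q))"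

lemma pull_restrict: "pull (restrict y J) = pull y"
  unfolding pull_def by (rule restrict_ext) auto

lemma Q_restrict: "Q (restrict y J) = Q y"
  unfolding Q_def by (intro sum.cong refl) auto

lemma pull_continuous: "continuous_on S pull"
proof (rule continuous_on_coordinatewise_then_product)
  show "continuous_on S (\<lambda>y. pull y f)" for f
    unfolding pull_def by (cases "f \<in> I") (auto intro: continuous_on_coordinate)
qed

lemma pull_in: "pull y \<in> PiE I (\<lambda>_. UNIV)"
  by (simp add: pull_def)

lemma Q_continuous: "continuous_on S Q"
  unfolding Q_def by (intro continuous_on_sum continuous_on_mult continuous_on_const continuous_on_coordinate)

lemma continuous_comp_pull:
  fixes h :: "('i \<Rightarrow> real) \<Rightarrow> real"
  assumes "continuous_on (PiE I (\<lambda>_. UNIV)) h"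
  shows "continuous_on S (\<lambda>y. h (pull y))"
  by (rule continuous_on_compose2[OF assms pull_continuous]) (use pull_in in blast)

lemma pull_X_measurable:
  fixes h :: "('i \<Rightarrow> real) \<Rightarrow> real"
  assumes "continuous_on (PiE I (\<lambda>_. UNIV)) h"
  shows "(\<lambda>z. h (pull (X m z))) \<in> borel_measurable (Pr m)"
proof -
  have "(\<lambda>z. (\<lambda>y. h (pull y)) (restrict (X m z) J)) \<in> borel_measurable (Pr m)"
    by (rule continuous_PiE_measurable[OF continuous_comp_pull[OF assms] X])
  then show ?thesis unfolding pull_restrict .
qed

lemma pull_U_measurable_PiM: "(\<lambda>w. pull (U w)) \<in> measurable (gauss J) (PiM I (\<lambda>_. borel))"
  unfolding pull_def by (intro measurable_restrict U_measurable)

lemma M_measurable: "M m \<in> borel_measurable (Pr m)"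
  unfolding M_def by (intro borel_measurable_sum borel_measurable_times borel_measurable_const X) auto

lemma Q_X_measurable: "(\<lambda>z. Q (X m z)) \<in> borel_measurable (Pr m)"
  unfolding Q_def by (intro borel_measurable_sum borel_measurable_times borel_measurable_const X) auto

abbreviation "T \<equiv> trunc (Inr ` P :: ('i + 'p) set) a"

lemma trunc_eq_Q: "T w = indicator {..a} (Q (U w))"
  unfolding Q_def U_mahalanobis trunc_def by (simp add: sum.reindex)

lemma Q_U_measurable: "(\<lambda>w. Q (U w)) \<in> borel_measurable (gauss J)"
  unfolding Q_def by (intro borel_measurable_sum borel_measurable_times borel_measurable_const U_measurable)

lemma Q_U_null: "(\<integral>w. indicator {a} (Q (U w)) \<partial>gauss J) = (0::real)"
proof -
  let ?P = "Inr ` P :: ('i + 'p) set"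
  let ?g = "\<lambda>w. indicator {a} (\<Sum>p\<in>?P. (w p)\<^sup>2) :: real"
  have m: "?g \<in> borel_measurable (gauss ?P)"
    by (rule measurable_compose[OF sq_norm_measurable borel_measurable_indicator]) auto
  have "(\<integral>w. ?g (\<lambda>p\<in>?P. w p) \<partial>gauss J) = (\<integral>w. ?g w \<partial>gauss ?P)"
    by (rule integral_gauss_marginal(1)[OF _ _ m]) (auto simp: inj_on_def)
  also have "\<dots> = 0" by (rule gauss_sphere_null) (use finP P_ne in auto)
  finally show ?thesis unfolding Q_def U_mahalanobis by (simp add: sum.reindex)
qed

definition \<psi> :: "real \<Rightarrow> real \<Rightarrow> real" where "\<psi> \<delta> s = max 0 (min 1 (1 + (a - s) / \<delta>))"
definition \<xi> :: "real \<Rightarrow> real \<Rightarrow> real" where "\<xi> \<delta> s = max 0 (min 1 (2 - \<bar>s - a\<bar> / \<delta>))"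

lemma \<psi>_bounds: "\<bar>\<psi> \<delta> s\<bar> \<le> 1" and \<xi>_bounds: "\<bar>\<xi> \<delta> s\<bar> \<le> 1"
  by (auto simp: \<psi>_def \<xi>_def)

lemma \<psi>_cont: "continuous_on S (\<lambda>y. \<psi> \<delta> (Q y))" and \<xi>_cont: "continuous_on S (\<lambda>y. \<xi> \<delta> (Q y))"
  unfolding \<psi>_def \<xi>_def divide_inverse
  by (intro continuous_on_max continuous_on_min continuous_on_const continuous_on_add continuous_on_diff
      continuous_on_mult continuous_on_rabs Q_continuous)+

lemma \<psi>_borel: "\<psi> \<delta> \<in> borel_measurable borel" and \<xi>_borel: "\<xi> \<delta> \<in> borel_measurable borel"
  unfolding \<psi>_def[abs_def] \<xi>_def[abs_def] by measurable

lemma \<xi>_small: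
  assumes e: "e > 0"
  shows "\<exists>\<delta>>0. (\<integral>w. \<xi> \<delta> (Q (U w)) \<partial>gauss J) < e"
proof -
  interpret G: prob_space "gauss J" by (rule prob_space_gauss)
  define d where "d n = 1 / (real n + 1)" for n :: nat
  have "(\<lambda>n. \<integral>w. \<xi> (d n) (Q (U w)) \<partial>gauss J) \<longlonglongrightarrow> (\<integral>w. indicator {a} (Q (U w)) \<partial>gauss J)"
  proof (rule integral_dominated_convergence[where w="\<lambda>_. 1"])
    show "AE w in gauss J. (\<lambda>n. \<xi> (d n) (Q (U w))) \<longlonglongrightarrow> indicator {a} (Q (U w))"
    proof (intro AE_I2)
      fix w
      let ?s = "Q (U w)"
      show "(\<lambda>n. \<xi> (d n) ?s) \<longlonglongrightarrow> indicator {a} ?s"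
      proof (cases "?s = a")
        case True
        then show ?thesis by (simp add: \<xi>_def)
      next
        case False
        obtain k :: nat where k: "2 / \<bar>?s - a\<bar> \<le> real k" using real_arch_simple by blast
        have "\<xi> (d n) ?s = 0" if "n \<ge> k" for n
        proof -
          have "2 / \<bar>?s - a\<bar> \<le> real n + 1" using k that by linarith
          then have "2 \<le> \<bar>?s - a\<bar> * (real n + 1)" using False by (simp add: divide_le_eq mult.commute)
          then show ?thesis by (simp add: \<xi>_def d_def)
        qed
        then have "\<forall>\<^sub>F n in sequentially. \<xi> (d n) ?s = indicator {a} ?s"
          using False unfolding eventually_sequentially by auto
        then show ?thesis by (rule tendsto_eventually)
      qed
    qed
    show "(\<lambda>w. \<xi> (d n) (Q (U w))) \<in> borel_measurable (gauss J)" for n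
      by (rule measurable_compose[OF Q_U_measurable \<xi>_borel])
    show "(\<lambda>w. indicator {a} (Q (U w)) :: real) \<in> borel_measurable (gauss J)"
      by (rule measurable_compose[OF Q_U_measurable borel_measurable_indicator]) simp
    show "AE w in gauss J. norm (\<xi> (d n) (Q (U w))) \<le> 1" for n
      unfolding real_norm_def by (intro AE_I2 \<xi>_bounds)
  qed simp
  then have "(\<lambda>n. \<integral>w. \<xi> (d n) (Q (U w)) \<partial>gauss J) \<longlonglongrightarrow> 0" unfolding Q_U_null .
  then have "\<forall>\<^sub>F n in sequentially. (\<integral>w. \<xi> (d n) (Q (U w)) \<partial>gauss J) < e"
    using e by (rule order_tendstoD(2))
  then obtain n where "(\<integral>w. \<xi> (d n) (Q (U w)) \<partial>gauss J) < e" unfolding eventually_sequentially by blast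
  moreover have "d n > 0" by (simp add: d_def)
  ultimately show ?thesis by blast
qed

definition err :: "nat \<Rightarrow> real" where
  "err m = (\<Sum>p\<in>P. \<Sum>q\<in>P. \<bar>Wm m p q - W p q\<bar>)"

lemma err_tendsto: "err \<longlonglongrightarrow> 0"
proof -
  have "(\<lambda>m. \<Sum>p\<in>P. \<Sum>q\<in>P. \<bar>Wm m p q - W p q\<bar>) \<longlonglongrightarrow> (\<Sum>p\<in>P. \<Sum>q\<in>P. \<bar>W p q - W p q\<bar>)"
    by (intro tendsto_sum tendsto_rabs tendsto_diff tendsto_const Wm)
  then show ?thesis by (simp add: err_def[abs_def])
qed

lemma M_Q_bound: "\<bar>M m z - Q (X m z)\<bar> \<le> err m * (\<Sum>p\<in>P. (X m z (Inr p))\<^sup>2)"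
proof -
  have "M m z - Q (X m z) = (\<Sum>p\<in>P. \<Sum>q\<in>P. X m z (Inr p) * (Wm m p q - W p q) * X m z (Inr q))"
    unfolding M_def Q_def by (simp only: sum_subtractf[symmetric] left_diff_distrib right_diff_distrib)
  then show ?thesis unfolding err_def using quadratic_form_bound[OF finP] by simp
qed

lemma conditional_numerator:
  fixes h :: "('i \<Rightarrow> real) \<Rightarrow> real"
  assumes h: "continuous_on (PiE I (\<lambda>_. UNIV)) h" "bounded (h ` PiE I (\<lambda>_. UNIV))"
  shows "(\<lambda>m. \<integral>z. h (pull (X m z)) * indicator {..a} (M m z) \<partial>Pr m) \<longlonglongrightarrow> (\<integral>w. h (pull (U w)) * T w \<partial>gauss J)"
proof (rule LIMSEQ_I)
  fix r :: real assume r: "r > 0"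
  interpret G: prob_space "gauss J" by (rule prob_space_gauss)
  obtain H where H: "H > 0" "\<And>y. y \<in> PiE I (\<lambda>_. UNIV) \<Longrightarrow> \<bar>h y\<bar> \<le> H"
    using h(2) unfolding bounded_pos by auto
  have hp: "\<bar>h (pull y)\<bar> \<le> H" for y by (rule H(2)[OF pull_in])
  define e where "e = r / (5 * H)"
  have e: "e > 0" "H * e = r / 5" using r H by (auto simp: e_def)
  obtain \<delta> where \<delta>: "\<delta> > 0" "(\<integral>w. \<xi> \<delta> (Q (U w)) \<partial>gauss J) < e" using \<xi>_small[OF e(1)] by blast
  let ?F = "\<lambda>m z. h (pull (X m z)) * indicator {..a} (M m z)"
  let ?G = "\<lambda>y. h (pull y) * \<psi> \<delta> (Q y)"
  have limG: "(\<lambda>m. \<integral>z. ?G (X m z) \<partial>Pr m) \<longlonglongrightarrow> (\<integral>w. ?G (U w) \<partial>gauss J)"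
  proof -
    have "(\<lambda>m. \<integral>z. ?G (restrict (X m z) J) \<partial>Pr m) \<longlonglongrightarrow> (\<integral>w. ?G (restrict (U w) J) \<partial>gauss J)"
    proof (rule joint_conv)
      show "continuous_on (PiE J (\<lambda>_. UNIV)) ?G"
        by (intro continuous_on_mult continuous_comp_pull[OF h(1)] \<psi>_cont)
      show "bounded (?G ` PiE J (\<lambda>_. UNIV))"
        unfolding bounded_iff
      proof (intro exI[of _ "H * 1"] ballI)
        fix x assume "x \<in> ?G ` PiE J (\<lambda>_. UNIV)"
        then obtain y where "x = ?G y" by blast
        then show "norm x \<le> H * 1" unfolding real_norm_def
          using mult_mono[OF hp[of y] \<psi>_bounds[of \<delta> "Q y"]] H(1) by (simp only: abs_mult)
      qed
    qed
    then show ?thesis unfolding pull_restrict Q_restrict .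
  qed
  have limX: "(\<lambda>m. \<integral>z. \<xi> \<delta> (Q (X m z)) \<partial>Pr m) \<longlonglongrightarrow> (\<integral>w. \<xi> \<delta> (Q (U w)) \<partial>gauss J)"
  proof -
    have "(\<lambda>m. \<integral>z. \<xi> \<delta> (Q (restrict (X m z) J)) \<partial>Pr m) \<longlonglongrightarrow> (\<integral>w. \<xi> \<delta> (Q (restrict (U w) J)) \<partial>gauss J)"
    proof (rule joint_conv[OF \<xi>_cont])
      show "bounded ((\<lambda>y. \<xi> \<delta> (Q y)) ` PiE J (\<lambda>_. UNIV))"
        unfolding bounded_iff using \<xi>_bounds by (intro exI[of _ 1]) auto
    qed
    then show ?thesis unfolding Q_restrict .
  qed
  have pr: "\<bar>(\<integral>z. ?F m z \<partial>Pr m) - (\<integral>z. ?G (X m z) \<partial>Pr m)\<bar>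
      \<le> H * ((\<integral>z. \<xi> \<delta> (Q (X m z)) \<partial>Pr m) + err m / \<delta> * (real (card P) * B))" for m
  proof -
    interpret Pm: prob_space "Pr m" by (rule Pr)
    have hm: "(\<lambda>z. h (pull (X m z))) \<in> borel_measurable (Pr m)" by (rule pull_X_measurable[OF h(1)])
    have iF: "integrable (Pr m) (?F m)"
    proof (rule Pm.integrable_const_bound[of _ H])
      show "AE z in Pr m. norm (?F m z) \<le> H"
        using hp H(1) by (intro AE_I2) (auto simp: indicator_def)
      show "?F m \<in> borel_measurable (Pr m)"
        by (intro borel_measurable_times hm measurable_compose[OF M_measurable borel_measurable_indicator]) simp
    qed
    have iG: "integrable (Pr m) (\<lambda>z. ?G (X m z))"
    proof (rule Pm.integrable_const_bound[of _ "H * 1"])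
      show "AE z in Pr m. norm (?G (X m z)) \<le> H * 1"
        unfolding real_norm_def abs_mult using H(1) by (intro AE_I2 mult_mono hp \<psi>_bounds) auto
      show "(\<lambda>z. ?G (X m z)) \<in> borel_measurable (Pr m)"
        by (intro borel_measurable_times hm measurable_compose[OF Q_X_measurable \<psi>_borel])
    qed
    have i\<xi>: "integrable (Pr m) (\<lambda>z. \<xi> \<delta> (Q (X m z)))"
    proof (rule Pm.integrable_const_bound[of _ 1])
      show "AE z in Pr m. norm (\<xi> \<delta> (Q (X m z))) \<le> 1"
        unfolding real_norm_def by (intro AE_I2 \<xi>_bounds)
    qed (rule measurable_compose[OF Q_X_measurable \<xi>_borel])
    have iS: "integrable (Pr m) (\<lambda>z. \<Sum>p\<in>P. (X m z (Inr p))\<^sup>2)"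
      by (intro Bochner_Integration.integrable_sum X2) auto
    have ptw: "\<bar>?F m z - ?G (X m z)\<bar> \<le> H * (\<xi> \<delta> (Q (X m z)) + err m / \<delta> * (\<Sum>p\<in>P. (X m z (Inr p))\<^sup>2))" for z
    proof -
      have "\<bar>?F m z - ?G (X m z)\<bar> = \<bar>h (pull (X m z))\<bar> * \<bar>indicator {..a} (M m z) - \<psi> \<delta> (Q (X m z))\<bar>"
        by (simp only: abs_mult[symmetric] right_diff_distrib)
      also have "\<dots> \<le> H * (\<xi> \<delta> (Q (X m z)) + \<bar>M m z - Q (X m z)\<bar> / \<delta>)"
        unfolding \<psi>_def \<xi>_def using H(1) by (intro mult_mono hp indicator_smoothing \<delta>) auto
      also have "\<dots> \<le> H * (\<xi> \<delta> (Q (X m z)) + err m * (\<Sum>p\<in>P. (X m z (Inr p))\<^sup>2) / \<delta>)"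
        using H(1) \<delta>(1) by (intro mult_left_mono add_left_mono divide_right_mono M_Q_bound) auto
      finally show ?thesis by simp
    qed
    have "\<bar>(\<integral>z. ?F m z \<partial>Pr m) - (\<integral>z. ?G (X m z) \<partial>Pr m)\<bar> = \<bar>\<integral>z. ?F m z - ?G (X m z) \<partial>Pr m\<bar>"
      by (subst Bochner_Integration.integral_diff[OF iF iG]) rule
    also have "\<dots> \<le> (\<integral>z. \<bar>?F m z - ?G (X m z)\<bar> \<partial>Pr m)" by (rule integral_abs_bound)
    also have "\<dots> \<le> (\<integral>z. H * (\<xi> \<delta> (Q (X m z)) + err m / \<delta> * (\<Sum>p\<in>P. (X m z (Inr p))\<^sup>2)) \<partial>Pr m)"
      by (intro integral_mono integrable_abs Bochner_Integration.integrable_diff iF iG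
          integrable_mult_right Bochner_Integration.integrable_add i\<xi> iS ptw)
    also have "\<dots> = H * ((\<integral>z. \<xi> \<delta> (Q (X m z)) \<partial>Pr m) + err m / \<delta> * (\<integral>z. (\<Sum>p\<in>P. (X m z (Inr p))\<^sup>2) \<partial>Pr m))"
      using i\<xi> iS by (simp only: integral_mult_right_zero Bochner_Integration.integral_add integrable_mult_right)
    also have "\<dots> \<le> H * ((\<integral>z. \<xi> \<delta> (Q (X m z)) \<partial>Pr m) + err m / \<delta> * (real (card P) * B))"
    proof (intro mult_left_mono add_left_mono)
      have "(\<integral>z. (\<Sum>p\<in>P. (X m z (Inr p))\<^sup>2) \<partial>Pr m) = (\<Sum>p\<in>P. \<integral>z. (X m z (Inr p))\<^sup>2 \<partial>Pr m)"
        by (rule Bochner_Integration.integral_sum) (intro X2, auto)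
      also have "\<dots> \<le> (\<Sum>p\<in>P. B)" by (intro sum_mono XB) auto
      finally show "(\<integral>z. (\<Sum>p\<in>P. (X m z (Inr p))\<^sup>2) \<partial>Pr m) \<le> real (card P) * B" by simp
      show "0 \<le> err m / \<delta>" using \<delta>(1) by (auto simp: err_def intro!: divide_nonneg_pos sum_nonneg)
    qed (use H(1) in simp)
    finally show ?thesis .
  qed
  have lim\<delta>: "\<bar>(\<integral>w. ?G (U w) \<partial>gauss J) - (\<integral>w. h (pull (U w)) * T w \<partial>gauss J)\<bar> \<le> H * (\<integral>w. \<xi> \<delta> (Q (U w)) \<partial>gauss J)"
  proof -
    have hm: "(\<lambda>w. h (pull (U w))) \<in> borel_measurable (gauss J)"
      by (rule measurable_compose[OF pull_U_measurable_PiM borel_measurable_continuous_PiE[OF h(1)]])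
    have iF: "integrable (gauss J) (\<lambda>w. h (pull (U w)) * T w)"
    proof (rule integrable_mult_trunc[OF _ Inr_P], rule G.integrable_const_bound[of _ H])
      show "AE w in gauss J. norm (h (pull (U w))) \<le> H" unfolding real_norm_def by (intro AE_I2 hp)
    qed (rule hm)
    have iG: "integrable (gauss J) (\<lambda>w. ?G (U w))"
    proof (rule G.integrable_const_bound[of _ "H * 1"])
      show "AE w in gauss J. norm (?G (U w)) \<le> H * 1"
        unfolding real_norm_def abs_mult using H(1) by (intro AE_I2 mult_mono hp \<psi>_bounds) auto
      show "(\<lambda>w. ?G (U w)) \<in> borel_measurable (gauss J)"
        by (intro borel_measurable_times hm measurable_compose[OF Q_U_measurable \<psi>_borel])
    qed
    have i\<xi>: "integrable (gauss J) (\<lambda>w. \<xi> \<delta> (Q (U w)))"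
    proof (rule G.integrable_const_bound[of _ 1])
      show "AE w in gauss J. norm (\<xi> \<delta> (Q (U w))) \<le> 1"
        unfolding real_norm_def by (intro AE_I2 \<xi>_bounds)
    qed (rule measurable_compose[OF Q_U_measurable \<xi>_borel])
    have ptw: "\<bar>?G (U w) - h (pull (U w)) * T w\<bar> \<le> H * \<xi> \<delta> (Q (U w))" for w
    proof -
      have "\<bar>?G (U w) - h (pull (U w)) * T w\<bar> = \<bar>h (pull (U w))\<bar> * \<bar>T w - \<psi> \<delta> (Q (U w))\<bar>"
        by (simp only: abs_mult[symmetric] right_diff_distrib abs_minus_commute)
      also have "\<dots> \<le> H * (\<xi> \<delta> (Q (U w)) + \<bar>Q (U w) - Q (U w)\<bar> / \<delta>)"
        unfolding trunc_eq_Q \<psi>_def \<xi>_def using H(1) by (intro mult_mono hp indicator_smoothing \<delta>) auto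
      finally show ?thesis by simp
    qed
    have "\<bar>(\<integral>w. ?G (U w) \<partial>gauss J) - (\<integral>w. h (pull (U w)) * T w \<partial>gauss J)\<bar> = \<bar>\<integral>w. ?G (U w) - h (pull (U w)) * T w \<partial>gauss J\<bar>"
      by (subst Bochner_Integration.integral_diff[OF iG iF]) rule
    also have "\<dots> \<le> (\<integral>w. \<bar>?G (U w) - h (pull (U w)) * T w\<bar> \<partial>gauss J)" by (rule integral_abs_bound)
    also have "\<dots> \<le> (\<integral>w. H * \<xi> \<delta> (Q (U w)) \<partial>gauss J)"
      by (intro integral_mono integrable_abs Bochner_Integration.integrable_diff iF iG integrable_mult_right i\<xi> ptw)
    finally show ?thesis by simp
  qed
  have "(\<lambda>m. (\<integral>z. \<xi> \<delta> (Q (X m z)) \<partial>Pr m) + err m / \<delta> * (real (card P) * B)) \<longlonglongrightarrow> (\<integral>w. \<xi> \<delta> (Q (U w)) \<partial>gauss J) + 0 / \<delta> * (real (card P) * B)"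
    using \<delta>(1) by (intro tendsto_add tendsto_mult tendsto_divide tendsto_const limX err_tendsto) auto
  then have "\<forall>\<^sub>F m in sequentially. (\<integral>z. \<xi> \<delta> (Q (X m z)) \<partial>Pr m) + err m / \<delta> * (real (card P) * B) < e"
    using \<delta>(2) by (intro order_tendstoD(2)) auto
  moreover have "\<forall>\<^sub>F m in sequentially. \<bar>(\<integral>z. ?G (X m z) \<partial>Pr m) - (\<integral>w. ?G (U w) \<partial>gauss J)\<bar> < r / 5"
    using tendstoD[OF limG, of "r / 5"] r by (simp add: dist_real_def)
  ultimately have "\<forall>\<^sub>F m in sequentially. norm ((\<integral>z. ?F m z \<partial>Pr m) - (\<integral>w. h (pull (U w)) * T w \<partial>gauss J)) < r"
  proof eventually_elim
    case (elim m)
    have 1: "H * ((\<integral>z. \<xi> \<delta> (Q (X m z)) \<partial>Pr m) + err m / \<delta> * (real (card P) * B)) \<le> H * e"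
      using elim(1) H(1) by (intro mult_left_mono) auto
    have 2: "H * (\<integral>w. \<xi> \<delta> (Q (U w)) \<partial>gauss J) \<le> H * e"
      using \<delta>(2) H(1) by (intro mult_left_mono) auto
    show ?case unfolding real_norm_def using pr[of m] lim\<delta> elim(2) 1 2 r unfolding e(2) by linarith
  qed
  then show "\<exists>no. \<forall>m\<ge>no. norm ((\<integral>z. ?F m z \<partial>Pr m) - (\<integral>w. h (pull (U w)) * T w \<partial>gauss J)) < r"
    unfolding eventually_sequentially .
qed

definition muC :: "('i \<Rightarrow> real) measure" where
  "muC = distr (gauss J) (PiM I (\<lambda>_. borel)) (\<lambda>w. pull (U w))"

definition acc :: real where "acc = chisq_cdf (card P) a"

definition gaussR :: "('i + 'p \<Rightarrow> real) measure" where
  "gaussR = density (gauss J) (\<lambda>w. ennreal (T w / acc))"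

definition muR :: "('i \<Rightarrow> real) measure" where
  "muR = distr gaussR (PiM I (\<lambda>_. borel)) (\<lambda>w. pull (U w))"

definition PrR :: "nat \<Rightarrow> 'a measure" where
  "PrR m = uniform_measure (Pr m) {z \<in> space (Pr m). M m z \<le> a}"

lemma card_P: "card P \<ge> 1" using finP P_ne by (simp add: Suc_le_eq card_gt_0_iff)

lemma acc_pos: "acc > 0" unfolding acc_def by (rule chisq_cdf_pos[OF card_P a])

lemma acc_eq: "(\<integral>w. T w \<partial>gauss J) = acc"
proof -
  have "card (Inr ` P :: ('i + 'p) set) = card P" by (simp add: card_image)
  then show ?thesis unfolding acc_def using prob_trunc[OF finJ Inr_P _ a] P_ne by simp
qed

lemma T_meas: "(\<lambda>w. T w / acc) \<in> borel_measurable (gauss J)"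
  by (intro borel_measurable_divide trunc_measurable Inr_P borel_measurable_const)

lemma T_nonneg: "T w / acc \<ge> 0"
  by (rule divide_nonneg_nonneg[OF trunc_bounds(1) less_imp_le[OF acc_pos]])

lemma gaussR_integral:
  fixes g :: "('i + 'p \<Rightarrow> real) \<Rightarrow> real"
  assumes g: "g \<in> borel_measurable (gauss J)"
  shows "(\<integral>w. g w \<partial>gaussR) = (\<integral>w. g w * T w \<partial>gauss J) / acc"
    "integrable (gauss J) g \<Longrightarrow> integrable gaussR g"
proof -
  have "(\<integral>w. g w \<partial>gaussR) = (\<integral>w. (T w / acc) *\<^sub>R g w \<partial>gauss J)"
    unfolding gaussR_def by (rule integral_density[OF g T_meas AE_I2[OF T_nonneg]])
  also have "\<dots> = (\<integral>w. g w * T w / acc \<partial>gauss J)"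
    by (intro Bochner_Integration.integral_cong) auto
  finally show "(\<integral>w. g w \<partial>gaussR) = (\<integral>w. g w * T w \<partial>gauss J) / acc" by simp
  assume i: "integrable (gauss J) g"
  have "integrable (gauss J) (\<lambda>w. (1 / acc) * (g w * T w))"
    by (intro integrable_mult_right integrable_mult_trunc i Inr_P)
  moreover have "(1 / acc) * (g w * T w) = (T w / acc) *\<^sub>R g w" for w by simp
  ultimately have "integrable (gauss J) (\<lambda>w. (T w / acc) *\<^sub>R g w)" by (simp add: mult.commute)
  then show "integrable gaussR g"
    unfolding gaussR_def integrable_density[OF g T_meas AE_I2[OF T_nonneg]] .
qed

lemma prob_gaussR: "prob_space gaussR"
proof (rule prob_spaceI)
  have i: "integrable (gauss J) (\<lambda>w. T w / acc)"
    by (intro integrable_divide integrable_trunc Inr_P)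
  have "emeasure gaussR (space gaussR) = (\<integral>\<^sup>+w. ennreal (T w / acc) * indicator (space (gauss J)) w \<partial>gauss J)"
    unfolding gaussR_def by (subst emeasure_density) (auto intro: measurable_compose[OF T_meas measurable_ennreal])
  also have "\<dots> = (\<integral>\<^sup>+w. ennreal (T w / acc) \<partial>gauss J)"
    by (intro nn_integral_cong) simp
  also have "\<dots> = ennreal (\<integral>w. T w / acc \<partial>gauss J)"
    by (rule nn_integral_eq_integral[OF i]) (intro AE_I2 T_nonneg)
  also have "(\<integral>w. T w / acc \<partial>gauss J) = 1" using acc_eq acc_pos by simp
  finally show "emeasure gaussR (space gaussR) = 1" by simp
qed

lemma pull_U_measurable_R: "(\<lambda>w. pull (U w)) \<in> measurable gaussR (PiM I (\<lambda>_. borel))"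
  using pull_U_measurable_PiM unfolding gaussR_def by simp

lemma muC_integral: "g \<in> borel_measurable (PiM I (\<lambda>_. borel)) \<Longrightarrow> (\<integral>y. g y \<partial>muC) = (\<integral>w. g (pull (U w)) \<partial>gauss J)"
  for g :: "('i \<Rightarrow> real) \<Rightarrow> real"
  unfolding muC_def by (rule integral_distr[OF pull_U_measurable_PiM])

lemma muR_integral:
  fixes g :: "('i \<Rightarrow> real) \<Rightarrow> real"
  assumes g: "g \<in> borel_measurable (PiM I (\<lambda>_. borel))"
  shows "(\<integral>y. g y \<partial>muR) = (\<integral>w. g (pull (U w)) * T w \<partial>gauss J) / acc"
proof -
  have "(\<integral>y. g y \<partial>muR) = (\<integral>w. g (pull (U w)) \<partial>gaussR)"
    unfolding muR_def by (rule integral_distr[OF pull_U_measurable_R g])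
  also have "\<dots> = (\<integral>w. g (pull (U w)) * T w \<partial>gauss J) / acc"
    by (rule gaussR_integral(1)[OF measurable_compose[OF pull_U_measurable_PiM g]])
  finally show ?thesis .
qed

lemma weak_C: "weak_conv_vec I Pr (\<lambda>m z. pull (X m z)) muC"
  unfolding weak_conv_vec_def
proof (intro conjI allI impI)
  show "prob_space muC" unfolding muC_def
    by (rule prob_space.prob_space_distr[OF prob_space_gauss pull_U_measurable_PiM])
  show "sets muC = sets (PiM I (\<lambda>_. borel))" by (simp add: muC_def)
  fix h :: "('i \<Rightarrow> real) \<Rightarrow> real"
  assume h: "continuous_on (PiE I (\<lambda>_. UNIV)) h \<and> bounded (h ` PiE I (\<lambda>_. UNIV))"
  have "(\<lambda>m. \<integral>z. h (pull (restrict (X m z) J)) \<partial>Pr m) \<longlonglongrightarrow> (\<integral>w. h (pull (restrict (U w) J)) \<partial>gauss J)"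
  proof (rule joint_conv)
    show "continuous_on (PiE J (\<lambda>_. UNIV)) (\<lambda>y. h (pull y))" using h by (intro continuous_comp_pull) blast
    have "(\<lambda>y. h (pull y)) ` PiE J (\<lambda>_. UNIV) \<subseteq> h ` PiE I (\<lambda>_. UNIV)" using pull_in by blast
    then show "bounded ((\<lambda>y. h (pull y)) ` PiE J (\<lambda>_. UNIV))" using h bounded_subset by blast
  qed
  then show "(\<lambda>m. \<integral>z. h (pull (X m z)) \<partial>Pr m) \<longlonglongrightarrow> (\<integral>y. h y \<partial>muC)"
    unfolding pull_restrict using h muC_integral[OF borel_measurable_continuous_PiE, of h] by simp
qed

lemma weak_R: "weak_conv_vec I PrR (\<lambda>m z. pull (X m z)) muR"
  unfolding weak_conv_vec_def
proof (intro conjI allI impI)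
  show "prob_space muR" unfolding muR_def
    by (rule prob_space.prob_space_distr[OF prob_gaussR pull_U_measurable_R])
  show "sets muR = sets (PiM I (\<lambda>_. borel))" by (simp add: muR_def)
  fix h :: "('i \<Rightarrow> real) \<Rightarrow> real"
  assume "continuous_on (PiE I (\<lambda>_. UNIV)) h \<and> bounded (h ` PiE I (\<lambda>_. UNIV))"
  then have h: "continuous_on (PiE I (\<lambda>_. UNIV)) h" "bounded (h ` PiE I (\<lambda>_. UNIV))" by blast+
  let ?A = "\<lambda>m. {z \<in> space (Pr m). M m z \<le> a}"
  have A: "?A m \<in> sets (Pr m)" for m
    by (rule borel_measurable_le[OF M_measurable borel_measurable_const])
  have num: "(\<lambda>m. \<integral>z. h (pull (X m z)) * indicator {..a} (M m z) \<partial>Pr m) \<longlonglongrightarrow> (\<integral>w. h (pull (U w)) * T w \<partial>gauss J)"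
    by (rule conditional_numerator[OF h])
  have den: "(\<lambda>m. measure (Pr m) (?A m)) \<longlonglongrightarrow> acc"
  proof -
    have "(\<lambda>m. \<integral>z. 1 * indicator {..a} (M m z) \<partial>Pr m) \<longlonglongrightarrow> (\<integral>w. 1 * T w \<partial>gauss J)"
      by (rule conditional_numerator[of "\<lambda>_. 1"]) (auto intro!: boundedI[of _ 1])
    moreover have "(\<integral>z. (1::real) * indicator {..a} (M m z) \<partial>Pr m) = measure (Pr m) (?A m)" for m
    proof -
      have "(\<integral>z. (1::real) * indicator {..a} (M m z) \<partial>Pr m) = (\<integral>z. (indicator (?A m) z :: real) \<partial>Pr m)"
        by (intro Bochner_Integration.integral_cong) (auto simp: indicator_def)
      also have "\<dots> = measure (Pr m) (?A m)"
        by (simp, intro arg_cong[where f="measure _"]) auto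
      finally show ?thesis .
    qed
    ultimately show ?thesis using acc_eq by simp
  qed
  have ev: "\<forall>\<^sub>F m in sequentially. measure (Pr m) (?A m) > 0"
    using den acc_pos by (rule order_tendstoD(1))
  have "(\<lambda>m. (\<integral>z. h (pull (X m z)) * indicator {..a} (M m z) \<partial>Pr m) / measure (Pr m) (?A m))
      \<longlonglongrightarrow> (\<integral>w. h (pull (U w)) * T w \<partial>gauss J) / acc"
    using acc_pos by (intro tendsto_divide num den) simp
  moreover have "\<forall>\<^sub>F m in sequentially. (\<integral>z. h (pull (X m z)) * indicator {..a} (M m z) \<partial>Pr m) / measure (Pr m) (?A m)
      = (\<integral>z. h (pull (X m z)) \<partial>PrR m)"
    using ev
  proof eventually_elim
    case (elim m)
    let ?c = "measure (Pr m) (?A m)"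
    have im: "(\<lambda>z. indicator (?A m) z / ?c) \<in> borel_measurable (Pr m)"
      by (intro borel_measurable_divide borel_measurable_const borel_measurable_indicator A)
    have nn: "0 \<le> indicator (?A m) z / ?c" for z using elim by simp
    have "(\<integral>z. h (pull (X m z)) \<partial>PrR m) = (\<integral>z. (indicator (?A m) z / ?c) *\<^sub>R h (pull (X m z)) \<partial>Pr m)"
      unfolding PrR_def uniform_measure_eq_density[OF Pr A elim]
      by (rule integral_density[OF pull_X_measurable[OF h(1)] im AE_I2[OF nn]])
    also have "\<dots> = (\<integral>z. h (pull (X m z)) * indicator {..a} (M m z) / ?c \<partial>Pr m)"
      by (intro Bochner_Integration.integral_cong refl) (auto simp: indicator_def)
    finally show ?case by simp
  qed
  ultimately have "(\<lambda>m. \<integral>z. h (pull (X m z)) \<partial>PrR m) \<longlonglongrightarrow> (\<integral>w. h (pull (U w)) * T w \<partial>gauss J) / acc"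
    by (rule Lim_transform_eventually)
  then show "(\<lambda>m. \<integral>z. h (pull (X m z)) \<partial>PrR m) \<longlonglongrightarrow> (\<integral>y. h y \<partial>muR)"
    unfolding muR_integral[OF borel_measurable_continuous_PiE[OF h(1)]] .
qed

lemma coord_PiM: "f \<in> I \<Longrightarrow> (\<lambda>y. y f) \<in> borel_measurable (PiM I (\<lambda>_. borel :: real measure))"
  by (rule measurable_component_singleton)

lemma pull_app: "f \<in> I \<Longrightarrow> pull y f = y (Inl f)" by (simp add: pull_def)

lemma muC_square: "f \<in> I \<Longrightarrow> integrable muC (\<lambda>y. (y f)\<^sup>2)"
  unfolding muC_def
  by (subst integrable_distr_eq[OF pull_U_measurable_PiM])
    (auto simp: pull_app power2_eq_square intro!: borel_measurable_times coord_PiM U_mult_integrable)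

lemma muR_square:
  assumes f: "f \<in> I"
  shows "integrable muR (\<lambda>y. (y f)\<^sup>2)"
proof -
  have i: "integrable (gauss J) (\<lambda>w. (U w (Inl f))\<^sup>2)" unfolding power2_eq_square by (rule U_mult_integrable)
  have m: "(\<lambda>y. (y f)\<^sup>2) \<in> borel_measurable (PiM I (\<lambda>_. borel :: real measure))"
    by (intro borel_measurable_power coord_PiM f)
  have "integrable gaussR (\<lambda>w. (U w (Inl f))\<^sup>2)"
    by (rule gaussR_integral(2)[OF borel_measurable_integrable[OF i] i])
  then show ?thesis unfolding muR_def integrable_distr_eq[OF pull_U_measurable_R m] pull_app[OF f] .
qed

lemma mcov_muC:
  assumes fg: "f \<in> I" "g \<in> I"
  shows "mcov muC f g = Sg (Inl f) (Inl g)"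
proof -
  have m: "(\<lambda>y. y f * y g) \<in> borel_measurable (PiM I (\<lambda>_. borel :: real measure))"
    by (intro borel_measurable_times coord_PiM fg)
  show ?thesis
    unfolding mcov_def muC_integral[OF m] muC_integral[OF coord_PiM[OF fg(1)]] pull_app[OF fg(1)] pull_app[OF fg(2)]
      U_first_moment(1) using U_second_moment[of "Inl f" "Inl g"] fg by auto
qed

lemma mcov_muR:
  assumes fg: "f \<in> I" "g \<in> I"
  shows "mcov muR f g = Sg (Inl f) (Inl g) - (1 - vma (card P) a) * Vpar_lim f g"
proof -
  have m: "(\<lambda>y. y f * y g) \<in> borel_measurable (PiM I (\<lambda>_. borel :: real measure))"
    by (intro borel_measurable_times coord_PiM fg)
  have "mcov muR f g = ((Sg (Inl f) (Inl g) - Vpar_lim f g) * acc + Vpar_lim f g * chisq_cdf (card P + 2) a) / acc"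
    unfolding mcov_def muR_integral[OF m] muR_integral[OF coord_PiM[OF fg(1)]] pull_app[OF fg(1)] pull_app[OF fg(2)]
      U_first_moment(2) U_second_moment_trunc[OF a P_ne fg] acc_def[symmetric] by simp
  also have "\<dots> = Sg (Inl f) (Inl g) - Vpar_lim f g + vma (card P) a * Vpar_lim f g"
    unfolding vma_def acc_def[symmetric] using acc_pos by (simp add: add_divide_distrib)
  finally show ?thesis by (simp add: algebra_simps)
qed

lemma vma_le_1: "vma (card P) a \<le> 1"
  unfolding vma_def using chisq_cdf_mono[OF card_P a] chisq_cdf_pos[OF card_P a] by (simp add: divide_le_eq)

lemma psd_Vpar_lim: "0 \<le> (\<Sum>f\<in>I. \<Sum>g\<in>I. u f * Vpar_lim f g * u g)"
proof -
  let ?G = "\<lambda>f p. R (Inl f) (Inr p)"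
  have V: "Vpar_lim f g = (\<Sum>p\<in>P. ?G f p * ?G g p)" if "f \<in> I" "g \<in> I" for f g
    by (rule R_Vpar[OF that, symmetric])
  have "(\<Sum>f\<in>I. \<Sum>g\<in>I. u f * Vpar_lim f g * u g) = (\<Sum>f\<in>I. \<Sum>g\<in>I. \<Sum>p\<in>P. (u f * ?G f p) * (u g * ?G g p))"
    by (intro sum.cong refl) (simp add: V sum_distrib_left sum_distrib_right mult_ac)
  also have "\<dots> = (\<Sum>f\<in>I. \<Sum>p\<in>P. \<Sum>g\<in>I. (u f * ?G f p) * (u g * ?G g p))"
    by (intro sum.cong refl sum.swap)
  also have "\<dots> = (\<Sum>p\<in>P. \<Sum>f\<in>I. \<Sum>g\<in>I. (u f * ?G f p) * (u g * ?G g p))" by (rule sum.swap)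
  also have "\<dots> = (\<Sum>p\<in>P. (\<Sum>f\<in>I. u f * ?G f p)\<^sup>2)"
    by (simp only: sum_product power2_eq_square)
  finally show ?thesis by (simp add: sum_nonneg)
qed

theorem weak_limit_covariances:
  assumes C: "weak_conv_vec I Pr (\<lambda>m z. pull (X m z)) mu" and R: "weak_conv_vec I PrR (\<lambda>m z. pull (X m z)) nu"
  shows "f \<in> I \<Longrightarrow> integrable mu (\<lambda>y. (y f)\<^sup>2)" "f \<in> I \<Longrightarrow> integrable nu (\<lambda>y. (y f)\<^sup>2)"
    "f \<in> I \<Longrightarrow> g \<in> I \<Longrightarrow> mcov mu f g = Sg (Inl f) (Inl g)"
    "f \<in> I \<Longrightarrow> g \<in> I \<Longrightarrow> mcov mu f g - mcov nu f g = (1 - vma (card P) a) * Vpar_lim f g"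
    "psd_on I (\<lambda>f g. mcov mu f g - mcov nu f g)"
proof -
  interpret C: same_weak_integrals I mu muC by (rule weak_limits_same_integrals[OF C weak_C muC_square])
  interpret R: same_weak_integrals I nu muR by (rule weak_limits_same_integrals[OF R weak_R muR_square])
  show "f \<in> I \<Longrightarrow> integrable mu (\<lambda>y. (y f)\<^sup>2)" by (rule C.sq_mu)
  show "f \<in> I \<Longrightarrow> integrable nu (\<lambda>y. (y f)\<^sup>2)" by (rule R.sq_mu)
  show "f \<in> I \<Longrightarrow> g \<in> I \<Longrightarrow> mcov mu f g = Sg (Inl f) (Inl g)" by (simp add: C.mcov_eq mcov_muC)
  have diff: "mcov mu f g - mcov nu f g = (1 - vma (card P) a) * Vpar_lim f g" if "f \<in> I" "g \<in> I" for f g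
    using that by (simp add: C.mcov_eq R.mcov_eq mcov_muC mcov_muR)
  then show "f \<in> I \<Longrightarrow> g \<in> I \<Longrightarrow> mcov mu f g - mcov nu f g = (1 - vma (card P) a) * Vpar_lim f g" .
  show "psd_on I (\<lambda>f g. mcov mu f g - mcov nu f g)"
    unfolding psd_on_def
  proof
    fix u :: "'i \<Rightarrow> real"
    have "(\<Sum>f\<in>I. \<Sum>g\<in>I. u f * (mcov mu f g - mcov nu f g) * u g)
        = (\<Sum>f\<in>I. \<Sum>g\<in>I. (1 - vma (card P) a) * (u f * Vpar_lim f g * u g))"
      by (intro sum.cong refl) (simp only: diff mult_ac)
    also have "\<dots> = (1 - vma (card P) a) * (\<Sum>f\<in>I. \<Sum>g\<in>I. u f * Vpar_lim f g * u g)"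
      by (simp only: sum_distrib_left)
    also have "\<dots> \<ge> 0" using vma_le_1 psd_Vpar_lim by simp
    finally show "0 \<le> (\<Sum>f\<in>I. \<Sum>g\<in>I. u f * (mcov mu f g - mcov nu f g) * u g)" .
  qed
qed

end

section \<open>A central limit theorem for completely randomized designs\<close>

locale crfe_design =
  fixes K n :: nat and nq :: "nat \<Rightarrow> nat"
  assumes nq_sum: "(\<Sum>q<2^K. nq q) = n" and n_pos: "n > 0"
begin

definition Om :: "(nat \<Rightarrow> nat) set" where "Om = assigns K n nq"

definition avg :: "((nat \<Rightarrow> nat) \<Rightarrow> 'b::real_vector) \<Rightarrow> 'b" where
  "avg F = (\<Sum>Z\<in>Om. F Z) /\<^sub>R real (card Om)"

lemma OmD:
  assumes "Z \<in> Om"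
  shows "\<And>i. i < n \<Longrightarrow> Z i < 2^K" "\<And>q. q < 2^K \<Longrightarrow> card {i\<in>{..<n}. Z i = q} = nq q"
  using assms unfolding Om_def assigns_def by (auto simp: PiE_iff)

lemma finite_Om: "finite Om"
proof -
  have "finite (PiE {..<n} (\<lambda>_. {..<2^K::nat}))" by (intro finite_PiE) auto
  then show ?thesis unfolding Om_def assigns_def by (rule rev_finite_subset) auto
qed

lemma ex_assignment:
  "\<exists>Z\<in>PiE {..<(\<Sum>q<r. nq q)} (\<lambda>_. {..<r}). \<forall>q<r. card {i\<in>{..<(\<Sum>q<r. nq q)}. Z i = q} = nq q"
proof (induction r)
  case 0
  show ?case by simp
next
  case (Suc r)
  define n' where "n' = (\<Sum>q<r. nq q)"
  from Suc.IH[folded n'_def] obtain Z where Z: "Z \<in> PiE {..<n'} (\<lambda>_. {..<r})"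
    "\<forall>q<r. card {i\<in>{..<n'}. Z i = q} = nq q"
    by (rule bexE)
  define Z' where "Z' = (\<lambda>i\<in>{..<n' + nq r}. if i < n' then Z i else r)"
  have "Z' \<in> PiE {..<n' + nq r} (\<lambda>_. {..<Suc r})"
    unfolding Z'_def
  proof (rule restrict_PiE_iff[THEN iffD2], rule ballI)
    fix i assume "i \<in> {..<n' + nq r}"
    show "(if i < n' then Z i else r) \<in> {..<Suc r}" using PiE_mem[OF Z(1), of i] by auto
  qed
  moreover have "card {i\<in>{..<n' + nq r}. Z' i = q} = nq q" if "q < Suc r" for q
  proof (cases "q = r")
    case True
    have "Z i \<noteq> r" if "i < n'" for i using PiE_mem[OF Z(1), of i] that by auto
    then have "{i\<in>{..<n' + nq r}. Z' i = q} = {n'..<n' + nq r}"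
      using True unfolding Z'_def by auto
    then show ?thesis using True by simp
  next
    case False
    then have "{i\<in>{..<n' + nq r}. Z' i = q} = {i\<in>{..<n'}. Z i = q}"
      unfolding Z'_def by auto
    then show ?thesis using Z(2) that False by simp
  qed
  ultimately show ?case unfolding n'_def sum.lessThan_Suc by blast
qed

lemma Om_nonempty: "Om \<noteq> {}"
  using ex_assignment[of "2^K"] unfolding Om_def assigns_def nq_sum by auto

lemma card_Om: "real (card Om) > 0"
  using finite_Om Om_nonempty by (simp add: card_gt_0_iff)

lemma avg_add: "avg (\<lambda>Z. F Z + G Z) = avg F + avg G"
  by (simp add: avg_def sum.distrib scaleR_right_distrib)

lemma avg_sum: "avg (\<lambda>Z. \<Sum>i\<in>A. F i Z) = (\<Sum>i\<in>A. avg (F i))"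
  unfolding avg_def by (subst sum.swap) (simp add: scaleR_sum_right)

lemma avg_mult_left: "avg (\<lambda>Z. c * F Z) = c * avg F" for c :: "'b::real_algebra"
  by (simp add: avg_def sum_distrib_left[symmetric])

lemma avg_scaleR: "avg (\<lambda>Z. k *\<^sub>R F Z) = k *\<^sub>R avg F"
  by (simp add: avg_def scaleR_sum_right mult.commute)

lemma avg_const: "avg (\<lambda>Z. c) = c"
  using card_Om by (simp add: avg_def sum_constant_scaleR)

lemma avg_cong: "(\<And>Z. Z \<in> Om \<Longrightarrow> F Z = G Z) \<Longrightarrow> avg F = avg G"
  unfolding avg_def by (simp cong: sum.cong)

lemma avg_mono: "(\<And>Z. Z \<in> Om \<Longrightarrow> F Z \<le> G Z) \<Longrightarrow> avg F \<le> avg G" for F G :: "_ \<Rightarrow> real"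
  unfolding avg_def using card_Om by (auto intro!: mult_left_mono sum_mono)

lemma norm_avg_le: "norm (avg F) \<le> avg (\<lambda>Z. norm (F Z))" for F :: "_ \<Rightarrow> 'b::real_normed_vector"
  unfolding avg_def using card_Om by (auto intro!: mult_left_mono norm_sum)

lemma avg_abs_le_sqrt:
  assumes "avg (\<lambda>Z. (F Z)\<^sup>2) \<le> B" shows "avg (\<lambda>Z. \<bar>F Z\<bar>) \<le> sqrt B"
proof -
  let ?m = "avg (\<lambda>Z. \<bar>F Z\<bar>)"
  have "0 \<le> avg (\<lambda>Z. (\<bar>F Z\<bar> - ?m)\<^sup>2)"
    using avg_mono[of "\<lambda>_. 0" "\<lambda>Z. (\<bar>F Z\<bar> - ?m)\<^sup>2"] by (simp add: avg_const)
  also have "avg (\<lambda>Z. (\<bar>F Z\<bar> - ?m)\<^sup>2) = avg (\<lambda>Z. (F Z)\<^sup>2 + (-2 * ?m) * \<bar>F Z\<bar> + ?m\<^sup>2)"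
    by (rule avg_cong) (simp add: power2_diff)
  also have "\<dots> = avg (\<lambda>Z. (F Z)\<^sup>2) - ?m\<^sup>2"
    unfolding avg_add avg_mult_left avg_const by (simp add: power2_eq_square)
  finally have "?m\<^sup>2 \<le> B" using assms by simp
  then show ?thesis by (rule real_le_rsqrt)
qed

lemma swap_in_Om:
  assumes Z: "Z \<in> Om" and ij: "i < n" "j < n"
  shows "Z \<circ> Transposition.transpose i j \<in> Om"
proof -
  let ?t = "Transposition.transpose i j"
  have t: "?t k < n \<longleftrightarrow> k < n" for k using ij by (auto simp: Transposition.transpose_def)
  have "Z \<circ> ?t \<in> PiE {..<n} (\<lambda>_. {..<2^K})"
  proof -
    have ZE: "Z \<in> PiE {..<n} (\<lambda>_. {..<2^K})" using Z unfolding Om_def assigns_def by blast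
    show ?thesis
    proof (rule PiE_I)
      fix k assume "k \<in> {..<n}"
      then show "(Z \<circ> ?t) k \<in> {..<2^K}" using PiE_mem[OF ZE, of "?t k"] t[of k] by simp
    next
      fix k assume "k \<notin> {..<n}"
      then show "(Z \<circ> ?t) k = undefined" using PiE_arb[OF ZE, of "?t k"] t[of k] by simp
    qed
  qed
  moreover have "card {k\<in>{..<n}. (Z \<circ> ?t) k = q} = nq q" if q: "q < 2^K" for q
  proof -
    have "{k\<in>{..<n}. (Z \<circ> ?t) k = q} = ?t ` {k\<in>{..<n}. Z k = q}"
    proof (intro equalityI subsetI)
      fix k assume "k \<in> {k\<in>{..<n}. (Z \<circ> ?t) k = q}"
      then show "k \<in> ?t ` {k\<in>{..<n}. Z k = q}"
        using t[of k] by (intro image_eqI[of _ _ "?t k"]) simp_all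
    next
      fix k assume "k \<in> ?t ` {k\<in>{..<n}. Z k = q}"
      then obtain l where "k = ?t l" "l < n" "Z l = q" by blast
      then show "k \<in> {k\<in>{..<n}. (Z \<circ> ?t) k = q}" using t[of l] by simp
    qed
    then show ?thesis using OmD(2)[OF Z q] by (simp add: card_image)
  qed
  ultimately show ?thesis unfolding Om_def assigns_def by blast
qed

lemma avg_swap:
  assumes "i < n" "j < n"
  shows "avg (\<lambda>Z. F (Z \<circ> Transposition.transpose i j)) = avg F"
proof -
  have "(\<Sum>Z\<in>Om. F (Z \<circ> Transposition.transpose i j)) = (\<Sum>Z\<in>Om. F Z)"
    by (rule sum.reindex_bij_witness[of _ "\<lambda>Z. Z \<circ> Transposition.transpose i j" "\<lambda>Z. Z \<circ> Transposition.transpose i j"])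
      (simp_all add: swap_in_Om[OF _ assms] comp_assoc)
  then show ?thesis by (simp add: avg_def)
qed

definition W :: "(nat \<Rightarrow> nat \<Rightarrow> real) \<Rightarrow> (nat \<Rightarrow> nat) \<Rightarrow> real" where
  "W c Z = (\<Sum>i<n. c i (Z i))"

definition \<Delta> :: "(nat \<Rightarrow> nat \<Rightarrow> real) \<Rightarrow> nat \<Rightarrow> nat \<Rightarrow> (nat \<Rightarrow> nat) \<Rightarrow> real" where
  "\<Delta> c i j Z = c i (Z j) + c j (Z i) - c i (Z i) - c j (Z j)"

definition col_centered :: "(nat \<Rightarrow> nat \<Rightarrow> real) \<Rightarrow> bool" where
  "col_centered c \<longleftrightarrow> (\<forall>q<2^K. (\<Sum>i<n. c i q) = 0)"

lemma W_swap:
  assumes ij: "i < n" "j < n"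
  shows "W c (Z \<circ> Transposition.transpose i j) = W c Z + \<Delta> c i j Z"
proof -
  have "W c (Z \<circ> Transposition.transpose i j) - W c Z = (\<Sum>k<n. c k (Z (Transposition.transpose i j k)) - c k (Z k))"
    by (simp add: W_def sum_subtractf)
  also have "\<dots> = (\<Sum>k\<in>{i,j}. c k (Z (Transposition.transpose i j k)) - c k (Z k))"
    using ij by (intro sum.mono_neutral_right) (auto simp: Transposition.transpose_def)
  also have "\<dots> = \<Delta> c i j Z"
    by (cases "i = j") (auto simp: \<Delta>_def)
  finally show ?thesis by simp
qed

lemma sum_over_groups:
  assumes Z: "Z \<in> Om"
  shows "(\<Sum>i<n. f i (Z i)) = (\<Sum>q<2^K. \<Sum>i<n. if Z i = q then f i q else (0::real))"
proof -
  have "(\<Sum>q<2^K. \<Sum>i<n. if Z i = q then f i q else 0) = (\<Sum>i<n. \<Sum>q<2^K. if Z i = q then f i q else 0)"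
    by (rule sum.swap)
  also have "\<dots> = (\<Sum>i<n. f i (Z i))"
    using OmD(1)[OF Z] by (intro sum.cong) auto
  finally show ?thesis by simp
qed

lemma sum_group_sizes:
  assumes Z: "Z \<in> Om"
  shows "(\<Sum>i<n. f (Z i)) = (\<Sum>q<2^K. real (nq q) * f q)"
proof -
  have "(\<Sum>i<n. if Z i = q then f q else 0) = real (nq q) * f q" if "q < 2^K" for q
  proof -
    have "(\<Sum>i<n. if Z i = q then f q else 0) = (\<Sum>i\<in>{i\<in>{..<n}. Z i = q}. f q)"
      by (subst sum.inter_filter) auto
    then show ?thesis using OmD(2)[OF Z that] by simp
  qed
  then show ?thesis unfolding sum_over_groups[OF Z, of "\<lambda>_. f"] by simp
qed

lemma col_centered_sum:
  assumes "col_centered c" "Z \<in> Om" "j < n"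
  shows "(\<Sum>i<n. c i (Z j)) = 0"
  using assms OmD(1)[OF assms(2,3)] unfolding col_centered_def by auto

lemma sum_\<Delta>:
  assumes c: "col_centered c" and Z: "Z \<in> Om"
  shows "(\<Sum>i<n. \<Sum>j<n. \<Delta> c i j Z) = - 2 * real n * W c Z"
proof -
  have 1: "(\<Sum>i<n. \<Sum>j<n. c i (Z j)) = 0"
    by (subst sum.swap) (simp add: col_centered_sum[OF c Z])
  have 2: "(\<Sum>i<n. \<Sum>j<n. c j (Z i)) = 0"
    by (simp add: col_centered_sum[OF c Z])
  show ?thesis
    by (simp add: \<Delta>_def sum.distrib sum_subtractf 1 2 W_def sum_distrib_left[symmetric])
qed

text \<open>Stein's method for the exchangeable pair formed by \<open>Z\<close> and \<open>Z\<close> with the labels of two units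
  swapped.\<close>

lemma Stein_identity:
  fixes \<psi> :: "real \<Rightarrow> 'b::real_vector"
  assumes c: "col_centered c"
  shows "avg (\<lambda>Z. \<Sum>i<n. \<Sum>j<n. \<Delta> c i j Z *\<^sub>R (\<psi> (W c Z + \<Delta> c i j Z) - \<psi> (W c Z)))
       = (4 * real n) *\<^sub>R avg (\<lambda>Z. W c Z *\<^sub>R \<psi> (W c Z))"
proof -
  have anti: "avg (\<lambda>Z. \<Delta> c i j Z *\<^sub>R (\<psi> (W c Z + \<Delta> c i j Z))) = - avg (\<lambda>Z. \<Delta> c i j Z *\<^sub>R \<psi> (W c Z))"
    if ij: "i < n" "j < n" for i j
  proof -
    let ?t = "Transposition.transpose i j"
    have "avg (\<lambda>Z. \<Delta> c i j Z *\<^sub>R \<psi> (W c Z)) = avg (\<lambda>Z. \<Delta> c i j (Z \<circ> ?t) *\<^sub>R \<psi> (W c (Z \<circ> ?t)))"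
      by (rule avg_swap[OF ij, symmetric])
    also have "\<dots> = avg (\<lambda>Z. - (\<Delta> c i j Z *\<^sub>R \<psi> (W c Z + \<Delta> c i j Z)))"
      unfolding W_swap[OF ij] by (rule avg_cong) (simp add: \<Delta>_def scaleR_left_diff_distrib scaleR_left_distrib)
    also have "\<dots> = - avg (\<lambda>Z. \<Delta> c i j Z *\<^sub>R (\<psi> (W c Z + \<Delta> c i j Z)))"
      by (simp add: avg_def sum_negf)
    finally show ?thesis by simp
  qed
  have "avg (\<lambda>Z. \<Sum>i<n. \<Sum>j<n. \<Delta> c i j Z *\<^sub>R (\<psi> (W c Z + \<Delta> c i j Z) - \<psi> (W c Z)))
      = (\<Sum>i<n. \<Sum>j<n. avg (\<lambda>Z. \<Delta> c i j Z *\<^sub>R (\<psi> (W c Z + \<Delta> c i j Z)) - \<Delta> c i j Z *\<^sub>R \<psi> (W c Z)))"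
    unfolding avg_sum scaleR_right_diff_distrib ..
  also have "\<dots> = (\<Sum>i<n. \<Sum>j<n. avg (\<lambda>Z. ((-2) * \<Delta> c i j Z) *\<^sub>R \<psi> (W c Z)))"
  proof (intro sum.cong refl)
    fix i j assume "i \<in> {..<n}" "j \<in> {..<n}"
    then have ij: "i < n" "j < n" by auto
    have "avg (\<lambda>Z. \<Delta> c i j Z *\<^sub>R (\<psi> (W c Z + \<Delta> c i j Z)) - \<Delta> c i j Z *\<^sub>R \<psi> (W c Z))
       = avg (\<lambda>Z. \<Delta> c i j Z *\<^sub>R (\<psi> (W c Z + \<Delta> c i j Z))) + avg (\<lambda>Z. - (\<Delta> c i j Z *\<^sub>R \<psi> (W c Z)))"
      unfolding avg_add[symmetric] by simp
    also have "\<dots> = avg (\<lambda>Z. - (\<Delta> c i j Z *\<^sub>R \<psi> (W c Z))) + avg (\<lambda>Z. - (\<Delta> c i j Z *\<^sub>R \<psi> (W c Z)))"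
      unfolding anti[OF ij] by (simp add: avg_def sum_negf)
    also have "\<dots> = avg (\<lambda>Z. ((-2) * \<Delta> c i j Z) *\<^sub>R \<psi> (W c Z))"
      unfolding avg_add[symmetric] by (rule avg_cong) (simp add: scaleR_left_distrib[symmetric] scaleR_minus_left[symmetric] del: scaleR_minus_left)
    finally show "avg (\<lambda>Z. \<Delta> c i j Z *\<^sub>R (\<psi> (W c Z + \<Delta> c i j Z)) - \<Delta> c i j Z *\<^sub>R \<psi> (W c Z))
       = avg (\<lambda>Z. ((-2) * \<Delta> c i j Z) *\<^sub>R \<psi> (W c Z))" .
  qed
  also have "\<dots> = avg (\<lambda>Z. ((-2) * (\<Sum>i<n. \<Sum>j<n. \<Delta> c i j Z)) *\<^sub>R \<psi> (W c Z))"
    unfolding avg_sum[symmetric] by (rule avg_cong) (simp only: scaleR_sum_left sum_distrib_left)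
  also have "\<dots> = avg (\<lambda>Z. (4 * real n) *\<^sub>R (W c Z *\<^sub>R \<psi> (W c Z)))"
    by (rule avg_cong) (simp add: sum_\<Delta>[OF c])
  also have "\<dots> = (4 * real n) *\<^sub>R avg (\<lambda>Z. W c Z *\<^sub>R \<psi> (W c Z))"
    by (rule avg_scaleR)
  finally show ?thesis .
qed

lemma second_moment_le:
  assumes c: "col_centered c"
  shows "avg (\<lambda>Z. (W c Z)\<^sup>2) \<le> 4 * (\<Sum>q<2^K. \<Sum>i<n. (c i q)\<^sup>2)"
proof -
  let ?C = "\<Sum>q<2^K. \<Sum>i<n. (c i q)\<^sup>2"
  have "(4 * real n) * avg (\<lambda>Z. (W c Z)\<^sup>2) = avg (\<lambda>Z. \<Sum>i<n. \<Sum>j<n. (\<Delta> c i j Z)\<^sup>2)"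
    using Stein_identity[OF c, of "\<lambda>w. w"] by (simp add: power2_eq_square)
  also have "\<dots> \<le> avg (\<lambda>Z. 16 * real n * ?C)"
  proof (rule avg_mono)
    fix Z assume Z: "Z \<in> Om"
    have a: "(\<Sum>i<n. (c i (Z i))\<^sup>2) \<le> ?C"
      unfolding sum_over_groups[OF Z, of "\<lambda>i q. (c i q)\<^sup>2"] by (intro sum_mono) auto
    have b: "(\<Sum>i<n. \<Sum>j<n. (c i (Z j))\<^sup>2) \<le> real n * ?C"
    proof -
      have "(\<Sum>i<n. \<Sum>j<n. (c i (Z j))\<^sup>2) = (\<Sum>j<n. \<Sum>i<n. (c i (Z j))\<^sup>2)" by (rule sum.swap)
      also have "\<dots> \<le> (\<Sum>j<n. ?C)"
        using OmD(1)[OF Z]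
        by (intro sum_mono member_le_sum[where f="\<lambda>q. \<Sum>i<n. (c i q)\<^sup>2"]) (auto intro: sum_nonneg)
      finally show ?thesis by simp
    qed
    have b': "(\<Sum>i<n. \<Sum>j<n. (c j (Z i))\<^sup>2) \<le> real n * ?C"
      by (rule order_trans[OF eq_refl[OF sum.swap] b])
    have sq: "(x + y - z - w)\<^sup>2 \<le> 4 * (x\<^sup>2 + y\<^sup>2 + z\<^sup>2 + w\<^sup>2)" for x y z w :: real
    proof -
      have "4 * (x\<^sup>2 + y\<^sup>2 + z\<^sup>2 + w\<^sup>2) - (x + y - z - w)\<^sup>2
         = (x - y)\<^sup>2 + (x + z)\<^sup>2 + (x + w)\<^sup>2 + (y + z)\<^sup>2 + (y + w)\<^sup>2 + (z - w)\<^sup>2"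
        by (simp add: power2_eq_square algebra_simps)
      moreover have "\<dots> \<ge> 0" by (intro add_nonneg_nonneg zero_le_power2)
      ultimately show ?thesis by linarith
    qed
    have "(\<Sum>i<n. \<Sum>j<n. (\<Delta> c i j Z)\<^sup>2)
      \<le> (\<Sum>i<n. \<Sum>j<n. 4 * ((c i (Z j))\<^sup>2 + (c j (Z i))\<^sup>2 + (c i (Z i))\<^sup>2 + (c j (Z j))\<^sup>2))"
      unfolding \<Delta>_def by (intro sum_mono sq)
    also have "\<dots> = 4 * ((\<Sum>i<n. \<Sum>j<n. (c i (Z j))\<^sup>2) + (\<Sum>i<n. \<Sum>j<n. (c j (Z i))\<^sup>2)
        + real n * (\<Sum>i<n. (c i (Z i))\<^sup>2) + real n * (\<Sum>i<n. (c i (Z i))\<^sup>2))"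
    proof -
      have 1: "(\<Sum>i<n. \<Sum>j<n. (c i (Z i))\<^sup>2) = real n * (\<Sum>i<n. (c i (Z i))\<^sup>2)"
        by (simp add: sum_distrib_left)
      have 2: "(\<Sum>i<n. \<Sum>j<n. (c j (Z j))\<^sup>2) = real n * (\<Sum>i<n. (c i (Z i))\<^sup>2)" by simp
      show ?thesis by (simp only: sum_distrib_left[symmetric] sum.distrib 1 2)
    qed
    also have "\<dots> \<le> 4 * (real n * ?C + real n * ?C + real n * ?C + real n * ?C)"
      by (intro mult_left_mono[OF _ of_nat_0_le_iff] mult_left_mono[where c=4] add_mono a b b') simp
    finally show "(\<Sum>i<n. \<Sum>j<n. (\<Delta> c i j Z)\<^sup>2) \<le> 16 * real n * ?C" by simp
  qed
  finally show ?thesis using n_pos by (simp add: avg_const)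
qed

definition grp :: "nat \<Rightarrow> (nat \<Rightarrow> real) \<Rightarrow> (nat \<Rightarrow> nat) \<Rightarrow> real" where
  "grp q u Z = (\<Sum>i<n. if Z i = q then u i else 0)"

definition share :: "nat \<Rightarrow> real" where
  "share q = real (nq q) / real n"

definition gram :: "(nat \<Rightarrow> nat \<Rightarrow> real) \<Rightarrow> nat \<Rightarrow> nat \<Rightarrow> real" where
  "gram c q k = (\<Sum>i<n. c i q * c i k)"

definition sig2 :: "(nat \<Rightarrow> nat \<Rightarrow> real) \<Rightarrow> real" where
  "sig2 c = (\<Sum>q<2^K. share q * gram c q q) - (\<Sum>q<2^K. \<Sum>k<2^K. share q * share k * gram c q k)"

lemma share_nonneg: "share q \<ge> 0" by (simp add: share_def)

lemma share_sum: "(\<Sum>q<2^K. share q) = 1"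
proof -
  have "(\<Sum>q<2^K. real (nq q)) = real n" using nq_sum by (metis of_nat_sum)
  then show ?thesis using n_pos by (simp add: share_def sum_divide_distrib[symmetric])
qed

lemma share_le_1: "q < 2^K \<Longrightarrow> share q \<le> 1"
  using member_le_sum[of q "{..<2^K}" share] share_sum share_nonneg by auto

lemma sig2_nonneg: "sig2 c \<ge> 0"
proof -
  define b where "b i = (\<Sum>q<2^K. share q * c i q)" for i
  have "sig2 c = (\<Sum>i<n. \<Sum>q<2^K. share q * (c i q - b i)\<^sup>2)"
  proof -
    have 1: "(\<Sum>q<2^K. share q * gram c q q) = (\<Sum>i<n. \<Sum>q<2^K. share q * (c i q)\<^sup>2)"
      unfolding gram_def sum_distrib_left power2_eq_square by (rule sum.swap)
    have 2: "(\<Sum>q<2^K. \<Sum>k<2^K. share q * share k * gram c q k) = (\<Sum>i<n. (b i)\<^sup>2)"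
    proof -
      have "(\<Sum>q<2^K. \<Sum>k<2^K. share q * share k * gram c q k)
        = (\<Sum>q<2^K. \<Sum>i<n. \<Sum>k<2^K. (share q * c i q) * (share k * c i k))"
        unfolding gram_def sum_distrib_left
        by (rule sum.cong[OF refl], subst sum.swap) (simp add: mult_ac)
      also have "\<dots> = (\<Sum>i<n. \<Sum>q<2^K. \<Sum>k<2^K. (share q * c i q) * (share k * c i k))"
        by (rule sum.swap)
      finally show ?thesis by (simp add: b_def power2_eq_square sum_product)
    qed
    have 3: "(\<Sum>q<2^K. share q * (c i q - b i)\<^sup>2) = (\<Sum>q<2^K. share q * (c i q)\<^sup>2) - (b i)\<^sup>2" for i
    proof -
      have "(\<Sum>q<2^K. share q * (c i q - b i)\<^sup>2)
        = (\<Sum>q<2^K. share q * (c i q)\<^sup>2 - 2 * b i * (share q * c i q) + (b i)\<^sup>2 * share q)"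
        by (intro sum.cong refl) (simp add: power2_eq_square algebra_simps)
      also have "\<dots> = (\<Sum>q<2^K. share q * (c i q)\<^sup>2) - 2 * b i * b i + (b i)\<^sup>2 * 1"
        by (simp only: sum.distrib sum_subtractf sum_distrib_left[symmetric] b_def[symmetric] share_sum)
      finally show ?thesis by (simp add: power2_eq_square)
    qed
    show ?thesis unfolding sig2_def 1 2 3 by (simp add: sum_subtractf)
  qed
  also have "\<dots> \<ge> 0" by (intro sum_nonneg mult_nonneg_nonneg share_nonneg) auto
  finally show ?thesis .
qed

lemma group_deviation:
  assumes q: "q < 2^K"
  shows "avg (\<lambda>Z. (grp q u Z - share q * (\<Sum>i<n. u i))\<^sup>2) \<le> 4 * (\<Sum>i<n. (u i)\<^sup>2)"
proof -
  define b where "b = (\<Sum>i<n. u i) / real n"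
  define c where "c i k = (if k = q then u i - b else 0)" for i k :: nat
  have sum_b: "(\<Sum>i<n. u i) = real n * b" using n_pos by (simp add: b_def)
  have c: "col_centered c" unfolding col_centered_def
  proof (intro allI impI)
    show "(\<Sum>i<n. c i k) = 0" for k by (cases "k = q") (simp_all add: c_def sum_subtractf sum_b)
  qed
  have W: "W c Z = grp q u Z - share q * (\<Sum>i<n. u i)" if Z: "Z \<in> Om" for Z
  proof -
    have "W c Z = grp q u Z - b * (\<Sum>i<n. if Z i = q then 1 else 0)"
      unfolding W_def c_def grp_def sum_distrib_left sum_subtractf[symmetric] by (intro sum.cong) auto
    also have "(\<Sum>i<n. if Z i = q then 1 else 0) = (\<Sum>k<2^K. real (nq k) * (if k = q then 1 else 0))"
      by (rule sum_group_sizes[OF Z])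
    also have "\<dots> = real (nq q)" using q by (simp add: if_distrib[of "\<lambda>z. _ * z"] cong: if_cong)
    also have "b * real (nq q) = share q * (\<Sum>i<n. u i)" by (simp add: b_def share_def)
    finally show ?thesis .
  qed
  have "avg (\<lambda>Z. (grp q u Z - share q * (\<Sum>i<n. u i))\<^sup>2) = avg (\<lambda>Z. (W c Z)\<^sup>2)"
    by (rule avg_cong) (simp add: W)
  also have "\<dots> \<le> 4 * (\<Sum>k<2^K. \<Sum>i<n. (c i k)\<^sup>2)" by (rule second_moment_le[OF c])
  also have "(\<Sum>k<2^K. \<Sum>i<n. (c i k)\<^sup>2) = (\<Sum>k<2^K. if k = q then \<Sum>i<n. (u i - b)\<^sup>2 else 0)"
    by (intro sum.cong) (auto simp: c_def)
  also have "\<dots> = (\<Sum>i<n. (u i - b)\<^sup>2)" using q by simp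
  also have "\<dots> = (\<Sum>i<n. (u i)\<^sup>2 - 2 * b * u i + b\<^sup>2)"
    by (intro sum.cong) (auto simp: power2_eq_square algebra_simps)
  also have "\<dots> = (\<Sum>i<n. (u i)\<^sup>2) - real n * b\<^sup>2"
    by (simp add: sum.distrib sum_subtractf sum_distrib_left[symmetric] sum_b power2_eq_square)
  also have "\<dots> \<le> (\<Sum>i<n. (u i)\<^sup>2)" by simp
  finally show ?thesis by simp
qed

definition A2 :: "(nat \<Rightarrow> nat \<Rightarrow> real) \<Rightarrow> (nat \<Rightarrow> nat) \<Rightarrow> real" where
  "A2 c Z = (\<Sum>i<n. \<Sum>j<n. (\<Delta> c i j Z)\<^sup>2) / (4 * real n)"

lemma A2_expand:
  assumes c: "col_centered c" and Z: "Z \<in> Om"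
  shows "A2 c Z - sig2 c
    = (1/2) * (\<Sum>q<2^K. grp q (\<lambda>i. (c i q)\<^sup>2) Z - share q * (\<Sum>i<n. (c i q)\<^sup>2))
      + (W c Z)\<^sup>2 / (2 * real n)
      + (\<Sum>q<2^K. \<Sum>k<2^K. grp q (\<lambda>i. c i k) Z * grp k (\<lambda>i. c i q) Z) / (2 * real n)
      - (\<Sum>q<2^K. \<Sum>k<2^K. share k * (grp q (\<lambda>i. c i q * c i k) Z - share q * gram c q k))"
proof -
  let ?a = "\<lambda>i. c i (Z i)" and ?b = "\<lambda>i j. c i (Z j)"
  have nn: "real n \<noteq> 0" using n_pos by simp
  have bb: "(\<Sum>i<n. \<Sum>j<n. (?b j i)\<^sup>2) = (\<Sum>i<n. \<Sum>j<n. (?b i j)\<^sup>2)" by (rule sum.swap)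
  have ab: "(\<Sum>i<n. \<Sum>j<n. ?a j * ?b j i) = (\<Sum>i<n. \<Sum>j<n. ?a i * ?b i j)" by (rule sum.swap)
  have ab0: "(\<Sum>i<n. \<Sum>j<n. ?a i * ?b j i) = 0"
    by (simp add: sum_distrib_left[symmetric] col_centered_sum[OF c Z])
  have ab0': "(\<Sum>i<n. \<Sum>j<n. ?a j * ?b i j) = 0"
    by (subst sum.swap) (rule ab0)
  have pull: "(\<Sum>i<n. \<Sum>j<n. 2 * F i j) = 2 * (\<Sum>i<n. \<Sum>j<n. F i j)" for F :: "nat \<Rightarrow> nat \<Rightarrow> real"
    by (simp only: sum_distrib_left)
  have sq: "(\<Sum>i<n. \<Sum>j<n. (?a i)\<^sup>2) = real n * (\<Sum>i<n. (?a i)\<^sup>2)"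
      "(\<Sum>i<n. \<Sum>j<n. (?a j)\<^sup>2) = real n * (\<Sum>i<n. (?a i)\<^sup>2)"
    by (simp_all add: sum_distrib_left)
  have aa: "(\<Sum>i<n. \<Sum>j<n. ?a i * ?a j) = (W c Z)\<^sup>2"
    by (simp add: W_def power2_eq_square sum_product)
  have "(\<Sum>i<n. \<Sum>j<n. (\<Delta> c i j Z)\<^sup>2)
    = (\<Sum>i<n. \<Sum>j<n. (?a i)\<^sup>2 + (?a j)\<^sup>2 + (?b i j)\<^sup>2 + (?b j i)\<^sup>2 + 2 * (?a i * ?a j) + 2 * (?b i j * ?b j i)
        - 2 * (?a i * ?b i j) - 2 * (?a i * ?b j i) - 2 * (?a j * ?b i j) - 2 * (?a j * ?b j i))"
    by (intro sum.cong refl) (simp add: \<Delta>_def power2_eq_square algebra_simps)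
  also have "\<dots> = 2 * real n * (\<Sum>i<n. (?a i)\<^sup>2) + 2 * (\<Sum>i<n. \<Sum>j<n. (?b i j)\<^sup>2) + 2 * (W c Z)\<^sup>2
      + 2 * (\<Sum>i<n. \<Sum>j<n. ?b i j * ?b j i) - 4 * (\<Sum>i<n. \<Sum>j<n. ?a i * ?b i j)"
    by (simp only: sum.distrib sum_subtractf pull bb ab ab0 ab0' aa sq)
  finally have D: "(\<Sum>i<n. \<Sum>j<n. (\<Delta> c i j Z)\<^sup>2) = 2 * real n * (\<Sum>i<n. (?a i)\<^sup>2) + 2 * (\<Sum>i<n. \<Sum>j<n. (?b i j)\<^sup>2)
      + 2 * (W c Z)\<^sup>2 + 2 * (\<Sum>i<n. \<Sum>j<n. ?b i j * ?b j i) - 4 * (\<Sum>i<n. \<Sum>j<n. ?a i * ?b i j)" .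
  have T1: "(\<Sum>i<n. (?a i)\<^sup>2) = (\<Sum>q<2^K. grp q (\<lambda>i. (c i q)\<^sup>2) Z)"
    unfolding grp_def by (rule sum_over_groups[OF Z])
  have T2: "(\<Sum>i<n. \<Sum>j<n. (?b i j)\<^sup>2) = real n * (\<Sum>q<2^K. share q * gram c q q)"
  proof -
    have "(\<Sum>i<n. \<Sum>j<n. (?b i j)\<^sup>2) = (\<Sum>j<n. gram c (Z j) (Z j))"
      by (subst sum.swap) (simp add: gram_def power2_eq_square)
    also have "\<dots> = (\<Sum>q<2^K. real (nq q) * gram c q q)" by (rule sum_group_sizes[OF Z])
    finally show ?thesis using nn by (simp add: share_def sum_distrib_left)
  qed
  have T3: "(\<Sum>i<n. \<Sum>j<n. ?b i j * ?b j i) = (\<Sum>q<2^K. \<Sum>k<2^K. grp q (\<lambda>i. c i k) Z * grp k (\<lambda>i. c i q) Z)"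
  proof -
    have "(\<Sum>i<n. \<Sum>j<n. ?b i j * ?b j i)
       = (\<Sum>q<2^K. \<Sum>i<n. if Z i = q then (\<Sum>j<n. c i (Z j) * c j q) else 0)"
      by (rule sum_over_groups[OF Z, of "\<lambda>i q. \<Sum>j<n. c i (Z j) * c j q"])
    also have "\<dots> = (\<Sum>q<2^K. \<Sum>i<n. if Z i = q then (\<Sum>k<2^K. \<Sum>j<n. if Z j = k then c i k * c j q else 0) else 0)"
      by (subst sum_over_groups[OF Z, of "\<lambda>j k. c _ k * c j _"]) rule
    also have "\<dots> = (\<Sum>q<2^K. \<Sum>i<n. \<Sum>k<2^K. (if Z i = q then c i k else 0) * grp k (\<lambda>i. c i q) Z)"
      unfolding grp_def sum_distrib_left by (intro sum.cong refl) (auto intro!: sum.cong)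
    also have "\<dots> = (\<Sum>q<2^K. \<Sum>k<2^K. \<Sum>i<n. (if Z i = q then c i k else 0) * grp k (\<lambda>i. c i q) Z)"
      by (intro sum.cong refl sum.swap)
    also have "\<dots> = (\<Sum>q<2^K. \<Sum>k<2^K. grp q (\<lambda>i. c i k) Z * grp k (\<lambda>i. c i q) Z)"
      by (simp add: grp_def[of _ "\<lambda>i. c i _"] sum_distrib_right[symmetric])
    finally show ?thesis .
  qed
  have T4: "(\<Sum>i<n. \<Sum>j<n. ?a i * ?b i j) = real n * (\<Sum>q<2^K. \<Sum>k<2^K. share k * grp q (\<lambda>i. c i q * c i k) Z)"
  proof -
    have "(\<Sum>i<n. \<Sum>j<n. ?a i * ?b i j) = (\<Sum>i<n. \<Sum>k<2^K. real (nq k) * (?a i * c i k))"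
      by (intro sum.cong refl sum_group_sizes[OF Z])
    also have "\<dots> = (\<Sum>q<2^K. \<Sum>i<n. if Z i = q then (\<Sum>k<2^K. real (nq k) * (c i q * c i k)) else 0)"
      by (rule sum_over_groups[OF Z, of "\<lambda>i q. \<Sum>k<2^K. real (nq k) * (c i q * c i k)"])
    also have "\<dots> = (\<Sum>q<2^K. \<Sum>i<n. \<Sum>k<2^K. real (nq k) * (if Z i = q then c i q * c i k else 0))"
      by (intro sum.cong refl) auto
    also have "\<dots> = (\<Sum>q<2^K. \<Sum>k<2^K. \<Sum>i<n. real (nq k) * (if Z i = q then c i q * c i k else 0))"
      by (intro sum.cong refl sum.swap)
    also have "\<dots> = (\<Sum>q<2^K. \<Sum>k<2^K. real (nq k) * grp q (\<lambda>i. c i q * c i k) Z)"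
      by (simp add: grp_def sum_distrib_left)
    finally show ?thesis using nn by (simp add: share_def sum_distrib_left)
  qed
  have A: "A2 c Z = (1/2) * (\<Sum>i<n. (?a i)\<^sup>2) + (1/2) * (\<Sum>q<2^K. share q * gram c q q) + (W c Z)\<^sup>2 / (2 * real n)
     + (\<Sum>i<n. \<Sum>j<n. ?b i j * ?b j i) / (2 * real n)
     - (\<Sum>q<2^K. \<Sum>k<2^K. share k * grp q (\<lambda>i. c i q * c i k) Z)"
    unfolding A2_def D T2 T4 using nn by (simp add: field_simps)
  have g: "(\<Sum>i<n. (c i q)\<^sup>2) = gram c q q" for q by (simp add: gram_def power2_eq_square)
  show ?thesis unfolding A T1 T3 sig2_def g
    by (simp add: sum_subtractf right_diff_distrib mult_ac)
qed

lemma A2_deviation: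
  assumes c: "col_centered c"
    and \<delta>: "\<And>i q. i < n \<Longrightarrow> q < 2^K \<Longrightarrow> \<bar>c i q\<bar> \<le> \<delta>" "\<delta> \<ge> 0"
    and H: "\<And>q. q < 2^K \<Longrightarrow> gram c q q \<le> H" "H \<ge> 0"
  shows "avg (\<lambda>Z. \<bar>A2 c Z - sig2 c\<bar>) \<le> 3 * (2^K)\<^sup>2 * \<delta> * sqrt H + 4 * (2^K)\<^sup>2 * H / real n"
proof -
  let ?Q = "2^K :: real"
  have Q1: "?Q \<ge> 1" by simp
  have prod: "(\<Sum>i<n. (c i q * c i k)\<^sup>2) \<le> \<delta>\<^sup>2 * H" if "q < 2^K" "k < 2^K" for q k
  proof -
    have "(\<Sum>i<n. (c i q * c i k)\<^sup>2) \<le> (\<Sum>i<n. \<delta>\<^sup>2 * (c i k * c i k))"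
    proof (rule sum_mono)
      fix i assume "i \<in> {..<n}"
      then have "(c i q)\<^sup>2 \<le> \<delta>\<^sup>2"
        using \<delta>(1)[OF _ that(1), of i] \<delta>(2) abs_le_square_iff[of "c i q" \<delta>] by simp
      then show "(c i q * c i k)\<^sup>2 \<le> \<delta>\<^sup>2 * (c i k * c i k)"
        unfolding power_mult_distrib power2_eq_square[of "c i k"] by (rule mult_right_mono) simp
    qed
    also have "\<dots> = \<delta>\<^sup>2 * gram c k k" by (simp add: gram_def sum_distrib_left)
    also have "\<dots> \<le> \<delta>\<^sup>2 * H" using H(1)[OF that(2)] by (intro mult_left_mono) auto
    finally show ?thesis .
  qed
  have dev: "avg (\<lambda>Z. \<bar>grp q u Z - share q * (\<Sum>i<n. u i)\<bar>) \<le> 2 * \<delta> * sqrt H"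
    if "q < 2^K" "(\<Sum>i<n. (u i)\<^sup>2) \<le> \<delta>\<^sup>2 * H" for q u
  proof -
    have "avg (\<lambda>Z. \<bar>grp q u Z - share q * (\<Sum>i<n. u i)\<bar>) \<le> sqrt (4 * (\<delta>\<^sup>2 * H))"
      using group_deviation[OF that(1), of u] that(2) by (intro avg_abs_le_sqrt) simp
    also have "\<dots> = 2 * \<delta> * sqrt H" using \<delta>(2) by (simp add: real_sqrt_mult)
    finally show ?thesis .
  qed
  have g2: "avg (\<lambda>Z. (grp q (\<lambda>i. c i k) Z)\<^sup>2) \<le> 4 * H" if "q < 2^K" "k < 2^K" for q k
  proof -
    have "(\<Sum>i<n. c i k) = 0" using c that unfolding col_centered_def by auto
    then show ?thesis using group_deviation[OF that(1), of "\<lambda>i. c i k"] H(1)[OF that(2)]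
      by (simp add: gram_def power2_eq_square)
  qed
  let ?X1 = "\<lambda>Z. \<Sum>q<2^K. \<bar>grp q (\<lambda>i. (c i q)\<^sup>2) Z - share q * (\<Sum>i<n. (c i q)\<^sup>2)\<bar>"
  let ?X3 = "\<lambda>Z. \<Sum>q<2^K. \<Sum>k<2^K. (1/2) * ((grp q (\<lambda>i. c i k) Z)\<^sup>2 + (grp k (\<lambda>i. c i q) Z)\<^sup>2)"
  let ?X4 = "\<lambda>Z. \<Sum>q<2^K. \<Sum>k<2^K. \<bar>grp q (\<lambda>i. c i q * c i k) Z - share q * (\<Sum>i<n. c i q * c i k)\<bar>"
  have "avg (\<lambda>Z. \<bar>A2 c Z - sig2 c\<bar>)
     \<le> avg (\<lambda>Z. (1/2) * ?X1 Z + (1 / (2 * real n)) * (W c Z)\<^sup>2 + (1 / (2 * real n)) * ?X3 Z + ?X4 Z)"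
  proof (rule avg_mono)
    fix Z assume Z: "Z \<in> Om"
    have 1: "\<bar>\<Sum>q<2^K. grp q (\<lambda>i. (c i q)\<^sup>2) Z - share q * (\<Sum>i<n. (c i q)\<^sup>2)\<bar> \<le> ?X1 Z" by (rule sum_abs)
    have 3: "\<bar>\<Sum>q<2^K. \<Sum>k<2^K. grp q (\<lambda>i. c i k) Z * grp k (\<lambda>i. c i q) Z\<bar> \<le> ?X3 Z"
    proof (rule order_trans[OF sum_abs], rule sum_mono, rule order_trans[OF sum_abs], rule sum_mono)
      fix q k
      have "\<bar>x * y\<bar> \<le> (1/2) * (x\<^sup>2 + y\<^sup>2)" for x y :: real
        using sum_squares_bound[of "\<bar>x\<bar>" "\<bar>y\<bar>"] by (simp add: abs_mult)
      then show "\<bar>grp q (\<lambda>i. c i k) Z * grp k (\<lambda>i. c i q) Z\<bar>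
        \<le> (1/2) * ((grp q (\<lambda>i. c i k) Z)\<^sup>2 + (grp k (\<lambda>i. c i q) Z)\<^sup>2)" .
    qed
    have 4: "\<bar>\<Sum>q<2^K. \<Sum>k<2^K. share k * (grp q (\<lambda>i. c i q * c i k) Z - share q * gram c q k)\<bar> \<le> ?X4 Z"
    proof (rule order_trans[OF sum_abs], rule sum_mono, rule order_trans[OF sum_abs], rule sum_mono)
      fix q k :: nat assume "k \<in> {..<2^K}"
      then show "\<bar>share k * (grp q (\<lambda>i. c i q * c i k) Z - share q * gram c q k)\<bar>
        \<le> \<bar>grp q (\<lambda>i. c i q * c i k) Z - share q * (\<Sum>i<n. c i q * c i k)\<bar>"
        using share_le_1[of k] share_nonneg[of k] by (simp add: abs_mult gram_def mult_left_le_one_le)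
    qed
    have q3: "\<bar>(\<Sum>q<2^K. \<Sum>k<2^K. grp q (\<lambda>i. c i k) Z * grp k (\<lambda>i. c i q) Z) / (2 * real n)\<bar> \<le> (1 / (2 * real n)) * ?X3 Z"
      using divide_right_mono[OF 3, of "2 * real n"] by simp
    have tri: "\<bar>a\<bar> \<le> a' \<Longrightarrow> w \<ge> 0 \<Longrightarrow> \<bar>b\<bar> \<le> b' \<Longrightarrow> \<bar>d\<bar> \<le> d' \<Longrightarrow> \<bar>(1/2) * a + w + b - d\<bar> \<le> (1/2) * a' + w + b' + d'"
      for a a' w b b' d d' :: real by linarith
    have w: "(W c Z)\<^sup>2 / (2 * real n) \<ge> 0" by simp
    show "\<bar>A2 c Z - sig2 c\<bar> \<le> (1/2) * ?X1 Z + (1 / (2 * real n)) * (W c Z)\<^sup>2 + (1 / (2 * real n)) * ?X3 Z + ?X4 Z"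
      using tri[OF 1 w q3 4] unfolding A2_expand[OF c Z] by simp
  qed
  also have "\<dots> = (1/2) * (\<Sum>q<2^K. avg (\<lambda>Z. \<bar>grp q (\<lambda>i. (c i q)\<^sup>2) Z - share q * (\<Sum>i<n. (c i q)\<^sup>2)\<bar>))
     + (1 / (2 * real n)) * avg (\<lambda>Z. (W c Z)\<^sup>2)
     + (1 / (2 * real n)) * (\<Sum>q<2^K. \<Sum>k<2^K. (1/2) * (avg (\<lambda>Z. (grp q (\<lambda>i. c i k) Z)\<^sup>2) + avg (\<lambda>Z. (grp k (\<lambda>i. c i q) Z)\<^sup>2)))
     + (\<Sum>q<2^K. \<Sum>k<2^K. avg (\<lambda>Z. \<bar>grp q (\<lambda>i. c i q * c i k) Z - share q * (\<Sum>i<n. c i q * c i k)\<bar>))"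
    unfolding avg_add avg_mult_left avg_sum ..
  also have "\<dots> \<le> (1/2) * (\<Sum>q<(2::nat)^K. 2 * \<delta> * sqrt H) + (1 / (2 * real n)) * (4 * (\<Sum>q<(2::nat)^K. H))
     + (1 / (2 * real n)) * (\<Sum>q<(2::nat)^K. \<Sum>k<(2::nat)^K. (1/2) * (4 * H + 4 * H))
     + (\<Sum>q<(2::nat)^K. \<Sum>k<(2::nat)^K. 2 * \<delta> * sqrt H)"
  proof (intro add_mono mult_left_mono sum_mono dev g2)
    show "avg (\<lambda>Z. (W c Z)\<^sup>2) \<le> 4 * (\<Sum>q<(2::nat)^K. H)"
    proof (rule order_trans[OF second_moment_le[OF c]], intro mult_left_mono sum_mono)
      fix q :: nat assume "q \<in> {..<2^K}"
      then show "(\<Sum>i<n. (c i q)\<^sup>2) \<le> H" using H(1)[of q] by (simp add: gram_def power2_eq_square)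
    qed simp
    fix q assume "q \<in> {..<(2::nat)^K}"
    then show "(\<Sum>i<n. ((c i q)\<^sup>2)\<^sup>2) \<le> \<delta>\<^sup>2 * H" using prod[of q q] by (simp add: power2_eq_square)
  qed (use H(2) in \<open>simp_all add: prod\<close>)
  also have "\<dots> = ?Q * \<delta> * sqrt H + 2 * ?Q * H / real n + 2 * ?Q\<^sup>2 * H / real n + 2 * ?Q\<^sup>2 * \<delta> * sqrt H"
    by (simp add: power2_eq_square add_divide_distrib mult_ac)
  also have "\<dots> \<le> ?Q\<^sup>2 * \<delta> * sqrt H + 2 * ?Q\<^sup>2 * H / real n + 2 * ?Q\<^sup>2 * H / real n + 2 * ?Q\<^sup>2 * \<delta> * sqrt H"
  proof -
    have Q2: "?Q \<le> ?Q\<^sup>2" using Q1 by (simp add: power2_eq_square)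
    show ?thesis
      using \<delta>(2) H(2) by (intro add_mono mult_right_mono divide_right_mono mult_left_mono Q2) auto
  qed
  also have "\<dots> = 3 * ?Q\<^sup>2 * \<delta> * sqrt H + 4 * ?Q\<^sup>2 * H / real n" by (simp add: field_simps)
  finally show ?thesis .
qed

lemma iexp_remainder: "cmod (iexp x - 1 - \<i> * x) \<le> x\<^sup>2 / 2"
  using iexp_approx1[of x 1] by (simp add: power2_eq_square algebra_simps)

lemma char_derivative_bound:
  assumes c: "col_centered c"
    and \<delta>: "\<And>i q. i < n \<Longrightarrow> q < 2^K \<Longrightarrow> \<bar>c i q\<bar> \<le> \<delta>" "\<delta> \<ge> 0"
    and \<eta>: "avg (\<lambda>Z. \<bar>A2 c Z - sig2 c\<bar>) \<le> \<eta>"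
    and t: "0 \<le> t" "t \<le> 1"
  shows "cmod (avg (\<lambda>Z. \<i> * W c Z * iexp (t * W c Z)) + t * sig2 c * avg (\<lambda>Z. iexp (t * W c Z)))
      \<le> \<eta> + 2 * \<delta> * (sig2 c + \<eta>)"
proof -
  define \<psi> where "\<psi> w = iexp (t * w)" for w :: real
  have norm_\<psi>: "cmod (\<psi> w) = 1" for w by (simp add: \<psi>_def)
  define R where "R Z = (\<Sum>i<n. \<Sum>j<n. \<Delta> c i j Z *\<^sub>R (\<psi> (W c Z + \<Delta> c i j Z) - \<psi> (W c Z)))
      - complex_of_real (4 * real n * A2 c Z) * (\<i> * t * \<psi> (W c Z))" for Z
  have nn: "real n > 0" using n_pos by simp
  have R_le: "cmod (R Z) \<le> 8 * real n * \<delta> * A2 c Z" if Z: "Z \<in> Om" for Z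
  proof -
    have A: "4 * real n * A2 c Z = (\<Sum>i<n. \<Sum>j<n. (\<Delta> c i j Z)\<^sup>2)" using nn by (simp add: A2_def)
    have "R Z = (\<Sum>i<n. \<Sum>j<n. \<Delta> c i j Z *\<^sub>R (\<psi> (W c Z + \<Delta> c i j Z) - \<psi> (W c Z))
        - complex_of_real ((\<Delta> c i j Z)\<^sup>2) * (\<i> * t * \<psi> (W c Z)))"
      by (simp only: R_def A of_real_sum sum_distrib_right sum_subtractf)
    also have "\<dots> = (\<Sum>i<n. \<Sum>j<n. \<Delta> c i j Z * \<psi> (W c Z) * (iexp (t * \<Delta> c i j Z) - 1 - \<i> * complex_of_real (t * \<Delta> c i j Z)))"
    proof (intro sum.cong refl)
      fix i j
      have add: "\<psi> (W c Z + \<Delta> c i j Z) = \<psi> (W c Z) * iexp (t * \<Delta> c i j Z)"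
        unfolding \<psi>_def exp_add[symmetric] by (simp add: distrib_left)
      show "\<Delta> c i j Z *\<^sub>R (\<psi> (W c Z + \<Delta> c i j Z) - \<psi> (W c Z)) - complex_of_real ((\<Delta> c i j Z)\<^sup>2) * (\<i> * t * \<psi> (W c Z))
        = \<Delta> c i j Z * \<psi> (W c Z) * (iexp (t * \<Delta> c i j Z) - 1 - \<i> * complex_of_real (t * \<Delta> c i j Z))"
      proof -
        have "d *\<^sub>R (p * e - p) - complex_of_real (d\<^sup>2) * (\<i> * t * p) = d * p * (e - 1 - \<i> * complex_of_real (t * d))"
          for d :: real and p e :: complex
          by (simp add: scaleR_conv_of_real power2_eq_square algebra_simps)
        then show ?thesis unfolding add .
      qed
    qed
    finally have RZ: "R Z = (\<Sum>i<n. \<Sum>j<n. \<Delta> c i j Z * \<psi> (W c Z) * (iexp (t * \<Delta> c i j Z) - 1 - \<i> * complex_of_real (t * \<Delta> c i j Z)))" .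
    have "cmod (R Z) \<le> (\<Sum>i<n. \<Sum>j<n. cmod (\<Delta> c i j Z * \<psi> (W c Z) * (iexp (t * \<Delta> c i j Z) - 1 - \<i> * complex_of_real (t * \<Delta> c i j Z))))"
      unfolding RZ by (rule order_trans[OF norm_sum]) (intro sum_mono norm_sum)
    also have "\<dots> \<le> (\<Sum>i<n. \<Sum>j<n. 2 * \<delta> * (\<Delta> c i j Z)\<^sup>2)"
    proof (intro sum_mono)
      fix i j assume "i \<in> {..<n}" "j \<in> {..<n}"
      then have ij: "i < n" "j < n" by auto
      have D: "\<bar>\<Delta> c i j Z\<bar> \<le> 4 * \<delta>"
      proof -
        have four: "\<bar>x + y - z - w\<bar> \<le> 4 * \<delta>" if "\<bar>x\<bar> \<le> \<delta>" "\<bar>y\<bar> \<le> \<delta>" "\<bar>z\<bar> \<le> \<delta>" "\<bar>w\<bar> \<le> \<delta>"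
          for x y z w :: real
          using that unfolding abs_le_iff by linarith
        show ?thesis unfolding \<Delta>_def by (intro four \<delta>(1) OmD(1)[OF Z] ij)
      qed
      have "t\<^sup>2 \<le> 1" using t by (simp add: power_le_one)
      then have "(t * \<Delta> c i j Z)\<^sup>2 / 2 \<le> (\<Delta> c i j Z)\<^sup>2 / 2"
        using mult_right_mono[of "t\<^sup>2" 1 "(\<Delta> c i j Z)\<^sup>2"] by (simp add: power_mult_distrib)
      then have r: "cmod (iexp (t * \<Delta> c i j Z) - 1 - \<i> * complex_of_real (t * \<Delta> c i j Z)) \<le> (\<Delta> c i j Z)\<^sup>2 / 2"
        by (rule order_trans[OF iexp_remainder])
      have "cmod (\<Delta> c i j Z * \<psi> (W c Z) * (iexp (t * \<Delta> c i j Z) - 1 - \<i> * complex_of_real (t * \<Delta> c i j Z)))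
         = \<bar>\<Delta> c i j Z\<bar> * cmod (iexp (t * \<Delta> c i j Z) - 1 - \<i> * complex_of_real (t * \<Delta> c i j Z))"
        by (simp only: norm_mult norm_\<psi> norm_of_real mult_1_right)
      also have "\<dots> \<le> (4 * \<delta>) * ((\<Delta> c i j Z)\<^sup>2 / 2)"
        by (rule mult_mono[OF D r]) (use \<delta>(2) in simp_all)
      finally show "cmod (\<Delta> c i j Z * \<psi> (W c Z) * (iexp (t * \<Delta> c i j Z) - 1 - \<i> * complex_of_real (t * \<Delta> c i j Z)))
         \<le> 2 * \<delta> * (\<Delta> c i j Z)\<^sup>2" by simp
    qed
    also have "\<dots> = 2 * \<delta> * (4 * real n * A2 c Z)" unfolding A by (simp only: sum_distrib_left)
    finally show ?thesis by (simp only: mult_ac)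
  qed
  have Stein: "(4 * real n) *\<^sub>R avg (\<lambda>Z. W c Z *\<^sub>R \<psi> (W c Z))
      = avg R + avg (\<lambda>Z. (4 * real n * A2 c Z) * (\<i> * t * \<psi> (W c Z)))"
    unfolding Stein_identity[OF c, symmetric] avg_add[symmetric] by (rule avg_cong) (simp add: R_def)
  have "avg (\<lambda>Z. (4 * real n * A2 c Z) * (\<i> * t * \<psi> (W c Z)))
      = (4 * real n) * (\<i> * t) * avg (\<lambda>Z. A2 c Z * \<psi> (W c Z))"
    unfolding avg_mult_left[symmetric] by (rule avg_cong) (simp add: mult_ac)
  note Stein' = Stein[unfolded this]
  have alg: "a = r / complex_of_real N + z" if "N *\<^sub>R a = r + N * (\<i> * t) * b" "z = \<i> * t * b" "N \<noteq> 0"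
    for N :: real and a b r z :: complex
    using that by (simp add: scaleR_conv_of_real field_simps)
  have E: "avg (\<lambda>Z. W c Z *\<^sub>R \<psi> (W c Z)) = avg R / (4 * real n) + \<i> * t * avg (\<lambda>Z. A2 c Z * \<psi> (W c Z))"
    using Stein' nn by (intro alg[OF _ refl]) auto
  have "avg (\<lambda>Z. \<i> * W c Z * iexp (t * W c Z)) = \<i> * avg (\<lambda>Z. W c Z *\<^sub>R \<psi> (W c Z))"
    unfolding avg_mult_left[symmetric] by (rule avg_cong) (simp add: \<psi>_def scaleR_conv_of_real)
  also have "\<dots> = \<i> * (avg R / (4 * real n)) - t * avg (\<lambda>Z. A2 c Z * \<psi> (W c Z))"
  proof -
    have "\<i> * (r + \<i> * t * b) = \<i> * r - t * b" for r b :: complex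
      by (simp add: algebra_simps)
    then show ?thesis unfolding E .
  qed
  finally have F: "avg (\<lambda>Z. \<i> * W c Z * iexp (t * W c Z)) = \<i> * (avg R / (4 * real n)) - t * avg (\<lambda>Z. A2 c Z * \<psi> (W c Z))" .
  have "avg (\<lambda>Z. (A2 c Z - sig2 c) * \<psi> (W c Z)) = avg (\<lambda>Z. A2 c Z * \<psi> (W c Z)) + avg (\<lambda>Z. (- sig2 c) * \<psi> (W c Z))"
    unfolding avg_add[symmetric] by (rule avg_cong) (simp add: left_diff_distrib)
  moreover have "avg (\<lambda>Z. (- sig2 c) * \<psi> (W c Z)) = (- sig2 c) * avg (\<lambda>Z. iexp (t * W c Z))"
    unfolding avg_mult_left \<psi>_def ..
  ultimately have G: "avg (\<lambda>Z. A2 c Z * \<psi> (W c Z)) = avg (\<lambda>Z. (A2 c Z - sig2 c) * \<psi> (W c Z)) + sig2 c * avg (\<lambda>Z. iexp (t * W c Z))"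
    by simp
  have FG: "avg (\<lambda>Z. \<i> * W c Z * iexp (t * W c Z)) + t * sig2 c * avg (\<lambda>Z. iexp (t * W c Z))
     = \<i> * (avg R / (4 * real n)) - t * avg (\<lambda>Z. (A2 c Z - sig2 c) * \<psi> (W c Z))"
  proof -
    have "x - t * (y + sig2 c * z) + t * sig2 c * z = x - t * y" for x y z :: complex
      by (simp add: algebra_simps)
    then show ?thesis unfolding F G .
  qed
  have "cmod (avg (\<lambda>Z. \<i> * W c Z * iexp (t * W c Z)) + t * sig2 c * avg (\<lambda>Z. iexp (t * W c Z)))
     \<le> cmod (avg R) / (4 * real n) + t * cmod (avg (\<lambda>Z. (A2 c Z - sig2 c) * \<psi> (W c Z)))"
    unfolding FG by (rule order_trans[OF norm_triangle_ineq4]) (use t in \<open>simp add: norm_mult norm_divide\<close>)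
  also have "\<dots> \<le> 2 * \<delta> * (sig2 c + \<eta>) + 1 * \<eta>"
  proof (intro add_mono mult_mono)
    have "cmod (avg (\<lambda>Z. (A2 c Z - sig2 c) * \<psi> (W c Z))) \<le> avg (\<lambda>Z. \<bar>A2 c Z - sig2 c\<bar>)"
      by (rule order_trans[OF norm_avg_le])
        (simp only: norm_mult norm_\<psi> mult_1_right norm_of_real order_refl)
    then show "cmod (avg (\<lambda>Z. (A2 c Z - sig2 c) * \<psi> (W c Z))) \<le> \<eta>" using \<eta> by simp
    have "avg (A2 c) \<le> avg (\<lambda>Z. sig2 c + \<bar>A2 c Z - sig2 c\<bar>)" by (rule avg_mono) linarith
    then have A: "avg (A2 c) \<le> sig2 c + \<eta>" using \<eta> by (simp add: avg_add avg_const)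
    have "cmod (avg R) \<le> avg (\<lambda>Z. 8 * real n * \<delta> * A2 c Z)"
      by (rule order_trans[OF norm_avg_le]) (intro avg_mono R_le)
    also have "\<dots> = 8 * real n * \<delta> * avg (A2 c)" by (rule avg_mult_left)
    also have "\<dots> \<le> 8 * real n * \<delta> * (sig2 c + \<eta>)" using A \<delta>(2) by (intro mult_left_mono) auto
    finally show "cmod (avg R) / (4 * real n) \<le> 2 * \<delta> * (sig2 c + \<eta>)"
      using nn by (simp add: divide_le_eq mult_ac)
  qed (use t in auto)
  finally show ?thesis by simp
qed

lemma char_function_bound:
  assumes c: "col_centered c"
    and \<delta>: "\<And>i q. i < n \<Longrightarrow> q < 2^K \<Longrightarrow> \<bar>c i q\<bar> \<le> \<delta>" "\<delta> \<ge> 0"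
    and \<eta>: "avg (\<lambda>Z. \<bar>A2 c Z - sig2 c\<bar>) \<le> \<eta>"
  shows "cmod (avg (\<lambda>Z. iexp (W c Z)) - exp (- sig2 c / 2)) \<le> \<eta> + 2 * \<delta> * (sig2 c + \<eta>)"
proof -
  define \<phi> where "\<phi> t = avg (\<lambda>Z. iexp (t * W c Z))" for t :: real
  define \<phi>' where "\<phi>' t = avg (\<lambda>Z. \<i> * W c Z * iexp (t * W c Z))" for t :: real
  define E where "E t = exp (sig2 c * t\<^sup>2 / 2)" for t :: real
  define \<epsilon> where "\<epsilon> = \<eta> + 2 * \<delta> * (sig2 c + \<eta>)"
  have d1: "(\<phi> has_vector_derivative \<phi>' t) (at t within S)" for t S
  proof -
    have "((\<lambda>t. iexp (t * w)) has_vector_derivative \<i> * w * iexp (t * w)) (at t within S)" for w :: real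
    proof -
      have "((\<lambda>t. t * w) has_vector_derivative w) (at t within S)"
        by (auto intro!: derivative_eq_intros)
      from vector_diff_chain_within[OF this has_vector_derivative_iexp] show ?thesis
        by (simp add: o_def scaleR_conv_of_real mult_ac)
    qed
    then show ?thesis unfolding \<phi>_def \<phi>'_def avg_def
      by (intro bounded_linear.has_vector_derivative[OF bounded_linear_scaleR_right] has_vector_derivative_sum)
  qed
  have d2: "((\<lambda>t. complex_of_real (E t)) has_vector_derivative complex_of_real (t * sig2 c * E t)) (at t within S)" for t S
  proof -
    have "(E has_field_derivative t * sig2 c * E t) (at t within S)"
      unfolding E_def by (auto intro!: derivative_eq_intros)
    then show ?thesis by (intro has_vector_derivative_of_real) (simp add: has_real_derivative_iff_has_vector_derivative)
  qed
  define g where "g t = \<phi> t * E t" for t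
  define g' where "g' t = (\<phi>' t + t * sig2 c * \<phi> t) * E t" for t
  have dg: "(g has_vector_derivative g' t) (at t within S)" for t S
    unfolding g_def g'_def using has_vector_derivative_mult[OF d1 d2, of t S] by (simp add: algebra_simps)
  have "norm (g 1 - g 0) \<le> (\<epsilon> * E 1) * norm (1 - 0 :: real)"
  proof (rule differentiable_bound[of "{0..1::real}" g "\<lambda>t h. h *\<^sub>R g' t"])
    show "(g has_derivative (\<lambda>h. h *\<^sub>R g' t)) (at t within {0..1})" if "t \<in> {0..1}" for t
      using dg unfolding has_vector_derivative_def .
    show "onorm (\<lambda>h. h *\<^sub>R g' t) \<le> \<epsilon> * E 1" if t: "t \<in> {0..1}" for t
    proof (rule onorm_le)
      fix h :: real
      have 1: "cmod (\<phi>' t + t * sig2 c * \<phi> t) \<le> \<epsilon>"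
        unfolding \<phi>_def \<phi>'_def \<epsilon>_def using t by (intro char_derivative_bound assms) auto
      have 2: "E t \<le> E 1"
      proof -
        have "t\<^sup>2 \<le> 1" using t by (simp add: power_le_one)
        then show ?thesis unfolding E_def using sig2_nonneg[of c] by (simp add: mult_left_le)
      qed
      have "cmod (g' t) = cmod (\<phi>' t + t * sig2 c * \<phi> t) * E t"
        unfolding g'_def norm_mult[of _ "complex_of_real (E t)"] by (simp add: E_def)
      also have "\<dots> \<le> \<epsilon> * E 1"
        using 1 2 order_trans[OF norm_ge_zero 1] by (intro mult_mono) (auto simp: E_def)
      finally show "norm (h *\<^sub>R g' t) \<le> \<epsilon> * E 1 * norm h"
        using mult_left_mono[of "cmod (g' t)" "\<epsilon> * E 1" "\<bar>h\<bar>"] by (simp add: mult_ac)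
    qed
  qed auto
  then have "cmod (\<phi> 1 * E 1 - 1) \<le> \<epsilon> * E 1"
    by (simp add: g_def \<phi>_def E_def avg_const)
  moreover have "\<phi> 1 - exp (- sig2 c / 2) = (\<phi> 1 * E 1 - 1) / E 1"
    by (simp add: E_def diff_divide_distrib exp_minus inverse_eq_divide exp_of_real)
  ultimately have "cmod (\<phi> 1 - exp (- sig2 c / 2)) \<le> \<epsilon>"
    by (simp add: norm_divide E_def divide_le_eq del: of_real_exp)
  then show ?thesis unfolding \<phi>_def \<epsilon>_def by simp
qed

lemma integral_crfe: "(\<integral>Z. F Z \<partial>crfe K n nq) = avg F" for F :: "_ \<Rightarrow> real"
  unfolding crfe_def avg_def Om_def[symmetric]
  using integral_pmf_of_set[OF Om_nonempty finite_Om, of F] by (simp add: field_simps)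

lemma Re_avg: "Re (avg F) = avg (\<lambda>Z. Re (F Z))"
  by (simp add: avg_def)

lemma integral_cos_bound:
  assumes c: "col_centered c"
    and \<delta>: "\<And>i q. i < n \<Longrightarrow> q < 2^K \<Longrightarrow> \<bar>c i q\<bar> \<le> \<delta>" "\<delta> \<ge> 0"
    and H: "\<And>q. q < 2^K \<Longrightarrow> gram c q q \<le> H" "H \<ge> 0"
  defines "\<eta> \<equiv> 3 * (2^K)\<^sup>2 * \<delta> * sqrt H + 4 * (2^K)\<^sup>2 * H / real n"
  shows "\<bar>(\<integral>Z. cos (W c Z + \<theta>) \<partial>crfe K n nq) - cos \<theta> * exp (- sig2 c / 2)\<bar> \<le> \<eta> + 2 * \<delta> * (sig2 c + \<eta>)"
proof -
  have \<eta>: "avg (\<lambda>Z. \<bar>A2 c Z - sig2 c\<bar>) \<le> \<eta>" unfolding \<eta>_def by (rule A2_deviation[OF c \<delta> H])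
  have 1: "avg (\<lambda>Z. cos (W c Z + \<theta>)) = Re (iexp \<theta> * avg (\<lambda>Z. iexp (W c Z)))"
    unfolding avg_mult_left[symmetric] Re_avg
    by (rule avg_cong) (simp add: Re_exp Im_exp cos_add algebra_simps)
  have 2: "cos \<theta> * exp (- sig2 c / 2) = Re (iexp \<theta> * complex_of_real (exp (- sig2 c / 2)))"
    by (simp add: Re_exp)
  have "\<bar>avg (\<lambda>Z. cos (W c Z + \<theta>)) - cos \<theta> * exp (- sig2 c / 2)\<bar>
      = \<bar>Re (iexp \<theta> * (avg (\<lambda>Z. iexp (W c Z)) - complex_of_real (exp (- sig2 c / 2))))\<bar>"
    unfolding 1 2 right_diff_distrib minus_complex.sel(1) ..
  also have "\<dots> \<le> cmod (iexp \<theta> * (avg (\<lambda>Z. iexp (W c Z)) - complex_of_real (exp (- sig2 c / 2))))"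
    by (rule abs_Re_le_cmod)
  also have "\<dots> = cmod (avg (\<lambda>Z. iexp (W c Z)) - complex_of_real (exp (- sig2 c / 2)))"
    by (simp only: norm_mult norm_exp_i_times mult_1_left)
  also have "\<dots> \<le> \<eta> + 2 * \<delta> * (sig2 c + \<eta>)" by (rule char_function_bound[OF c \<delta> \<eta>])
  finally show ?thesis unfolding integral_crfe .
qed

end

theorem combinatorial_CLT:
  fixes N :: "nat \<Rightarrow> nat" and nq :: "nat \<Rightarrow> nat \<Rightarrow> nat" and c :: "nat \<Rightarrow> nat \<Rightarrow> nat \<Rightarrow> real"
  assumes design: "\<And>m. crfe_design K (N m) (nq m)"
    and N: "filterlim N at_top sequentially"
    and centered: "\<And>m q. q < 2^K \<Longrightarrow> (\<Sum>i<N m. c m i q) = 0"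
    and \<delta>: "\<And>m i q. i < N m \<Longrightarrow> q < 2^K \<Longrightarrow> \<bar>c m i q\<bar> \<le> \<delta> m" "\<delta> \<longlonglongrightarrow> 0"
    and gram: "\<And>q k. q < 2^K \<Longrightarrow> k < 2^K \<Longrightarrow> (\<lambda>m. \<Sum>i<N m. c m i q * c m i k) \<longlonglongrightarrow> \<kappa> q k"
    and share: "\<And>q. q < 2^K \<Longrightarrow> (\<lambda>m. real (nq m q) / real (N m)) \<longlonglongrightarrow> p q"
  defines "s2 \<equiv> (\<Sum>q<2^K. p q * \<kappa> q q) - (\<Sum>q<2^K. \<Sum>k<2^K. p q * p k * \<kappa> q k)"
  shows "(\<lambda>m. \<integral>Z. cos ((\<Sum>i<N m. c m i (Z i)) + \<theta>) \<partial>crfe K (N m) (nq m)) \<longlonglongrightarrow> cos \<theta> * exp (- s2 / 2)"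
    and "s2 \<ge> 0"
proof -
  define V where "V m = crfe_design.sig2 K (N m) (nq m) (c m)" for m
  have V: "V \<longlonglongrightarrow> s2"
    unfolding V_def crfe_design.sig2_def[OF design] crfe_design.gram_def[OF design]
      crfe_design.share_def[OF design] s2_def
    by (intro tendsto_intros gram share) auto
  have "V m \<ge> 0" for m unfolding V_def by (rule crfe_design.sig2_nonneg[OF design])
  then show "s2 \<ge> 0" by (intro LIMSEQ_le_const[OF V]) auto
  have "\<exists>B. \<forall>m. (\<Sum>i<N m. c m i q * c m i q) \<le> B" if "q < 2^K" for q
  proof -
    have "Bseq (\<lambda>m. \<Sum>i<N m. c m i q * c m i q)"
      using gram[OF that that] by (intro convergent_imp_Bseq convergentI)
    then obtain B where B: "\<And>m. norm (\<Sum>i<N m. c m i q * c m i q) \<le> B" unfolding Bseq_def by auto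
    show ?thesis
    proof (intro exI[of _ B] allI)
      show "(\<Sum>i<N m. c m i q * c m i q) \<le> B" for m using B[of m] by simp
    qed
  qed
  then obtain B where B: "\<And>q m. q < 2^K \<Longrightarrow> (\<Sum>i<N m. c m i q * c m i q) \<le> B q" by metis
  define H where "H = (\<Sum>q<2^K. \<bar>B q\<bar>)"
  have H: "(\<Sum>i<N m. c m i q * c m i q) \<le> H" if "q < 2^K" for q m
    using B[OF that, of m] member_le_sum[of q "{..<2^K}" "\<lambda>q. \<bar>B q\<bar>"] that unfolding H_def by auto
  have H0: "H \<ge> 0" unfolding H_def by (intro sum_nonneg) auto
  define \<eta> where "\<eta> m = 3 * (2^K)\<^sup>2 * \<bar>\<delta> m\<bar> * sqrt H + 4 * (2^K)\<^sup>2 * H / real (N m)" for m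
  have bound: "norm ((\<integral>Z. cos ((\<Sum>i<N m. c m i (Z i)) + \<theta>) \<partial>crfe K (N m) (nq m)) - cos \<theta> * exp (- V m / 2))
     \<le> \<eta> m + 2 * \<bar>\<delta> m\<bar> * (V m + \<eta> m)" for m
  proof -
    have "\<bar>(\<integral>Z. cos (crfe_design.W (N m) (c m) Z + \<theta>) \<partial>crfe K (N m) (nq m)) - cos \<theta> * exp (- V m / 2)\<bar>
      \<le> \<eta> m + 2 * \<bar>\<delta> m\<bar> * (V m + \<eta> m)"
      unfolding \<eta>_def V_def
    proof (rule crfe_design.integral_cos_bound[OF design])
      show "crfe_design.col_centered K (N m) (c m)"
        unfolding crfe_design.col_centered_def[OF design] using centered by blast
      show "\<bar>c m i q\<bar> \<le> \<bar>\<delta> m\<bar>" if "i < N m" "q < 2^K" for i q using \<delta>(1)[OF that] by simp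
      show "crfe_design.gram (N m) (c m) q q \<le> H" if "q < 2^K" for q
        unfolding crfe_design.gram_def[OF design] by (rule H[OF that])
    qed (simp_all add: H0)
    then show ?thesis unfolding crfe_design.W_def[OF design] real_norm_def .
  qed
  have lim0: "(\<lambda>m. \<eta> m + 2 * \<bar>\<delta> m\<bar> * (V m + \<eta> m)) \<longlonglongrightarrow> 0"
  proof -
    have 1: "(\<lambda>m. \<bar>\<delta> m\<bar>) \<longlonglongrightarrow> 0" using \<delta>(2) by (rule tendsto_rabs_zero)
    have 2: "(\<lambda>m. 4 * (2^K)\<^sup>2 * H / real (N m)) \<longlonglongrightarrow> 0"
      by (intro tendsto_divide_0[OF tendsto_const] filterlim_at_top_imp_at_infinity
          filterlim_compose[OF filterlim_real_sequentially N])
    have "\<eta> \<longlonglongrightarrow> 3 * (2^K)\<^sup>2 * 0 * sqrt H + 0"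
      unfolding \<eta>_def by (intro tendsto_intros 1 2)
    then have 3: "\<eta> \<longlonglongrightarrow> 0" by simp
    have "(\<lambda>m. \<eta> m + 2 * \<bar>\<delta> m\<bar> * (V m + \<eta> m)) \<longlonglongrightarrow> 0 + 2 * 0 * (s2 + 0)"
      by (intro tendsto_intros 1 V 3)
    then show ?thesis by simp
  qed
  have z0: "(\<lambda>m. (\<integral>Z. cos ((\<Sum>i<N m. c m i (Z i)) + \<theta>) \<partial>crfe K (N m) (nq m)) - cos \<theta> * exp (- V m / 2)) \<longlonglongrightarrow> 0"
    by (rule Lim_null_comparison[OF always_eventually lim0]) (intro allI bound)
  have l: "(\<lambda>m. cos \<theta> * exp (- V m / 2)) \<longlonglongrightarrow> cos \<theta> * exp (- s2 / 2)"
    by (intro tendsto_intros V) auto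
  show "(\<lambda>m. \<integral>Z. cos ((\<Sum>i<N m. c m i (Z i)) + \<theta>) \<partial>crfe K (N m) (nq m)) \<longlonglongrightarrow> cos \<theta> * exp (- s2 / 2)"
    using tendsto_add[OF z0 l] by simp
qed

section \<open>Factorial contrasts\<close>

lemma sum_lessThan_add: "(\<Sum>i<m + n. h i) = (\<Sum>i<m. h i) + (\<Sum>i<n. h (m + i))" for m n :: nat
  by (induction n) (simp_all add: add.assoc)

lemma sum_double: "(\<Sum>i<2 ^ Suc K. h i) = (\<Sum>i<2 ^ K. h i) + (\<Sum>i<2 ^ K. h (2 ^ K + i :: nat))"
  unfolding power_Suc mult_2 by (rule sum_lessThan_add)

lemma odd_div_add_power: "k < K \<Longrightarrow> odd ((2 ^ K + f) div 2 ^ k) = odd (f div 2 ^ k)" for f :: nat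
proof -
  assume k: "k < K"
  have "(2 ^ K :: nat) = 2 ^ k * 2 ^ (K - k)" using k by (simp add: power_add[symmetric])
  then have "(2 ^ K + f) div 2 ^ k = 2 ^ (K - k) + f div 2 ^ k" by simp
  then show ?thesis using k by simp
qed

lemma gcoef_Suc: "gcoef (Suc K) f q = gcoef K f q * (if odd (f div 2 ^ K) then iota K q else 1)"
  by (simp add: gcoef_def)

lemma gcoef_shift_effect: "gcoef K (2 ^ K + f) q = gcoef K f q"
  unfolding gcoef_def by (intro prod.cong refl) (simp add: odd_div_add_power)

lemma gcoef_shift_treatment: "gcoef K f (2 ^ K + q) = gcoef K f q"
  unfolding gcoef_def iota_def by (intro prod.cong refl) (simp add: odd_div_add_power)

lemma gcoef_0: "gcoef K 0 q = 1" by (simp add: gcoef_def)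

lemma mod_power_Suc_eq_iff:
  "q mod 2 ^ Suc K = k mod 2 ^ Suc K \<longleftrightarrow> q mod 2 ^ K = k mod 2 ^ K \<and> (odd (q div 2 ^ K) \<longleftrightarrow> odd (k div 2 ^ K))"
  for q k :: nat
proof -
  have s: "x mod 2 ^ Suc K = 2 ^ K * (x div 2 ^ K mod 2) + x mod 2 ^ K" for x :: nat
    unfolding power_Suc2 by (rule mod_mult2_eq)
  show ?thesis
  proof
    assume eq: "q mod 2 ^ Suc K = k mod 2 ^ Suc K"
    have "q mod 2 ^ Suc K mod 2 ^ K = k mod 2 ^ Suc K mod 2 ^ K" using eq by simp
    then have 1: "q mod 2 ^ K = k mod 2 ^ K" unfolding s by simp
    then have "q div 2 ^ K mod 2 = k div 2 ^ K mod 2" using eq unfolding s by simp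
    then show "q mod 2 ^ K = k mod 2 ^ K \<and> (odd (q div 2 ^ K) \<longleftrightarrow> odd (k div 2 ^ K))"
      using 1 by (simp add: odd_iff_mod_2_eq_one)
  next
    assume "q mod 2 ^ K = k mod 2 ^ K \<and> (odd (q div 2 ^ K) \<longleftrightarrow> odd (k div 2 ^ K))"
    then show "q mod 2 ^ Suc K = k mod 2 ^ Suc K" unfolding s by (simp add: mod_2_eq_odd)
  qed
qed

lemma gcoef_complete_mod:
  "(\<Sum>f<2 ^ K. gcoef K f q * gcoef K f k) = (if q mod 2 ^ K = k mod 2 ^ K then 2 ^ K else 0)"
proof (induction K)
  case 0
  show ?case by (simp add: gcoef_def)
next
  case (Suc K)
  have lo: "gcoef (Suc K) f x = gcoef K f x" if "f < 2 ^ K" for f x using that by (simp add: gcoef_Suc)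
  have hi: "gcoef (Suc K) (2 ^ K + f) x = gcoef K f x * iota K x" if "f < 2 ^ K" for f x
    using that by (simp add: gcoef_Suc gcoef_shift_effect)
  have "(\<Sum>f<2 ^ Suc K. gcoef (Suc K) f q * gcoef (Suc K) f k)
     = (\<Sum>f<2 ^ K. gcoef K f q * gcoef K f k) + (\<Sum>f<2 ^ K. (iota K q * iota K k) * (gcoef K f q * gcoef K f k))"
    unfolding sum_double by (intro arg_cong2[where f="(+)"] sum.cong refl) (simp_all add: lo hi mult_ac)
  also have "\<dots> = (1 + iota K q * iota K k) * (\<Sum>f<2 ^ K. gcoef K f q * gcoef K f k)"
    by (subst distrib_right) (simp only: sum_distrib_left mult_1_left)
  also have "\<dots> = (if q mod 2 ^ Suc K = k mod 2 ^ Suc K then 2 ^ Suc K else 0)"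
    unfolding Suc.IH mod_power_Suc_eq_iff by (auto simp: iota_def)
  finally show ?case .
qed

lemma gcoef_orthogonal_mod:
  "(\<Sum>q<2 ^ K. gcoef K f q * gcoef K f' q) = (if f mod 2 ^ K = f' mod 2 ^ K then 2 ^ K else 0)"
proof (induction K)
  case 0
  show ?case by (simp add: gcoef_def)
next
  case (Suc K)
  let ?e = "\<lambda>f b. if odd (f div 2 ^ K) then b else (1::real)"
  have lo: "gcoef (Suc K) f q = gcoef K f q * ?e f (-1)" if "q < 2 ^ K" for f q using that by (simp add: gcoef_Suc iota_def)
  have hi: "gcoef (Suc K) f (2 ^ K + q) = gcoef K f q * ?e f 1" if "q < 2 ^ K" for f q
    using that by (simp add: gcoef_Suc gcoef_shift_treatment iota_def)
  have "(\<Sum>q<2 ^ Suc K. gcoef (Suc K) f q * gcoef (Suc K) f' q)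
     = (\<Sum>q<2 ^ K. (?e f (-1) * ?e f' (-1)) * (gcoef K f q * gcoef K f' q)) + (\<Sum>q<2 ^ K. (?e f 1 * ?e f' 1) * (gcoef K f q * gcoef K f' q))"
    unfolding sum_double by (intro arg_cong2[where f="(+)"] sum.cong refl) (simp_all only: lo hi lessThan_iff mult_ac)
  also have "\<dots> = (?e f (-1) * ?e f' (-1) + ?e f 1 * ?e f' 1) * (\<Sum>q<2 ^ K. gcoef K f q * gcoef K f' q)"
    by (subst distrib_right) (simp only: sum_distrib_left)
  also have "\<dots> = (if f mod 2 ^ Suc K = f' mod 2 ^ Suc K then 2 ^ Suc K else 0)"
    unfolding Suc.IH mod_power_Suc_eq_iff by auto
  finally show ?case .
qed

lemma gcoef_orthogonal:
  assumes "f \<in> effs K" "f' \<in> effs K"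
  shows "(\<Sum>q<2 ^ K. gcoef K f q * gcoef K f' q) = (if f = f' then 2 ^ K else 0)"
  using assms gcoef_orthogonal_mod[of K f f'] by (simp add: effs_def)

lemma gcoef_sum_zero:
  assumes "f \<in> effs K"
  shows "(\<Sum>q<2 ^ K. gcoef K f q) = 0"
  using assms gcoef_orthogonal_mod[of K f 0] by (auto simp: effs_def gcoef_0)

lemma gcoef_complete:
  assumes "q < 2 ^ K" "k < 2 ^ K"
  shows "(\<Sum>f\<in>effs K. gcoef K f q * gcoef K f k) = (if q = k then 2 ^ K else 0) - 1"
proof -
  have "{..<2 ^ K} = insert 0 (effs K)" by (auto simp: effs_def)
  then have "(\<Sum>f<2 ^ K. gcoef K f q * gcoef K f k) = 1 + (\<Sum>f\<in>effs K. gcoef K f q * gcoef K f k)"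
    by (simp add: effs_def gcoef_0)
  then show ?thesis using gcoef_complete_mod[of K q k] assms by simp
qed

lemma finite_effs: "finite (effs K)" by (simp add: effs_def)

text \<open>The Gram matrix of the contrasts under the weights \<open>1 / p\<close>, and its inverse, which is a
  quarter of the covariance matrix of the contrasts under the distribution \<open>p\<close>.\<close>

definition contrast_gram :: "nat \<Rightarrow> (nat \<Rightarrow> real) \<Rightarrow> nat \<Rightarrow> nat \<Rightarrow> real" where
  "contrast_gram K p f f' = (\<Sum>q<2^K. gcoef K f q * gcoef K f' q / p q) / (2^(K-1))^2"

definition contrast_cov :: "nat \<Rightarrow> (nat \<Rightarrow> real) \<Rightarrow> nat \<Rightarrow> nat \<Rightarrow> real" where
  "contrast_cov K p f f' = (\<Sum>q<2^K. p q * gcoef K f q * gcoef K f' q)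
     - (\<Sum>q<2^K. p q * gcoef K f q) * (\<Sum>q<2^K. p q * gcoef K f' q)"

lemma sum_effs_contrast:
  assumes r: "r < 2 ^ K"
  shows "(\<Sum>f\<in>effs K. (\<Sum>q<2^K. \<alpha> q * gcoef K f q) * gcoef K f r) = 2 ^ K * \<alpha> r - (\<Sum>q<2^K. \<alpha> q)"
proof -
  have "(\<Sum>f\<in>effs K. (\<Sum>q<2^K. \<alpha> q * gcoef K f q) * gcoef K f r)
      = (\<Sum>q<2^K. \<alpha> q * (\<Sum>f\<in>effs K. gcoef K f q * gcoef K f r))"
    unfolding sum_distrib_left sum_distrib_right by (subst sum.swap) (simp add: mult_ac)
  also have "\<dots> = (\<Sum>q<2^K. \<alpha> q * ((if q = r then 2 ^ K else 0) - 1))"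
    using r by (intro sum.cong refl) (simp add: gcoef_complete)
  also have "\<dots> = (\<Sum>q<2^K. (if q = r then \<alpha> r * 2 ^ K else 0) - \<alpha> q)"
    by (intro sum.cong refl) (simp add: right_diff_distrib)
  also have "\<dots> = 2 ^ K * \<alpha> r - (\<Sum>q<2^K. \<alpha> q)"
    using r by (simp add: sum_subtractf)
  finally show ?thesis .
qed

lemma sum_effs_contrast_mean:
  assumes p: "(\<Sum>q<2^K. p q) = 1"
  shows "(\<Sum>f\<in>effs K. (\<Sum>q<2^K. \<alpha> q * gcoef K f q) * (\<Sum>r<2^K. p r * gcoef K f r))
     = 2 ^ K * (\<Sum>r<2^K. p r * \<alpha> r) - (\<Sum>q<2^K. \<alpha> q)"
proof -
  have "(\<Sum>f\<in>effs K. (\<Sum>q<2^K. \<alpha> q * gcoef K f q) * (\<Sum>r<2^K. p r * gcoef K f r))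
      = (\<Sum>r<2^K. p r * (\<Sum>f\<in>effs K. (\<Sum>q<2^K. \<alpha> q * gcoef K f q) * gcoef K f r))"
    unfolding sum_distrib_left[of "\<Sum>q<2^K. \<alpha> q * gcoef K _ q"] sum_distrib_left[of "p _"]
    by (subst sum.swap) (simp add: mult_ac)
  also have "\<dots> = (\<Sum>r<2^K. p r * (2 ^ K * \<alpha> r - (\<Sum>q<2^K. \<alpha> q)))"
    by (intro sum.cong refl) (simp add: sum_effs_contrast)
  also have "\<dots> = 2 ^ K * (\<Sum>r<2^K. p r * \<alpha> r) - (\<Sum>r<2^K. p r) * (\<Sum>q<2^K. \<alpha> q)"
    by (simp only: right_diff_distrib sum_subtractf sum_distrib_left sum_distrib_right mult_ac)
  finally show ?thesis by (simp only: p mult_1_left)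
qed

lemma sum_scale_diff:
  "(\<Sum>f\<in>E. c * (u f - b * v f)) = c * (sum u E - b * sum v E)" for c b :: real
  by (simp add: sum_distrib_left[symmetric] sum_subtractf)

lemma sum_effs_contrast_cov:
  assumes p: "(\<Sum>q<2^K. p q) = 1"
  shows "(\<Sum>f\<in>effs K. (\<Sum>q<2^K. \<alpha> q * gcoef K f q) * contrast_cov K p f f')
     = 2 ^ K * ((\<Sum>r<2^K. p r * \<alpha> r * gcoef K f' r) - (\<Sum>r<2^K. p r * \<alpha> r) * (\<Sum>r<2^K. p r * gcoef K f' r))"
proof -
  let ?a = "\<lambda>f. \<Sum>q<2^K. \<alpha> q * gcoef K f q" and ?s = "\<Sum>q<2^K. \<alpha> q" and ?m = "\<Sum>r<2^K. p r * gcoef K f' r"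
  have "(\<Sum>f\<in>effs K. ?a f * contrast_cov K p f f')
     = (\<Sum>f\<in>effs K. \<Sum>r<2^K. (p r * gcoef K f' r) * (?a f * gcoef K f r)) - ?m * (\<Sum>f\<in>effs K. ?a f * (\<Sum>r<2^K. p r * gcoef K f r))"
  proof -
    have key: "x * contrast_cov K p f f' = 1 * ((\<Sum>r<2^K. (p r * gcoef K f' r) * (x * gcoef K f r)) - ?m * (x * (\<Sum>r<2^K. p r * gcoef K f r)))"
      for x f
    proof -
      have "x * (\<Sum>r<2^K. p r * gcoef K f r * gcoef K f' r) = (\<Sum>r<2^K. (p r * gcoef K f' r) * (x * gcoef K f r))"
        by (simp add: sum_distrib_left mult_ac)
      moreover have "x * (y * z) = z * (x * y)" for y z by (simp only: mult_ac)
      ultimately show ?thesis unfolding contrast_cov_def right_diff_distrib by simp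
    qed
    show ?thesis unfolding key sum_scale_diff by (simp only: mult_1_left)
  qed
  also have "(\<Sum>f\<in>effs K. \<Sum>r<2^K. (p r * gcoef K f' r) * (?a f * gcoef K f r))
     = (\<Sum>r<2^K. (p r * gcoef K f' r) * (\<Sum>f\<in>effs K. ?a f * gcoef K f r))"
    by (subst sum.swap) (simp only: sum_distrib_left)
  also have "\<dots> = (\<Sum>r<2^K. (p r * gcoef K f' r) * (2 ^ K * \<alpha> r - ?s))"
    by (intro sum.cong refl) (simp add: sum_effs_contrast)
  also have "\<dots> = 2 ^ K * (\<Sum>r<2^K. p r * \<alpha> r * gcoef K f' r) - ?m * ?s"
    by (simp only: right_diff_distrib sum_subtractf sum_distrib_left sum_distrib_right mult_ac)
  finally show ?thesis unfolding sum_effs_contrast_mean[OF p] by (simp add: algebra_simps)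
qed

lemma power_double: "K \<ge> 1 \<Longrightarrow> (2::real) ^ K = 2 * 2 ^ (K - 1)"
  by (cases K) auto

lemma contrast_gram_inverse:
  assumes K: "K \<ge> 1" and p: "(\<Sum>q<2^K. p q) = 1" "\<And>q. q < 2^K \<Longrightarrow> p q > 0"
  shows "inverse_on (effs K) (contrast_gram K p) (\<lambda>f f'. contrast_cov K p f f' / 4)"
proof -
  let ?h = "2 ^ (K - 1) :: real"
  have *: "(\<Sum>f'\<in>effs K. contrast_gram K p f f' * (contrast_cov K p f' f'' / 4)) = (if f = f'' then 1 else 0)"
    if f: "f \<in> effs K" "f'' \<in> effs K" for f f''
  proof -
    define \<alpha> where "\<alpha> q = gcoef K f q / p q" for q
    have pa: "p r * \<alpha> r = gcoef K f r" if "r < 2^K" for r using p(2)[OF that] by (simp add: \<alpha>_def)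
    have "(\<Sum>f'\<in>effs K. contrast_gram K p f f' * (contrast_cov K p f' f'' / 4))
       = (\<Sum>f'\<in>effs K. (\<Sum>q<2^K. \<alpha> q * gcoef K f' q) * contrast_cov K p f' f'') / (?h^2 * 4)"
      unfolding sum_divide_distrib by (intro sum.cong refl) (simp add: contrast_gram_def \<alpha>_def)
    also have "\<dots> = 2 ^ K * ((\<Sum>r<2^K. p r * \<alpha> r * gcoef K f'' r) - (\<Sum>r<2^K. p r * \<alpha> r) * (\<Sum>r<2^K. p r * gcoef K f'' r)) / (?h^2 * 4)"
      unfolding sum_effs_contrast_cov[OF p(1)] ..
    also have "(\<Sum>r<2^K. p r * \<alpha> r * gcoef K f'' r) = (if f = f'' then 2 ^ K else 0)"
      unfolding gcoef_orthogonal[OF f, symmetric] by (intro sum.cong refl) (simp add: pa)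
    also have "(\<Sum>r<2^K. p r * \<alpha> r) = 0"
      unfolding gcoef_sum_zero[OF f(1), symmetric] by (intro sum.cong refl) (simp add: pa)
    finally show ?thesis using power_double[OF K] by (simp add: power2_eq_square)
  qed
  have sg: "contrast_gram K p f f' = contrast_gram K p f' f" for f f'
    by (simp add: contrast_gram_def mult.commute)
  have sc: "contrast_cov K p f f' = contrast_cov K p f' f" for f f'
    by (simp add: contrast_cov_def mult_ac)
  show ?thesis unfolding inverse_on_def
  proof (intro conjI ballI)
    fix i j assume ij: "i \<in> effs K" "j \<in> effs K"
    show "(\<Sum>k\<in>effs K. contrast_gram K p i k * (contrast_cov K p k j / 4)) = (if i = j then 1 else 0)"
      by (rule *[OF ij])
    have "(\<Sum>k\<in>effs K. contrast_cov K p i k / 4 * contrast_gram K p k j) = (\<Sum>k\<in>effs K. contrast_gram K p j k * (contrast_cov K p k i / 4))"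
      by (intro sum.cong refl) (simp add: sg[of _ j] sc[of i])
    then show "(\<Sum>k\<in>effs K. contrast_cov K p i k / 4 * contrast_gram K p k j) = (if i = j then 1 else 0)"
      using *[OF ij(2,1)] by simp
  qed
qed

lemma contrast_cov_form:
  assumes p: "(\<Sum>q<2^K. p q) = 1"
  shows "(\<Sum>f\<in>effs K. \<Sum>f'\<in>effs K. (\<Sum>q<2^K. \<alpha> q * gcoef K f q) * contrast_cov K p f f' * (\<Sum>q<2^K. \<beta> q * gcoef K f' q))
     = (2 ^ K)^2 * ((\<Sum>r<2^K. p r * \<alpha> r * \<beta> r) - (\<Sum>r<2^K. p r * \<alpha> r) * (\<Sum>r<2^K. p r * \<beta> r))"
proof -
  let ?b = "\<lambda>f. \<Sum>q<2^K. \<beta> q * gcoef K f q" and ?A = "\<Sum>r<2^K. p r * \<alpha> r"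
  have "(\<Sum>f\<in>effs K. \<Sum>f'\<in>effs K. (\<Sum>q<2^K. \<alpha> q * gcoef K f q) * contrast_cov K p f f' * ?b f')
     = (\<Sum>f'\<in>effs K. (\<Sum>f\<in>effs K. (\<Sum>q<2^K. \<alpha> q * gcoef K f q) * contrast_cov K p f f') * ?b f')"
    by (subst sum.swap) (simp only: sum_distrib_right)
  also have "\<dots> = (\<Sum>f'\<in>effs K. 2 ^ K * ((\<Sum>r<2^K. p r * \<alpha> r * gcoef K f' r) - ?A * (\<Sum>r<2^K. p r * gcoef K f' r)) * ?b f')"
    unfolding sum_effs_contrast_cov[OF p] ..
  also have "\<dots> = 2 ^ K * ((\<Sum>f'\<in>effs K. \<Sum>r<2^K. (p r * \<alpha> r) * (?b f' * gcoef K f' r)) - ?A * (\<Sum>f'\<in>effs K. ?b f' * (\<Sum>r<2^K. p r * gcoef K f' r)))"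
  proof -
    have "c * ((\<Sum>r<2^K. (p r * \<alpha> r) * gcoef K f r) - x * y) * z
        = c * ((\<Sum>r<2^K. (p r * \<alpha> r) * (z * gcoef K f r)) - x * (z * y))" for c x y z :: real and f
    proof -
      have "(\<Sum>r<2^K. (p r * \<alpha> r) * (z * gcoef K f r)) = z * (\<Sum>r<2^K. (p r * \<alpha> r) * gcoef K f r)"
        by (simp add: sum_distrib_left mult_ac)
      moreover have "c * (w - x * y) * z = c * (z * w - x * (z * y))" for w by (simp add: algebra_simps)
      ultimately show ?thesis by (simp only:)
    qed
    then show ?thesis by (simp only: sum_scale_diff)
  qed
  also have "(\<Sum>f'\<in>effs K. \<Sum>r<2^K. (p r * \<alpha> r) * (?b f' * gcoef K f' r)) = (\<Sum>r<2^K. (p r * \<alpha> r) * (\<Sum>f'\<in>effs K. ?b f' * gcoef K f' r))"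
    by (subst sum.swap) (simp only: sum_distrib_left)
  also have "\<dots> = (\<Sum>r<2^K. (p r * \<alpha> r) * (2 ^ K * \<beta> r - (\<Sum>q<2^K. \<beta> q)))"
    by (intro sum.cong refl) (simp add: sum_effs_contrast)
  also have "\<dots> = 2 ^ K * (\<Sum>r<2^K. p r * \<alpha> r * \<beta> r) - ?A * (\<Sum>q<2^K. \<beta> q)"
    by (simp only: right_diff_distrib sum_subtractf sum_distrib_left sum_distrib_right mult_ac)
  finally show ?thesis unfolding sum_effs_contrast_mean[OF p]
    by (simp add: power2_eq_square algebra_simps)
qed

lemma kronecker_inverse:
  assumes fin: "finite A" "finite B" and G: "inverse_on A G G'" and S: "inverse_on B S S'"
  shows "inverse_on (A \<times> B) (\<lambda>p p'. G (fst p) (fst p') * S (snd p) (snd p')) (\<lambda>p p'. G' (fst p) (fst p') * S' (snd p) (snd p'))"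
proof -
  have prod: "(\<Sum>k\<in>A \<times> B. (X (fst i) (fst k) * Y (snd i) (snd k)) * (X' (fst k) (fst j) * Y' (snd k) (snd j)))
    = (\<Sum>k\<in>A. X (fst i) k * X' k (fst j)) * (\<Sum>k\<in>B. Y (snd i) k * Y' k (snd j))"
    for X X' :: "'a \<Rightarrow> 'a \<Rightarrow> real" and Y Y' :: "'b \<Rightarrow> 'b \<Rightarrow> real" and i j
    unfolding sum_product sum.cartesian_product by (intro sum.cong refl) (auto simp: mult_ac)
  show ?thesis unfolding inverse_on_def prod
    using G S unfolding inverse_on_def by (auto simp: prod_eq_iff)
qed

lemma pcov_commute: "pcov n y z = pcov n z y"
  by (simp add: pcov_def mult.commute)

lemma sum_mult_divide: "(\<Sum>q\<in>A. s q * z q) / w = (\<Sum>q\<in>A. s q * (z q / w))" for w :: real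
  by (simp add: sum_divide_distrib)

lemma pcov_affine:
  assumes n: "n > 0"
  shows "pcov n (\<lambda>i. b + (\<Sum>q\<in>A. s q * y q i)) z = (\<Sum>q\<in>A. s q * pcov n (y q) z)"
proof -
  have m: "pmean n (\<lambda>i. b + (\<Sum>q\<in>A. s q * y q i)) = b + (\<Sum>q\<in>A. s q * pmean n (y q))"
  proof -
    have "(\<Sum>i<n. \<Sum>q\<in>A. s q * y q i) = (\<Sum>q\<in>A. s q * (\<Sum>i<n. y q i))"
      by (subst sum.swap) (simp only: sum_distrib_left)
    then show ?thesis using n by (simp add: pmean_def sum.distrib add_divide_distrib sum_mult_divide)
  qed
  have "(\<Sum>i<n. (b + (\<Sum>q\<in>A. s q * y q i) - pmean n (\<lambda>i. b + (\<Sum>q\<in>A. s q * y q i))) * (z i - pmean n z))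
      = (\<Sum>i<n. \<Sum>q\<in>A. s q * ((y q i - pmean n (y q)) * (z i - pmean n z)))"
    unfolding m by (intro sum.cong refl) (simp add: sum_distrib_left sum_distrib_right sum_subtractf[symmetric] algebra_simps)
  also have "\<dots> = (\<Sum>q\<in>A. s q * (\<Sum>i<n. (y q i - pmean n (y q)) * (z i - pmean n z)))"
    by (subst sum.swap) (simp only: sum_distrib_left)
  finally have F: "(\<Sum>i<n. (b + (\<Sum>q\<in>A. s q * y q i) - pmean n (\<lambda>i. b + (\<Sum>q\<in>A. s q * y q i))) * (z i - pmean n z))
      = (\<Sum>q\<in>A. s q * (\<Sum>i<n. (y q i - pmean n (y q)) * (z i - pmean n z)))" .
  show ?thesis unfolding pcov_def F by (rule sum_mult_divide)
qed

lemma pcov_bilinear: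
  assumes n: "n > 0"
  shows "pcov n (\<lambda>i. b + (\<Sum>q\<in>A. s q * y q i)) (\<lambda>i. d + (\<Sum>k\<in>C. t k * z k i))
     = (\<Sum>q\<in>A. \<Sum>k\<in>C. s q * t k * pcov n (y q) (z k))"
  unfolding pcov_affine[OF n] pcov_commute[of n "y _"] 
  by (simp add: sum_distrib_left mult.assoc)

lemma scaled_Vtt:
  assumes n: "n > 0"
  shows "real n * Vtt K n nq Y f g = ((\<Sum>q<2^K. gcoef K f q * gcoef K g q * pcov n (\<lambda>i. Y i q) (\<lambda>i. Y i q) / (real (nq q) / real n))
      - (\<Sum>q<2^K. \<Sum>k<2^K. gcoef K f q * gcoef K g k * pcov n (\<lambda>i. Y i q) (\<lambda>i. Y i k))) / (2^(K-1))^2"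
proof -
  let ?h = "2 ^ (K - 1) :: real"
  have tau: "tau_unit K Y i f = 0 + (\<Sum>q<2^K. (gcoef K f q / ?h) * Y i q)" for i f
    by (simp add: tau_unit_def sum_divide_distrib)
  have "pcov n (\<lambda>i. tau_unit K Y i f) (\<lambda>i. tau_unit K Y i g)
      = (\<Sum>q<2^K. \<Sum>k<2^K. (gcoef K f q / ?h) * (gcoef K g k / ?h) * pcov n (\<lambda>i. Y i q) (\<lambda>i. Y i k))"
    unfolding tau by (rule pcov_bilinear[OF n])
  also have "\<dots> = (\<Sum>q<2^K. \<Sum>k<2^K. gcoef K f q * gcoef K g k * pcov n (\<lambda>i. Y i q) (\<lambda>i. Y i k)) / ?h^2"
    by (simp add: sum_divide_distrib power2_eq_square)
  finally have 1: "pcov n (\<lambda>i. tau_unit K Y i f) (\<lambda>i. tau_unit K Y i g) = \<dots>" .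
  have 2: "real n * ((\<Sum>q<2^K. gcoef K f q * gcoef K g q * pcov n (\<lambda>i. Y i q) (\<lambda>i. Y i q) / real (nq q)) / ?h^2)
     = (\<Sum>q<2^K. gcoef K f q * gcoef K g q * pcov n (\<lambda>i. Y i q) (\<lambda>i. Y i q) / (real (nq q) / real n)) / ?h^2"
    by (simp add: sum_distrib_left mult_ac)
  show ?thesis unfolding Vtt_def 1 right_diff_distrib 2 using n by (simp add: diff_divide_distrib)
qed

lemma pcov_Ypar:
  assumes n: "n > 0" and inv: "invertible_on {..<L} (Sxx n x)"
  shows "pcov n (\<lambda>i. Ypar L n Y x i q) (\<lambda>i. Ypar L n Y x i k)
     = (\<Sum>l<L. \<Sum>l'<L. Sqx n Y x q l * minv {..<L} (Sxx n x) l l' * Sqx n Y x k l')"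
proof -
  let ?M = "minv {..<L} (Sxx n x)"
  define c where "c q l' = (\<Sum>l<L. Sqx n Y x q l * ?M l l')" for q l'
  define b where "b q = pmean n (\<lambda>j. Y j q) - (\<Sum>l'<L. c q l' * pmean n (\<lambda>j. x j l'))" for q
  have Y: "Ypar L n Y x i q = b q + (\<Sum>l'<L. c q l' * x i l')" for i q
  proof -
    have "(\<Sum>l<L. \<Sum>l'<L. Sqx n Y x q l * ?M l l' * (x i l' - pmean n (\<lambda>j. x j l')))
      = (\<Sum>l'<L. c q l' * (x i l' - pmean n (\<lambda>j. x j l')))"
      unfolding c_def sum_distrib_right by (rule sum.swap)
    then show ?thesis by (simp add: Ypar_def b_def right_diff_distrib sum_subtractf)
  qed
  have cS: "(\<Sum>l<L. c q l * Sxx n x l l') = Sqx n Y x q l'" if "l' < L" for q l'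
  proof -
    have "(\<Sum>l<L. c q l * Sxx n x l l') = (\<Sum>k<L. Sqx n Y x q k * (\<Sum>l<L. ?M k l * Sxx n x l l'))"
      unfolding c_def sum_distrib_right sum_distrib_left by (subst sum.swap) (simp add: mult.assoc)
    also have "\<dots> = (\<Sum>k<L. Sqx n Y x q k * (if k = l' then 1 else 0))"
      using inverse_on_minv[OF inv] that unfolding inverse_on_def by (intro sum.cong) auto
    also have "\<dots> = Sqx n Y x q l'" using that by (simp add: if_distrib[of "\<lambda>z. _ * z"] cong: if_cong)
    finally show ?thesis .
  qed
  have "pcov n (\<lambda>i. Ypar L n Y x i q) (\<lambda>i. Ypar L n Y x i k)
     = (\<Sum>l<L. \<Sum>l'<L. c q l * c k l' * pcov n (\<lambda>i. x i l) (\<lambda>i. x i l'))"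
    unfolding Y by (rule pcov_bilinear[OF n])
  also have "\<dots> = (\<Sum>l<L. c q l * (\<Sum>l'<L. c k l' * Sxx n x l' l))"
  proof -
    have "pcov n (\<lambda>i. x i l) (\<lambda>i. x i l') = Sxx n x l' l" for l l'
      unfolding Sxx_def by (rule pcov_commute)
    then show ?thesis by (simp only: sum_distrib_left mult.assoc)
  qed
  also have "\<dots> = (\<Sum>l<L. c q l * Sqx n Y x k l)" by (intro sum.cong refl) (simp add: cS)
  also have "\<dots> = (\<Sum>l<L. \<Sum>l'<L. Sqx n Y x q l * ?M l l' * Sqx n Y x k l')"
    unfolding c_def sum_distrib_right by (rule sum.swap)
  finally show ?thesis .
qed

section \<open>Asymptotics of rerandomized factorial experiments\<close>

definition eff :: "nat + nat \<times> nat \<Rightarrow> nat" where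
  "eff j = (case j of Inl f \<Rightarrow> f | Inr p \<Rightarrow> fst p)"

definition val :: "(nat \<Rightarrow> nat \<Rightarrow> real) \<Rightarrow> (nat \<Rightarrow> nat \<Rightarrow> real) \<Rightarrow> nat + nat \<times> nat \<Rightarrow> nat \<Rightarrow> nat \<Rightarrow> real" where
  "val Y x j q i = (case j of Inl f \<Rightarrow> Y i q | Inr p \<Rightarrow> x i (snd p))"

definition score :: "nat \<Rightarrow> nat \<Rightarrow> (nat \<Rightarrow> nat) \<Rightarrow> (nat \<Rightarrow> nat \<Rightarrow> real) \<Rightarrow> (nat \<Rightarrow> nat \<Rightarrow> real)
    \<Rightarrow> nat + nat \<times> nat \<Rightarrow> nat \<Rightarrow> nat \<Rightarrow> real" where
  "score K n nq Y x j i q = sqrt (real n) / (2^(K-1) * real (nq q)) * gcoef K (eff j) q * (val Y x j q i - pmean n (val Y x j q))"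

definition joint_stat :: "nat \<Rightarrow> nat \<Rightarrow> (nat \<Rightarrow> nat \<Rightarrow> real) \<Rightarrow> (nat \<Rightarrow> nat \<Rightarrow> real) \<Rightarrow> (nat \<Rightarrow> nat) \<Rightarrow> nat + nat \<times> nat \<Rightarrow> real" where
  "joint_stat K n Y x Z j = (case j of Inl f \<Rightarrow> sqrt (real n) * (tau_hat K n Y Z f - tau_pop K n Y f)
     | Inr p \<Rightarrow> sqrt (real n) * taux_hat K n x Z p)"

lemma sum_deviation_zero: "n > 0 \<Longrightarrow> (\<Sum>i<n. y i - pmean n y) = 0"
  by (simp add: sum_subtractf pmean_def)

lemma score_centered: "n > 0 \<Longrightarrow> (\<Sum>i<n. score K n nq Y x j i q) = 0"
  unfolding score_def sum_distrib_left[symmetric] by (simp add: sum_deviation_zero)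

lemma score_sum:
  assumes D: "crfe_design K n nq" and nq: "\<And>q. q < 2^K \<Longrightarrow> nq q \<ge> 1" and Z: "Z \<in> assigns K n nq"
  shows "(\<Sum>i<n. score K n nq Y x j i (Z i))
    = sqrt (real n) * ((\<Sum>q<2^K. gcoef K (eff j) q * gmean n Z q (val Y x j q)) - (\<Sum>q<2^K. gcoef K (eff j) q * pmean n (val Y x j q))) / 2^(K-1)"
proof -
  interpret D: crfe_design K n nq by (rule D)
  have ZO: "Z \<in> D.Om" using Z by (simp add: D.Om_def)
  have grp: "(\<Sum>i<n. if Z i = q then score K n nq Y x j i q else 0)
     = sqrt (real n) / 2^(K-1) * (gcoef K (eff j) q * gmean n Z q (val Y x j q) - gcoef K (eff j) q * pmean n (val Y x j q))" if q: "q < 2^K" for q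
  proof -
    let ?A = "{i\<in>{..<n}. Z i = q}" and ?v = "val Y x j q"
    have card: "card ?A = nq q" by (rule D.OmD(2)[OF ZO q])
    have nz: "real (nq q) \<noteq> 0" using nq[OF q] by simp
    have "(\<Sum>i\<in>?A. ?v i - pmean n ?v) = real (nq q) * (gmean n Z q ?v - pmean n ?v)"
      unfolding gmean_def sum_subtractf card using nz card by (simp add: right_diff_distrib)
    moreover have "(\<Sum>i<n. if Z i = q then score K n nq Y x j i q else 0) = (\<Sum>i\<in>?A. score K n nq Y x j i q)"
      by (subst sum.inter_filter) auto
    moreover have "(\<Sum>i\<in>?A. score K n nq Y x j i q)
        = sqrt (real n) / (2^(K-1) * real (nq q)) * gcoef K (eff j) q * (\<Sum>i\<in>?A. ?v i - pmean n ?v)"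
      by (simp only: score_def sum_distrib_left)
    ultimately show ?thesis using nz by (simp add: right_diff_distrib)
  qed
  have "(\<Sum>i<n. score K n nq Y x j i (Z i)) = (\<Sum>q<2^K. \<Sum>i<n. if Z i = q then score K n nq Y x j i q else 0)"
    by (rule D.sum_over_groups[OF ZO])
  also have "\<dots> = (\<Sum>q<2^K. sqrt (real n) / 2^(K-1) * (gcoef K (eff j) q * gmean n Z q (val Y x j q) - gcoef K (eff j) q * pmean n (val Y x j q)))"
    by (intro sum.cong refl) (simp only: grp lessThan_iff)
  also have "\<dots> = sqrt (real n) / 2^(K-1) * ((\<Sum>q<2^K. gcoef K (eff j) q * gmean n Z q (val Y x j q)) - (\<Sum>q<2^K. gcoef K (eff j) q * pmean n (val Y x j q)))"
    by (simp only: sum_distrib_left[symmetric] sum_subtractf)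
  finally show ?thesis by simp
qed

lemma joint_stat_eq_score_sum:
  assumes D: "crfe_design K n nq" and nq: "\<And>q. q < 2^K \<Longrightarrow> nq q \<ge> 1" and Z: "Z \<in> assigns K n nq"
    and j: "j \<in> effs K <+> effs K \<times> {..<L}"
  shows "joint_stat K n Y x Z j = (\<Sum>i<n. score K n nq Y x j i (Z i))"
proof -
  have S: "(\<Sum>i<n. score K n nq Y x j i (Z i))
    = sqrt (real n) * ((\<Sum>q<2^K. gcoef K (eff j) q * gmean n Z q (val Y x j q)) - (\<Sum>q<2^K. gcoef K (eff j) q * pmean n (val Y x j q))) / 2^(K-1)"
    by (rule score_sum[OF D _ Z]) (rule nq)
  show ?thesis
proof (cases j)
  case (Inl f)
  have v: "val Y x (Inl f) q = (\<lambda>i. Y i q)" for q by (simp add: val_def fun_eq_iff)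
  show ?thesis unfolding S unfolding Inl
    by (simp add: joint_stat_def eff_def v tau_hat_def tau_pop_def right_diff_distrib diff_divide_distrib)
next
  case (Inr p)
  have v: "val Y x (Inr p) q = (\<lambda>i. x i (snd p))" for q by (simp add: val_def fun_eq_iff)
  have p: "fst p \<in> effs K" using j Inr by auto
  have z: "(\<Sum>q<2^K. gcoef K (fst p) q * pmean n (\<lambda>i. x i (snd p))) = 0"
    unfolding sum_distrib_right[symmetric] by (simp add: gcoef_sum_zero[OF p])
  show ?thesis unfolding S unfolding Inr
    by (simp add: joint_stat_def eff_def v taux_hat_def z)
qed
qed

lemma score_gram:
  assumes n: "n > 1" and nq: "nq q \<ge> 1" "nq k \<ge> 1"
  shows "(\<Sum>i<n. score K n nq Y x j i q * score K n nq Y x j' i k)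
    = (1 - 1 / real n) * (gcoef K (eff j) q * gcoef K (eff j') k * pcov n (val Y x j q) (val Y x j' k))
       / ((2^(K-1))^2 * (real (nq q) / real n) * (real (nq k) / real n))"
proof -
  let ?s = "\<Sum>i<n. (val Y x j q i - pmean n (val Y x j q)) * (val Y x j' k i - pmean n (val Y x j' k))"
  have s: "?s = (real n - 1) * pcov n (val Y x j q) (val Y x j' k)"
    using n by (simp add: pcov_def)
  have sq: "sqrt (real n) * sqrt (real n) = real n" by simp
  have "(\<Sum>i<n. score K n nq Y x j i q * score K n nq Y x j' i k)
     = (sqrt (real n) / (2^(K-1) * real (nq q)) * gcoef K (eff j) q) * (sqrt (real n) / (2^(K-1) * real (nq k)) * gcoef K (eff j') k) * ?s"
    unfolding score_def sum_distrib_left by (intro sum.cong refl) (simp only: mult_ac)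
  also have "\<dots> = real n * (real n - 1) * (gcoef K (eff j) q * gcoef K (eff j') k * pcov n (val Y x j q) (val Y x j' k)) / ((2^(K-1))^2 * real (nq q) * real (nq k))"
  proof -
    have "(r / (H * a) * g) * (r / (H * b) * g') * (t * p) = (r * r) * t * (g * g' * p) / (H\<^sup>2 * a * b)"
      for r H a b g g' t p :: real
      by (simp add: power2_eq_square mult_ac)
    then show ?thesis unfolding s by (simp only: sq)
  qed
  also have "\<dots> = (1 - 1 / real n) * (gcoef K (eff j) q * gcoef K (eff j') k * pcov n (val Y x j q) (val Y x j' k))
       / ((2^(K-1))^2 * (real (nq q) / real n) * (real (nq k) / real n))"
    using n nq by (simp add: field_simps)
  finally show ?thesis .
qed

lemma abs_gcoef: "\<bar>gcoef K f q\<bar> = 1"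
  unfolding gcoef_def abs_prod by (intro prod.neutral) (auto simp: iota_def)

lemma score_bound:
  assumes n: "n > 0" and nq: "nq q \<ge> 1" and m: "(val Y x j q i - pmean n (val Y x j q))\<^sup>2 \<le> m"
  shows "\<bar>score K n nq Y x j i q\<bar> \<le> (real n / real (nq q)) * sqrt (m / real n)"
proof -
  let ?d = "val Y x j q i - pmean n (val Y x j q)"
  have "\<bar>?d\<bar> \<le> sqrt m" using m by (metis real_sqrt_abs real_sqrt_le_iff)
  have h: "(1::real) \<le> 2^(K-1)" by simp
  have "\<bar>score K n nq Y x j i q\<bar> = sqrt (real n) / (2^(K-1) * real (nq q)) * \<bar>?d\<bar>"
    unfolding score_def abs_mult abs_gcoef by simp
  also have "\<dots> \<le> sqrt (real n) / (1 * real (nq q)) * sqrt m"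
    using nq h \<open>\<bar>?d\<bar> \<le> sqrt m\<close> by (intro mult_mono divide_left_mono mult_right_mono) auto
  also have "\<dots> = (real n / real (nq q)) * sqrt (m / real n)"
  proof -
    have "real n * sqrt (m / real n) = (real n / sqrt (real n)) * sqrt m"
      unfolding real_sqrt_divide by (simp only: times_divide_eq_left times_divide_eq_right)
    also have "\<dots> = sqrt (real n) * sqrt m" by (simp add: real_div_sqrt)
    finally have "real n * sqrt (m / real n) = sqrt (real n) * sqrt m" .
    then show ?thesis by (simp only: mult_1_left times_divide_eq_left)
  qed
  finally show ?thesis .
qed

lemma inverse_on_scale:
  assumes "inverse_on I A B" "s \<noteq> 0"
  shows "inverse_on I (\<lambda>i j. A i j / s) (\<lambda>i j. s * B i j)"
proof -
  have "u / s * (s * v) = u * v" "s * v * (u / s) = v * u" for u v using assms(2) by simp_all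
  then show ?thesis using assms(1) unfolding inverse_on_def by (simp only:)
qed

locale refm_asymptotics =
  fixes K L :: nat and a :: real
    and N :: "nat \<Rightarrow> nat"
    and nq :: "nat \<Rightarrow> nat \<Rightarrow> nat"
    and Y :: "nat \<Rightarrow> nat \<Rightarrow> nat \<Rightarrow> real"
    and x :: "nat \<Rightarrow> nat \<Rightarrow> nat \<Rightarrow> real"
    and c :: "nat \<Rightarrow> real"
    and SYlim :: "nat \<Rightarrow> nat \<Rightarrow> real"
    and Sxxlim :: "nat \<Rightarrow> nat \<Rightarrow> real"
    and Sqxlim :: "nat \<Rightarrow> nat \<Rightarrow> real"
  assumes K: "K \<ge> 1" and L: "L \<ge> 1" and a: "a > 0"
    and N_lim: "filterlim N at_top sequentially"
    and design: "\<forall>m. (\<forall>q<2^K. nq m q \<ge> 1) \<and> (\<Sum>q<2^K. nq m q) = N m"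
    and cond_i: "\<forall>q<2^K. ((\<lambda>m. real (nq m q) / real (N m)) \<longlonglongrightarrow> c q) \<and> c q > 0"
    and cond_ii_Y: "\<forall>q<2^K. \<forall>k<2^K.
          (\<lambda>m. pcov (N m) (\<lambda>i. Y m i q) (\<lambda>i. Y m i k)) \<longlonglongrightarrow> SYlim q k"
    and cond_ii_xx: "\<forall>l<L. \<forall>l'<L. (\<lambda>m. Sxx (N m) (x m) l l') \<longlonglongrightarrow> Sxxlim l l'"
    and cond_ii_xx_nonsing: "\<forall>m. invertible_on {..<L} (Sxx (N m) (x m))"
    and cond_ii_xxlim_nonsing: "invertible_on {..<L} Sxxlim"
    and cond_ii_qx: "\<forall>q<2^K. \<forall>l<L. (\<lambda>m. Sqx (N m) (Y m) (x m) q l) \<longlonglongrightarrow> Sqxlim q l"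
    and cond_iii_Y: "\<forall>q<2^K. (\<lambda>m. (MAX i\<in>{..<N m}. \<bar>Y m i q - pmean (N m) (\<lambda>j. Y m j q)\<bar>^2) / real (N m))
                              \<longlonglongrightarrow> 0"
    and cond_iii_x: "(\<lambda>m. (MAX i\<in>{..<N m}. \<Sum>l<L. (x m i l - pmean (N m) (\<lambda>j. x m j l))^2) / real (N m))
                       \<longlonglongrightarrow> 0"
begin

abbreviation "P \<equiv> effs K \<times> {..<L}"
abbreviation "JJ \<equiv> effs K <+> P"
abbreviation "h \<equiv> 2 ^ (K - 1) :: real"

lemma nq_pos: "q < 2^K \<Longrightarrow> nq m q \<ge> 1" using design by blast

lemma N_gt_1: "N m > 1"
proof -
  have "(\<Sum>q<(2::nat)^K. 1) \<le> (\<Sum>q<2^K. nq m q)" by (intro sum_mono nq_pos) simp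
  moreover have "(2::nat) ^ 1 \<le> 2 ^ K" using K by (intro power_increasing) auto
  ultimately show ?thesis using design by simp
qed

lemma design_m: "crfe_design K (N m) (nq m)"
  using design N_gt_1[of m] by unfold_locales auto

definition sh :: "nat \<Rightarrow> nat \<Rightarrow> real" where "sh m q = real (nq m q) / real (N m)"

lemma sh_lim: "q < 2^K \<Longrightarrow> (\<lambda>m. sh m q) \<longlonglongrightarrow> c q" and c_pos: "q < 2^K \<Longrightarrow> c q > 0"
  using cond_i by (auto simp: sh_def)

lemma sh_pos: "q < 2^K \<Longrightarrow> sh m q > 0"
  using nq_pos[of q m] N_gt_1[of m] by (simp add: sh_def)

lemma sh_sum: "(\<Sum>q<2^K. sh m q) = 1"
  using crfe_design.share_sum[OF design_m] unfolding crfe_design.share_def[OF design_m] sh_def .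

lemma c_sum: "(\<Sum>q<2^K. c q) = 1"
proof -
  have "(\<lambda>m. \<Sum>q<2^K. sh m q) \<longlonglongrightarrow> (\<Sum>q<2^K. c q)" by (intro tendsto_sum sh_lim) simp
  then show ?thesis unfolding sh_sum using LIMSEQ_unique[OF _ tendsto_const] by blast
qed

definition Slim :: "nat + nat \<times> nat \<Rightarrow> nat \<Rightarrow> nat + nat \<times> nat \<Rightarrow> nat \<Rightarrow> real" where
  "Slim j q j' k = (case j of
      Inl f \<Rightarrow> (case j' of Inl f' \<Rightarrow> SYlim q k | Inr p' \<Rightarrow> Sqxlim q (snd p'))
    | Inr p \<Rightarrow> (case j' of Inl f' \<Rightarrow> Sqxlim k (snd p) | Inr p' \<Rightarrow> Sxxlim (snd p) (snd p')))"

lemma val_Inl: "val Y' x' (Inl f) q = (\<lambda>i. Y' i q)" and val_Inr: "val Y' x' (Inr p) q = (\<lambda>i. x' i (snd p))"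
  by (simp_all add: val_def fun_eq_iff)

lemma pcov_lim:
  assumes j: "j \<in> JJ" "j' \<in> JJ" and q: "q < 2^K" "k < 2^K"
  shows "(\<lambda>m. pcov (N m) (val (Y m) (x m) j q) (val (Y m) (x m) j' k)) \<longlonglongrightarrow> Slim j q j' k"
proof (cases j; cases j')
  fix f f' assume "j = Inl f" "j' = Inl f'"
  then show ?thesis using cond_ii_Y q by (simp add: val_Inl Slim_def)
next
  fix f p assume "j = Inl f" "j' = Inr p"
  then show ?thesis using cond_ii_qx q j by (auto simp: val_Inl val_Inr Slim_def Sqx_def)
next
  fix f p assume jj: "j = Inr p" "j' = Inl f"
  then have "(\<lambda>m. pcov (N m) (\<lambda>i. Y m i k) (\<lambda>i. x m i (snd p))) \<longlonglongrightarrow> Sqxlim k (snd p)"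
    using cond_ii_qx q j by (auto simp: Sqx_def)
  then have "(\<lambda>m. pcov (N m) (\<lambda>i. x m i (snd p)) (\<lambda>i. Y m i k)) \<longlonglongrightarrow> Sqxlim k (snd p)"
    by (rule Lim_transform_eventually) (intro always_eventually allI pcov_commute)
  then show ?thesis using jj by (simp add: val_Inl val_Inr Slim_def)
next
  fix p p' assume "j = Inr p" "j' = Inr p'"
  then show ?thesis using cond_ii_xx j by (auto simp: val_Inr Slim_def Sxx_def)
qed

lemma Slim_sym:
  assumes "j \<in> JJ" "j' \<in> JJ" "q < 2^K" "k < 2^K"
  shows "Slim j q j' k = Slim j' k j q"
proof (rule LIMSEQ_unique[OF pcov_lim[OF assms]])
  show "(\<lambda>m. pcov (N m) (val (Y m) (x m) j q) (val (Y m) (x m) j' k)) \<longlonglongrightarrow> Slim j' k j q"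
    by (rule Lim_transform_eventually[OF pcov_lim[OF assms(2,1,4,3)]]) (intro always_eventually allI pcov_commute)
qed

definition \<kappa> :: "nat + nat \<times> nat \<Rightarrow> nat + nat \<times> nat \<Rightarrow> nat \<Rightarrow> nat \<Rightarrow> real" where
  "\<kappa> j j' q k = gcoef K (eff j) q * gcoef K (eff j') k * Slim j q j' k / (h^2 * c q * c k)"

definition sc :: "nat \<Rightarrow> nat + nat \<times> nat \<Rightarrow> nat \<Rightarrow> nat \<Rightarrow> real" where
  "sc m j i q = score K (N m) (nq m) (Y m) (x m) j i q"

lemma gram_lim:
  assumes j: "j \<in> JJ" "j' \<in> JJ" and q: "q < 2^K" "k < 2^K"
  shows "(\<lambda>m. \<Sum>i<N m. sc m j i q * sc m j' i k) \<longlonglongrightarrow> \<kappa> j j' q k"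
proof -
  have eq: "(\<Sum>i<N m. sc m j i q * sc m j' i k)
     = (1 - 1 / real (N m)) * (gcoef K (eff j) q * gcoef K (eff j') k * pcov (N m) (val (Y m) (x m) j q) (val (Y m) (x m) j' k))
       / (h^2 * sh m q * sh m k)" for m
    unfolding sc_def sh_def by (intro score_gram N_gt_1 nq_pos q)
  have N0: "(\<lambda>m. 1 / real (N m)) \<longlonglongrightarrow> 0"
    by (intro tendsto_divide_0[OF tendsto_const] filterlim_at_top_imp_at_infinity
        filterlim_compose[OF filterlim_real_sequentially N_lim])
  have "(\<lambda>m. (1 - 1 / real (N m)) * (gcoef K (eff j) q * gcoef K (eff j') k * pcov (N m) (val (Y m) (x m) j q) (val (Y m) (x m) j' k))
       / (h^2 * sh m q * sh m k)) \<longlonglongrightarrow> (1 - 0) * (gcoef K (eff j) q * gcoef K (eff j') k * Slim j q j' k) / (h^2 * c q * c k)"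
    using c_pos[OF q(1)] c_pos[OF q(2)]
    by (intro tendsto_divide tendsto_mult tendsto_diff tendsto_const N0 pcov_lim[OF j q] sh_lim q) auto
  then show ?thesis unfolding eq \<kappa>_def by simp
qed

definition mx :: "nat + nat \<times> nat \<Rightarrow> nat \<Rightarrow> nat \<Rightarrow> real" where
  "mx j q m = (case j of Inl f \<Rightarrow> (MAX i\<in>{..<N m}. \<bar>Y m i q - pmean (N m) (\<lambda>j. Y m j q)\<bar>^2)
     | Inr p \<Rightarrow> (MAX i\<in>{..<N m}. \<Sum>l<L. (x m i l - pmean (N m) (\<lambda>j. x m j l))^2))"

definition dl :: "nat + nat \<times> nat \<Rightarrow> nat \<Rightarrow> real" where
  "dl j m = (\<Sum>q<2^K. (1 / sh m q) * sqrt (mx j q m / real (N m)))"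

lemma mx_lim: "q < 2^K \<Longrightarrow> (\<lambda>m. mx j q m / real (N m)) \<longlonglongrightarrow> 0"
  using cond_iii_Y cond_iii_x by (cases j) (auto simp: mx_def)

lemma dl_lim: "dl j \<longlonglongrightarrow> 0"
proof -
  have "(\<lambda>m. \<Sum>q<2^K. (1 / sh m q) * sqrt (mx j q m / real (N m))) \<longlonglongrightarrow> (\<Sum>q<2^K. (1 / c q) * sqrt 0)"
    by (intro tendsto_sum tendsto_mult tendsto_divide tendsto_const tendsto_real_sqrt mx_lim sh_lim)
      (auto dest: c_pos)
  then show ?thesis by (simp add: dl_def[abs_def])
qed

lemma mx_bound:
  assumes j: "j \<in> JJ" and i: "i < N m"
  shows "(val (Y m) (x m) j q i - pmean (N m) (val (Y m) (x m) j q))\<^sup>2 \<le> mx j q m"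
proof (cases j)
  case (Inl f)
  have "\<bar>Y m i q - pmean (N m) (\<lambda>j. Y m j q)\<bar>^2 \<le> (MAX i\<in>{..<N m}. \<bar>Y m i q - pmean (N m) (\<lambda>j. Y m j q)\<bar>^2)"
    using i by (intro Max_ge) auto
  then show ?thesis unfolding Inl by (simp add: mx_def val_Inl)
next
  case (Inr p)
  then have p: "snd p < L" using j by auto
  have "(x m i (snd p) - pmean (N m) (\<lambda>j. x m j (snd p)))^2 \<le> (\<Sum>l<L. (x m i l - pmean (N m) (\<lambda>j. x m j l))^2)"
    using p by (intro member_le_sum[where f="\<lambda>l. (x m i l - pmean (N m) (\<lambda>j. x m j l))^2"]) auto
  also have "\<dots> \<le> (MAX i\<in>{..<N m}. \<Sum>l<L. (x m i l - pmean (N m) (\<lambda>j. x m j l))^2)"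
    using i by (intro Max_ge) auto
  finally show ?thesis unfolding Inr by (simp add: mx_def val_Inr)
qed

lemma sc_bound:
  assumes j: "j \<in> JJ" and i: "i < N m" and q: "q < 2^K"
  shows "\<bar>sc m j i q\<bar> \<le> dl j m"
proof -
  have mx0: "mx j q m \<ge> 0" for q by (rule order_trans[OF zero_le_power2 mx_bound[OF j i]])
  have "\<bar>sc m j i q\<bar> \<le> (real (N m) / real (nq m q)) * sqrt (mx j q m / real (N m))"
    unfolding sc_def using N_gt_1[of m] by (intro score_bound mx_bound j i nq_pos q) auto
  also have "\<dots> = (1 / sh m q) * sqrt (mx j q m / real (N m))" by (simp add: sh_def)
  also have "\<dots> \<le> dl j m"
    unfolding dl_def
  proof (rule member_le_sum[where f="\<lambda>q. (1 / sh m q) * sqrt (mx j q m / real (N m))"])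
    fix y assume "y \<in> {..<2 ^ K} - {q}"
    then have "1 / sh m y \<ge> 0" using sh_pos[of y m] by simp
    moreover have "sqrt (mx j y m / real (N m)) \<ge> 0" using mx0 by simp
    ultimately show "0 \<le> (1 / sh m y) * sqrt (mx j y m / real (N m))" by (rule mult_nonneg_nonneg)
  qed (use q in auto)
  finally show ?thesis .
qed

definition Sg :: "nat + nat \<times> nat \<Rightarrow> nat + nat \<times> nat \<Rightarrow> real" where
  "Sg j j' = (\<Sum>q<2^K. c q * \<kappa> j j' q q) - (\<Sum>q<2^K. \<Sum>k<2^K. c q * c k * \<kappa> j j' q k)"

lemma finJJ: "finite JJ" by (simp add: finite_effs)

definition lin :: "(nat + nat \<times> nat \<Rightarrow> real) \<Rightarrow> nat \<Rightarrow> nat \<Rightarrow> nat \<Rightarrow> real" where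
  "lin t m i q = (\<Sum>j\<in>JJ. t j * sc m j i q)"

definition kt :: "(nat + nat \<times> nat \<Rightarrow> real) \<Rightarrow> nat \<Rightarrow> nat \<Rightarrow> real" where
  "kt t q k = (\<Sum>j\<in>JJ. \<Sum>j'\<in>JJ. t j * \<kappa> j j' q k * t j')"

lemma kt_form: "(\<Sum>q<2^K. c q * kt t q q) - (\<Sum>q<2^K. \<Sum>k<2^K. c q * c k * kt t q k) = (\<Sum>j\<in>JJ. \<Sum>j'\<in>JJ. t j * Sg j j' * t j')"
proof -
  have lin: "(\<Sum>q\<in>A. b q * (\<Sum>j\<in>JJ. \<Sum>j'\<in>JJ. t j * g j j' q * t j')) = (\<Sum>j\<in>JJ. \<Sum>j'\<in>JJ. t j * (\<Sum>q\<in>A. b q * g j j' q) * t j')"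
    for A :: "'q set" and b :: "'q \<Rightarrow> real" and g
  proof -
    have "(\<Sum>q\<in>A. b q * (\<Sum>j\<in>JJ. \<Sum>j'\<in>JJ. t j * g j j' q * t j')) = (\<Sum>q\<in>A. \<Sum>j\<in>JJ. \<Sum>j'\<in>JJ. t j * (b q * g j j' q) * t j')"
      by (simp add: sum_distrib_left mult_ac)
    also have "\<dots> = (\<Sum>j\<in>JJ. \<Sum>q\<in>A. \<Sum>j'\<in>JJ. t j * (b q * g j j' q) * t j')" by (rule sum.swap)
    also have "\<dots> = (\<Sum>j\<in>JJ. \<Sum>j'\<in>JJ. \<Sum>q\<in>A. t j * (b q * g j j' q) * t j')" by (intro sum.cong refl sum.swap)
    finally show ?thesis by (simp only: sum_distrib_left sum_distrib_right)
  qed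
  have 2: "(\<Sum>q<2^K. \<Sum>k<2^K. f q k) = (\<Sum>z\<in>{..<2^K} \<times> {..<2^K}. f (fst z) (snd z))" for f :: "nat \<Rightarrow> nat \<Rightarrow> real"
    by (simp add: sum.cartesian_product case_prod_beta)
  have A: "(\<Sum>q<2^K. c q * kt t q q) = (\<Sum>j\<in>JJ. \<Sum>j'\<in>JJ. t j * (\<Sum>q<2^K. c q * \<kappa> j j' q q) * t j')"
    unfolding kt_def by (rule lin)
  have B: "(\<Sum>q<2^K. \<Sum>k<2^K. c q * c k * kt t q k) = (\<Sum>j\<in>JJ. \<Sum>j'\<in>JJ. t j * (\<Sum>q<2^K. \<Sum>k<2^K. c q * c k * \<kappa> j j' q k) * t j')"
    unfolding kt_def 2 by (rule lin)
  show ?thesis unfolding A B Sg_def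
    by (simp only: right_diff_distrib left_diff_distrib sum_subtractf)
qed

lemma lin_CLT:
  "(\<lambda>m. \<integral>Z. cos ((\<Sum>i<N m. lin t m i (Z i)) + \<theta>) \<partial>crfe K (N m) (nq m))
      \<longlonglongrightarrow> cos \<theta> * exp (- (\<Sum>j\<in>JJ. \<Sum>j'\<in>JJ. t j * Sg j j' * t j') / 2)"
  "0 \<le> (\<Sum>j\<in>JJ. \<Sum>j'\<in>JJ. t j * Sg j j' * t j')"
proof -
  have centered: "(\<Sum>i<N m. lin t m i q) = 0" for m q
  proof -
    have "(\<Sum>i<N m. lin t m i q) = (\<Sum>j\<in>JJ. t j * (\<Sum>i<N m. sc m j i q))"
      unfolding lin_def by (subst sum.swap) (simp only: sum_distrib_left)
    then show ?thesis using N_gt_1[of m] by (simp add: sc_def score_centered)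
  qed
  have bound: "\<bar>lin t m i q\<bar> \<le> (\<Sum>j\<in>JJ. \<bar>t j\<bar> * dl j m)" if "i < N m" "q < 2^K" for m i q
    unfolding lin_def using that
    by (intro order_trans[OF sum_abs] sum_mono) (simp add: abs_mult mult_left_mono sc_bound)
  have d0: "(\<lambda>m. \<Sum>j\<in>JJ. \<bar>t j\<bar> * dl j m) \<longlonglongrightarrow> 0"
  proof -
    have "(\<lambda>m. \<Sum>j\<in>JJ. \<bar>t j\<bar> * dl j m) \<longlonglongrightarrow> (\<Sum>j\<in>JJ. \<bar>t j\<bar> * 0)"
      by (intro tendsto_sum tendsto_mult tendsto_const dl_lim)
    then show ?thesis by simp
  qed
  have gram: "(\<lambda>m. \<Sum>i<N m. lin t m i q * lin t m i k) \<longlonglongrightarrow> kt t q k" if "q < 2^K" "k < 2^K" for q k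
  proof -
    have "(\<Sum>i<N m. lin t m i q * lin t m i k) = (\<Sum>j\<in>JJ. \<Sum>j'\<in>JJ. t j * (\<Sum>i<N m. sc m j i q * sc m j' i k) * t j')" for m
    proof -
      have "(\<Sum>i<N m. lin t m i q * lin t m i k) = (\<Sum>i<N m. \<Sum>j\<in>JJ. \<Sum>j'\<in>JJ. t j * (sc m j i q * sc m j' i k) * t j')"
        unfolding lin_def sum_product by (intro sum.cong refl) (simp only: mult_ac)
      also have "\<dots> = (\<Sum>j\<in>JJ. \<Sum>i<N m. \<Sum>j'\<in>JJ. t j * (sc m j i q * sc m j' i k) * t j')" by (rule sum.swap)
      also have "\<dots> = (\<Sum>j\<in>JJ. \<Sum>j'\<in>JJ. \<Sum>i<N m. t j * (sc m j i q * sc m j' i k) * t j')" by (intro sum.cong refl sum.swap)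
      finally show ?thesis by (simp only: sum_distrib_left sum_distrib_right)
    qed
    moreover have "(\<lambda>m. \<Sum>j\<in>JJ. \<Sum>j'\<in>JJ. t j * (\<Sum>i<N m. sc m j i q * sc m j' i k) * t j') \<longlonglongrightarrow> kt t q k"
      unfolding kt_def by (intro tendsto_sum tendsto_mult tendsto_const gram_lim that)
    ultimately show ?thesis by simp
  qed
  have sh': "(\<lambda>m. real (nq m q) / real (N m)) \<longlonglongrightarrow> c q" if "q < 2^K" for q using cond_i that by blast
  note CLT = combinatorial_CLT[where c="lin t" and \<delta>="\<lambda>m. \<Sum>j\<in>JJ. \<bar>t j\<bar> * dl j m" and \<kappa>="kt t" and p=c,
      OF design_m N_lim centered bound d0 gram sh']
  show "(\<lambda>m. \<integral>Z. cos ((\<Sum>i<N m. lin t m i (Z i)) + \<theta>) \<partial>crfe K (N m) (nq m))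
      \<longlonglongrightarrow> cos \<theta> * exp (- (\<Sum>j\<in>JJ. \<Sum>j'\<in>JJ. t j * Sg j j' * t j') / 2)"
    unfolding kt_form[symmetric] by (rule CLT(1))
  show "0 \<le> (\<Sum>j\<in>JJ. \<Sum>j'\<in>JJ. t j * Sg j j' * t j')"
    unfolding kt_form[symmetric] by (rule CLT(2))
qed

lemma Sg_eq:
  assumes j: "j \<in> JJ" "j' \<in> JJ"
  shows "Sg j j' = ((\<Sum>q<2^K. gcoef K (eff j) q * gcoef K (eff j') q * Slim j q j' q / c q)
      - (\<Sum>q<2^K. \<Sum>k<2^K. gcoef K (eff j) q * gcoef K (eff j') k * Slim j q j' k)) / h^2"
proof -
  have 1: "c q * \<kappa> j j' q q = gcoef K (eff j) q * gcoef K (eff j') q * Slim j q j' q / c q / h^2" if "q < 2^K" for q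
    using c_pos[OF that] by (simp add: \<kappa>_def)
  have 2: "c q * c k * \<kappa> j j' q k = gcoef K (eff j) q * gcoef K (eff j') k * Slim j q j' k / h^2" if "q < 2^K" "k < 2^K" for q k
    using c_pos[OF that(1)] c_pos[OF that(2)] by (simp add: \<kappa>_def)
  have "Sg j j' = (\<Sum>q<2^K. gcoef K (eff j) q * gcoef K (eff j') q * Slim j q j' q / c q / h^2)
      - (\<Sum>q<2^K. \<Sum>k<2^K. gcoef K (eff j) q * gcoef K (eff j') k * Slim j q j' k / h^2)"
    unfolding Sg_def by (intro arg_cong2[where f="(-)"] sum.cong refl) (simp_all only: 1 2 lessThan_iff)
  then show ?thesis by (simp only: sum_divide_distrib[symmetric] diff_divide_distrib)
qed

lemma Sg_sym: "j \<in> JJ \<Longrightarrow> j' \<in> JJ \<Longrightarrow> Sg j j' = Sg j' j"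
proof -
  assume j: "j \<in> JJ" "j' \<in> JJ"
  have 1: "\<kappa> j j' q k = \<kappa> j' j k q" if "q < 2^K" "k < 2^K" for q k
    unfolding \<kappa>_def Slim_sym[OF j that] by (simp add: mult_ac)
  have "(\<Sum>q<2^K. \<Sum>k<2^K. c q * c k * \<kappa> j j' q k) = (\<Sum>q<2^K. \<Sum>k<2^K. c k * c q * \<kappa> j' j k q)"
    by (intro sum.cong refl) (simp add: 1 mult.commute)
  also have "\<dots> = (\<Sum>q<2^K. \<Sum>k<2^K. c q * c k * \<kappa> j' j q k)" by (rule sum.swap)
  finally show ?thesis unfolding Sg_def by (simp add: 1)
qed

abbreviation "Mi \<equiv> minv {..<L} Sxxlim"

definition W0 :: "nat \<times> nat \<Rightarrow> nat \<times> nat \<Rightarrow> real" where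
  "W0 p p' = contrast_cov K c (fst p) (fst p') / 4 * Mi (snd p) (snd p')"

definition Wm :: "nat \<Rightarrow> nat \<times> nat \<Rightarrow> nat \<times> nat \<Rightarrow> real" where
  "Wm m p p' = minv P (Vxx K (N m) (nq m) (x m)) p p' / real (N m)"

lemma Sg_Inr: "p \<in> P \<Longrightarrow> p' \<in> P \<Longrightarrow> Sg (Inr p) (Inr p') = contrast_gram K c (fst p) (fst p') * Sxxlim (snd p) (snd p')"
proof -
  assume p: "p \<in> P" "p' \<in> P"
  have f: "fst p \<in> effs K" using p by auto
  have z: "(\<Sum>q<2^K. \<Sum>k<2^K. gcoef K (fst p) q * gcoef K (fst p') k * Sxxlim (snd p) (snd p')) = 0"
    unfolding sum_distrib_right[symmetric] sum_distrib_left[symmetric] by (simp add: gcoef_sum_zero[OF f])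
  have "(\<Sum>q<2^K. gcoef K (fst p) q * gcoef K (fst p') q * Sxxlim (snd p) (snd p') / c q)
     = (\<Sum>q<2^K. gcoef K (fst p) q * gcoef K (fst p') q / c q) * Sxxlim (snd p) (snd p')"
    unfolding sum_distrib_right by (intro sum.cong refl) simp
  then show ?thesis using p by (subst Sg_eq) (auto simp: eff_def Slim_def z contrast_gram_def)
qed

lemma W0_inverse: "inverse_on P (\<lambda>p p'. Sg (Inr p) (Inr p')) W0"
proof -
  have "inverse_on P (\<lambda>p p'. contrast_gram K c (fst p) (fst p') * Sxxlim (snd p) (snd p')) W0"
    unfolding W0_def[abs_def]
    by (rule kronecker_inverse[OF finite_effs _ contrast_gram_inverse[OF K c_sum c_pos] inverse_on_minv[OF cond_ii_xxlim_nonsing]]) auto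
  then show ?thesis unfolding inverse_on_def by (simp add: Sg_Inr cong: sum.cong)
qed

lemma Wm_eq:
  assumes p: "p \<in> P" "p' \<in> P"
  shows "Wm m p p' = contrast_cov K (sh m) (fst p) (fst p') / 4 * minv {..<L} (Sxx (N m) (x m)) (snd p) (snd p')"
proof -
  let ?V = "Vxx K (N m) (nq m) (x m)"
  let ?G = "\<lambda>p p'. contrast_gram K (sh m) (fst p) (fst p') * Sxx (N m) (x m) (snd p) (snd p')"
  let ?E = "\<lambda>p p'. contrast_cov K (sh m) (fst p) (fst p') / 4 * minv {..<L} (Sxx (N m) (x m)) (snd p) (snd p')"
  have n: "real (N m) \<noteq> 0" using N_gt_1[of m] by simp
  have V: "?V p p' = ?G p p' / real (N m)" for p p'
  proof -
    have "(\<Sum>q<2^K. gcoef K (fst p) q * gcoef K (fst p') q / sh m q)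
        = real (N m) * (\<Sum>q<2^K. gcoef K (fst p) q * gcoef K (fst p') q / real (nq m q))"
      unfolding sum_distrib_left by (intro sum.cong refl) (simp add: sh_def)
    then show ?thesis using n by (simp add: Vxx_def contrast_gram_def)
  qed
  have inv: "inverse_on P ?G ?E"
    using kronecker_inverse[OF finite_effs finite_lessThan contrast_gram_inverse[OF K sh_sum sh_pos]
        inverse_on_minv[OF cond_ii_xx_nonsing[rule_format]]] by auto
  have "inverse_on P ?V (\<lambda>p p'. real (N m) * ?E p p')"
    unfolding ext[OF ext[OF V]] by (rule inverse_on_scale[OF inv n])
  moreover from this have "inverse_on P ?V (minv P ?V)" by (intro inverse_on_minv inverse_on_invertible)
  ultimately have "minv P ?V p p' = real (N m) * ?E p p'"
    using p by (intro inverse_on_unique[of P ?V]) (auto simp: finite_effs)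
  then show ?thesis unfolding Wm_def using n by simp
qed

lemma minv_lim: "l < L \<Longrightarrow> l' < L \<Longrightarrow> (\<lambda>m. minv {..<L} (Sxx (N m) (x m)) l l') \<longlonglongrightarrow> Mi l l'"
  by (rule inverse_on_tendsto[of "{..<L}" "\<lambda>m. Sxx (N m) (x m)" Sxxlim])
    (use cond_ii_xx cond_ii_xx_nonsing cond_ii_xxlim_nonsing in \<open>auto intro: inverse_on_minv\<close>)

lemma Wm_lim:
  assumes p: "p \<in> P" "p' \<in> P"
  shows "(\<lambda>m. Wm m p p') \<longlonglongrightarrow> W0 p p'"
  unfolding Wm_eq[OF p] W0_def contrast_cov_def using p
  by (intro tendsto_mult tendsto_divide tendsto_diff tendsto_sum tendsto_const sh_lim minv_lim) auto

definition X :: "nat \<Rightarrow> (nat \<Rightarrow> nat) \<Rightarrow> nat + nat \<times> nat \<Rightarrow> real" where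
  "X m Z j = joint_stat K (N m) (Y m) (x m) Z j"

lemma X_eq: "Z \<in> assigns K (N m) (nq m) \<Longrightarrow> j \<in> JJ \<Longrightarrow> X m Z j = (\<Sum>i<N m. sc m j i (Z i))"
  unfolding X_def sc_def by (rule joint_stat_eq_score_sum[OF design_m nq_pos])

lemma X_lin: "Z \<in> assigns K (N m) (nq m) \<Longrightarrow> (\<Sum>j\<in>JJ. t j * X m Z j) = (\<Sum>i<N m. lin t m i (Z i))"
  unfolding lin_def by (subst sum.swap) (simp add: X_eq sum_distrib_left)

lemma integral_crfe_cong:
  fixes F G :: "(nat \<Rightarrow> nat) \<Rightarrow> real"
  assumes "\<And>Z. Z \<in> assigns K (N m) (nq m) \<Longrightarrow> F Z = G Z"
  shows "(\<integral>Z. F Z \<partial>crfe K (N m) (nq m)) = (\<integral>Z. G Z \<partial>crfe K (N m) (nq m))"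
  unfolding crfe_design.integral_crfe[OF design_m]
  by (rule crfe_design.avg_cong[OF design_m]) (simp add: crfe_design.Om_def[OF design_m] assms)

lemma X_second_moment:
  assumes j: "j \<in> JJ"
  shows "(\<integral>Z. (X m Z j)\<^sup>2 \<partial>crfe K (N m) (nq m)) \<le> 4 * (\<Sum>q<2^K. \<Sum>i<N m. (sc m j i q)\<^sup>2)"
proof -
  have "(\<integral>Z. (X m Z j)\<^sup>2 \<partial>crfe K (N m) (nq m)) = (\<integral>Z. (crfe_design.W (N m) (sc m j) Z)\<^sup>2 \<partial>crfe K (N m) (nq m))"
    by (rule integral_crfe_cong) (simp only: X_eq[OF _ j] crfe_design.W_def[OF design_m])
  also have "\<dots> \<le> 4 * (\<Sum>q<2^K. \<Sum>i<N m. (sc m j i q)\<^sup>2)"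
    unfolding crfe_design.integral_crfe[OF design_m]
    using N_gt_1[of m]
    by (intro crfe_design.second_moment_le[OF design_m]) (auto simp: crfe_design.col_centered_def[OF design_m] sc_def score_centered)
  finally show ?thesis .
qed

lemma ex_moment_bound: "\<exists>B. \<forall>j\<in>JJ. \<forall>m. (\<integral>Z. (X m Z j)\<^sup>2 \<partial>crfe K (N m) (nq m)) \<le> B"
proof -
  have "\<exists>b. \<forall>m. (\<integral>Z. (X m Z j)\<^sup>2 \<partial>crfe K (N m) (nq m)) \<le> b" if j: "j \<in> JJ" for j
  proof -
    have "(\<lambda>m. 4 * (\<Sum>q<2^K. \<Sum>i<N m. sc m j i q * sc m j i q)) \<longlonglongrightarrow> 4 * (\<Sum>q<2^K. \<kappa> j j q q)"
      by (intro tendsto_mult tendsto_const tendsto_sum gram_lim j) auto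
    then have "Bseq (\<lambda>m. 4 * (\<Sum>q<2^K. \<Sum>i<N m. sc m j i q * sc m j i q))"
      by (intro convergent_imp_Bseq convergentI)
    then obtain b where b: "\<And>m. norm (4 * (\<Sum>q<2^K. \<Sum>i<N m. sc m j i q * sc m j i q)) \<le> b" unfolding Bseq_def by auto
    show ?thesis
    proof (intro exI[of _ b] allI)
      fix m
      have "(\<integral>Z. (X m Z j)\<^sup>2 \<partial>crfe K (N m) (nq m)) \<le> 4 * (\<Sum>q<2^K. \<Sum>i<N m. sc m j i q * sc m j i q)"
        using X_second_moment[OF j, of m] by (simp only: power2_eq_square)
      also have "\<dots> \<le> b" by (rule order_trans[OF abs_ge_self b[unfolded real_norm_def]])
      finally show "(\<integral>Z. (X m Z j)\<^sup>2 \<partial>crfe K (N m) (nq m)) \<le> b" .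
    qed
  qed
  then obtain b where b: "\<And>j m. j \<in> JJ \<Longrightarrow> (\<integral>Z. (X m Z j)\<^sup>2 \<partial>crfe K (N m) (nq m)) \<le> b j" by metis
  have "b j \<le> (\<Sum>j\<in>JJ. \<bar>b j\<bar>)" if "j \<in> JJ" for j
    using member_le_sum[of j JJ "\<lambda>j. \<bar>b j\<bar>"] that finJJ by (meson abs_ge_self abs_ge_zero order_trans)
  then show ?thesis using b by (intro exI[of _ "\<Sum>j\<in>JJ. \<bar>b j\<bar>"]) (meson order_trans)
qed

lemma crfe_prob: "prob_space (crfe K (N m) (nq m))"
  unfolding crfe_def by (rule prob_space_measure_pmf)

lemma crfe_integrable: "integrable (crfe K (N m) (nq m)) F" for F :: "(nat \<Rightarrow> nat) \<Rightarrow> real"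
proof -
  have "assigns K (N m) (nq m) \<noteq> {}" "finite (assigns K (N m) (nq m))"
    using crfe_design.Om_nonempty[OF design_m] crfe_design.finite_Om[OF design_m]
    unfolding crfe_design.Om_def[OF design_m] by auto
  then show ?thesis unfolding crfe_def by (intro integrable_measure_pmf_finite) simp
qed

lemma ex_joint_limit: "\<exists>B. joint_normal_limit (effs K) P Sg W0 (\<lambda>m. crfe K (N m) (nq m)) X Wm a B"
proof -
  obtain B where B: "\<And>j m. j \<in> JJ \<Longrightarrow> (\<integral>Z. (X m Z j)\<^sup>2 \<partial>crfe K (N m) (nq m)) \<le> B" using ex_moment_bound by blast
  have "joint_normal_limit (effs K) P Sg W0 (\<lambda>m. crfe K (N m) (nq m)) X Wm a B"
  proof (intro joint_normal_limit.intro block_cov.intro joint_normal_limit_axioms.intro)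
    show "finite (effs K)" by (rule finite_effs)
    show "finite P" by (simp add: finite_effs)
    show "psd_on JJ Sg" unfolding psd_on_def using lin_CLT(2) by blast
    show "P \<noteq> {}"
    proof -
      have "(2::nat) ^ 1 \<le> 2 ^ K" using K by (intro power_increasing) auto
      then have "1 \<in> effs K" by (simp add: effs_def)
      then show ?thesis using L by (auto simp: lessThan_empty_iff)
    qed
    show "(\<lambda>Z. X m Z j) \<in> borel_measurable (crfe K (N m) (nq m))" for m j by (simp add: crfe_def)
    show "(\<lambda>m. \<integral>Z. cos ((\<Sum>j\<in>JJ. t j * X m Z j) + \<theta>) \<partial>crfe K (N m) (nq m))
        \<longlonglongrightarrow> cos \<theta> * exp (- (\<Sum>j\<in>JJ. \<Sum>k\<in>JJ. t j * Sg j k * t k) / 2)" for t \<theta>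
    proof -
      have "(\<integral>Z. cos ((\<Sum>j\<in>JJ. t j * X m Z j) + \<theta>) \<partial>crfe K (N m) (nq m))
          = (\<integral>Z. cos ((\<Sum>i<N m. lin t m i (Z i)) + \<theta>) \<partial>crfe K (N m) (nq m))" for m
        by (rule integral_crfe_cong) (simp only: X_lin)
      then show ?thesis using lin_CLT(1)[of t \<theta>] by (simp only:)
    qed
    show "integrable (crfe K (N m) (nq m)) (\<lambda>Z. (X m Z j)\<^sup>2)" for m j by (rule crfe_integrable)
    show "(\<integral>Z. (X m Z j)\<^sup>2 \<partial>crfe K (N m) (nq m)) \<le> B" if "j \<in> JJ" for m j by (rule B[OF that])
    show "(\<lambda>m. Wm m p q) \<longlonglongrightarrow> W0 p q" if "p \<in> P" "q \<in> P" for p q by (rule Wm_lim[OF that])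
  qed (fact Sg_sym W0_inverse a crfe_prob)+
  then show ?thesis by blast
qed

definition Zlim :: "nat \<Rightarrow> nat \<Rightarrow> real" where
  "Zlim q k = (\<Sum>l<L. \<Sum>l'<L. Sqxlim q l * Mi l l' * Sqxlim k l')"

definition Vlim :: "nat \<Rightarrow> nat \<Rightarrow> real" where
  "Vlim f g = ((\<Sum>q<2^K. gcoef K f q * gcoef K g q * Zlim q q / c q)
      - (\<Sum>q<2^K. \<Sum>k<2^K. gcoef K f q * gcoef K g k * Zlim q k)) / h^2"

lemma N_pos: "N m > 0" using N_gt_1[of m] by simp

lemma scaled_Vtt_tendsto:
  assumes lim: "\<And>q k. q < 2^K \<Longrightarrow> k < 2^K \<Longrightarrow> (\<lambda>m. pcov (N m) (\<lambda>i. Y' m i q) (\<lambda>i. Y' m i k)) \<longlonglongrightarrow> S q k"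
  shows "(\<lambda>m. real (N m) * Vtt K (N m) (nq m) (Y' m) f g) \<longlonglongrightarrow>
    ((\<Sum>q<2^K. gcoef K f q * gcoef K g q * S q q / c q) - (\<Sum>q<2^K. \<Sum>k<2^K. gcoef K f q * gcoef K g k * S q k)) / h^2"
  unfolding scaled_Vtt[OF N_pos] sh_def[symmetric]
  by (intro tendsto_divide tendsto_diff tendsto_sum tendsto_mult tendsto_const lim sh_lim) (auto dest: c_pos)

lemma Vpar_tendsto: "(\<lambda>m. real (N m) * Vpar K L (N m) (nq m) (Y m) (x m) f g) \<longlonglongrightarrow> Vlim f g"
  unfolding Vlim_def Vpar_def
proof (rule scaled_Vtt_tendsto)
  fix q k :: nat assume q: "q < 2^K" "k < 2^K"
  show "(\<lambda>m. pcov (N m) (\<lambda>i. Ypar L (N m) (Y m) (x m) i q) (\<lambda>i. Ypar L (N m) (Y m) (x m) i k)) \<longlonglongrightarrow> Zlim q k"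
    unfolding pcov_Ypar[OF N_pos cond_ii_xx_nonsing[rule_format]] Zlim_def
    using cond_ii_qx q by (intro tendsto_sum tendsto_mult minv_lim) auto
qed

lemma Vtt_tendsto:
  assumes fg: "f \<in> effs K" "g \<in> effs K"
  shows "(\<lambda>m. real (N m) * Vtt K (N m) (nq m) (Y m) f g) \<longlonglongrightarrow> Sg (Inl f) (Inl g)"
proof -
  have "(\<lambda>m. real (N m) * Vtt K (N m) (nq m) (Y m) f g) \<longlonglongrightarrow>
    ((\<Sum>q<2^K. gcoef K f q * gcoef K g q * SYlim q q / c q) - (\<Sum>q<2^K. \<Sum>k<2^K. gcoef K f q * gcoef K g k * SYlim q k)) / h^2"
    using cond_ii_Y by (intro scaled_Vtt_tendsto) blast
  then show ?thesis using fg by (subst Sg_eq) (auto simp: eff_def Slim_def)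
qed

lemma Sg_Inl_Inr:
  assumes f: "f \<in> effs K" and p: "f' \<in> effs K" "l < L"
  shows "Sg (Inl f) (Inr (f', l)) = (\<Sum>q<2^K. (gcoef K f q * Sqxlim q l / c q) * gcoef K f' q) / h^2"
proof -
  have z: "(\<Sum>q<2^K. \<Sum>k<2^K. gcoef K f q * gcoef K f' k * Sqxlim q l) = 0"
  proof -
    have "(\<Sum>k<2^K. gcoef K f q * gcoef K f' k * Sqxlim q l) = 0" for q
      unfolding sum_distrib_right[symmetric] sum_distrib_left[symmetric] by (simp add: gcoef_sum_zero[OF p(1)])
    then show ?thesis by simp
  qed
  have "Sg (Inl f) (Inr (f', l)) = (\<Sum>q<2^K. gcoef K f q * gcoef K f' q * Sqxlim q l / c q) / h^2"
    using f p by (subst Sg_eq) (auto simp: eff_def Slim_def z)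
  also have "(\<Sum>q<2^K. gcoef K f q * gcoef K f' q * Sqxlim q l / c q)
     = (\<Sum>q<2^K. (gcoef K f q * Sqxlim q l / c q) * gcoef K f' q)"
    by (intro sum.cong refl) (simp add: mult_ac)
  finally show ?thesis .
qed

lemma projection_limit:
  assumes fg: "f \<in> effs K" "g \<in> effs K"
  shows "(\<Sum>p\<in>P. \<Sum>p'\<in>P. Sg (Inl f) (Inr p) * W0 p p' * Sg (Inl g) (Inr p')) = Vlim f g"
proof -
  define \<alpha> where "\<alpha> f l q = gcoef K f q * Sqxlim q l / c q" for f l q
  have pairs: "(\<Sum>p\<in>P. F p) = (\<Sum>f\<in>effs K. \<Sum>l<L. F (f, l))" for F :: "nat \<times> nat \<Rightarrow> real"
    by (simp add: sum.cartesian_product)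
  let ?a = "\<lambda>f l f'. \<Sum>q<2^K. \<alpha> f l q * gcoef K f' q"
  have ca: "c r * \<alpha> f l r = gcoef K f r * Sqxlim r l" if "r < 2^K" for f l r
    using c_pos[OF that] by (simp add: \<alpha>_def)
  have "(\<Sum>p\<in>P. \<Sum>p'\<in>P. Sg (Inl f) (Inr p) * W0 p p' * Sg (Inl g) (Inr p'))
     = (\<Sum>f'\<in>effs K. \<Sum>l<L. \<Sum>f''\<in>effs K. \<Sum>l'<L. Sg (Inl f) (Inr (f', l)) * W0 (f', l) (f'', l') * Sg (Inl g) (Inr (f'', l')))"
    by (simp only: pairs)
  also have "\<dots> = (\<Sum>f'\<in>effs K. \<Sum>l<L. \<Sum>f''\<in>effs K. \<Sum>l'<L. (Mi l l' / (4 * h^2 * h^2)) * (?a f l f' * contrast_cov K c f' f'' * ?a g l' f''))"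
  proof (intro sum.cong refl)
    fix f' l f'' l' assume "f' \<in> effs K" "l \<in> {..<L}" "f'' \<in> effs K" "l' \<in> {..<L}"
    then have 1: "Sg (Inl f) (Inr (f', l)) = ?a f l f' / h^2" and 2: "Sg (Inl g) (Inr (f'', l')) = ?a g l' f'' / h^2"
      using Sg_Inl_Inr fg unfolding \<alpha>_def by auto
    have "u / H * (v / 4 * w) * (z / H) = (w / (4 * H * H)) * (u * v * z)" for u v w z H :: real
      by (simp add: mult_ac)
    then show "Sg (Inl f) (Inr (f', l)) * W0 (f', l) (f'', l') * Sg (Inl g) (Inr (f'', l'))
       = (Mi l l' / (4 * h^2 * h^2)) * (?a f l f' * contrast_cov K c f' f'' * ?a g l' f'')"
      unfolding 1 2 W0_def fst_conv snd_conv .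
  qed
  also have "\<dots> = (\<Sum>l<L. \<Sum>l'<L. (Mi l l' / (4 * h^2 * h^2)) * (\<Sum>f'\<in>effs K. \<Sum>f''\<in>effs K. ?a f l f' * contrast_cov K c f' f'' * ?a g l' f''))"
  proof -
    let ?t = "\<lambda>f' l f'' l'. (Mi l l' / (4 * h^2 * h^2)) * (?a f l f' * contrast_cov K c f' f'' * ?a g l' f'')"
    have "(\<Sum>f'\<in>effs K. \<Sum>l<L. \<Sum>f''\<in>effs K. \<Sum>l'<L. ?t f' l f'' l') = (\<Sum>l<L. \<Sum>f'\<in>effs K. \<Sum>f''\<in>effs K. \<Sum>l'<L. ?t f' l f'' l')"
      by (rule sum.swap)
    also have "\<dots> = (\<Sum>l<L. \<Sum>f'\<in>effs K. \<Sum>l'<L. \<Sum>f''\<in>effs K. ?t f' l f'' l')" by (intro sum.cong refl sum.swap)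
    also have "\<dots> = (\<Sum>l<L. \<Sum>l'<L. \<Sum>f'\<in>effs K. \<Sum>f''\<in>effs K. ?t f' l f'' l')" by (intro sum.cong refl sum.swap)
    finally show ?thesis by (simp only: sum_distrib_left)
  qed
  also have "\<dots> = (\<Sum>l<L. \<Sum>l'<L. (Mi l l' / h^2) * ((\<Sum>r<2^K. gcoef K f r * gcoef K g r * (Sqxlim r l * Sqxlim r l') / c r)
      - (\<Sum>r<2^K. gcoef K f r * Sqxlim r l) * (\<Sum>k<2^K. gcoef K g k * Sqxlim k l')))"
  proof (intro sum.cong refl)
    fix l l'
    have 1: "(\<Sum>r<2^K. c r * \<alpha> f l r * \<alpha> g l' r) = (\<Sum>r<2^K. gcoef K f r * gcoef K g r * (Sqxlim r l * Sqxlim r l') / c r)"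
      by (intro sum.cong refl) (simp add: ca \<alpha>_def[of g])
    have 2: "(\<Sum>r<2^K. c r * \<alpha> f l r) = (\<Sum>r<2^K. gcoef K f r * Sqxlim r l)" for f l
      by (intro sum.cong refl) (simp add: ca)
    have "(w / (4 * H * H)) * ((2 * e)^2 * z) = (w / H) * z" if "H = e^2" "e \<noteq> 0" for w H z e :: real
      using that by (simp add: power2_eq_square)
    then show "(Mi l l' / (4 * h^2 * h^2)) * (\<Sum>f'\<in>effs K. \<Sum>f''\<in>effs K. ?a f l f' * contrast_cov K c f' f'' * ?a g l' f'')
       = (Mi l l' / h^2) * ((\<Sum>r<2^K. gcoef K f r * gcoef K g r * (Sqxlim r l * Sqxlim r l') / c r)
      - (\<Sum>r<2^K. gcoef K f r * Sqxlim r l) * (\<Sum>k<2^K. gcoef K g k * Sqxlim k l'))"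
      unfolding contrast_cov_form[OF c_sum] 1 2 power_double[OF K] by simp
  qed
  also have "\<dots> = (\<Sum>l<L. \<Sum>l'<L. ((\<Sum>r<2^K. gcoef K f r * gcoef K g r * (Sqxlim r l * Mi l l' * Sqxlim r l') / c r)
      - (\<Sum>q<2^K. \<Sum>k<2^K. gcoef K f q * gcoef K g k * (Sqxlim q l * Mi l l' * Sqxlim k l'))) / h^2)"
  proof (intro sum.cong refl)
    fix l l'
    have "(Mi l l' / h^2) * (u - v) = (Mi l l' * u - Mi l l' * v) / h^2" for u v by (simp add: right_diff_distrib diff_divide_distrib)
    moreover have "Mi l l' * (\<Sum>r<2^K. gcoef K f r * gcoef K g r * (Sqxlim r l * Sqxlim r l') / c r)
       = (\<Sum>r<2^K. gcoef K f r * gcoef K g r * (Sqxlim r l * Mi l l' * Sqxlim r l') / c r)"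
      unfolding sum_distrib_left by (intro sum.cong refl) (simp add: mult_ac)
    moreover have "Mi l l' * ((\<Sum>r<2^K. gcoef K f r * Sqxlim r l) * (\<Sum>k<2^K. gcoef K g k * Sqxlim k l'))
       = (\<Sum>q<2^K. \<Sum>k<2^K. gcoef K f q * gcoef K g k * (Sqxlim q l * Mi l l' * Sqxlim k l'))"
      unfolding sum_product unfolding sum_distrib_left by (intro sum.cong refl) (simp only: mult_ac)
    ultimately show "(Mi l l' / h^2) * ((\<Sum>r<2^K. gcoef K f r * gcoef K g r * (Sqxlim r l * Sqxlim r l') / c r)
      - (\<Sum>r<2^K. gcoef K f r * Sqxlim r l) * (\<Sum>k<2^K. gcoef K g k * Sqxlim k l'))
      = ((\<Sum>r<2^K. gcoef K f r * gcoef K g r * (Sqxlim r l * Mi l l' * Sqxlim r l') / c r)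
      - (\<Sum>q<2^K. \<Sum>k<2^K. gcoef K f q * gcoef K g k * (Sqxlim q l * Mi l l' * Sqxlim k l'))) / h^2"
      by (simp only:)
  qed
  also have "\<dots> = ((\<Sum>l<L. \<Sum>l'<L. \<Sum>r<2^K. gcoef K f r * gcoef K g r * (Sqxlim r l * Mi l l' * Sqxlim r l') / c r)
      - (\<Sum>l<L. \<Sum>l'<L. \<Sum>q<2^K. \<Sum>k<2^K. gcoef K f q * gcoef K g k * (Sqxlim q l * Mi l l' * Sqxlim k l'))) / h^2"
    by (simp only: sum_subtractf sum_divide_distrib[symmetric])
  also have "(\<Sum>l<L. \<Sum>l'<L. \<Sum>r<2^K. gcoef K f r * gcoef K g r * (Sqxlim r l * Mi l l' * Sqxlim r l') / c r)
     = (\<Sum>r<2^K. gcoef K f r * gcoef K g r * Zlim r r / c r)"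
  proof -
    have "(\<Sum>l<L. \<Sum>l'<L. \<Sum>r<2^K. gcoef K f r * gcoef K g r * (Sqxlim r l * Mi l l' * Sqxlim r l') / c r)
      = (\<Sum>l<L. \<Sum>r<2^K. \<Sum>l'<L. gcoef K f r * gcoef K g r * (Sqxlim r l * Mi l l' * Sqxlim r l') / c r)"
      by (intro sum.cong refl sum.swap)
    also have "\<dots> = (\<Sum>r<2^K. \<Sum>l<L. \<Sum>l'<L. gcoef K f r * gcoef K g r * (Sqxlim r l * Mi l l' * Sqxlim r l') / c r)" by (rule sum.swap)
    finally show ?thesis by (simp only: Zlim_def sum_distrib_left sum_divide_distrib)
  qed
  also have "(\<Sum>l<L. \<Sum>l'<L. \<Sum>q<2^K. \<Sum>k<2^K. gcoef K f q * gcoef K g k * (Sqxlim q l * Mi l l' * Sqxlim k l'))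
     = (\<Sum>q<2^K. \<Sum>k<2^K. gcoef K f q * gcoef K g k * Zlim q k)"
  proof -
    let ?t = "\<lambda>l l' q k. gcoef K f q * gcoef K g k * (Sqxlim q l * Mi l l' * Sqxlim k l')"
    have "(\<Sum>l<L. \<Sum>l'<L. \<Sum>q<2^K. \<Sum>k<2^K. ?t l l' q k) = (\<Sum>l<L. \<Sum>q<2^K. \<Sum>l'<L. \<Sum>k<2^K. ?t l l' q k)"
      by (intro sum.cong refl sum.swap)
    also have "\<dots> = (\<Sum>q<2^K. \<Sum>l<L. \<Sum>l'<L. \<Sum>k<2^K. ?t l l' q k)" by (rule sum.swap)
    also have "\<dots> = (\<Sum>q<2^K. \<Sum>l<L. \<Sum>k<2^K. \<Sum>l'<L. ?t l l' q k)" by (intro sum.cong refl sum.swap)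
    also have "\<dots> = (\<Sum>q<2^K. \<Sum>k<2^K. \<Sum>l<L. \<Sum>l'<L. ?t l l' q k)" by (intro sum.cong refl sum.swap)
    finally show ?thesis by (simp only: Zlim_def sum_distrib_left)
  qed
  finally show ?thesis unfolding Vlim_def .
qed

theorem asymptotic_covariances:
  shows "(\<forall>f\<in>effs K. \<forall>g\<in>effs K.
        (\<lambda>m. real (N m) * Vpar K L (N m) (nq m) (Y m) (x m) f g) \<longlonglongrightarrow> Vlim f g)
   \<and> (\<exists>muC. weak_conv_vec (effs K) (\<lambda>m. crfe K (N m) (nq m)) (\<lambda>m. stat K (N m) (Y m)) muC)
   \<and> (\<exists>muR. weak_conv_vec (effs K) (\<lambda>m. refm K L (N m) (nq m) (x m) a) (\<lambda>m. stat K (N m) (Y m)) muR)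
   \<and> (\<forall>muC muR.
        weak_conv_vec (effs K) (\<lambda>m. crfe K (N m) (nq m)) (\<lambda>m. stat K (N m) (Y m)) muC \<longrightarrow>
        weak_conv_vec (effs K) (\<lambda>m. refm K L (N m) (nq m) (x m) a) (\<lambda>m. stat K (N m) (Y m)) muR \<longrightarrow>
          (\<forall>f\<in>effs K. integrable muC (\<lambda>y. (y f)^2) \<and> integrable muR (\<lambda>y. (y f)^2))
        \<and> psd_on (effs K) (\<lambda>f g. mcov muC f g - mcov muR f g)
        \<and> (\<forall>f\<in>effs K. \<forall>g\<in>effs K.
             mcov muC f g - mcov muR f g = (1 - vma (L * (2^K - 1)) a) * Vlim f g)
        \<and> (\<forall>f\<in>effs K. mcov muC f f > 0 \<longrightarrow>
             (\<exists>r. (\<lambda>m. Vpar K L (N m) (nq m) (Y m) (x m) f f / Vtt K (N m) (nq m) (Y m) f f)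
                     \<longlonglongrightarrow> r
                \<and> 1 - mcov muR f f / mcov muC f f = (1 - vma (L * (2^K - 1)) a) * r)))"
proof -
  obtain B where "joint_normal_limit (effs K) P Sg W0 (\<lambda>m. crfe K (N m) (nq m)) X Wm a B"
    using ex_joint_limit by blast
  then interpret J: joint_normal_limit "effs K" P Sg W0 "\<lambda>m. crfe K (N m) (nq m)" X Wm a B .
  have stat: "(\<lambda>m Z. J.pull (X m Z)) = (\<lambda>m. stat K (N m) (Y m))"
    by (intro ext) (simp add: J.pull_def X_def joint_stat_def stat_def)
  have M: "J.M m Z = Mstat K L (N m) (nq m) (x m) Z" for m Z
  proof -
    have "sqrt n * u * (w / n) * (sqrt n * v) = u * w * v" if "n > 0" for n u v w :: real
    proof -
      have "sqrt n * sqrt n = n" using that by simp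
      then have "sqrt n * u * (w / n) * (sqrt n * v) = n * (u * w * v) / n"
        by (metis (no_types, opaque_lifting) mult.assoc mult.commute times_divide_eq_left times_divide_eq_right)
      then show ?thesis using that by simp
    qed
    then show ?thesis unfolding J.M_def Mstat_def Let_def X_def Wm_def joint_stat_def
      using N_pos[of m] by simp
  qed
  have refm: "J.PrR = (\<lambda>m. refm K L (N m) (nq m) (x m) a)"
  proof (intro ext)
    fix m
    have "space (crfe K (N m) (nq m)) = UNIV" by (simp add: crfe_def)
    then show "J.PrR m = refm K L (N m) (nq m) (x m) a" unfolding J.PrR_def refm_def M by simp
  qed
  have card: "card P = L * (2 ^ K - 1)" by (simp add: effs_def mult.commute)
  have V: "J.Vpar_lim f g = Vlim f g" if "f \<in> effs K" "g \<in> effs K" for f g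
    unfolding J.Vpar_lim_def by (rule projection_limit[OF that])
  show ?thesis
  proof (intro conjI ballI allI impI)
    show "(\<lambda>m. real (N m) * Vpar K L (N m) (nq m) (Y m) (x m) f g) \<longlonglongrightarrow> Vlim f g" for f g by (rule Vpar_tendsto)
    show "\<exists>muC. weak_conv_vec (effs K) (\<lambda>m. crfe K (N m) (nq m)) (\<lambda>m. stat K (N m) (Y m)) muC"
      using J.weak_C unfolding stat by blast
    show "\<exists>muR. weak_conv_vec (effs K) (\<lambda>m. refm K L (N m) (nq m) (x m) a) (\<lambda>m. stat K (N m) (Y m)) muR"
      using J.weak_R unfolding stat refm by blast
    fix muC muR
    assume C: "weak_conv_vec (effs K) (\<lambda>m. crfe K (N m) (nq m)) (\<lambda>m. stat K (N m) (Y m)) muC"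
      and R: "weak_conv_vec (effs K) (\<lambda>m. refm K L (N m) (nq m) (x m) a) (\<lambda>m. stat K (N m) (Y m)) muR"
    note lims = J.weak_limit_covariances[unfolded stat refm, OF C R]
    show "integrable muC (\<lambda>y. (y f)^2)" "integrable muR (\<lambda>y. (y f)^2)" if "f \<in> effs K" for f
      using lims(1,2) that by blast+
    show "psd_on (effs K) (\<lambda>f g. mcov muC f g - mcov muR f g)" by (rule lims(5))
    show red: "mcov muC f g - mcov muR f g = (1 - vma (L * (2^K - 1)) a) * Vlim f g"
      if "f \<in> effs K" "g \<in> effs K" for f g
      using lims(4)[OF that] unfolding V[OF that] card .
    fix f assume f: "f \<in> effs K" and pos: "mcov muC f f > 0"
    have C_eq: "mcov muC f f = Sg (Inl f) (Inl f)" by (rule lims(3)[OF f f])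
    show "\<exists>r. (\<lambda>m. Vpar K L (N m) (nq m) (Y m) (x m) f f / Vtt K (N m) (nq m) (Y m) f f) \<longlonglongrightarrow> r
                \<and> 1 - mcov muR f f / mcov muC f f = (1 - vma (L * (2^K - 1)) a) * r"
    proof (intro exI[of _ "Vlim f f / mcov muC f f"] conjI)
      have "(\<lambda>m. (real (N m) * Vpar K L (N m) (nq m) (Y m) (x m) f f) / (real (N m) * Vtt K (N m) (nq m) (Y m) f f))
          \<longlonglongrightarrow> Vlim f f / mcov muC f f"
        using pos unfolding C_eq by (intro tendsto_divide Vpar_tendsto Vtt_tendsto f) simp
      moreover have "(real (N m) * u) / (real (N m) * v) = u / v" for m u v using N_pos[of m] by simp
      ultimately show "(\<lambda>m. Vpar K L (N m) (nq m) (Y m) (x m) f f / Vtt K (N m) (nq m) (Y m) f f) \<longlonglongrightarrow> Vlim f f / mcov muC f f"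
        by (simp only:)
      have "1 - mcov muR f f / mcov muC f f = (mcov muC f f - mcov muR f f) / mcov muC f f"
        using pos by (simp add: diff_divide_distrib)
      then show "1 - mcov muR f f / mcov muC f f = (1 - vma (L * (2^K - 1)) a) * (Vlim f f / mcov muC f f)"
        unfolding red[OF f f] by simp
    qed
  qed
qed

end

theorem theorem3:
  fixes K L :: nat and a :: real
    and N :: "nat \<Rightarrow> nat"
    and nq :: "nat \<Rightarrow> nat \<Rightarrow> nat"
    and Y :: "nat \<Rightarrow> nat \<Rightarrow> nat \<Rightarrow> real"
    and x :: "nat \<Rightarrow> nat \<Rightarrow> nat \<Rightarrow> real"
    and c :: "nat \<Rightarrow> real"
    and SYlim :: "nat \<Rightarrow> nat \<Rightarrow> real"
    and Sxxlim :: "nat \<Rightarrow> nat \<Rightarrow> real"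
    and Sqxlim :: "nat \<Rightarrow> nat \<Rightarrow> real"
  assumes K: "K \<ge> 1" and L: "L \<ge> 1" and a: "a > 0"
    and N_lim: "filterlim N at_top sequentially"
    and design: "\<forall>m. (\<forall>q<2^K. nq m q \<ge> 1) \<and> (\<Sum>q<2^K. nq m q) = N m"
    and cond_i: "\<forall>q<2^K. ((\<lambda>m. real (nq m q) / real (N m)) \<longlonglongrightarrow> c q) \<and> c q > 0"
    and cond_ii_Y: "\<forall>q<2^K. \<forall>k<2^K.
          (\<lambda>m. pcov (N m) (\<lambda>i. Y m i q) (\<lambda>i. Y m i k)) \<longlonglongrightarrow> SYlim q k"
    and cond_ii_xx: "\<forall>l<L. \<forall>l'<L. (\<lambda>m. Sxx (N m) (x m) l l') \<longlonglongrightarrow> Sxxlim l l'"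
    and cond_ii_xx_nonsing: "\<forall>m. invertible_on {..<L} (Sxx (N m) (x m))"
    and cond_ii_xxlim_nonsing: "invertible_on {..<L} Sxxlim"
    and cond_ii_qx: "\<forall>q<2^K. \<forall>l<L. (\<lambda>m. Sqx (N m) (Y m) (x m) q l) \<longlonglongrightarrow> Sqxlim q l"
    and cond_iii_Y: "\<forall>q<2^K. (\<lambda>m. (MAX i\<in>{..<N m}. \<bar>Y m i q - pmean (N m) (\<lambda>j. Y m j q)\<bar>^2) / real (N m))
                              \<longlonglongrightarrow> 0"
    and cond_iii_x: "(\<lambda>m. (MAX i\<in>{..<N m}. \<Sum>l<L. (x m i l - pmean (N m) (\<lambda>j. x m j l))^2) / real (N m))
                       \<longlonglongrightarrow> 0"
  shows "\<exists>Vlim.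
     (\<forall>f\<in>effs K. \<forall>g\<in>effs K.
        (\<lambda>m. real (N m) * Vpar K L (N m) (nq m) (Y m) (x m) f g) \<longlonglongrightarrow> Vlim f g)
   \<and> (\<exists>muC. weak_conv_vec (effs K) (\<lambda>m. crfe K (N m) (nq m)) (\<lambda>m. stat K (N m) (Y m)) muC)
   \<and> (\<exists>muR. weak_conv_vec (effs K) (\<lambda>m. refm K L (N m) (nq m) (x m) a) (\<lambda>m. stat K (N m) (Y m)) muR)
   \<and> (\<forall>muC muR.
        weak_conv_vec (effs K) (\<lambda>m. crfe K (N m) (nq m)) (\<lambda>m. stat K (N m) (Y m)) muC \<longrightarrow>
        weak_conv_vec (effs K) (\<lambda>m. refm K L (N m) (nq m) (x m) a) (\<lambda>m. stat K (N m) (Y m)) muR \<longrightarrow>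
          (\<forall>f\<in>effs K. integrable muC (\<lambda>y. (y f)^2) \<and> integrable muR (\<lambda>y. (y f)^2))
        \<and> psd_on (effs K) (\<lambda>f g. mcov muC f g - mcov muR f g)
        \<and> (\<forall>f\<in>effs K. \<forall>g\<in>effs K.
             mcov muC f g - mcov muR f g = (1 - vma (L * (2^K - 1)) a) * Vlim f g)
        \<and> (\<forall>f\<in>effs K. mcov muC f f > 0 \<longrightarrow>
             (\<exists>r. (\<lambda>m. Vpar K L (N m) (nq m) (Y m) (x m) f f / Vtt K (N m) (nq m) (Y m) f f)
                     \<longlonglongrightarrow> r
                \<and> 1 - mcov muR f f / mcov muC f f = (1 - vma (L * (2^K - 1)) a) * r)))"
proof -
  interpret refm_asymptotics K L a N nq Y x c SYlim Sxxlim Sqxlim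
    by (rule refm_asymptotics.intro[OF assms])
  show ?thesis by (rule exI[of _ Vlim]) (rule asymptotic_covariances)
qed

end
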